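(* Let $(M,x_0)$ be a path-connected pointed CW-complex with $\dim M = 2$. Let $G$ be a topological group with unit $g_0$ such that $\pi_0(G,g_0)$ is abelian and discrete and acts trivially on the higher homotopy groups $\pi_n(G,g_0)$ for all $n\ge 1$. Let $\mathcal{B}_G(M)$ be the pointed set of equivalence classes of principal $G$-bundles over $M$. Then there exists a short exact sequence of pointed sets $$0 \longrightarrow H^2(M,x_0;\pi_1(G,g_0)) \longrightarrow \mathcal{B}_G(M) \longrightarrow H^1(M,x_0;\pi_0(G,g_0)) \longrightarrow 0 .$$
   Context: A principal $G$-bundle over $M$ consists of a total space $E$ with a right action of $G$ and a continuous map $p:E\to M$ such that there is an open covering $\{U\}$ of $M$ with homeomorphisms $\phi_U: U\times G\to p^{-1}(U)$ satisfying $p(\phi_U(b,g))=b$ and $\phi_U(b,g)=\phi_U(b,g_0)\cdot g$. Two principal $G$-bundles $p_1:E_1\to M$ and $p_2:E_2\to M$ are equivalent if there is a homeomorphism $h:E_1\to E_2$ with $p_2\circ h=p_1$ and $h(e\cdot g)=h(e)\cdot g$ for all $e\in E_1$, $g\in G$. $\mathcal{B}_G(M)$ is the set of equivalence classes; its base point is the class of the trivial bundle $\mathrm{pr}_1: M\times G\to M$. $\pi_0(G,g_0)=G/G_0$, where $G_0$ is the path component of the unit, and it carries the quotient topology; it acts on $\pi_n(G,g_0)$, $n\ge 1$, by the maps induced by conjugation in $G$. $H^n(M,x_0;\pi)$ is the singular cohomology group of the pointed space $(M,x_0)$ (i.e. of the pair, which for $n\geq 1$ is $H^n(M;\pi)$)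 with coefficients in the abelian group $\pi$, regarded as a pointed set with base point $0$. Exactness is in the category of pointed sets: at each term, the image of the incoming map equals the preimage of the base point under the outgoing map; $0$ denotes the one-point set. *)

theory Defs
  imports "HOL-Homology.Homology"
begin

section \<open>CW complexes\<close>

definition closed_disc :: "nat \<Rightarrow> (nat \<Rightarrow> real) set" where
  "closed_disc n = {x \<in> topspace (Euclidean_space n). (\<Sum>i<n. (x i)\<^sup>2) \<le> 1}"

definition open_disc :: "nat \<Rightarrow> (nat \<Rightarrow> real) set" where
  "open_disc n = {x \<in> topspace (Euclidean_space n). (\<Sum>i<n. (x i)\<^sup>2) < 1}"

text \<open>
  \<open>I\<close> indexes the cells, \<open>d i\<close> is the dimension of the cell \<open>i\<close> and \<open>\<Phi> i\<close> is its characteristic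
  map. The last two clauses are closure finiteness and the weak topology; since \<open>X\<close> is Hausdorff,
  the image of the closed disc under \<open>\<Phi> i\<close> is the closure of the cell \<open>i\<close>. For \<open>n = 0\<close> the closed and the
  open disc are both the one-point space.
\<close>

definition cw_complex ::
  "'a topology \<Rightarrow> 'i set \<Rightarrow> ('i \<Rightarrow> nat) \<Rightarrow> ('i \<Rightarrow> (nat \<Rightarrow> real) \<Rightarrow> 'a) \<Rightarrow> bool" where
  "cw_complex X I d \<Phi> \<longleftrightarrow>
     Hausdorff_space X \<and>
     (\<forall>i\<in>I. continuous_map (subtopology (Euclidean_space (d i)) (closed_disc (d i))) X (\<Phi> i)) \<and>
     (\<forall>i\<in>I. homeomorphic_map (subtopology (Euclidean_space (d i)) (open_disc (d i)))
               (subtopology X (\<Phi> i ` open_disc (d i))) (\<Phi> i)) \<and>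
     disjoint_family_on (\<lambda>i. \<Phi> i ` open_disc (d i)) I \<and>
     (\<Union>i\<in>I. \<Phi> i ` open_disc (d i)) = topspace X \<and>
     (\<forall>i\<in>I. \<exists>J. J \<subseteq> I \<and> finite J \<and> (\<forall>j\<in>J. d j < d i) \<and>
        \<Phi> i ` (closed_disc (d i) - open_disc (d i)) \<subseteq> (\<Union>j\<in>J. \<Phi> j ` open_disc (d j))) \<and>
     (\<forall>A. A \<subseteq> topspace X \<and> (\<forall>i\<in>I. closedin X (A \<inter> \<Phi> i ` closed_disc (d i))) \<longrightarrow> closedin X A)"

definition cw_dimension :: "'i set \<Rightarrow> ('i \<Rightarrow> nat) \<Rightarrow> nat \<Rightarrow> bool" where
  "cw_dimension I d n \<longleftrightarrow> (\<forall>i\<in>I. d i \<le> n) \<and> (\<exists>i\<in>I. d i = n)"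


section \<open>Homotopy groups\<close>

text \<open>
  \<open>\<pi>\<^sub>n(X,x)\<close>, for \<open>n \<ge> 1\<close>, consists of the homotopy classes of maps of pairs
  from the \<open>n\<close>-cube and its boundary to \<open>(X,x)\<close>, multiplied by concatenation in the first coordinate
  (which has index \<open>0\<close>). Operations on classes are unions over representatives.
\<close>

definition cube :: "nat \<Rightarrow> (nat \<Rightarrow> real) topology" where
  "cube n = subtopology (Euclidean_space n) {s. \<forall>i<n. 0 \<le> s i \<and> s i \<le> 1}"

definition cube_boundary :: "nat \<Rightarrow> (nat \<Rightarrow> real) set" where
  "cube_boundary n = {s \<in> topspace (cube n). \<exists>i<n. s i = 0 \<or> s i = 1}"

definition pi_maps :: "nat \<Rightarrow> 'a topology \<Rightarrow> 'a \<Rightarrow> ((nat \<Rightarrow> real) \<Rightarrow> 'a) set" where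
  "pi_maps n X x = {f. continuous_map (cube n) X f \<and> (\<forall>s\<in>cube_boundary n. f s = x)}"

definition pi_class ::
  "nat \<Rightarrow> 'a topology \<Rightarrow> 'a \<Rightarrow> ((nat \<Rightarrow> real) \<Rightarrow> 'a) \<Rightarrow> ((nat \<Rightarrow> real) \<Rightarrow> 'a) set" where
  "pi_class n X x f = {g. homotopic_with (\<lambda>h. \<forall>s\<in>cube_boundary n. h s = x) (cube n) X f g}"

definition pi_concat ::
  "((nat \<Rightarrow> real) \<Rightarrow> 'a) \<Rightarrow> ((nat \<Rightarrow> real) \<Rightarrow> 'a) \<Rightarrow> (nat \<Rightarrow> real) \<Rightarrow> 'a" where
  "pi_concat f g s = (if s 0 \<le> 1/2 then f (s(0 := 2 * s 0)) else g (s(0 := 2 * s 0 - 1)))"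

definition homotopy_group ::
  "nat \<Rightarrow> 'a topology \<Rightarrow> 'a \<Rightarrow> ((nat \<Rightarrow> real) \<Rightarrow> 'a) set monoid" where
  "homotopy_group n X x =
     \<lparr>carrier = pi_class n X x ` pi_maps n X x,
      mult = (\<lambda>A B. \<Union>f\<in>A. \<Union>g\<in>B. pi_class n X x (pi_concat f g)),
      one = pi_class n X x (\<lambda>s. x)\<rparr>"

text \<open>The map from \<open>\<pi>\<^sub>n(X,x)\<close> to \<open>\<pi>\<^sub>n(Y,h x)\<close> induced by \<open>h\<close>.\<close>

definition homotopy_group_map ::
  "nat \<Rightarrow> 'b topology \<Rightarrow> 'a \<Rightarrow> ('a \<Rightarrow> 'b)
     \<Rightarrow> ((nat \<Rightarrow> real) \<Rightarrow> 'a) set \<Rightarrow> ((nat \<Rightarrow> real) \<Rightarrow> 'b) set" where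
  "homotopy_group_map n Y x h \<alpha> = (\<Union>f\<in>\<alpha>. pi_class n Y (h x) (h \<circ> f))"


section \<open>Topological groups\<close>

locale topological_group = group G for G (structure) +
  fixes T :: "'a topology"
  assumes topspace_eq: "topspace T = carrier G"
    and continuous_mult: "continuous_map (prod_topology T T) T (\<lambda>(g, h). g \<otimes> h)"
    and continuous_inv: "continuous_map T T (\<lambda>g. inv g)"

definition unit_component :: "'g monoid \<Rightarrow> 'g topology \<Rightarrow> 'g set" where
  "unit_component G T = path_component_of_set T \<one>\<^bsub>G\<^esub>"

definition pi0_group :: "'g monoid \<Rightarrow> 'g topology \<Rightarrow> 'g set monoid" where
  "pi0_group G T = G Mod unit_component G T"

text \<open>The quotient topology is the only topology on \<open>\<pi>\<^sub>0(G)\<close> making the projection a quotient map.\<close>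

definition pi0_discrete :: "'g monoid \<Rightarrow> 'g topology \<Rightarrow> bool" where
  "pi0_discrete G T \<longleftrightarrow>
     quotient_map T (discrete_topology (carrier (pi0_group G T)))
       (\<lambda>g. unit_component G T #>\<^bsub>G\<^esub> g)"

text \<open>
  A class \<open>C\<close> in \<open>\<pi>\<^sub>0(G)\<close> acts on \<open>\<pi>\<^sub>n(G,1)\<close> by the map induced by conjugation with any
  of its elements. All elements of \<open>C\<close> induce the same map, so the union is that of copies of
  one homotopy class.
\<close>

definition pi0_action ::
  "'g monoid \<Rightarrow> 'g topology \<Rightarrow> nat \<Rightarrow> 'g set
     \<Rightarrow> ((nat \<Rightarrow> real) \<Rightarrow> 'g) set \<Rightarrow> ((nat \<Rightarrow> real) \<Rightarrow> 'g) set" where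
  "pi0_action G T n C \<alpha> =
     (\<Union>g\<in>C. homotopy_group_map n T \<one>\<^bsub>G\<^esub> (\<lambda>x. g \<otimes>\<^bsub>G\<^esub> x \<otimes>\<^bsub>G\<^esub> inv\<^bsub>G\<^esub> g) \<alpha>)"


section \<open>Singular cohomology\<close>

text \<open>
  The cochains of the pair \<open>(X,S)\<close> with coefficients in \<open>A\<close> are the homomorphisms from the singular
  chain group of \<open>X\<close> to \<open>A\<close> that vanish on the chains of \<open>S\<close>; they are made extensional so
  that equality of cochains is equality of functions. \<open>A\<close> is meant to be a commutative group,
  written multiplicatively.
\<close>

definition cochain_group ::
  "nat \<Rightarrow> 'a topology \<Rightarrow> 'a set \<Rightarrow> 'c monoid \<Rightarrow> ('a chain \<Rightarrow> 'c) monoid" where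
  "cochain_group n X S A =
     \<lparr>carrier = {\<phi> \<in> hom (chain_group n X) A \<inter> extensional (carrier (chain_group n X)).
                  \<forall>c \<in> carrier (chain_group n (subtopology X S)). \<phi> c = \<one>\<^bsub>A\<^esub>},
      mult = (\<lambda>\<phi> \<psi>. \<lambda>c\<in>carrier (chain_group n X). \<phi> c \<otimes>\<^bsub>A\<^esub> \<psi> c),
      one = (\<lambda>c\<in>carrier (chain_group n X). \<one>\<^bsub>A\<^esub>)\<rparr>"

definition cochain_coboundary ::
  "nat \<Rightarrow> 'a topology \<Rightarrow> ('a chain \<Rightarrow> 'c) \<Rightarrow> 'a chain \<Rightarrow> 'c" where
  "cochain_coboundary n X \<phi> =
     (\<lambda>c\<in>carrier (chain_group (Suc n) X). \<phi> (chain_boundary (Suc n) c))"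

definition singular_cocycles ::
  "nat \<Rightarrow> 'a topology \<Rightarrow> 'a set \<Rightarrow> 'c monoid \<Rightarrow> ('a chain \<Rightarrow> 'c) set" where
  "singular_cocycles n X S A =
     {\<phi> \<in> carrier (cochain_group n X S A).
        cochain_coboundary n X \<phi> = \<one>\<^bsub>cochain_group (Suc n) X S A\<^esub>}"

definition singular_coboundaries ::
  "nat \<Rightarrow> 'a topology \<Rightarrow> 'a set \<Rightarrow> 'c monoid \<Rightarrow> ('a chain \<Rightarrow> 'c) set" where
  "singular_coboundaries n X S A =
     (case n of 0 \<Rightarrow> {\<one>\<^bsub>cochain_group 0 X S A\<^esub>}
      | Suc k \<Rightarrow> cochain_coboundary k X ` carrier (cochain_group k X S A))"

definition singular_cohomology ::
  "nat \<Rightarrow> 'a topology \<Rightarrow> 'a set \<Rightarrow> 'c monoid \<Rightarrow> ('a chain \<Rightarrow> 'c) set monoid" where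
  "singular_cohomology n X S A =
     (cochain_group n X S A)\<lparr>carrier := singular_cocycles n X S A\<rparr> Mod singular_coboundaries n X S A"


section \<open>Principal bundles\<close>

record ('e, 'g, 'm) gbundle =
  total :: "'e topology"
  act :: "'e \<Rightarrow> 'g \<Rightarrow> 'e"
  proj :: "'e \<Rightarrow> 'm"

definition principal_bundle ::
  "'g monoid \<Rightarrow> 'g topology \<Rightarrow> 'm topology \<Rightarrow> ('e, 'g, 'm) gbundle \<Rightarrow> bool" where
  "principal_bundle G T M P \<longleftrightarrow>
     continuous_map (prod_topology (total P) T) (total P) (\<lambda>(e, g). act P e g) \<and>
     (\<forall>e\<in>topspace (total P). act P e \<one>\<^bsub>G\<^esub> = e) \<and>
     (\<forall>e\<in>topspace (total P). \<forall>g\<in>carrier G. \<forall>h\<in>carrier G.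
        act P e (g \<otimes>\<^bsub>G\<^esub> h) = act P (act P e g) h) \<and>
     continuous_map (total P) M (proj P) \<and>
     (\<exists>\<U>. (\<forall>U\<in>\<U>. openin M U) \<and> \<Union>\<U> = topspace M \<and>
        (\<forall>U\<in>\<U>. \<exists>\<phi>.
           homeomorphic_map (prod_topology (subtopology M U) T)
             (subtopology (total P) {e \<in> topspace (total P). proj P e \<in> U}) \<phi> \<and>
           (\<forall>b\<in>U. \<forall>g\<in>carrier G.
              proj P (\<phi> (b, g)) = b \<and> \<phi> (b, g) = act P (\<phi> (b, \<one>\<^bsub>G\<^esub>)) g)))"

definition bundle_equivalent ::
  "'g monoid \<Rightarrow> ('e, 'g, 'm) gbundle \<Rightarrow> ('f, 'g, 'm) gbundle \<Rightarrow> bool" where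
  "bundle_equivalent G P Q \<longleftrightarrow>
     (\<exists>h. homeomorphic_map (total P) (total Q) h \<and>
        (\<forall>e\<in>topspace (total P). proj Q (h e) = proj P e) \<and>
        (\<forall>e\<in>topspace (total P). \<forall>g\<in>carrier G. h (act P e g) = act Q (h e) g))"

definition trivial_bundle ::
  "'g monoid \<Rightarrow> 'g topology \<Rightarrow> 'm topology \<Rightarrow> ('m \<times> 'g, 'g, 'm) gbundle" where
  "trivial_bundle G T M =
     \<lparr>total = prod_topology M T, act = (\<lambda>(b, g) h. (b, g \<otimes>\<^bsub>G\<^esub> h)), proj = fst\<rparr>"

text \<open>
  The total spaces of the bundles in an equivalence class have to be carried by subsets of one
  fixed type. The type \<open>'m \<times> 'g\<close> is large enough: by \<open>principal_bundle_equivalent_to_standard\<close>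
  below, every principal bundle is equivalent to one with total space of this type.
\<close>

definition bundle_rel ::
  "'g monoid \<Rightarrow> 'g topology \<Rightarrow> 'm topology
     \<Rightarrow> (('m \<times> 'g, 'g, 'm) gbundle \<times> ('m \<times> 'g, 'g, 'm) gbundle) set" where
  "bundle_rel G T M =
     {(P, Q). principal_bundle G T M P \<and> principal_bundle G T M Q \<and> bundle_equivalent G P Q}"

definition bundle_classes ::
  "'g monoid \<Rightarrow> 'g topology \<Rightarrow> 'm topology \<Rightarrow> ('m \<times> 'g, 'g, 'm) gbundle set set" where
  "bundle_classes G T M = {P. principal_bundle G T M P} // bundle_rel G T M"

definition trivial_class ::
  "'g monoid \<Rightarrow> 'g topology \<Rightarrow> 'm topology \<Rightarrow> ('m \<times> 'g, 'g, 'm) gbundle set" where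
  "trivial_class G T M = bundle_rel G T M `` {trivial_bundle G T M}"


section \<open>Exact sequences of pointed sets\<close>

definition pointed_map :: "'a set \<Rightarrow> 'a \<Rightarrow> 'b set \<Rightarrow> 'b \<Rightarrow> ('a \<Rightarrow> 'b) \<Rightarrow> bool" where
  "pointed_map A a B b f \<longleftrightarrow> a \<in> A \<and> b \<in> B \<and> f \<in> A \<rightarrow> B \<and> f a = b"

definition pointed_exact ::
  "'a set \<Rightarrow> ('a \<Rightarrow> 'b) \<Rightarrow> 'b set \<Rightarrow> ('b \<Rightarrow> 'c) \<Rightarrow> 'c \<Rightarrow> bool" where
  "pointed_exact A f B g c \<longleftrightarrow> f ` A = {y \<in> B. g y = c}"

definition short_exact_pointed ::
  "'a set \<Rightarrow> 'a \<Rightarrow> 'b set \<Rightarrow> 'b \<Rightarrow> 'c set \<Rightarrow> 'c \<Rightarrow> ('a \<Rightarrow> 'b) \<Rightarrow> ('b \<Rightarrow> 'c) \<Rightarrow> bool" where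
  "short_exact_pointed A a B b C c f g \<longleftrightarrow>
     pointed_map A a B b f \<and> pointed_map B b C c g \<and>
     pointed_exact {()} (\<lambda>_. a) A f b \<and>
     pointed_exact A f B g c \<and>
     pointed_exact B g C (\<lambda>_. ()) ()"


section \<open>Adequacy of the choice of type for total spaces\<close>

lemma principal_bundle_inj:
  fixes P :: "('e, 'g, 'm) gbundle" and M :: "'m topology"
  assumes P: "principal_bundle G T M P" and T: "topological_group G T"
  shows "\<exists>k :: 'e \<Rightarrow> 'm \<times> 'g. inj_on k (topspace (total P))"
proof -
  have topT: "topspace T = carrier G"
    using T by (rule topological_group.topspace_eq)
  have "\<exists>q :: 'e \<Rightarrow> 'g. inj_on q {e \<in> topspace (total P). proj P e = b}"
    if b: "b \<in> topspace M" for b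
  proof -
    obtain \<U> where \<U>: "\<Union>\<U> = topspace M"
      and triv: "\<forall>U\<in>\<U>. \<exists>\<phi>.
           homeomorphic_map (prod_topology (subtopology M U) T)
             (subtopology (total P) {e \<in> topspace (total P). proj P e \<in> U}) \<phi> \<and>
           (\<forall>b\<in>U. \<forall>g\<in>carrier G.
              proj P (\<phi> (b, g)) = b \<and> \<phi> (b, g) = act P (\<phi> (b, \<one>\<^bsub>G\<^esub>)) g)"
      using P unfolding principal_bundle_def by (elim conjE exE)
    obtain U where "U \<in> \<U>" and U: "b \<in> U"
      using b \<U> by blast
    obtain \<phi> where h: "homeomorphic_map (prod_topology (subtopology M U) T)
             (subtopology (total P) {e \<in> topspace (total P). proj P e \<in> U}) \<phi>"
      and "\<forall>b\<in>U. \<forall>g\<in>carrier G.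
              proj P (\<phi> (b, g)) = b \<and> \<phi> (b, g) = act P (\<phi> (b, \<one>\<^bsub>G\<^esub>)) g"
      using bspec[OF triv \<open>U \<in> \<U>\<close>] by (elim exE conjE)
    then have pr: "proj P (\<phi> (b, g)) = b" if "b \<in> U" "g \<in> carrier G" for b g
      using that by blast
    have im: "\<phi> ` ((topspace M \<inter> U) \<times> carrier G) = {e \<in> topspace (total P). proj P e \<in> U}"
      using homeomorphic_imp_surjective_map[OF h] topT by auto
    have "\<exists>g\<in>carrier G. \<phi> (b, g) = e" if e: "e \<in> topspace (total P)" "proj P e = b" for e
    proof -
      have "e \<in> \<phi> ` ((topspace M \<inter> U) \<times> carrier G)"
        using im e U by blast
      then show ?thesis
        using pr e by auto
    qed
    then obtain q where "\<And>e. e \<in> topspace (total P) \<Longrightarrow> proj P e = b \<Longrightarrow> \<phi> (b, q e) = e"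
      by metis
    then have "inj_on q {e \<in> topspace (total P). proj P e = b}"
      by (smt (verit) inj_onI mem_Collect_eq)
    then show ?thesis
      by (rule exI[of _ q])
  qed
  then obtain q :: "'m \<Rightarrow> 'e \<Rightarrow> 'g" where
    q: "\<And>b. b \<in> topspace M \<Longrightarrow> inj_on (q b) {e \<in> topspace (total P). proj P e = b}"
    by metis
  have "continuous_map (total P) M (proj P)"
    using P by (simp add: principal_bundle_def)
  then have pM: "proj P e \<in> topspace M" if "e \<in> topspace (total P)" for e
    using that by (rule continuous_map_image_subset_topspace[THEN subsetD, OF _ imageI])
  have "inj_on (\<lambda>e. (proj P e, q (proj P e) e)) (topspace (total P))"
  proof (rule inj_onI)
    fix x y
    assume xy: "x \<in> topspace (total P)" "y \<in> topspace (total P)"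
      and "(proj P x, q (proj P x) x) = (proj P y, q (proj P y) y)"
    then show "x = y"
      using inj_onD[OF q[OF pM[OF xy(2)]], of x y] by auto
  qed
  then show ?thesis
    by (intro exI)
qed

proposition principal_bundle_equivalent_to_standard:
  fixes P :: "('e, 'g, 'm) gbundle" and M :: "'m topology"
  assumes P: "principal_bundle G T M P" and T: "topological_group G T"
  shows "\<exists>Q :: ('m \<times> 'g, 'g, 'm) gbundle. principal_bundle G T M Q \<and> bundle_equivalent G P Q"
proof -
  obtain k :: "'e \<Rightarrow> 'm \<times> 'g" where k: "inj_on k (topspace (total P))"
    using principal_bundle_inj[OF P T] by blast
  have topT: "topspace T = carrier G"
    using T by (rule topological_group.topspace_eq)
  define E where "E = topspace (total P)"
  define j where "j = inv_into E k"
  have jk: "j (k e) = e" if "e \<in> E" for e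
    using k that unfolding j_def E_def by simp
  define X where "X = pullback_topology (k ` E) j (total P)"
  define Q :: "('m \<times> 'g, 'g, 'm) gbundle" where
    "Q = \<lparr>total = X, act = (\<lambda>x g. k (act P (j x) g)), proj = (\<lambda>x. proj P (j x))\<rparr>"
  have topX: "topspace X = k ` E"
    unfolding X_def topspace_pullback_topology using jk by (auto simp: E_def)
  have jcont: "continuous_map X (total P) j"
    unfolding X_def using continuous_map_pullback[OF continuous_map_id, of "k ` E" j "total P"]
    by simp
  have kcont: "continuous_map (total P) X k"
    unfolding X_def
  proof (rule continuous_map_pullback')
    have "continuous_map (total P) (total P) (\<lambda>e. e)"
      by simp
    then show "continuous_map (total P) (total P) (j \<circ> k)"
      by (rule continuous_map_eq) (simp add: jk E_def)
    show "topspace (total P) \<subseteq> k -` (k ` E)"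
      by (auto simp: E_def)
  qed
  have kj: "homeomorphic_maps (total P) X k j"
    unfolding homeomorphic_maps_def using jcont kcont jk topX by (auto simp: E_def)
  then have kh: "homeomorphic_map (total P) X k"
    by (rule homeomorphic_maps_imp_map)
  have actE: "act P e g \<in> E" if "e \<in> E" "g \<in> carrier G" for e g
  proof -
    have "continuous_map (prod_topology (total P) T) (total P) (\<lambda>(e, g). act P e g)"
      using P by (simp add: principal_bundle_def)
    then have "(\<lambda>(e, g). act P e g) ` (E \<times> carrier G) \<subseteq> E"
      using topT by (metis E_def continuous_map_image_subset_topspace topspace_prod_topology)
    then show ?thesis
      using that by auto
  qed
  have "principal_bundle G T M Q"
    unfolding principal_bundle_def
  proof (intro conjI)
    have "continuous_map (prod_topology X T) (prod_topology (total P) T) (\<lambda>(x, g). (j x, g))"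
      using jcont continuous_map_prod_top[of X T "total P" T j "\<lambda>g. g"] by simp
    moreover have "continuous_map (prod_topology (total P) T) (total P) (\<lambda>(e, g). act P e g)"
      using P by (simp add: principal_bundle_def)
    ultimately have "continuous_map (prod_topology X T) X
        (k \<circ> ((\<lambda>(e, g). act P e g) \<circ> (\<lambda>(x, g). (j x, g))))"
      by (intro continuous_map_compose[OF _ kcont] continuous_map_compose)
    then show "continuous_map (prod_topology (total Q) T) (total Q) (\<lambda>(e, g). act Q e g)"
      by (simp add: Q_def o_def case_prod_unfold)
    show "\<forall>e\<in>topspace (total Q). act Q e \<one>\<^bsub>G\<^esub> = e"
      using P by (auto simp: Q_def topX jk principal_bundle_def E_def[symmetric])
    show "\<forall>e\<in>topspace (total Q). \<forall>g\<in>carrier G. \<forall>h\<in>carrier G.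
        act Q e (g \<otimes>\<^bsub>G\<^esub> h) = act Q (act Q e g) h"
      using P by (auto simp: Q_def topX jk actE principal_bundle_def E_def[symmetric])
    have "continuous_map (total P) M (proj P)"
      using P by (simp add: principal_bundle_def)
    then have "continuous_map X M (proj P \<circ> j)"
      by (rule continuous_map_compose[OF jcont])
    then show "continuous_map (total Q) M (proj Q)"
      by (simp add: Q_def o_def)
    obtain \<U> where \<U>: "\<forall>U\<in>\<U>. openin M U" "\<Union>\<U> = topspace M"
      and triv: "\<forall>U\<in>\<U>. \<exists>\<phi>.
           homeomorphic_map (prod_topology (subtopology M U) T)
             (subtopology (total P) {e \<in> topspace (total P). proj P e \<in> U}) \<phi> \<and>
           (\<forall>b\<in>U. \<forall>g\<in>carrier G.
              proj P (\<phi> (b, g)) = b \<and> \<phi> (b, g) = act P (\<phi> (b, \<one>\<^bsub>G\<^esub>)) g)"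
      using P unfolding principal_bundle_def by (elim conjE exE)
    have "\<exists>\<psi>. homeomorphic_map (prod_topology (subtopology M U) T)
             (subtopology (total Q) {e \<in> topspace (total Q). proj Q e \<in> U}) \<psi> \<and>
           (\<forall>b\<in>U. \<forall>g\<in>carrier G.
              proj Q (\<psi> (b, g)) = b \<and> \<psi> (b, g) = act Q (\<psi> (b, \<one>\<^bsub>G\<^esub>)) g)"
      if U: "U \<in> \<U>" for U
    proof -
      obtain \<phi> where h: "homeomorphic_map (prod_topology (subtopology M U) T)
             (subtopology (total P) {e \<in> topspace (total P). proj P e \<in> U}) \<phi>"
        and eq: "\<forall>b\<in>U. \<forall>g\<in>carrier G.
              proj P (\<phi> (b, g)) = b \<and> \<phi> (b, g) = act P (\<phi> (b, \<one>\<^bsub>G\<^esub>)) g"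
        using triv U by blast
      have UM: "U \<subseteq> topspace M"
        using \<U> U by blast
      have im: "\<phi> ` (U \<times> carrier G) = {e \<in> topspace (total P). proj P e \<in> U}"
        using homeomorphic_imp_surjective_map[OF h] topT UM by (auto simp: Int_absorb1)
      have \<phi>E: "\<phi> (b, g) \<in> E" if "b \<in> U" "g \<in> carrier G" for b g
        using im that by (auto simp: E_def)
      have one: "\<one>\<^bsub>G\<^esub> \<in> carrier G"
        using T by (simp add: topological_group_def group.is_monoid monoid.one_closed)
      have "homeomorphic_map (subtopology (total P) {e \<in> topspace (total P). proj P e \<in> U})
              (subtopology X {x \<in> topspace X. proj P (j x) \<in> U}) k"
        by (rule homeomorphic_map_subtopologies[OF kh])
          (auto simp: topX jk E_def[symmetric])
      then have "homeomorphic_map (prod_topology (subtopology M U) T)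
              (subtopology X {x \<in> topspace X. proj P (j x) \<in> U}) (k \<circ> \<phi>)"
        by (rule homeomorphic_map_compose[OF h])
      moreover have "proj P (j ((k \<circ> \<phi>) (b, g))) = b
          \<and> (k \<circ> \<phi>) (b, g) = k (act P (j ((k \<circ> \<phi>) (b, \<one>\<^bsub>G\<^esub>))) g)"
        if "b \<in> U" "g \<in> carrier G" for b g
        proof -
          have "\<phi> (b, g) \<in> E" "\<phi> (b, \<one>\<^bsub>G\<^esub>) \<in> E"
            using that one \<phi>E by simp_all
          moreover have "proj P (\<phi> (b, g)) = b" "\<phi> (b, g) = act P (\<phi> (b, \<one>\<^bsub>G\<^esub>)) g"
            by (rule conjunct1[OF eq[rule_format, OF that]], rule conjunct2[OF eq[rule_format, OF that]])
          ultimately show ?thesis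
            by (simp add: jk)
        qed
      ultimately show ?thesis
        unfolding Q_def gbundle.select_convs
        by (intro exI[of _ "k \<circ> \<phi>"] conjI[OF _ ballI[OF ballI]])
    qed
    then show "\<exists>\<U>. (\<forall>U\<in>\<U>. openin M U) \<and> \<Union>\<U> = topspace M \<and>
        (\<forall>U\<in>\<U>. \<exists>\<psi>. homeomorphic_map (prod_topology (subtopology M U) T)
             (subtopology (total Q) {e \<in> topspace (total Q). proj Q e \<in> U}) \<psi> \<and>
           (\<forall>b\<in>U. \<forall>g\<in>carrier G.
              proj Q (\<psi> (b, g)) = b \<and> \<psi> (b, g) = act Q (\<psi> (b, \<one>\<^bsub>G\<^esub>)) g))"
      by (intro exI[of _ \<U>] conjI[OF \<U>(1)] conjI[OF \<U>(2)] ballI)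
  qed
  moreover have "bundle_equivalent G P Q"
    unfolding bundle_equivalent_def
    by (rule exI[of _ k]) (use kh jk actE in \<open>auto simp: Q_def E_def\<close>)
  ultimately show ?thesis
    by blast
qed

end

(*
  A bundle is encoded by the coordinate functions of its local sections with respect to an arbitrary
  discontinuous global section, so that sections along simplices become G-valued functions. Along a
  path a section changes its pi_0-class by an amount independent of the section; this is a 1-cocycle,
  whose class in H^1 is the second map. It is trivial exactly if the structure group reduces to the
  unit component K. In that case one chooses along every edge a section with end values 1; comparing
  these with a K-valued section over a triangle gives a 2-cocycle with values in pi_1(G), the
  obstruction class. If two such bundles have cohomologous obstructions, an isomorphism given on the
  1-skeleton by the edge sections, twisted by the cobounding cochain, has null-homotopic comparison
  loops around the 2-cells and therefore extends over them.
  Conversely, the values of a 1-cocycle on the 1-cells are clutching data over the 1-skeleton, and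
  the cocycle condition makes the resulting bundle trivial around each 2-cell, so it extends and the
  second map is onto. Clutching by loops around the 2-cells shows that a nonzero H^2 forces a
  nontrivial bundle in the kernel of the second map. Since the obstruction map on that kernel is
  injective and respects base points, its partial inverse can be completed to the first map.
*)

theory Submission
 imports Defs "HOL-Analysis.Analysis"
begin

text \<open>Cohomology is given by singular simplices and the space by cells. Every cellular fact is
  recovered from one open cover: the complex without the centres of its top cells, which deforms
  onto the lower skeleton, and the union of the open top cells. A cocycle that is trivial on the
  simplices small for the cover gets a primitive by subdivision; the same argument serves the graph
  and the surface.

  For loops the obstacle is that a path in the unit component has no canonical class in pi_1.
  Pointwise multiplication in the group replaces concatenation, and a path is closed up by chosen
  paths from 1 to its end values. The resulting class is multiplicative only up to a term that
  depends on the end values, hence up to the coboundary of a 0-cochain. Identities are therefore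
  proved for coboundaries over triangles, or for paths with equal ends, where this term disappears.

  For a clutched bundle no formula for the second cocycle is derived: it is enough that a
  trivialisation would turn the clutching data into a coboundary.\<close>

abbreviation "cmap \<equiv> continuous_map"
abbreviation "subtop \<equiv> subtopology"
abbreviation "sing \<equiv> singular_simplex"
abbreviation "splx \<equiv> standard_simplex"
abbreviation "cdisc \<equiv> closed_disc"
abbreviation "odisc \<equiv> open_disc"

lemmas cmap_in_sub = continuous_map_in_subtopology and
 cont_prod = continuous_on_coordinatewise_then_product and
 cmap_from_sub = continuous_map_from_subtopology and
 subtop_subtop = subtopology_subtopology and
 openin_cmap = openin_continuous_map_preimage and
 cmap_comp = continuous_map_compose and
 cmap_eq = continuous_map_eq and
 cmap_def = continuous_map_def and
 cmap_mono = continuous_map_from_subtopology_mono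

section \<open>Cochains with values in an abelian group\<close>

text \<open>Total functions are used, with arbitrary values in the carrier off the singular
  simplices. One and the same function then serves as a cochain of a space and of each of its
  subspaces.\<close>

definition cochain :: "('c, 'd) monoid_scheme => ('b => 'c) => bool" where
 "cochain A f \<longleftrightarrow> (\<forall>x. f x \<in> carrier A)"

lemma cochainI: "(!!x. f x \<in> carrier A) ==> cochain A f"
 by (simp add: cochain_def)

lemma cochainD: "cochain A f ==> f x \<in> carrier A"
 by (simp add: cochain_def)

lemma cochain_comp: "cochain A f ==> cochain A (%x. f (h x))"
 by (simp add: cochain_def)

text \<open>The homomorphic extension to chains, in multiplicative notation. It is determined by the
  values on simplices, so the choice is immaterial.\<close>

definition chain_eval :: "('c, 'd) monoid_scheme => ('b => 'c) => ('b \<Rightarrow>\<^sub>0 int) => 'c" where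
 "chain_eval A f = (SOME h. h \<in> hom (free_Abelian_group UNIV) A \<and> (\<forall>x. h (frag_of x) = f x))"

text \<open>The index \<open>p\<close> is the degree of the result, hence the dimension of
  \<open>t\<close>; the cochain \<open>b\<close> has degree \<open>p - 1\<close>.\<close>

definition cobd :: "('c, 'd) monoid_scheme => nat => (((nat => real) => 'a) => 'c) => ((nat => real) => 'a) => 'c" where
 "cobd A p b t = chain_eval A b (chain_boundary p (frag_of t))"

definition cocycle :: "('c, 'd) monoid_scheme => nat => 'a topology => (((nat => real) => 'a) => 'c) => bool" where
 "cocycle A p X z \<longleftrightarrow> cochain A z \<and>
   (\<forall>t. sing (Suc p) X t --> cobd A (Suc p) z t = \<one>\<^bsub>A\<^esub>)"

definition cobounds :: "('c, 'd) monoid_scheme => nat => 'a topology => (((nat => real) => 'a) => 'c) => (((nat => real) => 'a) => 'c) => bool" where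
 "cobounds A p X b z \<longleftrightarrow> cochain A b \<and>
   (\<forall>t. sing p X t --> z t = cobd A p b t)"

lemma keys_chain_boundary:
 assumes "singular_chain p X c"
 shows "!!x. x \<in> Poly_Mapping.keys (chain_boundary p c) ==> sing (p - 1) X x"
 using singular_chain_boundary[OF assms] by (auto simp: singular_chain_def)

context comm_group begin

lemma chain_eval:
 assumes "cochain G f"
 shows chain_eval_hom: "chain_eval G f \<in> hom (free_Abelian_group UNIV) G"
  and chain_eval_of [simp]: "chain_eval G f (frag_of x) = f x"
proof -
 have "\<exists>h. h \<in> hom (free_Abelian_group UNIV) G \<and> (\<forall>x. h (frag_of x) = f x)"
  using free_Abelian_group_universal[of f UNIV] cochainD[OF assms] by (metis UNIV_I image_subsetI)
 hence "chain_eval G f \<in> hom (free_Abelian_group UNIV) G \<and> (\<forall>x. chain_eval G f (frag_of x) = f x)"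
  unfolding chain_eval_def by (rule someI_ex)
 thus "chain_eval G f \<in> hom (free_Abelian_group UNIV) G" "chain_eval G f (frag_of x) = f x"
  by auto
qed

context
 fixes f :: "'s => 'a" assumes f: "cochain G f"
begin

lemma chain_eval_closed [simp, intro]: "chain_eval G f c \<in> carrier G"
 using chain_eval_hom[OF f] by (auto simp: hom_def)

lemma chain_eval_add: "chain_eval G f (a + b) = chain_eval G f a \<otimes> chain_eval G f b"
 using chain_eval_hom[OF f] by (auto simp: hom_def)

lemma chain_eval_diff: "chain_eval G f (a - b) = chain_eval G f a \<otimes> inv (chain_eval G f b)"
proof -
 have "chain_eval G f a = chain_eval G f (a - b) \<otimes> chain_eval G f b"
  using chain_eval_add[of "a - b" b] by simp
 thus ?thesis
  by (simp add: inv_solve_right)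
qed

lemma chain_eval_0 [simp]: "chain_eval G f 0 = \<one>"
 using chain_eval_diff[of 0 0] by simp

lemma chain_eval_uminus: "chain_eval G f (- a) = inv (chain_eval G f a)"
 using chain_eval_diff[of 0 a] by simp

end

lemma cochain_mult: "cochain G f ==> cochain G g ==> cochain G (%x. f x \<otimes> g x)"
 by (simp add: cochain_def)

lemma cochain_inv: "cochain G f ==> cochain G (%x. inv (f x))"
 by (simp add: cochain_def)

lemma chain_eval_cong:
 assumes "cochain G f" "cochain G g" "!!x. x \<in> Poly_Mapping.keys c ==> f x = g x"
 shows "chain_eval G f c = chain_eval G g c"
proof -
 have "Poly_Mapping.keys c \<subseteq> {x. f x = g x}"
  using assms by auto
 thus ?thesis
  by (induction c rule: frag_induction) (simp_all add: assms(1,2) chain_eval_diff)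
qed

lemma chain_eval_eq_one:
 assumes "cochain G f" "!!x. x \<in> Poly_Mapping.keys c ==> f x = \<one>"
 shows "chain_eval G f c = \<one>"
proof -
 have "Poly_Mapping.keys c \<subseteq> {x. f x = \<one>}"
  using assms by auto
 thus ?thesis
  by (induction c rule: frag_induction) (simp_all add: assms(1) chain_eval_diff)
qed

lemma chain_eval_mult:
 assumes "cochain G f" "cochain G g"
 shows "chain_eval G (%x. f x \<otimes> g x) c = chain_eval G f c \<otimes> chain_eval G g c"
proof -
 note [simp] = cochainD[OF assms(1)] cochainD[OF assms(2)]
 have fg: "cochain G (%x. f x \<otimes> g x)"
  by (simp add: cochainI)
 show ?thesis
  using subset_UNIV
  by (induction c rule: frag_induction)
   (use assms in \<open>simp_all add: chain_eval_diff fg m_ac inv_mult\<close>)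
qed

lemma chain_eval_inv:
 assumes "cochain G f"
 shows "chain_eval G (%x. inv (f x)) c = inv (chain_eval G f c)"
proof -
 note [simp] = cochainD[OF assms]
 have fg: "cochain G (%x. inv (f x))"
  by (simp add: cochainI)
 show ?thesis
  using subset_UNIV
  by (induction c rule: frag_induction)
   (use assms in \<open>simp_all add: chain_eval_diff fg m_ac inv_mult\<close>)
qed

lemma chain_eval_extend:
 assumes "cochain G f"
 shows "chain_eval G f (frag_extend e c) = chain_eval G (%x. chain_eval G f (e x)) c"
proof -
 have fe: "cochain G (%x. chain_eval G f (e x))"
  using assms by (simp add: cochainI)
 show ?thesis
  using subset_UNIV
  by (induction c rule: frag_induction) (simp_all add: assms fe chain_eval_diff frag_extend_diff)
qed

lemma chain_eval_chain_map:
 assumes "cochain G f"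
 shows "chain_eval G f (chain_map p g c) = chain_eval G (%x. f (simplex_map p g x)) c"
 unfolding chain_map_def chain_eval_extend[OF assms] by (simp add: assms)

text \<open>A homomorphism on the chain group of \<open>X\<close> is controlled on singular chains
  only, so the induction carries along that the sums remain singular chains. This is the bridge from
  the homomorphisms in \<open>cochain_group\<close> to functions on simplices.\<close>

lemma hom_eq_chain_eval:
 assumes h: "v \<in> hom (chain_group p X) G" and c: "singular_chain p X c"
  and f: "cochain G f" "!!u. sing p X u ==> f u = v (frag_of u)"
 shows "v c = chain_eval G f c"
proof -
 interpret H: group_hom "chain_group p X" G v
  by (simp add: group_hom_def group_hom_axioms_def h is_group)
 have "singular_chain p X c \<and> v c = chain_eval G f c"
  using c unfolding singular_chain_def
 proof (induction c rule: frag_induction)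
  case zero
  show ?case using H.hom_one by (simp add: f)
 next
  case (one x)
  thus ?case by (simp add: f)
 next
  case (diff a b)
  hence ab: "singular_chain p X a" "singular_chain p X b" "singular_chain p X (- b)"
   by (simp_all add: singular_chain_minus singular_chain_def)
  have "v (a + - b) = v a \<otimes> v (- b)"
   using H.hom_mult[of a "- b"] ab by simp
  moreover have "v (- b) = inv (v b)"
   using H.hom_inv[of b] ab by (simp add: singular_chain_def)
  ultimately show ?case
   using diff keys_diff[of a b] by (auto simp: chain_eval_diff f)
 qed
 thus ?thesis ..
qed

lemma cobd_closed [simp, intro]:
 "cochain G b ==> cobd G p b t \<in> carrier G"
 by (auto simp: cobd_def)

lemma cobd_fun [simp, intro]: "cochain G b ==> cochain G (cobd G p b)"
 by (simp add: cochainI)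

text \<open>Stokes' formula: both sides are additive in \<open>c\<close> and agree by definition on
  a single simplex.\<close>

lemma eval_boundary:
 assumes "cochain G b"
 shows "chain_eval G b (chain_boundary p c) = chain_eval G (cobd G p b) c"
proof -
 have cb: "cochain G (cobd G p b)"
  using assms by (rule cobd_fun)
 show ?thesis
  using subset_UNIV[of "Poly_Mapping.keys c"]
  by (induction c rule: frag_induction)
   (simp_all add: assms cb chain_eval_diff chain_boundary_diff, simp add: cobd_def)
qed

lemma cobd_mult:
 assumes "cochain G f" "cochain G g"
 shows "cobd G p (%x. f x \<otimes> g x) t = cobd G p f t \<otimes> cobd G p g t"
 by (simp add: assms cobd_def chain_eval_mult)

lemma cobd_inv:
 assumes "cochain G f"
 shows "cobd G p (%x. inv (f x)) t = inv (cobd G p f t)"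
 by (simp add: assms cobd_def chain_eval_inv)

lemma cobd_1:
 assumes "cochain G f"
 shows "cobd G 1 f t = f (singular_face 1 0 t) \<otimes> inv (f (singular_face 1 1 t))"
 by (simp add: assms cobd_def chain_boundary_of chain_eval_diff chain_eval_add chain_eval_uminus)

lemma cobd_2:
 assumes "cochain G f"
 shows "cobd G 2 f t = f (singular_face 2 0 t) \<otimes> inv (f (singular_face 2 1 t)) \<otimes> f (singular_face 2 2 t)"
 by (simp add: assms cobd_def chain_boundary_of chain_eval_add chain_eval_diff chain_eval_uminus numeral_2_eq_2)

lemma cobd_cong:
 assumes "cochain G f" "cochain G g" "sing p X t"
  "!!x. sing (p - 1) X x ==> f x = g x"
 shows "cobd G p f t = cobd G p g t"
 unfolding cobd_def
proof (rule chain_eval_cong[OF assms(1,2)])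
 fix x assume "x \<in> Poly_Mapping.keys (chain_boundary p (frag_of t))"
 moreover have "singular_chain p X (frag_of t)"
  unfolding singular_chain_of by (rule assms(3))
 ultimately show "f x = g x"
  by (intro assms(4) keys_chain_boundary)
qed

lemma cobd_cobd:
 assumes "cochain G b" "sing (Suc p) X t"
 shows "cobd G (Suc p) (cobd G p b) t = \<one>"
proof -
 have "cobd G (Suc p) (cobd G p b) t = chain_eval G b (chain_boundary p (chain_boundary (Suc p) (frag_of t)))"
  unfolding cobd_def[of _ "Suc p"] eval_boundary[OF assms(1)] ..
 also have "chain_boundary p (chain_boundary (Suc p) (frag_of t)) = 0"
  using chain_boundary_boundary[of "Suc p" X "frag_of t"] assms by (simp add: singular_chain_of)
 finally show ?thesis by (simp add: assms)
qed

lemma cocycle_fun: "cocycle G p X z ==> cochain G z"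
 by (simp add: cocycle_def)

lemma cocycle_boundary:
 assumes "cocycle G p X z" "singular_chain (Suc p) X d"
 shows "chain_eval G z (chain_boundary (Suc p) d) = \<one>"
 unfolding eval_boundary[OF cocycle_fun[OF assms(1)]]
 by (rule chain_eval_eq_one) (use assms in \<open>auto simp: cocycle_def singular_chain_def subset_iff\<close>)

lemma cobounds_fun: "cobounds G p X b z ==> cochain G b"
 by (simp add: cobounds_def)

lemma cobounds_chain:
 assumes "cobounds G p X b z" "cochain G z" "singular_chain p X c"
 shows "chain_eval G z c = chain_eval G b (chain_boundary p c)"
 unfolding eval_boundary[OF cobounds_fun[OF assms(1)]]
 by (rule chain_eval_cong) (use assms in \<open>auto simp: cobounds_def singular_chain_def subset_iff\<close>)

lemma cocycle_mult:
 assumes "cocycle G p X z" "cocycle G p X w"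
 shows "cocycle G p X (%x. z x \<otimes> w x)"
 using assms by (auto simp: cocycle_def cobd_mult cochain_mult)

lemma cocycle_inv:
 assumes "cocycle G p X z"
 shows "cocycle G p X (%x. inv (z x))"
 using assms by (auto simp: cocycle_def cobd_inv cochain_inv)

lemma cocycle_cobd:
 assumes "cochain G b"
 shows "cocycle G p X (cobd G p b)"
 using assms by (auto simp: cocycle_def cobd_cobd)

lemma cocycle_subtopology:
 assumes "cocycle G p X z" shows "cocycle G p (subtop X S) z"
 using assms by (auto simp: cocycle_def singular_simplex_subtopology)

lemma cobd_simplex_map:
 assumes b: "cochain G b" and t: "sing p X t"
 shows "cobd G p b (simplex_map p g t) = cobd G p (%u. b (simplex_map (p - 1) g u)) t"
proof -
 have "chain_boundary p (frag_of (simplex_map p g t)) = chain_map (p - 1) g (chain_boundary p (frag_of t))"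
  using chain_boundary_chain_map[of p X "frag_of t" g] t by (simp add: singular_chain_of)
 thus ?thesis
  by (simp add: cobd_def chain_eval_chain_map b)
qed

lemma cocycle_pullback:
 assumes z: "cocycle G p X z" and g: "cmap Y X g"
 shows "cocycle G p Y (%u. z (simplex_map p g u))"
 unfolding cocycle_def
proof (intro conjI allI impI)
 show "cochain G (%u. z (simplex_map p g u))"
  using cocycle_fun[OF z] by (rule cochain_comp)
 fix t assume "sing (Suc p) Y t"
 thus "cobd G (Suc p) (%u. z (simplex_map p g u)) t = \<one>"
  using cobd_simplex_map[OF cocycle_fun[OF z], of "Suc p" Y t g] z singular_simplex_simplex_map[OF _ g]
  by (auto simp: cocycle_def)
qed

end

section \<open>Acyclic pairs\<close>

text \<open>Vanishing of relative homology in degree \<open>p\<close>, on the level of chains. The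
  subcomplex is a family \<open>S\<close> of sets of simplices instead of a subspace, so that the
  simplices small for an open cover also qualify. For \<open>p = 0\<close> the boundary is 0 and the
  condition on it is empty.\<close>

definition acyclic_mod :: "nat => 'a topology => (nat => ((nat => real) => 'a) set) => bool" where
 "acyclic_mod p X S \<longleftrightarrow>
   (\<forall>c. singular_chain p X c --> Poly_Mapping.keys (chain_boundary p c) \<subseteq> S (p - 1) -->
    (\<exists>d. singular_chain (Suc p) X d \<and> Poly_Mapping.keys (c - chain_boundary (Suc p) d) \<subseteq> S p))"

lemma acyclic_modD:
 assumes "acyclic_mod p X S" "singular_chain p X c" "Poly_Mapping.keys (chain_boundary p c) \<subseteq> S (p - 1)"
 obtains d where "singular_chain (Suc p) X d" "Poly_Mapping.keys (c - chain_boundary (Suc p) d) \<subseteq> S p"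
 using assms unfolding acyclic_mod_def by blast

text \<open>Simultaneous choice of fillings, one for each simplex, with filling 0 inside
  \<open>S\<close>. These are the stages of a chain contraction, built degree by degree
  below.\<close>

lemma acyclic_mod_choice:
 assumes "acyclic_mod p X S"
  and "!!u. sing p X u ==> singular_chain p X (e u)
    \<and> Poly_Mapping.keys (chain_boundary p (e u)) \<subseteq> S (p - 1)"
  and "!!u. u \<in> S p ==> Poly_Mapping.keys (e u) \<subseteq> S p"
 obtains D where "!!u. sing p X u ==> singular_chain (Suc p) X (D u)"
  "!!u. sing p X u ==> Poly_Mapping.keys (e u - chain_boundary (Suc p) (D u)) \<subseteq> S p"
  "!!u. u \<in> S p ==> D u = 0"
proof -
 have "\<exists>d. (sing p X u --> singular_chain (Suc p) X d
   \<and> Poly_Mapping.keys (e u - chain_boundary (Suc p) d) \<subseteq> S p) \<and> (u \<in> S p --> d = 0)" for u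
 proof (cases "u \<in> S p")
  case True
  thus ?thesis using assms(3) by (intro exI[of _ 0]) auto
 next
  case False
  show ?thesis
  proof (cases "sing p X u")
   case True
   thus ?thesis
    using acyclic_modD[OF assms(1), of "e u"] assms(2)[OF True] False by metis
  qed (use False in auto)
 qed
 thus thesis
  using that by metis
qed

lemma frag_extend_diff_fun: "frag_extend f c - frag_extend g c = frag_extend (%x. f x - g x) c"
 using subset_UNIV[of "Poly_Mapping.keys c"]
proof (induction c rule: frag_induction)
 case (diff a b)
 thus ?case
  by (simp add: frag_extend_diff algebra_simps flip: diff)
qed auto

lemma frag_extend_boundary:
 "chain_boundary p (frag_extend D c) = frag_extend (%x. chain_boundary p (D x)) c"
 using subset_UNIV[of "Poly_Mapping.keys c"]
 by (induction c rule: frag_induction) (auto simp: frag_extend_diff chain_boundary_diff)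

lemma keys_diff_frag_extend:
 assumes "!!u. u \<in> Poly_Mapping.keys c ==> Poly_Mapping.keys (e u) \<subseteq> S"
 shows "Poly_Mapping.keys (frag_extend e c) \<subseteq> S"
 using assms keys_frag_extend[of e c] by blast

context comm_group begin

text \<open>The chain is a boundary, which the cocycle kills, plus a chain in \<open>S\<close>, on
  which \<open>z\<close> is trivial.\<close>

lemma chain_eval_eq_boundary:
 assumes z: "cocycle G p X z" and one: "!!u. u \<in> S ==> z u = \<one>"
  and d: "singular_chain (Suc p) X d" "Poly_Mapping.keys (c - chain_boundary (Suc p) d) \<subseteq> S"
 shows "chain_eval G z c = \<one>"
proof -
 note zf = cocycle_fun[OF z]
 have "chain_eval G z (c - chain_boundary (Suc p) d) = \<one>"
  by (rule chain_eval_eq_one) (use zf one d in auto)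
 moreover have "chain_eval G z (c - chain_boundary (Suc p) d)
  = chain_eval G z c \<otimes> inv (chain_eval G z (chain_boundary (Suc p) d))"
  by (rule chain_eval_diff[OF zf])
 ultimately show ?thesis
  using cocycle_boundary[OF z d(1)] zf by simp
qed

text \<open>The primitive is the integral of \<open>z\<close> along a chosen chain
  \<open>D u\<close> that joins the point \<open>u\<close> to \<open>S\<close>. An edge together
  with the chains chosen for its end points is a cycle relative to \<open>S\<close>, so
  \<open>z\<close> is trivial on it.\<close>

lemma cobounds_acyclic_1:
 assumes a0: "acyclic_mod 0 X S" and a1: "acyclic_mod 1 X S"
  and z: "cocycle G 1 X z" and one: "!!u. u \<in> S 1 ==> z u = \<one>"
 obtains f where "cobounds G 1 X f z" "!!u. u \<in> S 0 ==> f u = \<one>"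
proof -
 note zf = cocycle_fun[OF z]
 obtain D where D: "!!u. sing 0 X u ==> singular_chain (Suc 0) X (D u)"
  "!!u. sing 0 X u ==> Poly_Mapping.keys (frag_of u - chain_boundary (Suc 0) (D u)) \<subseteq> S 0"
  "!!u. u \<in> S 0 ==> D u = 0"
  using acyclic_mod_choice[OF a0, of frag_of] by (auto simp: singular_chain_of chain_boundary_def)
 define f where "f u = chain_eval G z (D u)" for u
 have ff: "cochain G f"
  by (simp add: f_def zf cochainI)
 show thesis
 proof
  show "cobounds G 1 X f z"
   unfolding cobounds_def
  proof (intro conjI allI impI ff)
   fix v assume v: "sing 1 X v"
   let ?b = "chain_boundary 1 (frag_of v)"
   have kb: "sing 0 X x" if "x \<in> Poly_Mapping.keys ?b" for x
    using keys_chain_boundary[of 1 X "frag_of v" x] v that by (simp add: singular_chain_of)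
   let ?c = "frag_of v - frag_extend D ?b"
   have c: "singular_chain 1 X ?c"
    using v kb D by (auto intro!: singular_chain_diff singular_chain_extend simp: singular_chain_of)
   have "chain_boundary 1 ?c = frag_extend frag_of ?b - frag_extend (%x. chain_boundary 1 (D x)) ?b"
    by (simp add: chain_boundary_diff frag_extend_boundary flip: frag_expansion)
   also have "\<dots> = frag_extend (%x. frag_of x - chain_boundary 1 (D x)) ?b"
    by (rule frag_extend_diff_fun)
   finally have "Poly_Mapping.keys (chain_boundary 1 ?c) \<subseteq> S (1 - 1)"
    using keys_diff_frag_extend[of ?b "%x. frag_of x - chain_boundary 1 (D x)" "S 0"] D(2) kb by simp
   then obtain d where "singular_chain (Suc 1) X d" "Poly_Mapping.keys (?c - chain_boundary (Suc 1) d) \<subseteq> S 1"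
    using acyclic_modD[OF a1 c] by blast
   hence "chain_eval G z ?c = \<one>"
    using chain_eval_eq_boundary[OF z one] by blast
   moreover have "chain_eval G z ?c = z v \<otimes> inv (cobd G 1 f v)"
    by (simp add: zf chain_eval_diff chain_eval_extend cobd_def f_def[abs_def])
   ultimately show "z v = cobd G 1 f v"
    using zf ff by (metis cochainD cobd_closed inv_closed inv_equality inv_inv)
  qed
  show "f u = \<one>" if "u \<in> S 0" for u
   using that D(3) by (simp add: f_def zf)
 qed
qed

text \<open>The same integration one degree higher. An edge is first turned into a relative cycle
  \<open>e u\<close> by subtracting the fillings of its end points, and the primitive is the value
  of \<open>z\<close> on a filling of \<open>e u\<close>. The assumption \<open>face\<close> makes
  the correction vanish for edges in \<open>S\<close>, so that the primitive is trivial
  there.\<close>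

lemma cobounds_acyclic_2:
 assumes a0: "acyclic_mod 0 X S" and a1: "acyclic_mod 1 X S" and a2: "acyclic_mod 2 X S"
  and face: "!!u. u \<in> S 1 ==> Poly_Mapping.keys (chain_boundary 1 (frag_of u)) \<subseteq> S 0"
  and z: "cocycle G 2 X z" and one: "!!u. u \<in> S 2 ==> z u = \<one>"
 obtains b where "cobounds G 2 X b z" "!!u. u \<in> S 1 ==> b u = \<one>"
proof -
 note zf = cocycle_fun[OF z]
 obtain D where D: "!!u. sing 0 X u ==> singular_chain (Suc 0) X (D u)"
  "!!u. sing 0 X u ==> Poly_Mapping.keys (frag_of u - chain_boundary (Suc 0) (D u)) \<subseteq> S 0"
  "!!u. u \<in> S 0 ==> D u = 0"
  using acyclic_mod_choice[OF a0, of frag_of] by (auto simp: singular_chain_of chain_boundary_def)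
 define e where "e u = frag_of u - frag_extend D (chain_boundary 1 (frag_of u))" for u
 have e: "singular_chain 1 X (e v)" "Poly_Mapping.keys (chain_boundary 1 (e v)) \<subseteq> S 0"
  if v: "sing 1 X v" for v
 proof -
  let ?b = "chain_boundary 1 (frag_of v)"
  have kb: "sing 0 X x" if "x \<in> Poly_Mapping.keys ?b" for x
   using keys_chain_boundary[of 1 X "frag_of v" x] v that by (simp add: singular_chain_of)
  show "singular_chain 1 X (e v)"
   unfolding e_def
   using v kb D by (auto intro!: singular_chain_diff singular_chain_extend simp: singular_chain_of)
  have "chain_boundary 1 (e v) = frag_extend frag_of ?b - frag_extend (%x. chain_boundary 1 (D x)) ?b"
   by (simp add: e_def chain_boundary_diff frag_extend_boundary flip: frag_expansion)
  also have "\<dots> = frag_extend (%x. frag_of x - chain_boundary 1 (D x)) ?b"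
   by (rule frag_extend_diff_fun)
  finally show "Poly_Mapping.keys (chain_boundary 1 (e v)) \<subseteq> S 0"
   using keys_diff_frag_extend[of ?b "%x. frag_of x - chain_boundary 1 (D x)" "S 0"] D(2) kb by simp
 qed
 have eS: "Poly_Mapping.keys (e u) \<subseteq> S 1" if "u \<in> S 1" for u
 proof -
  have "frag_extend D (chain_boundary 1 (frag_of u)) = 0"
   using face[OF that] D(3) by (intro frag_extend_eq_0) auto
  thus ?thesis using that by (simp add: e_def)
 qed
 obtain E where E: "!!u. sing 1 X u ==> singular_chain (Suc 1) X (E u)"
  "!!u. sing 1 X u ==> Poly_Mapping.keys (e u - chain_boundary (Suc 1) (E u)) \<subseteq> S 1"
  "!!u. u \<in> S 1 ==> E u = 0"
  using acyclic_mod_choice[OF a1, of e] e eS by auto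
 define b where "b u = chain_eval G z (E u)" for u
 have bf: "cochain G b"
  by (simp add: b_def zf cochainI)
 show thesis
 proof
  show "cobounds G 2 X b z"
   unfolding cobounds_def
  proof (intro conjI allI impI bf)
   fix t assume t: "sing 2 X t"
   let ?b = "chain_boundary 2 (frag_of t)"
   have kb: "sing 1 X x" if "x \<in> Poly_Mapping.keys ?b" for x
    using keys_chain_boundary[of 2 X "frag_of t" x] t that by (simp add: singular_chain_of)
   have bb: "chain_boundary 1 ?b = 0"
    using chain_boundary_boundary[of 2 X "frag_of t"] t by (simp add: singular_chain_of)
   let ?c = "frag_of t - frag_extend E ?b"
   have c: "singular_chain 2 X ?c"
    using t kb E by (auto intro!: singular_chain_diff singular_chain_extend simp: singular_chain_of numeral_2_eq_2)
   \<comment> \<open>The correction that leads from an edge to \<open>e\<close> depends on the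
     boundary of the edge only. On the boundary of a triangle it adds up to 0 by \<open>bb\<close>,
     so \<open>e\<close> may replace the edges there.\<close>
   have ee: "frag_extend e d = d - frag_extend D (chain_boundary 1 d)" for d
    using subset_UNIV[of "Poly_Mapping.keys d"]
    by (induction d rule: frag_induction) (auto simp: frag_extend_diff e_def chain_boundary_diff)
   have "chain_boundary 2 ?c = frag_extend e ?b - frag_extend (%x. chain_boundary 2 (E x)) ?b"
    unfolding ee bb by (simp add: chain_boundary_diff frag_extend_boundary)
   also have "\<dots> = frag_extend (%x. e x - chain_boundary 2 (E x)) ?b"
    by (rule frag_extend_diff_fun)
   finally have "Poly_Mapping.keys (chain_boundary 2 ?c) \<subseteq> S (2 - 1)"
    using keys_diff_frag_extend[of ?b "%x. e x - chain_boundary 2 (E x)" "S 1"] E(2) kb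
    by (simp add: numeral_2_eq_2)
   then obtain d where "singular_chain (Suc 2) X d" "Poly_Mapping.keys (?c - chain_boundary (Suc 2) d) \<subseteq> S 2"
    using acyclic_modD[OF a2 c] by blast
   hence "chain_eval G z ?c = \<one>"
    using chain_eval_eq_boundary[OF z one] by blast
   moreover have "chain_eval G z ?c = z t \<otimes> inv (cobd G 2 b t)"
    by (simp add: zf chain_eval_diff chain_eval_extend cobd_def b_def[abs_def])
   ultimately show "z t = cobd G 2 b t"
    using zf bf by (metis cochainD cobd_closed inv_closed inv_equality inv_inv)
  qed
  show "b u = \<one>" if "u \<in> S 1" for u
   using that E(3) by (simp add: b_def zf)
 qed
qed

end

text \<open>Iterated barycentric subdivision makes every chain subordinate to the cover, and it is
  chain homotopic to the identity by a homotopy that preserves smallness.\<close>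

lemma acyclic_mod_small:
 assumes UV: "openin X U" "openin X V" "topspace X \<subseteq> U \<union> V"
 shows "acyclic_mod p X (%p. {u. sing p (subtop X U) u \<or> sing p (subtop X V) u})"
  (is "acyclic_mod p X ?S")
 unfolding acyclic_mod_def
proof (intro allI impI)
 fix c assume c: "singular_chain p X c" and bc: "Poly_Mapping.keys (chain_boundary p c) \<subseteq> ?S (p - 1)"
 have C: "!!W. W \<in> {U,V} ==> openin X W" "topspace X \<subseteq> \<Union>{U,V}"
  using UV by auto
 obtain n where n: "!!m f. [|n \<le> m; f \<in> Poly_Mapping.keys ((singular_subdivision p ^^ m) c)|]
           ==> \<exists>W \<in> {U,V}. f \<in> (splx p) \<rightarrow> W"
 proof (rule sufficient_iterated_singular_subdivision_exists[OF _ C(2) c], goal_cases)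
  case (1 W)
  show ?case by (rule C(1)[OF 1(2)])
 next
  case (2 n)
  show ?case by (rule that[of n], rule 2(2))
 qed
 obtain h where h: "!!p. h p 0 = (0 :: 'a chain)"
    "!!p c1 c2. h p (c1-c2) = h p c1 - h p c2"
    "!!p X c. singular_chain p X c ==> singular_chain (Suc p) X (h p c)"
    "!!p X c. singular_chain p X c
         ==> chain_boundary (Suc p) (h p c) + h (p - Suc 0) (chain_boundary p c)
          = (singular_subdivision p ^^ n) c - c"
 proof (rule chain_homotopic_iterated_singular_subdivision[of n])
  fix h :: "nat => 'a chain => 'a chain"
  assume "!!p. h p 0 = (0 :: 'a chain)"
    "!!p c1 c2. h p (c1-c2) = h p c1 - h p c2"
    "!!p (X :: 'a topology) c. singular_chain p X c ==> singular_chain (Suc p) X (h p c)"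
    "!!p (X :: 'a topology) c. singular_chain p X c
         ==> chain_boundary (Suc p) (h p c) + h (p - Suc 0) (chain_boundary p c)
          = (singular_subdivision p ^^ n) c - c"
  thus thesis by (rule that)
 qed
 have sd: "Poly_Mapping.keys ((singular_subdivision p ^^ n) c) \<subseteq> ?S p"
 proof
  fix f assume f: "f \<in> Poly_Mapping.keys ((singular_subdivision p ^^ n) c)"
  have "singular_chain p X ((singular_subdivision p ^^ n) c)"
   using c by (induction n) (auto simp: singular_chain_singular_subdivision)
  hence "sing p X f"
   using f by (auto simp: singular_chain_def)
  thus "f \<in> ?S p"
   using n[OF order_refl f] by (auto simp: singular_simplex_subtopology)
 qed
 \<comment> \<open>The homotopy \<open>h\<close> is natural: it is one operator for all topologies
   on the type and takes chains of \<open>U\<close> to chains of \<open>U\<close>, likewise for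
   \<open>V\<close>. Hence it preserves sums of small simplices.\<close>
 have hb: "Poly_Mapping.keys (h (p - 1) (chain_boundary p c)) \<subseteq> ?S p"
 proof (cases "p = 0")
  case True
  thus ?thesis by (simp add: chain_boundary_def h)
 next
  case False
  have "Poly_Mapping.keys (h (p - 1) b) \<subseteq> ?S p" if "Poly_Mapping.keys b \<subseteq> ?S (p - 1)" for b
   using that
  proof (induction b rule: frag_induction)
   case (one x)
   hence "singular_chain (Suc (p - 1)) (subtop X U) (h (p - 1) (frag_of x)) \<or>
    singular_chain (Suc (p - 1)) (subtop X V) (h (p - 1) (frag_of x))"
    using h(3)[of "p - 1" _ "frag_of x"] by (auto simp: singular_chain_of)
   thus ?case
    using False by (auto simp: singular_chain_def)
  next
   case (diff a b)
   thus ?case using keys_diff[of "h (p - 1) a" "h (p - 1) b"] by (simp add: h) blast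
  qed (auto simp: h)
  thus ?thesis using bc by blast
 qed
 have eq: "c - chain_boundary (Suc p) (- h p c) = (singular_subdivision p ^^ n) c - h (p - 1) (chain_boundary p c)"
  using h(4)[OF c] by (simp add: chain_boundary_minus algebra_simps)
 show "\<exists>d. singular_chain (Suc p) X d \<and> Poly_Mapping.keys (c - chain_boundary (Suc p) d) \<subseteq> ?S p"
 proof (intro exI conjI)
  show "singular_chain (Suc p) X (- h p c)"
   using h(3)[OF c] by (simp add: singular_chain_minus)
  show "Poly_Mapping.keys (c - chain_boundary (Suc p) (- h p c)) \<subseteq> ?S p"
   unfolding eq by (rule order_trans[OF keys_diff Un_least[OF sd hb]])
 qed
qed

text \<open>Homotopy invariance of relative homology: the end map takes every chain into
  \<open>S\<close>, and it is chain homotopic to the identity relative to \<open>S\<close> because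
  \<open>S\<close> moves within itself.\<close>

lemma acyclic_mod_deformation:
 assumes H: "cmap (prod_topology (top_of_set {0..1::real}) X) X H"
  and H0: "!!x. x \<in> topspace X ==> H (0, x) = x"
  and H1: "!!x. x \<in> topspace X ==> H (1, x) \<in> S"
  and HS: "!!t x. [|0 \<le> t; t \<le> 1; x \<in> S; x \<in> topspace X|] ==> H (t, x) \<in> S"
 shows "acyclic_mod p X (%p. {u. sing p (subtop X S) u})"
 unfolding acyclic_mod_def
proof (intro allI impI)
 let ?T = "topspace X \<inter> S"
 fix c assume c: "singular_chain p X c"
  and bc: "Poly_Mapping.keys (chain_boundary p c) \<subseteq> {u. sing (p - 1) (subtop X S) u}"
 define r where "r x = H (1, x)" for x
 have rel: "singular_relcycle p X ?T c"
  unfolding singular_relcycle_restrict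
  using c bc by (auto simp: singular_relcycle singular_chain_def)
 have hom: "homotopic_with (%h. h \<in> ?T \<rightarrow> ?T) X X (%x. H (0, x)) r"
  unfolding homotopic_with_def
 proof (intro exI conjI)
  show "cmap (prod_topology (top_of_set {0..1}) X) X H" by (fact H)
  have "H (t, x) \<in> topspace X" if "0 \<le> t" "t \<le> 1" "x \<in> topspace X" for t x
   using continuous_map_image_subset_topspace[OF H] that by auto
  thus "\<forall>t\<in>{0..1}. (%x. H (t, x)) \<in> ?T \<rightarrow> ?T"
   using HS by auto
 qed (auto simp: r_def)
 have "homologous_rel p X ?T (chain_map p (%x. H (0, x)) c) (chain_map p r c)"
  by (rule homotopic_imp_homologous_rel_chain_maps[OF hom rel])
 moreover have "chain_map p (%x. H (0, x)) c = c"
  using chain_map_id_gen[OF c, of "%x. H (0, x)"] H0 by simp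
 ultimately have "singular_relboundary p X ?T (c - chain_map p r c)"
  by (simp add: homologous_rel_def)
 then obtain d e where d: "singular_chain (Suc p) X d" "singular_chain p (subtop X S) e"
   "chain_boundary (Suc p) d + e = c - chain_map p r c"
  unfolding singular_relboundary_restrict singular_relboundary by blast
 have rc: "cmap X (subtop X S) r"
 proof -
  have "cmap X (prod_topology (top_of_set {0..1::real}) X) (%x. (1, x))"
   by (intro continuous_intros) (auto simp: cmap_in_sub)
  hence "cmap X X (H \<circ> (%x. (1, x)))"
   using H cmap_comp by blast
  thus ?thesis
   unfolding cmap_in_sub r_def o_def using H1 by auto
 qed
 have "singular_chain p (subtop X S) (chain_map p r c)"
  by (rule singular_chain_chain_map[OF c rc])
 hence "singular_chain p (subtop X S) (e + chain_map p r c)"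
  using d(2) singular_chain_add by blast
 moreover have "e + chain_map p r c = c - chain_boundary (Suc p) d"
  using d(3) by (simp add: algebra_simps)
 ultimately show "\<exists>d. singular_chain (Suc p) X d \<and> Poly_Mapping.keys (c - chain_boundary (Suc p) d) \<subseteq> {u. sing p (subtop X S) u}"
  using d(1) by (auto simp: singular_chain_def)
qed

definition csimp :: "nat => 'a => (nat => real) => 'a" where
 "csimp p a = (\<lambda>x\<in>standard_simplex p. a)"

lemma singular_face_const:
 "[|0 < p; k \<le> p|] ==> singular_face p k (csimp p a) = csimp (p - 1) a"
 by (auto simp: csimp_def singular_face_def fun_eq_iff simplical_face_in_standard_simplex)

lemma singular_simplex_const: "a \<in> topspace X ==> sing p X (csimp p a)"
 by (auto simp: csimp_def singular_simplex_def)

lemma const_simplex_eq_iff: "csimp p a = csimp p b \<longleftrightarrow> a = b"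
 using nonempty_standard_simplex[of p] by (auto simp: csimp_def fun_eq_iff)

lemma singular_simplex_point:
 assumes "a \<in> topspace X"
 shows "sing p (subtop X {a}) u \<longleftrightarrow> u = csimp p a"
 unfolding csimp_def by (rule singular_simplex_singleton) (use assms in auto)

abbreviation simplices_in :: "'a topology => 'a set => nat => ((nat => real) => 'a) set" where
 "simplices_in X S p \<equiv> {u. sing p (subtop X S) u}"

lemma keys_face_simplices_in:
 assumes "sing p (subtop X S) u"
 shows "Poly_Mapping.keys (chain_boundary p (frag_of u)) \<subseteq> simplices_in X S (p - 1)"
 using keys_chain_boundary[of p "subtop X S" "frag_of u"] assms by (auto simp: singular_chain_of)

context comm_group begin

text \<open>All three faces of the constant triangle are the constant edge, so the cocycle relation
  on it reads z z^-1 z = 1.\<close>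

lemma cocycle_1_const:
 assumes "cocycle G 1 X z" "a \<in> topspace X"
 shows "z (csimp 1 a) = \<one>"
proof -
 have c: "z x \<in> carrier G" for x
  using cochainD[OF cocycle_fun[OF assms(1)]] .
 have "cobd G 2 z (csimp 2 a) = \<one>"
  using assms singular_simplex_const[of a X 2] by (simp add: cocycle_def numeral_2_eq_2)
 thus ?thesis
  by (simp add: cobd_2[OF cocycle_fun[OF assms(1)]] singular_face_const c)
qed

lemma cocycle_diff:
 assumes "cocycle G p X z" "cocycle G p X w"
 shows "cocycle G p X (%x. z x \<otimes> inv (w x))"
 by (intro cocycle_mult cocycle_inv assms)

lemma cobounds_diffD:
 assumes "cobounds G p X b (%x. z x \<otimes> inv (w x))" "cochain G z" "cochain G w" "sing p X u"
 shows "z u = w u \<otimes> cobd G p b u"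
proof -
 have "z u \<otimes> inv (w u) = cobd G p b u"
  using assms by (simp add: cobounds_def)
 thus ?thesis
  using assms(2,3) by (metis cochainD cobd_closed cobounds_fun[OF assms(1)] inv_solve_right m_comm)
qed

text \<open>Serves for sets \<open>S\<close> all of whose simplices are constant, such as a point or
  a discrete set: in degree 1 a cocycle is automatically trivial on them.\<close>

lemma cobounds_constant_1:
 assumes a: "!!p. acyclic_mod p X (simplices_in X S)"
  and S: "!!p u. sing p (subtop X S) u ==> \<exists>a\<in>topspace X. u = csimp p a"
  and z: "cocycle G 1 X z"
 obtains f where "cobounds G 1 X f z" "!!u. u \<in> simplices_in X S 0 ==> f u = \<one>"
proof -
 have one: "z u = \<one>" if "u \<in> simplices_in X S 1" for u
  using that S[of 1 u] cocycle_1_const[OF z] by auto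
 show thesis
  by (rule cobounds_acyclic_1[OF a a z], erule one, rule that)
qed

text \<open>In degree 2 a cocycle can be nontrivial on constant triangles. Their three faces enter
  with the signs +, -, +, so the 1-cochain \<open>b0\<close> that copies the value of
  \<open>z\<close> from the constant triangle to the constant edge has this value as its coboundary
  and removes it.\<close>

lemma cobounds_constant_2:
 assumes a: "!!p. acyclic_mod p X (simplices_in X S)"
  and S: "!!p u. sing p (subtop X S) u ==> \<exists>a\<in>topspace X. u = csimp p a"
  and z: "cocycle G 2 X z"
 obtains b where "cobounds G 2 X b z"
proof -
 note zf = cocycle_fun[OF z]
 define b0 where "b0 c = (if \<exists>a. c = csimp 1 a then z (csimp 2 (THE a. c = csimp 1 a)) else \<one>)" for c
 have b0c: "b0 (csimp 1 a) = z (csimp 2 a)" for a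
  unfolding b0_def by (auto simp: const_simplex_eq_iff)
 have b0: "cochain G b0"
  by (rule cochainI) (simp add: b0_def cochainD[OF zf])
 define w where "w u = z u \<otimes> inv (cobd G 2 b0 u)" for u
 have w: "cocycle G 2 X w"
  unfolding w_def using cocycle_diff[OF z cocycle_cobd[OF b0]] by simp
 have one: "w u = \<one>" if u: "u \<in> simplices_in X S 2" for u
 proof -
  obtain a where "a \<in> topspace X" and a: "u = csimp 2 a"
   using S[of 2 u] u by auto
  have "cobd G 2 b0 u = z u"
   by (simp add: cobd_2[OF b0] a singular_face_const b0c[unfolded One_nat_def] cochainD[OF zf])
  thus ?thesis
   by (simp add: w_def cochainD[OF zf])
 qed
 obtain b where b: "cobounds G 2 X b w"
 proof (rule cobounds_acyclic_2[OF a a a _ w one])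
  show "Poly_Mapping.keys (chain_boundary 1 (frag_of u)) \<subseteq> simplices_in X S 0" if "u \<in> simplices_in X S 1" for u
   using keys_face_simplices_in[of 1 X S u] that by simp
 qed auto
 note bf = cobounds_fun[OF b]
 show thesis
 proof
  show "cobounds G 2 X (%x. b0 x \<otimes> b x) z"
   unfolding cobounds_def
  proof (intro conjI allI impI cochain_mult b0 bf)
   fix t assume "sing 2 X t"
   thus "z t = cobd G 2 (%x. b0 x \<otimes> b x) t"
    using cobounds_diffD[OF b[unfolded w_def] zf cobd_fun[OF b0]] by (simp add: cobd_mult b0 bf)
  qed
 qed
qed

text \<open>Points are always small, so a primitive that is trivial at the points of
  \<open>U\<close> and of \<open>V\<close> is trivial at every point; its coboundary is then trivial
  on every edge, however long.\<close>

lemma cocycle_small_1: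
 assumes UV: "openin X U" "openin X V" "topspace X \<subseteq> U \<union> V"
  and z: "cocycle G 1 X z"
  and U: "!!u. sing 1 (subtop X U) u ==> z u = \<one>"
  and V: "!!u. sing 1 (subtop X V) u ==> z u = \<one>"
  and c: "sing 1 X c"
 shows "z c = \<one>"
proof -
 let ?S = "%p. {u. sing p (subtop X U) u \<or> sing p (subtop X V) u}"
 obtain f where f: "cobounds G 1 X f z" "!!u. u \<in> ?S 0 ==> f u = \<one>"
  by (rule cobounds_acyclic_1[OF acyclic_mod_small[OF UV] acyclic_mod_small[OF UV] z]) (use U V in auto)
 have f1: "f (singular_face 1 k c) = \<one>" if "k \<le> 1" for k
 proof (rule f(2))
  have s: "sing 0 X (singular_face 1 k c)"
   using singular_simplex_singular_face[OF c _ that] by simp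
  have "singular_face 1 k c ` splx 0 \<subseteq> topspace X"
   using s by (auto simp: singular_simplex_def cmap_def)
  thus "singular_face 1 k c \<in> ?S 0"
   using s UV by (auto simp: singular_simplex_subtopology standard_simplex_0)
 qed
 show ?thesis
  using f(1) c f1[of 0] f1[of 1] by (simp add: cobounds_def cobd_1[unfolded One_nat_def])
qed

lemma cobounds_small_2:
 assumes UV: "openin X U" "openin X V" "topspace X \<subseteq> U \<union> V"
  and z: "cocycle G 2 X z"
  and U: "!!u. sing 2 (subtop X U) u ==> z u = \<one>"
  and V: "!!u. sing 2 (subtop X V) u ==> z u = \<one>"
 obtains b where "cobounds G 2 X b z"
proof -
 let ?S = "%p. {u. sing p (subtop X U) u \<or> sing p (subtop X V) u}"
 note a = acyclic_mod_small[OF UV]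
 show thesis
 proof (rule cobounds_acyclic_2[OF a a a _ z])
  show "Poly_Mapping.keys (chain_boundary 1 (frag_of u)) \<subseteq> ?S 0" if "u \<in> ?S 1" for u
   using keys_face_simplices_in[of 1 X U u] keys_face_simplices_in[of 1 X V u] that by auto
 qed (use U V that in auto)
qed

end

section \<open>Singular cohomology classes from cochains\<close>

locale coeff_group = comm_group G for G :: "'a monoid" (structure)
begin

lemma cochain_group_iff:
 "f \<in> carrier (cochain_group n X S G) \<longleftrightarrow> f \<in> extensional (singular_chain_set n X) \<and>
   (\<forall>c. singular_chain n X c --> f c \<in> carrier G) \<and>
   (\<forall>c d. singular_chain n X c --> singular_chain n X d --> f (c + d) = f c \<otimes> f d) \<and>
   (\<forall>c. singular_chain n (subtop X S) c --> f c = \<one>)"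
 by (auto simp: cochain_group_def hom_def)

lemma comm_group_cochain_group: "comm_group (cochain_group n X S G)"
proof (rule comm_groupI)
 let ?C = "cochain_group n X S G"
 have car: "f c \<in> carrier G" if "f \<in> carrier ?C" "singular_chain n X c" for f c
  using that by (auto simp: cochain_group_def hom_def)
 have ext: "f = g" if "f \<in> carrier ?C" "g \<in> carrier ?C" "!!c. singular_chain n X c ==> f c = g c" for f g
  using that by (auto simp: cochain_group_def intro: extensionalityI)
 have sub: "singular_chain n X c" if "singular_chain n (subtop X S) c" for c
  using that by (simp add: singular_chain_subtopology)
 note mem = cochain_group_iff
 have mult: "f \<otimes>\<^bsub>?C\<^esub> g = (\<lambda>c\<in>singular_chain_set n X. f c \<otimes> g c)" for f g
  by (simp add: cochain_group_def)
 have one: "\<one>\<^bsub>?C\<^esub> = (\<lambda>c\<in>singular_chain_set n X. \<one>)"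
  by (simp add: cochain_group_def)
 show m: "f \<otimes>\<^bsub>?C\<^esub> g \<in> carrier ?C" if f: "f \<in> carrier ?C" and g: "g \<in> carrier ?C" for f g
  using f g unfolding mem mult by (simp add: sub singular_chain_add m_ac)
 show o: "\<one>\<^bsub>?C\<^esub> \<in> carrier ?C"
  unfolding mem one by (simp add: sub singular_chain_add)
 show "f \<otimes>\<^bsub>?C\<^esub> g \<otimes>\<^bsub>?C\<^esub> h = f \<otimes>\<^bsub>?C\<^esub> (g \<otimes>\<^bsub>?C\<^esub> h)"
  if f: "f \<in> carrier ?C" and g: "g \<in> carrier ?C" and h: "h \<in> carrier ?C" for f g h
  unfolding mult by (rule restrict_ext) (simp add: car[OF f] car[OF g] car[OF h] m_assoc)
 show "f \<otimes>\<^bsub>?C\<^esub> g = g \<otimes>\<^bsub>?C\<^esub> f" if f: "f \<in> carrier ?C" and g: "g \<in> carrier ?C" for f g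
  unfolding mult by (rule restrict_ext) (simp add: car[OF f] car[OF g] m_comm)
 show "\<one>\<^bsub>?C\<^esub> \<otimes>\<^bsub>?C\<^esub> f = f" if f: "f \<in> carrier ?C" for f
  by (rule ext[OF m[OF o f] f]) (simp add: mult one car[OF f])
 show "\<exists>g\<in>carrier ?C. g \<otimes>\<^bsub>?C\<^esub> f = \<one>\<^bsub>?C\<^esub>" if f: "f \<in> carrier ?C" for f
 proof (intro bexI)
  let ?g = "\<lambda>c\<in>singular_chain_set n X. inv (f c)"
  show g: "?g \<in> carrier ?C"
   using f unfolding mem by (simp add: sub singular_chain_add inv_mult)
  show "?g \<otimes>\<^bsub>?C\<^esub> f = \<one>\<^bsub>?C\<^esub>"
   unfolding mult one by (rule restrict_ext) (simp add: car[OF f])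
 qed
qed

lemma coboundary_hom:
 "group_hom (cochain_group n X S G) (cochain_group (Suc n) X S G) (cochain_coboundary n X)"
proof -
 have d: "cochain_coboundary n X f \<in> carrier (cochain_group (Suc n) X S G)"
  if f: "f \<in> carrier (cochain_group n X S G)" for f
 proof -
  have "singular_chain (Suc n) X c \<and> singular_chain n (subtop X S) (chain_boundary (Suc n) c)"
   if "singular_chain (Suc n) (subtop X S) c" for c
   using that singular_chain_boundary_alt singular_chain_subtopology by blast
  thus ?thesis
   using f unfolding cochain_group_iff cochain_coboundary_def
   by (simp add: singular_chain_boundary_alt singular_chain_add chain_boundary_add)
 qed
 show ?thesis
  unfolding group_hom_def group_hom_axioms_def
 proof (intro conjI homI d)
  fix f g assume "f \<in> carrier (cochain_group n X S G)" "g \<in> carrier (cochain_group n X S G)"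
  show "cochain_coboundary n X (f \<otimes>\<^bsub>cochain_group n X S G\<^esub> g) =
    cochain_coboundary n X f \<otimes>\<^bsub>cochain_group (Suc n) X S G\<^esub> cochain_coboundary n X g"
   by (simp add: cochain_group_def cochain_coboundary_def singular_chain_boundary_alt cong: restrict_cong)
 qed (rule comm_group.axioms(2)[OF comm_group_cochain_group])+
qed

definition to_cochain :: "nat => 'x topology => (((nat => real) => 'x) => 'a) => 'x chain => 'a" where
 "to_cochain n X z = (\<lambda>c\<in>carrier (chain_group n X). chain_eval G z c)"

context
 fixes X :: "'x topology" and x\<^sub>0 assumes x0: "x\<^sub>0 \<in> topspace X"
begin

text \<open>The simplices of the one-point subspace are the constant ones, so vanishing on its
  chains amounts to the single condition at \<open>csimp n x\<^sub>0\<close>.\<close>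

lemma to_cochain_in:
 assumes z: "cochain G z" and "z (csimp n x\<^sub>0) = \<one>"
 shows "to_cochain n X z \<in> carrier (cochain_group n X {x\<^sub>0} G)"
proof -
 have "chain_eval G z c = \<one>" if "singular_chain n (subtop X {x\<^sub>0}) c" for c
  by (rule chain_eval_eq_one[OF z]) (use that assms(2) in \<open>auto simp: singular_chain_def singular_simplex_point[OF x0] subset_iff\<close>)
 thus ?thesis
  by (auto simp: cochain_group_def to_cochain_def hom_def z chain_eval_add singular_chain_add singular_chain_subtopology)
qed

lemma from_cochain:
 assumes f: "f \<in> carrier (cochain_group n X {x\<^sub>0} G)"
 obtains z where "cochain G z" "z (csimp n x\<^sub>0) = \<one>" "f = to_cochain n X z"
proof -
 \<comment> \<open>The value off the simplices of \<open>X\<close> is a dummy; only membership in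
   the carrier matters there.\<close>
 define z where "z u = (if sing n X u then f (frag_of u) else \<one>)" for u
 have h: "f \<in> hom (chain_group n X) G"
  using f by (simp add: cochain_group_def)
 have z: "cochain G z"
  by (rule cochainI) (use h in \<open>auto simp: z_def hom_def singular_chain_of\<close>)
 show thesis
 proof (rule that[OF z])
  have "singular_chain n (subtop X {x\<^sub>0}) (frag_of (csimp n x\<^sub>0))"
   by (simp add: singular_chain_of singular_simplex_point[OF x0])
  thus "z (csimp n x\<^sub>0) = \<one>"
   using f by (simp add: z_def cochain_group_def)
  show "f = to_cochain n X z"
  proof (rule extensionalityI[of _ "carrier (chain_group n X)"])
   show "f c = to_cochain n X z c" if "c \<in> carrier (chain_group n X)" for c
    using hom_eq_chain_eval[OF h _ z, of c] that by (simp add: to_cochain_def z_def)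
  qed (use f in \<open>auto simp: cochain_group_def to_cochain_def\<close>)
 qed
qed

lemma coboundary_to_cochain:
 assumes "cochain G z"
 shows "cochain_coboundary n X (to_cochain n X z) = to_cochain (Suc n) X (cobd G (Suc n) z)"
 by (auto simp: fun_eq_iff cochain_coboundary_def to_cochain_def singular_chain_boundary_alt eval_boundary[OF assms])

lemma to_cochain_eq_iff:
 assumes "cochain G z" "cochain G w"
 shows "to_cochain n X z = to_cochain n X w \<longleftrightarrow> (\<forall>u. sing n X u --> z u = w u)"
proof
 assume L: "to_cochain n X z = to_cochain n X w"
 show "\<forall>u. sing n X u --> z u = w u"
 proof (intro allI impI)
  fix u assume "sing n X u"
  thus "z u = w u"
   using fun_cong[OF L, of "frag_of u"] by (simp add: to_cochain_def singular_chain_of assms)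
 qed
next
 assume R: "\<forall>u. sing n X u --> z u = w u"
 show "to_cochain n X z = to_cochain n X w"
  unfolding to_cochain_def
  by (intro restrict_ext chain_eval_cong assms) (use R in \<open>auto simp: singular_chain_def\<close>)
qed

lemma one_cochain: "cochain G (%_. \<one>)"
 by (simp add: cochain_def)

lemma one_cochain_group: "\<one>\<^bsub>cochain_group n X {x\<^sub>0} G\<^esub> = to_cochain n X (%_. \<one>)"
 by (auto simp: cochain_group_def to_cochain_def fun_eq_iff chain_eval_eq_one one_cochain)

lemma to_cochain_cocycle:
 assumes "cocycle G n X z" "z (csimp n x\<^sub>0) = \<one>"
 shows "to_cochain n X z \<in> singular_cocycles n X {x\<^sub>0} G"
 using assms to_cochain_in[of z n] to_cochain_eq_iff[of "cobd G (Suc n) z" "%_. \<one>" "Suc n"] one_cochain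
 by (auto simp: singular_cocycles_def coboundary_to_cochain cocycle_def one_cochain_group)

lemma from_cochain_cocycle:
 assumes "f \<in> singular_cocycles n X {x\<^sub>0} G"
 obtains z where "cocycle G n X z" "z (csimp n x\<^sub>0) = \<one>" "f = to_cochain n X z"
proof -
 obtain z where z: "cochain G z" "z (csimp n x\<^sub>0) = \<one>" "f = to_cochain n X z"
  using from_cochain assms unfolding singular_cocycles_def by blast
 moreover have "cocycle G n X z"
  using assms z(1) to_cochain_eq_iff[of "cobd G (Suc n) z" "%_. \<one>" "Suc n"] one_cochain
  by (auto simp: cocycle_def z(3) singular_cocycles_def coboundary_to_cochain one_cochain_group)
 ultimately show thesis using that by blast
qed

definition coh_class :: "nat => (((nat => real) => 'x) => 'a) => ('x chain => 'a) set" where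
 "coh_class n z = singular_coboundaries n X {x\<^sub>0} G
   #>\<^bsub>(cochain_group n X {x\<^sub>0} G)\<lparr>carrier := singular_cocycles n X {x\<^sub>0} G\<rparr>\<^esub> to_cochain n X z"

lemma carrier_cohomology:
 "carrier (singular_cohomology n X {x\<^sub>0} G) = {coh_class n z | z. cocycle G n X z \<and> z (csimp n x\<^sub>0) = \<one>}"
proof -
 have "singular_cocycles n X {x\<^sub>0} G = to_cochain n X ` {z. cocycle G n X z \<and> z (csimp n x\<^sub>0) = \<one>}"
  by (auto simp: to_cochain_cocycle elim: from_cochain_cocycle)
 thus ?thesis
  unfolding singular_cohomology_def FactGroup_def RCOSETS_def coh_class_def by auto
qed

lemma cocycles_subgroup: "subgroup (singular_cocycles n X {x\<^sub>0} G) (cochain_group n X {x\<^sub>0} G)"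
proof -
 have "singular_cocycles n X {x\<^sub>0} G = kernel (cochain_group n X {x\<^sub>0} G) (cochain_group (Suc n) X {x\<^sub>0} G) (cochain_coboundary n X)"
  by (simp add: singular_cocycles_def kernel_def)
 thus ?thesis
  using group_hom.subgroup_kernel[OF coboundary_hom] by metis
qed

lemma coboundaries_subgroup:
 "subgroup (singular_coboundaries (Suc n) X {x\<^sub>0} G)
  ((cochain_group (Suc n) X {x\<^sub>0} G)\<lparr>carrier := singular_cocycles (Suc n) X {x\<^sub>0} G\<rparr>)"
proof (rule group.subgroup_incl)
 show "group (cochain_group (Suc n) X {x\<^sub>0} G)"
  by (rule comm_group.axioms(2)[OF comm_group_cochain_group])
 show "subgroup (singular_coboundaries (Suc n) X {x\<^sub>0} G) (cochain_group (Suc n) X {x\<^sub>0} G)"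
  using group_hom.img_is_subgroup[OF coboundary_hom] by (simp add: singular_coboundaries_def)
 show "subgroup (singular_cocycles (Suc n) X {x\<^sub>0} G) (cochain_group (Suc n) X {x\<^sub>0} G)"
  by (rule cocycles_subgroup)
 show "singular_coboundaries (Suc n) X {x\<^sub>0} G \<subseteq> singular_cocycles (Suc n) X {x\<^sub>0} G"
 proof
  fix g assume "g \<in> singular_coboundaries (Suc n) X {x\<^sub>0} G"
  then obtain f where f: "f \<in> carrier (cochain_group n X {x\<^sub>0} G)" "g = cochain_coboundary n X f"
   by (auto simp: singular_coboundaries_def)
  obtain b where b: "cochain G b" "f = to_cochain n X b"
   using from_cochain f(1) by blast
  have "g \<in> carrier (cochain_group (Suc n) X {x\<^sub>0} G)"
   using f group_hom.hom_closed[OF coboundary_hom] by blast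
  moreover have "cochain_coboundary (Suc n) X g = \<one>\<^bsub>cochain_group (Suc (Suc n)) X {x\<^sub>0} G\<^esub>"
   unfolding f(2) b(2) one_cochain_group
   by (simp add: coboundary_to_cochain b cobd_fun to_cochain_eq_iff one_cochain cobd_cobd)
  ultimately show "g \<in> singular_cocycles (Suc n) X {x\<^sub>0} G"
   by (simp add: singular_cocycles_def)
 qed
qed

lemma one_cohomology: "\<one>\<^bsub>singular_cohomology (Suc n) X {x\<^sub>0} G\<^esub> = coh_class (Suc n) (%_. \<one>)"
proof -
 let ?Z = "(cochain_group (Suc n) X {x\<^sub>0} G)\<lparr>carrier := singular_cocycles (Suc n) X {x\<^sub>0} G\<rparr>"
 interpret C: comm_group "cochain_group (Suc n) X {x\<^sub>0} G" by (rule comm_group_cochain_group)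
 interpret Z: group ?Z
  by (rule subgroup.subgroup_is_group[OF cocycles_subgroup C.is_group])
 have "to_cochain (Suc n) X (%_. \<one>) = \<one>\<^bsub>?Z\<^esub>"
  by (simp add: one_cochain_group)
 thus ?thesis
  unfolding coh_class_def singular_cohomology_def FactGroup_def
  using Z.coset_mult_one[OF subgroup.subset[OF coboundaries_subgroup]] by simp
qed

text \<open>Two elements share a coset iff they differ by a coboundary, which can be read off on
  single simplices. From here on comparisons of classes concern functions on simplices.\<close>

lemma coh_class_eq_iff:
 assumes z: "cocycle G (Suc n) X z" "z (csimp (Suc n) x\<^sub>0) = \<one>"
  and w: "cocycle G (Suc n) X w" "w (csimp (Suc n) x\<^sub>0) = \<one>"
 shows "coh_class (Suc n) z = coh_class (Suc n) w \<longleftrightarrow>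
  (\<exists>b. cochain G b \<and> b (csimp n x\<^sub>0) = \<one> \<and>
   (\<forall>u. sing (Suc n) X u --> z u = cobd G (Suc n) b u \<otimes> w u))" (is "_ \<longleftrightarrow> ?R")
proof -
 let ?C = "cochain_group (Suc n) X {x\<^sub>0} G"
 let ?Z = "?C\<lparr>carrier := singular_cocycles (Suc n) X {x\<^sub>0} G\<rparr>"
 let ?B = "singular_coboundaries (Suc n) X {x\<^sub>0} G"
 interpret C: comm_group ?C by (rule comm_group_cochain_group)
 interpret Z: group ?Z
  by (rule subgroup.subgroup_is_group[OF cocycles_subgroup C.is_group])
 have zw: "to_cochain (Suc n) X z \<in> carrier ?Z" "to_cochain (Suc n) X w \<in> carrier ?Z"
  using to_cochain_cocycle z w by auto
 have "coh_class (Suc n) z = coh_class (Suc n) w \<longleftrightarrow> to_cochain (Suc n) X z \<in> coh_class (Suc n) w"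
  unfolding coh_class_def
  using Z.rcos_self[OF zw(1) coboundaries_subgroup] Z.repr_independence[OF _ zw(2) coboundaries_subgroup] by metis
 also have "\<dots> \<longleftrightarrow> (\<exists>b. cochain G b \<and> b (csimp n x\<^sub>0) = \<one> \<and>
   to_cochain (Suc n) X z = to_cochain (Suc n) X (cobd G (Suc n) b) \<otimes>\<^bsub>?C\<^esub> to_cochain (Suc n) X w)" (is "_ \<longleftrightarrow> ?M")
 proof
  assume "to_cochain (Suc n) X z \<in> coh_class (Suc n) w"
  then obtain f where "f \<in> carrier (cochain_group n X {x\<^sub>0} G)"
    "to_cochain (Suc n) X z = cochain_coboundary n X f \<otimes>\<^bsub>?C\<^esub> to_cochain (Suc n) X w"
   by (auto simp: coh_class_def r_coset_def singular_coboundaries_def)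
  thus ?M
   using from_cochain[of f n] by (metis coboundary_to_cochain)
 next
  assume ?M
  thus "to_cochain (Suc n) X z \<in> coh_class (Suc n) w"
   by (auto simp: coh_class_def r_coset_def singular_coboundaries_def simp flip: coboundary_to_cochain
     intro!: to_cochain_in)
 qed
 also have "\<dots> \<longleftrightarrow> ?R"
 proof -
  have 1: "to_cochain (Suc n) X (cobd G (Suc n) b) \<otimes>\<^bsub>?C\<^esub> to_cochain (Suc n) X w
   = to_cochain (Suc n) X (%x. cobd G (Suc n) b x \<otimes> w x)" if "cochain G b" for b
   using cocycle_fun[OF w(1)] that
   by (simp add: cochain_group_def to_cochain_def chain_eval_mult cobd_fun cong: restrict_cong)
  have 2: "to_cochain (Suc n) X z = to_cochain (Suc n) X (cobd G (Suc n) b) \<otimes>\<^bsub>?C\<^esub> to_cochain (Suc n) X w \<longleftrightarrow>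
   (\<forall>u. sing (Suc n) X u --> z u = cobd G (Suc n) b u \<otimes> w u)" if "cochain G b" for b
   unfolding 1[OF that]
   by (rule to_cochain_eq_iff[OF cocycle_fun[OF z(1)] cochain_mult[OF cobd_fun[OF that] cocycle_fun[OF w(1)]]])
  thus ?thesis
   by (metis (no_types, lifting))
 qed
 finally show ?thesis .
qed

end

end

section \<open>Discs and CW complexes\<close>

lemma powertop_eq: "powertop_real UNIV = (euclidean :: (nat => real) topology)"
 by (rule euclidean_product_topology)

lemma singular_simplex_iff:
 "sing p X f \<longleftrightarrow> cmap (top_of_set (splx p)) X f \<and> f \<in> extensional (splx p)"
 by (simp add: singular_simplex_def powertop_eq)

abbreviation disc :: "nat => (nat => real) topology" where
 "disc n \<equiv> top_of_set (cdisc n)"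

definition rad :: "nat => (nat => real) => real" where
 "rad n y = sqrt (\<Sum>i<n. (y i)\<^sup>2)"

definition disc_sphere :: "nat => (nat => real) set" where
 "disc_sphere n = cdisc n - odisc n"

lemma closed_disc_iff: "y \<in> cdisc n \<longleftrightarrow> (\<forall>i\<ge>n. y i = 0) \<and> rad n y \<le> 1"
 by (auto simp: closed_disc_def topspace_Euclidean_space rad_def sum_nonneg)

lemma open_disc_iff: "y \<in> odisc n \<longleftrightarrow> (\<forall>i\<ge>n. y i = 0) \<and> rad n y < 1"
 by (auto simp: open_disc_def topspace_Euclidean_space rad_def)

lemma disc_sphere_iff: "y \<in> disc_sphere n \<longleftrightarrow> (\<forall>i\<ge>n. y i = 0) \<and> rad n y = 1"
 by (auto simp: disc_sphere_def closed_disc_iff open_disc_iff)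

lemma open_sub_disc: "odisc n \<subseteq> cdisc n"
 by (auto simp: closed_disc_iff open_disc_iff)

lemma Euclidean_closed_disc: "subtop (Euclidean_space n) (cdisc n) = disc n"
proof -
 have "{x. \<forall>i\<ge>n. x i = 0} \<inter> cdisc n = cdisc n"
  by (auto simp: closed_disc_iff)
 thus ?thesis
  by (simp add: Euclidean_space_def powertop_eq subtop_subtop)
qed

lemma Euclidean_open_disc: "subtop (Euclidean_space n) (odisc n) = top_of_set (odisc n)"
proof -
 have "{x. \<forall>i\<ge>n. x i = 0} \<inter> odisc n = odisc n"
  by (auto simp: open_disc_iff)
 thus ?thesis
  by (simp add: Euclidean_space_def powertop_eq subtop_subtop)
qed

lemma rad_nonneg [simp]: "0 \<le> rad n y"
 by (simp add: rad_def sum_nonneg)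

lemma rad_eq_0: "(\<forall>i\<ge>n. y i = 0) ==> rad n y = 0 \<longleftrightarrow> y = (%_. 0)"
 by (auto simp: rad_def sum_nonneg_eq_0_iff fun_eq_iff) (metis lessThan_iff not_le)

lemma rad_scale: "rad n (%k. c * y k) = \<bar>c\<bar> * rad n y"
 by (simp add: rad_def power_mult_distrib real_sqrt_mult flip: sum_distrib_left)

lemma rad_zero [simp]: "rad n (%_. 0) = 0"
 by (simp add: rad_def)

lemma zero_in_disc [simp]: "(%_. 0) \<in> cdisc n" "(%_. 0) \<in> odisc n"
 by (auto simp: closed_disc_iff open_disc_iff)

lemma continuous_on_coord:
 fixes f :: "'x::topological_space => nat => real"
 shows "continuous_on S f ==> continuous_on S (%x. f x i)"
 by (rule continuous_on_product_then_coordinatewise)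

lemma continuous_on_rad [continuous_intros]:
 "continuous_on S f ==> continuous_on S (%x. rad n (f x))"
 unfolding rad_def
 by (intro continuous_on_real_sqrt continuous_on_sum continuous_on_power) (rule continuous_on_coord)

lemma scale_in_closed_disc:
 assumes "y \<in> cdisc n" "0 \<le> c" "c \<le> 1"
 shows "(%k. c * y k) \<in> cdisc n"
 using assms mult_le_one[of c "rad n y"] by (auto simp: closed_disc_iff rad_scale)

text \<open>The disc is a closed subset of a product of intervals, with the single value 0 in the
  coordinates from \<open>n\<close> on, and this product is compact by Tychonoff's theorem.\<close>

lemma compact_closed_disc: "compact (cdisc n)"
proof -
 let ?B = "\<Pi>\<^sub>E i\<in>UNIV. (if i < n then {-1..1} else {0::real})"
 have "closed (cdisc n)"
 proof -
  have "cdisc n = (\<Inter>i\<in>{n..}. {y. y i = 0}) \<inter> {y. rad n y \<le> 1}"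
   by (auto simp: closed_disc_iff)
  moreover have "closed {y::nat => real. y i = 0}" for i
   by (intro closed_Collect_eq continuous_intros) auto
  moreover have "closed {y. rad n y \<le> 1}"
   by (intro closed_Collect_le continuous_intros) auto
  ultimately show ?thesis by (auto intro!: closed_Int closed_INT)
 qed
 moreover have "compact ?B"
 proof -
  have "compactin (powertop_real UNIV) ?B"
   by (subst compactin_PiE) auto
  thus ?thesis
   by (simp add: powertop_eq)
 qed
 moreover have "cdisc n \<subseteq> ?B"
 proof
  fix y assume y: "y \<in> cdisc n"
  have "\<bar>y i\<bar> \<le> 1" if "i < n" for i
  proof -
   have "(y i)\<^sup>2 \<le> (\<Sum>i<n. (y i)\<^sup>2)"
    using that by (intro member_le_sum) auto
   hence "sqrt ((y i)\<^sup>2) \<le> rad n y"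
    unfolding rad_def by (rule real_sqrt_le_mono)
   thus ?thesis using y by (simp add: closed_disc_iff)
  qed
  thus "y \<in> ?B"
   using y by (auto simp: closed_disc_iff PiE_def Pi_iff abs_le_iff)
 qed
 ultimately show ?thesis
  by (metis compact_Int_closed inf.absorb_iff2)
qed

section \<open>CW complexes: weak topology and skeleta\<close>

locale cw =
 fixes X :: "'a topology" and I :: "'i set" and d :: "'i => nat" and ch :: "'i => (nat => real) => 'a"
 assumes cw: "cw_complex X I d ch"
begin

lemma Hausdorff: "Hausdorff_space X"
 using cw by (simp add: cw_complex_def)

lemma cont: "i \<in> I ==> cmap (disc (d i)) X (ch i)"
 using cw by (simp add: cw_complex_def Euclidean_closed_disc)

lemma homeo: "i \<in> I ==> homeomorphic_map (top_of_set (odisc (d i))) (subtop X (ch i ` odisc (d i))) (ch i)"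
 using cw by (simp add: cw_complex_def Euclidean_open_disc)

lemma cells_disjoint: "[|i \<in> I; j \<in> I; y \<in> odisc (d i); y' \<in> odisc (d j); ch i y = ch j y'|] ==> i = j"
proof -
 assume *: "i \<in> I" "j \<in> I" "y \<in> odisc (d i)" "y' \<in> odisc (d j)" "ch i y = ch j y'"
 have "disjoint_family_on (%i. ch i ` odisc (d i)) I"
  using cw by (simp add: cw_complex_def)
 moreover have "ch i y \<in> ch i ` odisc (d i) \<inter> ch j ` odisc (d j)"
  using * by (metis IntI imageI)
 ultimately show "i = j"
  using disjoint_family_onD[of _ I i j] * by blast
qed

lemma cell_inj: "i \<in> I ==> inj_on (ch i) (odisc (d i))"
 using homeo[of i] by (auto simp: homeomorphic_map_def)

lemma cells_cover: "(\<Union>i\<in>I. ch i ` odisc (d i)) = topspace X"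
 using cw by (simp add: cw_complex_def)

lemma in_cell: assumes "x \<in> topspace X" obtains i y where "i \<in> I" "y \<in> odisc (d i)" "x = ch i y"
 using assms cells_cover by blast

lemma in_X: "[|i \<in> I; y \<in> cdisc (d i)|] ==> ch i y \<in> topspace X"
 using cont[of i] by (auto simp: cmap_def)

lemma closure_finite:
 assumes "i \<in> I"
 obtains J where "J \<subseteq> I" "finite J" "\<forall>j\<in>J. d j < d i" "ch i ` disc_sphere (d i) \<subseteq> (\<Union>j\<in>J. ch j ` odisc (d j))"
proof -
 have "\<forall>i\<in>I. \<exists>J. J \<subseteq> I \<and> finite J \<and> (\<forall>j\<in>J. d j < d i) \<and>
    ch i ` disc_sphere (d i) \<subseteq> (\<Union>j\<in>J. ch j ` odisc (d j))"
  using cw unfolding cw_complex_def disc_sphere_def by (elim conjE)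
 thus thesis
  using assms that by metis
qed

lemma closedin_weak:
 assumes "A \<subseteq> topspace X" "!!i. i \<in> I ==> closedin X (A \<inter> ch i ` cdisc (d i))"
 shows "closedin X A"
proof -
 have "\<forall>A. A \<subseteq> topspace X \<and> (\<forall>i\<in>I. closedin X (A \<inter> ch i ` cdisc (d i))) --> closedin X A"
  using cw unfolding cw_complex_def by (elim conjE)
 thus ?thesis
  using assms by simp
qed

lemma closedin_image:
 assumes "i \<in> I" "closedin (disc (d i)) K"
 shows "closedin X (ch i ` K)"
proof -
 have "compactin (disc (d i)) K"
  using assms(2) compact_closed_disc
  by (intro closedin_compact_space) (simp_all add: compact_space_subtopology)
 thus ?thesis
  using image_compactin[OF _ cont[OF assms(1)]] compactin_imp_closedin[OF Hausdorff] by blast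
qed

text \<open>Discs are compact and the complex is Hausdorff, so closed subsets of a disc have closed
  images. The weak topology may therefore be tested by pulling back to the discs.\<close>

lemma openin_weak:
 assumes B: "B \<subseteq> topspace X"
  and o: "!!i. i \<in> I ==> openin (disc (d i)) {y \<in> cdisc (d i). ch i y \<in> B}"
 shows "openin X B"
proof -
 have "closedin X (topspace X - B)"
 proof (rule closedin_weak)
  fix i assume i: "i \<in> I"
  have "closedin (disc (d i)) (cdisc (d i) - {y \<in> cdisc (d i). ch i y \<in> B})"
   using o[OF i] by (metis closedin_diff closedin_topspace topspace_euclidean_subtopology)
  hence "closedin X (ch i ` (cdisc (d i) - {y \<in> cdisc (d i). ch i y \<in> B}))"
   by (rule closedin_image[OF i])
  moreover have "ch i ` (cdisc (d i) - {y \<in> cdisc (d i). ch i y \<in> B}) = (topspace X - B) \<inter> ch i ` cdisc (d i)"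
   using in_X[OF i] by auto
  ultimately show "closedin X ((topspace X - B) \<inter> ch i ` cdisc (d i))"
   by simp
 qed auto
 thus ?thesis
  using B by (metis double_diff openin_closedin_eq order_refl)
qed

lemma openin_preimage:
 assumes "i \<in> I" "openin X W"
 shows "openin (disc (d i)) {y \<in> cdisc (d i). ch i y \<in> W}"
 using openin_cmap[OF cont[OF assms(1)] assms(2)] by simp

text \<open>Stated over an open set \<open>W\<close>, because the maps to be tested live on
  intersections of charts.\<close>

lemma continuous_map_weak:
 assumes W: "openin X W"
  and c: "!!i. i \<in> I ==> cmap (top_of_set {y \<in> cdisc (d i). ch i y \<in> W}) Z (%y. f (ch i y))"
 shows "cmap (subtop X W) Z f"
 unfolding cmap_def
proof (intro conjI allI impI funcsetI)
 have tW: "topspace (subtop X W) = W"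
  using openin_subset[OF W] by auto
 show "f x \<in> topspace Z" if "x \<in> topspace (subtop X W)" for x
 proof -
  have "x \<in> topspace X" "x \<in> W"
   using that by auto
  then obtain i y where "i \<in> I" "y \<in> odisc (d i)" "x = ch i y"
   using in_cell by metis
  thus ?thesis
   using c[of i] that open_sub_disc[of "d i"] by (auto simp: cmap_def)
 qed
 fix Q assume Q: "openin Z Q"
 let ?B = "{x \<in> topspace (subtop X W). f x \<in> Q}"
 have "openin X ?B"
 proof (rule openin_weak)
  show "?B \<subseteq> topspace X" using openin_subset[OF W] by auto
  fix i assume i: "i \<in> I"
  let ?D = "{y \<in> cdisc (d i). ch i y \<in> W}"
  have "openin (top_of_set ?D) {y \<in> ?D. f (ch i y) \<in> Q}"
   using openin_cmap[OF c[OF i] Q] by simp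
  hence "openin (disc (d i)) {y \<in> ?D. f (ch i y) \<in> Q}"
   using openin_preimage[OF i W] openin_trans by blast
  moreover have "{y \<in> ?D. f (ch i y) \<in> Q} = {y \<in> cdisc (d i). ch i y \<in> ?B}"
   using tW by auto
  ultimately show "openin (disc (d i)) {y \<in> cdisc (d i). ch i y \<in> ?B}"
   by simp
 qed
 moreover have "?B \<subseteq> W" using tW by auto
 ultimately show "openin (subtop X W) ?B"
  using W by (metis openin_open_subtopology)
qed

text \<open>A product with the unit interval preserves the weak topology because the interval is
  locally compact. The argument is the usual one with the tube lemma, carried out cell by
  cell.\<close>

lemma continuous_map_weak_cylinder:
 assumes W: "openin X W"
  and c: "!!i. i \<in> I ==> cmap (prod_topology (top_of_set {0..1::real}) (top_of_set {y \<in> cdisc (d i). ch i y \<in> W})) Z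
       (%(t, y). F (t, ch i y))"
 shows "cmap (prod_topology (top_of_set {0..1::real}) (subtop X W)) Z F"
proof -
 let ?P = "prod_topology (top_of_set {0..1::real}) (subtop X W)"
 let ?D = "%i. {y \<in> cdisc (d i). ch i y \<in> W}"
 let ?Q = "%i. prod_topology (top_of_set {0..1::real}) (top_of_set (?D i))"
 have tW: "topspace (subtop X W) = W"
  using openin_subset[OF W] by auto
 have inW: "\<exists>i\<in>I. \<exists>y\<in>?D i. x = ch i y" if "x \<in> W" for x
 proof -
  have "x \<in> topspace X"
   using that openin_subset[OF W] by blast
  then obtain i y where "i \<in> I" "y \<in> odisc (d i)" "x = ch i y"
   using in_cell by metis
  thus ?thesis
   using that open_sub_disc[of "d i"] by blast
 qed
 show ?thesis
  unfolding cmap_def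
 proof (intro conjI allI impI funcsetI)
  show "F p \<in> topspace Z" if pP: "p \<in> topspace ?P" for p
  proof -
   obtain t x where p: "p = (t, x)" "x \<in> W" "t \<in> {0..1}"
    using pP unfolding topspace_prod_topology tW by fastforce
   obtain i y where iy: "i \<in> I" "y \<in> ?D i" "x = ch i y"
    using inW[OF p(2)] by blast
   have "(t, y) \<in> topspace (?Q i)"
    using p iy by simp
   hence "(%(t, y). F (t, ch i y)) (t, y) \<in> topspace Z"
    using continuous_map_image_subset_topspace[OF c[OF iy(1)]] by blast
   thus ?thesis
    by (simp add: p iy)
  qed
  fix Q assume Q: "openin Z Q"
  let ?B = "{p \<in> topspace ?P. F p \<in> Q}"
  define Bi where "Bi i = {p \<in> {0..1} \<times> ?D i. F (fst p, ch i (snd p)) \<in> Q}" for i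
  have Bi: "openin (?Q i) (Bi i)" if "i \<in> I" for i
   using openin_cmap[OF c[OF that] Q] by (simp add: Bi_def case_prod_unfold)
  show "openin ?P ?B"
   unfolding openin_subopen[of _ ?B]
  proof
   fix p assume p: "p \<in> ?B"
   then obtain t0 i y0 where p_eq: "p = (t0, ch i y0)" and i: "i \<in> I" and y0: "y0 \<in> ?D i" and t0: "t0 \<in> {0..1}"
   proof -
    obtain t x where tx: "p = (t, x)"
     by (cases p)
    have p': "p = (t, x)" "x \<in> W" "t \<in> {0..1}"
     using p unfolding mem_Collect_eq topspace_prod_topology tW tx by simp_all
    obtain i y where "i \<in> I" "y \<in> ?D i" "x = ch i y"
     using inW[OF p'(2)] by blast
    thus thesis
     using that[of t i y] p' by simp
   qed
   have ty: "(t0, y0) \<in> Bi i"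
    using p p_eq y0 t0 by (auto simp: Bi_def)
   obtain U V where UV: "openin (top_of_set {0..1}) U" "openin (top_of_set (?D i)) V" "t0 \<in> U" "y0 \<in> V" "U \<times> V \<subseteq> Bi i"
    using openin_prod_topology_alt[THEN iffD1, OF Bi[OF i], rule_format, OF ty] by blast
   obtain U' where U': "open U'" "U = {0..1} \<inter> U'"
    using UV(1) by (auto simp: openin_open)
   obtain e where e: "0 < e" "cball t0 e \<subseteq> U'"
    using U' UV(3) open_contains_cball by blast
   \<comment> \<open>A compact neighbourhood of \<open>t0\<close> inside the open set found in one
     cell through the point. Its compactness is what the tube lemma needs in all the other
     cells.\<close>
   define J where "J = {0..1} \<inter> cball t0 e"
   have "compact J" by (auto simp: J_def intro: compact_Int_closed)
   hence J: "compactin (top_of_set {0..1}) J"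
    by (auto simp: compactin_subtopology J_def)
   \<comment> \<open>The points whose whole strip over \<open>J\<close> stays in the preimage. The
     tube lemma makes this set open in each disc, so it is open in \<open>X\<close>.\<close>
   define A where "A = {x \<in> W. \<forall>t\<in>J. F (t, x) \<in> Q}"
   have "openin X A"
   proof (rule openin_weak)
    show "A \<subseteq> topspace X" using openin_subset[OF W] by (auto simp: A_def)
    fix j assume j: "j \<in> I"
    have "openin (top_of_set (?D j)) {y \<in> ?D j. \<forall>t\<in>J. F (t, ch j y) \<in> Q}" (is "openin _ ?N")
     unfolding openin_subopen[of _ ?N]
    proof
     fix y assume y: "y \<in> ?N"
     hence "J \<times> {y} \<subseteq> Bi j"
      by (auto simp: Bi_def J_def)
     then obtain U1 V1 where "openin (top_of_set (?D j)) V1" "J \<subseteq> U1" "y \<in> V1" "U1 \<times> V1 \<subseteq> Bi j"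
      using tube_lemma_left[OF Bi[OF j] J, of y] y by auto
     moreover have "V1 \<subseteq> ?N" if "V1 \<subseteq> ?D j" "J \<subseteq> U1" "U1 \<times> V1 \<subseteq> Bi j"
     proof
      fix x assume x: "x \<in> V1"
      have "(t, x) \<in> Bi j" if "t \<in> J" for t
       using \<open>U1 \<times> V1 \<subseteq> Bi j\<close> \<open>J \<subseteq> U1\<close> x that by blast
      thus "x \<in> ?N"
       using x that(1) by (auto simp: Bi_def)
     qed
     ultimately show "\<exists>T. openin (top_of_set (?D j)) T \<and> y \<in> T \<and> T \<subseteq> ?N"
      using openin_subset[of "top_of_set (?D j)" V1] by (intro exI[of _ V1]) simp
    qed
    hence "openin (disc (d j)) {y \<in> ?D j. \<forall>t\<in>J. F (t, ch j y) \<in> Q}"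
     using openin_preimage[OF j W] openin_trans by blast
    moreover have "{y \<in> ?D j. \<forall>t\<in>J. F (t, ch j y) \<in> Q} = {y \<in> cdisc (d j). ch j y \<in> A}"
     by (auto simp: A_def)
    ultimately show "openin (disc (d j)) {y \<in> cdisc (d j). ch j y \<in> A}" by simp
   qed
   hence "openin (subtop X W) A"
    using openin_subset_topspace_eq W by (metis (no_types, lifting) A_def mem_Collect_eq openin_open_subtopology subsetI)
   moreover have "openin (top_of_set {0..1}) ({0..1} \<inter> ball t0 e)"
    by (auto simp: openin_open)
   ultimately have "openin ?P (({0..1} \<inter> ball t0 e) \<times> A)"
    by (simp add: openin_prod_Times_iff)
   moreover have "p \<in> ({0..1} \<inter> ball t0 e) \<times> A"
   proof -
    have "F (t, ch i y0) \<in> Q" if "t \<in> J" for t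
    proof -
     have "(t, y0) \<in> U \<times> V" using that UV(4) U' e by (auto simp: J_def)
     thus ?thesis using UV(5) by (auto simp: Bi_def)
    qed
    thus ?thesis using p_eq t0 e(1) y0 by (auto simp: A_def)
   qed
   moreover have "({0..1} \<inter> ball t0 e) \<times> A \<subseteq> ?B"
    using tW by (auto simp: A_def J_def)
   ultimately show "\<exists>T. openin ?P T \<and> p \<in> T \<and> T \<subseteq> ?B"
    by blast
  qed
 qed
qed

text \<open>The index is exclusive: \<open>skel n\<close> consists of the cells of dimension less
  than \<open>n\<close>, so it is the skeleton of dimension \<open>n - 1\<close>. In particular
  \<open>skel 1\<close> is the set of vertices and \<open>skel 2\<close> is the graph.\<close>

definition skel :: "nat => 'a set" where
 "skel n = (\<Union>i\<in>{i \<in> I. d i < n}. ch i ` odisc (d i))"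

text \<open>By closure finiteness a closed cell meets only finitely many open cells. Its part in
  \<open>A\<close> is thus a finite union of pieces on closed cells of dimension below
  \<open>n\<close>.\<close>

lemma closedin_sub_skel:
 assumes A: "A \<subseteq> skel n" and c: "!!i. [|i \<in> I; d i < n|] ==> closedin X (A \<inter> ch i ` cdisc (d i))"
 shows "closedin X A"
proof (rule closedin_weak)
 show AX: "A \<subseteq> topspace X"
  using A cells_cover by (auto simp: skel_def)
 fix i assume i: "i \<in> I"
 obtain J where J: "J \<subseteq> I" "finite J" "ch i ` disc_sphere (d i) \<subseteq> (\<Union>j\<in>J. ch j ` odisc (d j))"
  using closure_finite[OF i] by metis
 let ?K = "{j \<in> insert i J. d j < n}"
 have "A \<inter> ch i ` cdisc (d i) = (\<Union>j\<in>?K. (A \<inter> ch j ` cdisc (d j)) \<inter> ch i ` cdisc (d i))" (is "?L = ?R")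
 proof
  show "?L \<subseteq> ?R"
  proof
   fix x assume x: "x \<in> ?L"
   then obtain k y where k: "k \<in> I" "d k < n" "y \<in> odisc (d k)" "x = ch k y"
    using A by (auto simp: skel_def)
   have "cdisc (d i) = odisc (d i) \<union> disc_sphere (d i)"
    using open_sub_disc by (auto simp: disc_sphere_def)
   hence "ch i ` cdisc (d i) = ch i ` odisc (d i) \<union> ch i ` disc_sphere (d i)"
    by (simp add: image_Un)
   moreover have "x \<in> ch i ` cdisc (d i)"
    using x by simp
   ultimately have "x \<in> (\<Union>j\<in>insert i J. ch j ` odisc (d j))"
    using subsetD[OF J(3), of x] by auto
   then obtain j y' where j: "j \<in> insert i J" "y' \<in> odisc (d j)" "x = ch j y'"
    by blast
   hence "j = k"
    using cells_disjoint[of j k y' y] k i J(1) by auto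
   thus "x \<in> ?R"
    using x j k open_sub_disc by blast
  qed
 qed auto
 moreover have "closedin X ?R"
  using J i by (intro closedin_Union finite_imageI) (auto intro!: closedin_Int c closedin_image)
 ultimately show "closedin X (A \<inter> ch i ` cdisc (d i))"
  by simp
qed

lemma skel_boundary:
 assumes "i \<in> I" "d i \<le> n" "y \<in> disc_sphere (d i)" shows "ch i y \<in> skel n"
proof -
 obtain J where J: "J \<subseteq> I" "\<forall>j\<in>J. d j < d i" "ch i ` disc_sphere (d i) \<subseteq> (\<Union>j\<in>J. ch j ` odisc (d j))"
  using closure_finite[OF assms(1)] by metis
 then obtain j where "j \<in> J" "ch i y \<in> ch j ` odisc (d j)"
  using assms(3) by blast
 moreover from this have "j \<in> I" "d j < n"
  using J assms(2) by auto
 ultimately show ?thesis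
  unfolding skel_def by blast
qed

lemma skel_closed_cell:
 assumes "i \<in> I" "d i < n" "y \<in> cdisc (d i)" shows "ch i y \<in> skel n"
proof (cases "y \<in> odisc (d i)")
 case True
 thus ?thesis using assms by (auto simp: skel_def)
next
 case False
 thus ?thesis using skel_boundary[of i n y] assms by (simp add: disc_sphere_def)
qed

lemma skel_subset: "skel n \<subseteq> topspace X"
 using cells_cover by (auto simp: skel_def)

lemma closedin_skel: "closedin X (skel n)"
proof (rule closedin_sub_skel[OF order_refl])
 fix i assume i: "i \<in> I" "d i < n"
 hence "skel n \<inter> ch i ` cdisc (d i) = ch i ` cdisc (d i)"
  using skel_closed_cell[OF i] by auto
 thus "closedin X (skel n \<inter> ch i ` cdisc (d i))"
  using closedin_image[OF i(1), of "cdisc (d i)"] by simp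
qed

lemma cw_skel: "cw_complex (subtop X (skel n)) {i \<in> I. d i < n} d ch"
 unfolding cw_complex_def Euclidean_closed_disc Euclidean_open_disc
proof (intro conjI ballI allI impI)
 let ?S = "subtop X (skel n)"
 show "Hausdorff_space ?S"
  using Hausdorff by (rule Hausdorff_space_subtopology)
 show "(\<Union>i\<in>{i \<in> I. d i < n}. ch i ` odisc (d i)) = topspace ?S"
  using skel_subset[of n] by (auto simp: skel_def)
 show "disjoint_family_on (%i. ch i ` odisc (d i)) {i \<in> I. d i < n}"
  using cells_disjoint by (auto simp: disjoint_family_on_def)
 fix i assume i: "i \<in> {i \<in> I. d i < n}"
 show "cmap (disc (d i)) ?S (ch i)"
  using cont i skel_closed_cell[of i n] by (auto simp: cmap_in_sub)
 have "ch i ` odisc (d i) \<subseteq> skel n"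
  using i by (auto simp: skel_def)
 hence "subtop ?S (ch i ` odisc (d i)) = subtop X (ch i ` odisc (d i))"
  by (simp add: subtop_subtop Int_absorb1)
 thus "homeomorphic_map (top_of_set (odisc (d i))) (subtop ?S (ch i ` odisc (d i))) (ch i)"
  using homeo i by simp
 obtain J where "J \<subseteq> I" "finite J" "\<forall>j\<in>J. d j < d i" "ch i ` disc_sphere (d i) \<subseteq> (\<Union>j\<in>J. ch j ` odisc (d j))"
  using closure_finite i by (metis (no_types, lifting) mem_Collect_eq)
 thus "\<exists>J\<subseteq>{i \<in> I. d i < n}. finite J \<and> (\<forall>j\<in>J. d j < d i) \<and>
    ch i ` (cdisc (d i) - odisc (d i)) \<subseteq> (\<Union>j\<in>J. ch j ` odisc (d j))"
  using i by (intro exI[of _ J]) (auto simp: disc_sphere_def)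
next
 fix A assume A: "A \<subseteq> topspace (subtop X (skel n)) \<and>
  (\<forall>i\<in>{i \<in> I. d i < n}. closedin (subtop X (skel n)) (A \<inter> ch i ` cdisc (d i)))"
 hence "closedin X A"
  by (intro closedin_sub_skel[of A n]) (auto intro: closedin_trans_full closedin_skel)
 thus "closedin (subtop X (skel n)) A"
  using A by (auto intro: closedin_subset_topspace)
qed

text \<open>Every set of vertices is closed, so the space of vertices is discrete; a simplex is
  connected, hence constant in it.\<close>

lemma path_component_cell_skel1:
 assumes "sing p (subtop X (skel 1)) u"
 shows "\<exists>a\<in>skel 1. u = csimp p a"
proof -
 have cl: "closedin X A" if "A \<subseteq> skel 1" for A
 proof (rule closedin_sub_skel[OF that])
  fix i assume i: "i \<in> I" "d i < 1"
  have "cdisc 0 = {%_. 0}"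
   by (auto simp: closed_disc_iff)
  hence "A \<inter> ch i ` cdisc (d i) = {} \<or> A \<inter> ch i ` cdisc (d i) = ch i ` cdisc (d i)"
   using i by auto
  thus "closedin X (A \<inter> ch i ` cdisc (d i))"
   using closedin_image[OF i(1), of "cdisc (d i)"] by auto
 qed
 let ?S = "subtop X (skel 1)" and ?s = "splx p"
 have c: "cmap (top_of_set ?s) ?S u" and ext: "u \<in> extensional ?s"
  using assms by (auto simp: singular_simplex_iff)
 have "connected ?s"
  using connectedin_standard_simplex[of p] by (simp add: powertop_eq)
 hence con: "connectedin ?S (u ` ?s)"
  by (intro connectedin_continuous_map_image[OF c]) (simp add: connectedin_subtopology)
 have im: "u ` ?s \<subseteq> skel 1"
  using c by (auto simp: cmap_def)
 obtain v where v: "v \<in> ?s" using nonempty_standard_simplex by blast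
 let ?a = "u v"
 have a: "?a \<in> skel 1" using im v by auto
 have "closedin ?S {?a}" "openin ?S {?a}"
 proof -
  show "closedin ?S {?a}"
   using cl[of "{?a}"] a by (intro closedin_subset_topspace) auto
  have "closedin ?S (skel 1 - {?a})"
   using cl[of "skel 1 - {?a}"] by (intro closedin_subset_topspace) auto
  hence "openin ?S (topspace ?S - (skel 1 - {?a}))"
   by blast
  moreover have "topspace ?S - (skel 1 - {?a}) = {?a}"
   using a skel_subset[of 1] by auto
  ultimately show "openin ?S {?a}" by simp
 qed
 hence "u ` ?s \<subseteq> {?a}"
  using connectedin_clopen_cases[OF con, of "{?a}"] v by (auto simp: disjnt_def)
 hence "u = csimp p ?a"
  using ext unfolding csimp_def
  by (intro extensionalityI[of _ ?s]) auto
 thus ?thesis using a by blast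
qed

end

section \<open>Cocycles on a CW complex\<close>

definition vert :: "nat => nat => real" where
 "vert k = (%j. if j = k then 1 else 0)"

lemma vert_in_simplex [simp]: "vert k \<in> splx p \<longleftrightarrow> k \<le> p"
 by (simp add: vert_def)

lemma standard_simplex_0_vert: "splx 0 = {vert 0}"
 by (simp add: standard_simplex_0 vert_def)

lemma face_vert: "simplical_face 0 (vert k) = vert (Suc k)" "k < j ==> simplical_face j (vert k) = vert k"
 by (auto simp: simplical_face_def vert_def fun_eq_iff)

lemma singular_face_1:
 "singular_face 1 0 c = csimp 0 (c (vert 1))" "singular_face 1 1 c = csimp 0 (c (vert 0))"
 unfolding singular_face_def csimp_def
 by (auto intro!: restrict_ext simp: standard_simplex_0_vert face_vert)

lemma (in comm_group) cobd_1_const: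
 assumes "cochain G f"
 shows "cobd G 1 f c = f (csimp 0 (c (vert 1))) \<otimes> inv (f (csimp 0 (c (vert 0))))"
 unfolding cobd_1[OF assms] singular_face_1 ..

lemma sing_maps:
 assumes "sing p X u" "x \<in> splx p" shows "u x \<in> topspace X"
 using assms by (auto simp: singular_simplex_iff cmap_def)

lemma singular_simplex_restrict:
 assumes "cmap (top_of_set (splx p)) X f"
 shows "sing p X (restrict f (splx p))"
 unfolding singular_simplex_iff using assms by (auto intro: cmap_eq)

text \<open>Scaling by this factor changes the radius r to (1 - t) r + t, which lies between r and
  1. So the centre is avoided, and the sphere is reached at t = 1.\<close>

lemma radial_in_disc:
 assumes "\<forall>k\<ge>n. y k = 0" "rad n y \<noteq> 0" "rad n y \<le> 1" "0 \<le> t" "t \<le> 1"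
 shows "(%k. ((1 - t) + t / rad n y) * y k) \<in> cdisc n - {%_. 0}"
  "t = 1 ==> (%k. ((1 - t) + t / rad n y) * y k) \<in> disc_sphere n"
proof -
 have p: "0 < rad n y" using assms(2) rad_nonneg[of n y] by linarith
 have c: "0 < (1 - t) + t / rad n y"
  using assms p by (cases "t = 0") (auto intro: add_nonneg_pos)
 have r: "rad n (%k. ((1 - t) + t / rad n y) * y k) = (1 - t) * rad n y + t"
  unfolding rad_scale using c p by (simp add: field_simps)
 have "(1 - t) * rad n y + t \<le> (1 - t) * 1 + t"
  using assms by (intro add_right_mono mult_left_mono) auto
 moreover have "(1 - t) * rad n y + t \<noteq> 0"
  using assms p by (metis add_nonneg_eq_0_iff diff_ge_0_iff_ge diff_zero less_imp_le mult_1 mult_nonneg_nonneg order_less_irrefl)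
 ultimately have "rad n (%k. ((1 - t) + t / rad n y) * y k) \<le> 1" "rad n (%k. ((1 - t) + t / rad n y) * y k) \<noteq> rad n (%_. 0)"
  unfolding r by auto
 thus "(%k. ((1 - t) + t / rad n y) * y k) \<in> cdisc n - {%_. 0}"
  using assms(1) unfolding Diff_iff closed_disc_iff singleton_iff by (metis mult_zero_right)
 show "(%k. ((1 - t) + t / rad n y) * y k) \<in> disc_sphere n" if "t = 1"
  using r that assms(1) by (simp add: disc_sphere_iff)
qed

lemma punctured_disc_rad:
 assumes "y \<in> cdisc n" "y \<noteq> (%_. 0)"
 shows "\<forall>k\<ge>n. y k = 0" "rad n y \<noteq> 0" "rad n y \<le> 1"
 using assms rad_eq_0[of n y] by (auto simp: closed_disc_iff)

lemma continuous_on_radial: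
 "continuous_on ({0..1::real} \<times> (cdisc n - {%_. 0})) (%(t, y). (%k. ((1 - t) + t / rad n y) * y k))"
proof -
 let ?S = "{0..1::real} \<times> (cdisc n - {%_. 0})"
 have "continuous_on ?S (%p. snd p k)" for k
  by (rule continuous_on_coord[OF continuous_on_snd[OF continuous_on_id]])
 moreover have "continuous_on ?S (%p. rad n (snd p))"
  by (rule continuous_on_rad[OF continuous_on_snd[OF continuous_on_id]])
 moreover have "continuous_on ?S (%p. fst p)"
  by (rule continuous_on_fst[OF continuous_on_id])
 moreover have "\<forall>p\<in>?S. rad n (snd p) \<noteq> 0"
  using punctured_disc_rad by auto
 ultimately show ?thesis
  unfolding case_prod_unfold
  by (intro cont_prod continuous_on_mult continuous_on_add continuous_on_diff
    continuous_on_divide continuous_on_const)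
qed

text \<open>The number \<open>n\<close> bounds the dimensions and may fail to be attained, so that
  the locale also covers the graph inside a surface.\<close>

locale cw_dim = cw X I d ch
 for X :: "'a topology" and I :: "'i set" and d :: "'i => nat" and ch :: "'i => (nat => real) => 'a" +
 fixes n :: nat
 assumes n: "1 \<le> n" and dim: "!!i. i \<in> I ==> d i \<le> n"
begin

definition cidx :: "'a => 'i" where
 "cidx x = (SOME i. i \<in> I \<and> x \<in> ch i ` odisc (d i))"

definition ccoord :: "'a => nat => real" where
 "ccoord x = (SOME y. y \<in> odisc (d (cidx x)) \<and> ch (cidx x) y = x)"

lemma cidx [simp]:
 assumes "i \<in> I" "y \<in> odisc (d i)" shows "cidx (ch i y) = i"
proof -
 have "cidx (ch i y) \<in> I \<and> ch i y \<in> ch (cidx (ch i y)) ` odisc (d (cidx (ch i y)))"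
  unfolding cidx_def by (rule someI[of _ i]) (use assms in auto)
 then obtain y' where "cidx (ch i y) \<in> I" "y' \<in> odisc (d (cidx (ch i y)))" "ch i y = ch (cidx (ch i y)) y'"
  by blast
 thus ?thesis
  using cells_disjoint[of "cidx (ch i y)" i y' y] assms by metis
qed

lemma ccoord [simp]:
 assumes "i \<in> I" "y \<in> odisc (d i)" shows "ccoord (ch i y) = y"
proof -
 have "ccoord (ch i y) \<in> odisc (d i) \<and> ch i (ccoord (ch i y)) = ch i y"
  unfolding ccoord_def cidx[OF assms] by (rule someI[of _ y]) (use assms in auto)
 thus ?thesis
  using cell_inj[OF assms(1)] assms(2) by (metis inj_onD)
qed

definition centres :: "'a set" where
 "centres = {ch i (%_. 0) | i. i \<in> I \<and> d i = n}"

text \<open>Together with \<open>top_part\<close> this is an open cover of \<open>X\<close>: the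
  first set deforms onto \<open>skel n\<close>, the second is a disjoint union of open
  balls.\<close>

definition punctured :: "'a set" where
 "punctured = topspace X - centres"

definition top_part :: "'a set" where
 "top_part = topspace X - skel n"

lemma skel_n_iff:
 assumes i: "i \<in> I" and y: "y \<in> cdisc (d i)"
 shows "ch i y \<in> skel n \<longleftrightarrow> d i < n \<or> y \<in> disc_sphere (d i)"
proof
 assume "ch i y \<in> skel n"
 then obtain k y' where k: "k \<in> I" "d k < n" "y' \<in> odisc (d k)" "ch i y = ch k y'"
  by (auto simp: skel_def)
 show "d i < n \<or> y \<in> disc_sphere (d i)"
 proof (rule ccontr)
  assume "\<not> ?thesis"
  hence "\<not> d i < n" "y \<in> odisc (d i)"
   using y by (auto simp: disc_sphere_def)
  thus False
   using cells_disjoint[OF i k(1) _ k(3,4)] k(2) by auto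
 qed
next
 assume "d i < n \<or> y \<in> disc_sphere (d i)"
 thus "ch i y \<in> skel n"
  using skel_closed_cell[OF i _ y] skel_boundary[OF i dim[OF i]] by auto
qed

lemma centres_iff:
 assumes i: "i \<in> I" and y: "y \<in> cdisc (d i)"
 shows "ch i y \<in> centres \<longleftrightarrow> d i = n \<and> y = (%_. 0)"
proof
 assume "ch i y \<in> centres"
 then obtain j where j: "j \<in> I" "d j = n" "ch i y = ch j (%_. 0)"
  by (auto simp: centres_def)
 have "ch j (%_. 0) \<notin> skel n"
  using skel_n_iff[OF j(1), of "%_. 0"] j(2) by (auto simp: disc_sphere_def)
 hence "d i = n" "y \<in> odisc (d i)"
  using skel_n_iff[OF i y] j(3) dim[OF i] y by (auto simp: disc_sphere_def)
 thus "d i = n \<and> y = (%_. 0)"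
  using j(3) cidx[OF i, of y] cidx[OF j(1), of "%_. 0"] ccoord[OF i, of y] ccoord[OF j(1), of "%_. 0"] by auto
qed (use i in \<open>auto simp: centres_def\<close>)

lemma punctured_iff:
 assumes i: "i \<in> I" and y: "y \<in> cdisc (d i)"
 shows "ch i y \<in> punctured \<longleftrightarrow> d i < n \<or> y \<noteq> (%_. 0)"
 using centres_iff[OF assms] in_X[OF assms] dim[OF i] by (auto simp: punctured_def)

lemma open_punctured: "openin X punctured"
proof (rule openin_weak)
 show "punctured \<subseteq> topspace X" by (auto simp: punctured_def)
 fix i assume i: "i \<in> I"
 have "{y \<in> cdisc (d i). ch i y \<in> punctured} = cdisc (d i) \<inter> (if d i < n then UNIV else - {%_. 0})"
  using punctured_iff[OF i] by auto
 moreover have "open (if d i < n then UNIV else - {%_::nat. 0::real})"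
  by auto
 ultimately show "openin (disc (d i)) {y \<in> cdisc (d i). ch i y \<in> punctured}"
  by (metis openin_open)
qed

lemma skel_subset_punctured: "skel n \<subseteq> punctured"
proof
 fix x assume x: "x \<in> skel n"
 then obtain i y where "i \<in> I" "d i < n" "y \<in> odisc (d i)" "x = ch i y"
  by (auto simp: skel_def)
 thus "x \<in> punctured"
  using punctured_iff[of i y] open_sub_disc[of "d i"] by auto
qed

lemma open_top_part: "openin X top_part"
 unfolding top_part_def using closedin_skel[of n] by blast

lemma punctured_top_part: "topspace X \<subseteq> punctured \<union> top_part"
 using skel_subset_punctured by (auto simp: top_part_def)

definition push :: "real \<times> 'a => 'a" where
 "push = (%(t, x). if x \<in> skel n then x
   else ch (cidx x) (%k. ((1 - t) + t / rad n (ccoord x)) * ccoord x k))"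

text \<open>On the boundary sphere the radius and hence the scaling factor are 1, so the formula of
  the open cell agrees with the identity on the skeleton. This gives one formula on the whole closed
  cell, as continuity in the weak topology requires.\<close>

lemma push_cell:
 assumes i: "i \<in> I" "d i = n" and y: "y \<in> cdisc n" "y \<noteq> (%_. 0)"
 shows "push (t, ch i y) = ch i (%k. ((1 - t) + t / rad n y) * y k)"
proof (cases "y \<in> disc_sphere n")
 case True
 hence "rad n y = 1" by (simp add: disc_sphere_iff)
 thus ?thesis
  using skel_n_iff[OF i(1), of y] True y i by (simp add: push_def)
next
 case False
 hence "y \<in> odisc (d i)" using y i by (simp add: disc_sphere_def)
 thus ?thesis
  using skel_n_iff[OF i(1), of y] False y i by (simp add: push_def)
qed

lemma continuous_push:
 "cmap (prod_topology (top_of_set {0..1::real}) (subtop X punctured)) (subtop X punctured) push"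
proof (rule continuous_map_weak_cylinder[OF open_punctured])
 fix i assume i: "i \<in> I"
 let ?D = "{y \<in> cdisc (d i). ch i y \<in> punctured}"
 show "cmap (prod_topology (top_of_set {0..1}) (top_of_set ?D)) (subtop X punctured) (%(t, y). push (t, ch i y))"
 proof (cases "d i < n")
  case True
  hence D: "?D = cdisc (d i)" and s: "!!y. y \<in> cdisc (d i) ==> ch i y \<in> skel n"
   using punctured_iff[OF i] skel_closed_cell[OF i] by auto
  have "cmap (prod_topology (top_of_set {0..1::real}) (disc (d i))) X (ch i \<circ> snd)"
   by (rule cmap_comp[OF continuous_map_snd cont[OF i]])
  thus ?thesis
   unfolding D cmap_in_sub using s skel_subset_punctured
   by (auto simp: push_def intro: cmap_eq)
 next
  case False
  hence di: "d i = n" using dim[OF i] by simp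
  have D: "?D = cdisc n - {%_. 0}"
   using punctured_iff[OF i] di by auto
  let ?r = "%(t, y). (%k. ((1 - t) + t / rad n y) * y k)"
  have r: "?r p \<in> cdisc n - {%_. 0}" if "p \<in> {0..1} \<times> ?D" for p
   using that radial_in_disc(1)[OF punctured_disc_rad] unfolding D by (cases p) auto
  have "cmap (prod_topology (top_of_set {0..1}) (top_of_set ?D)) (disc (d i)) ?r"
   unfolding D prod_topology_subtopology_eu cmap_in_sub continuous_map_iff_continuous
   using continuous_on_radial[of n] r[unfolded D] by (auto simp: di)
  hence "cmap (prod_topology (top_of_set {0..1}) (top_of_set ?D)) X (ch i \<circ> ?r)"
   by (rule cmap_comp[OF _ cont[OF i]])
  moreover have "(ch i \<circ> ?r) p = (%(t, y). push (t, ch i y)) p"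
   if "p \<in> topspace (prod_topology (top_of_set {0..1}) (top_of_set ?D))" for p
   using that push_cell[OF i di] unfolding D by (cases p) auto
  ultimately have "cmap (prod_topology (top_of_set {0..1}) (top_of_set ?D)) X (%(t, y). push (t, ch i y))"
   by (rule cmap_eq)
  moreover have "(%(t, y). push (t, ch i y)) p \<in> punctured" if p: "p \<in> {0..1} \<times> ?D" for p
  proof -
   obtain t y where ty: "p = (t, y)" by (cases p)
   have "push (t, ch i y) = ch i (?r (t, y))"
    using push_cell[OF i di, of y t] p unfolding ty D by auto
   thus ?thesis
    using punctured_iff[OF i, of "?r (t, y)"] r[OF p] by (auto simp: ty di)
  qed
  ultimately show ?thesis
   unfolding cmap_in_sub by auto
 qed
qed

lemma acyclic_punctured: "acyclic_mod p (subtop X punctured) (simplices_in X (skel n))"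
proof -
 have eq: "subtop (subtop X punctured) (skel n) = subtop X (skel n)"
  using skel_subset_punctured by (simp add: subtop_subtop Int_absorb1)
 have U: "\<exists>i\<in>I. d i = n \<and> (\<exists>y\<in>closed_disc n. y \<noteq> (%_. 0) \<and> x = ch i y)"
  if x: "x \<in> punctured" "x \<notin> skel n" for x
 proof -
  have "x \<in> topspace X" using x by (auto simp: punctured_def)
  then obtain i y where i: "i \<in> I" "y \<in> odisc (d i)" "x = ch i y"
   using in_cell by metis
  hence y: "y \<in> cdisc (d i)" using open_sub_disc by blast
  thus ?thesis
   using x i skel_n_iff[OF i(1) y] punctured_iff[OF i(1) y] dim[OF i(1)] by auto
 qed
 have "acyclic_mod p (subtop X punctured) (simplices_in (subtop X punctured) (skel n))"
 proof (rule acyclic_mod_deformation[OF continuous_push])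
  fix x assume "x \<in> topspace (subtop X punctured)"
  hence x: "x \<in> punctured" by simp
  show "push (0, x) = x"
  proof (cases "x \<in> skel n")
   case False
   thus ?thesis using U[OF x False] push_cell[of _ _ 0] by auto
  qed (simp add: push_def)
  show "push (1, x) \<in> skel n"
  proof (cases "x \<in> skel n")
   case False
   then obtain i y where i: "i \<in> I" "d i = n" and y: "y \<in> cdisc n" "y \<noteq> (%_. 0)" and x: "x = ch i y"
    using U[OF x False] by blast
   let ?y = "%k. ((1 - 1) + 1 / rad n y) * y k"
   have "?y \<in> disc_sphere n" "?y \<in> cdisc n"
    using radial_in_disc[OF punctured_disc_rad[OF y], of 1] by auto
   thus ?thesis
    using push_cell[OF i y, of 1] skel_n_iff[OF i(1), of ?y] i x by simp
  qed (simp add: push_def)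
 next
  fix t x assume "x \<in> skel n"
  thus "push (t, x) \<in> skel n" by (simp add: push_def)
 qed
 thus ?thesis unfolding eq .
qed

lemma openin_cell:
 assumes i: "i \<in> I" "d i = n"
 shows "openin X (ch i ` odisc n)"
proof (rule openin_weak)
 show "ch i ` odisc n \<subseteq> topspace X"
  using in_X[OF i(1)] open_sub_disc[of n] i by auto
 fix j assume j: "j \<in> I"
 have ns: "ch i y \<notin> skel n" if "y \<in> odisc n" for y
  using skel_n_iff[OF i(1), of y] that i open_sub_disc[of n] by (auto simp: disc_sphere_def)
 have "{y \<in> cdisc (d j). ch j y \<in> ch i ` odisc n} = (if j = i then cdisc n \<inter> {y. rad n y < 1} else {})"
  (is "?L = ?R")
 proof -
  have "y \<in> ?L \<longleftrightarrow> j = i \<and> y \<in> odisc n" for y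
  proof
   assume y: "y \<in> ?L"
   then obtain y' where y': "y' \<in> odisc n" "ch j y = ch i y'" by auto
   have "ch j y \<notin> skel n" using ns[OF y'(1)] y'(2) by simp
   hence "y \<in> odisc (d j)"
    using skel_n_iff[OF j, of y] y by (auto simp: disc_sphere_def)
   hence "j = i"
    using cells_disjoint[OF j i(1) _ _ y'(2)] y' i by simp
   thus "j = i \<and> y \<in> odisc n"
    using \<open>y \<in> open_disc (d j)\<close> i by simp
  qed (use i open_sub_disc[of n] in auto)
  moreover have "odisc n = cdisc n \<inter> {y. rad n y < 1}"
   by (auto simp: open_disc_iff closed_disc_iff)
  ultimately show ?thesis by auto
 qed
 moreover have "open {y. rad n y < 1}"
  by (intro open_Collect_less continuous_on_rad continuous_on_id continuous_on_const)
 ultimately show "openin (disc (d j)) {y \<in> cdisc (d j). ch j y \<in> ch i ` odisc n}"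
  using i by (auto simp: openin_open)
qed

lemma top_part_eq: "top_part = (\<Union>i\<in>{i \<in> I. d i = n}. ch i ` odisc n)"
proof -
 have "x \<in> top_part \<longleftrightarrow> (\<exists>i\<in>I. d i = n \<and> x \<in> ch i ` odisc n)" for x
 proof
  assume x: "x \<in> top_part"
  then obtain i y where i: "i \<in> I" "y \<in> odisc (d i)" "x = ch i y"
   using in_cell by (metis DiffD1 top_part_def)
  hence "d i = n"
   using x skel_n_iff[OF i(1), of y] dim[OF i(1)] open_sub_disc[of "d i"] by (auto simp: top_part_def)
  thus "\<exists>i\<in>I. d i = n \<and> x \<in> ch i ` odisc n" using i by auto
 next
  assume "\<exists>i\<in>I. d i = n \<and> x \<in> ch i ` odisc n"
  then obtain i y where i: "i \<in> I" "d i = n" "y \<in> odisc n" "x = ch i y" by blast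
  thus "x \<in> top_part"
   using skel_n_iff[OF i(1), of y] in_X[OF i(1), of y] open_sub_disc[of n]
   by (auto simp: top_part_def disc_sphere_def)
 qed
 thus ?thesis by blast
qed

text \<open>Each open top cell is clopen in their union, the complement being the union of the
  others. A simplex is connected, so it lies in one of them, where it lifts through the
  homeomorphism with the open disc.\<close>

lemma simplex_top_part:
 assumes u: "sing p (subtop X top_part) u"
 obtains i u' where "i \<in> I" "d i = n" "sing p (disc n) u'" "u' ` splx p \<subseteq> odisc n"
  "u = simplex_map p (ch i) u'"
proof -
 let ?V = "subtop X top_part" and ?s = "splx p"
 have c: "cmap (top_of_set ?s) ?V u" and ext: "u \<in> extensional ?s"
  using u by (auto simp: singular_simplex_iff)
 have "connected ?s"
  using connectedin_standard_simplex[of p] by (simp add: powertop_eq)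
 hence con: "connectedin ?V (u ` ?s)"
  by (intro connectedin_continuous_map_image[OF c]) (simp add: connectedin_subtopology)
 obtain v where v: "v \<in> ?s" using nonempty_standard_simplex by blast
 have "u v \<in> top_part" using c v by (auto simp: cmap_def)
 then obtain i where i: "i \<in> I" "d i = n" "u v \<in> ch i ` odisc n"
  unfolding top_part_eq by blast
 let ?C = "ch i ` odisc n"
 have C: "?C \<subseteq> top_part" using i unfolding top_part_eq by blast
 have "openin ?V ?C"
  using openin_cell[OF i(1,2)] C by (simp add: openin_open_subtopology open_top_part)
 moreover have "closedin ?V ?C"
 proof -
  let ?R = "\<Union>j\<in>{j \<in> I. d j = n} - {i}. ch j ` odisc n"
  have "openin X ?R"
   using openin_cell by (intro openin_Union) auto
  moreover have R: "?R \<subseteq> top_part" unfolding top_part_eq by blast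
  ultimately have "openin ?V ?R"
   by (simp add: openin_open_subtopology open_top_part)
  moreover have "topspace ?V - ?R = ?C"
  proof -
   have tV: "topspace ?V = top_part"
    using openin_subset[OF open_top_part] by auto
   have CR: "x \<notin> ?R" if xC: "x \<in> ?C" for x
   proof
    assume "x \<in> ?R"
    then obtain j y' where j: "j \<in> I" "d j = n" "j \<noteq> i" "y' \<in> odisc n" "x = ch j y'"
     by blast
    obtain y where "y \<in> odisc n" "x = ch i y"
     using xC by blast
    thus False
     using cells_disjoint[OF j(1) i(1), of y' y] j i by auto
   qed
   have tp: "top_part = ?C \<union> ?R"
    unfolding top_part_eq using i(1,2) by blast
   show ?thesis
    unfolding tV
   proof (intro equalityI subsetI)
    fix x assume "x \<in> top_part - ?R"
    thus "x \<in> ?C" unfolding tp by (elim DiffE UnE) auto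
   next
    fix x assume x: "x \<in> ?C"
    show "x \<in> top_part - ?R"
     by (rule DiffI[OF subsetD[OF C x] CR[OF x]])
   qed
  qed
  moreover have "closedin ?V (topspace ?V - ?R)"
   by (rule closedin_diff[OF closedin_topspace \<open>openin ?V ?R\<close>])
  ultimately show ?thesis
   by simp
 qed
 ultimately have im: "u ` ?s \<subseteq> ?C"
  using connectedin_clopen_cases[OF con, of ?C] v i(3) by (auto simp: disjnt_def)
 obtain g where g: "homeomorphic_maps (top_of_set (odisc n)) (subtop X ?C) (ch i) g"
  using homeo[OF i(1)] unfolding i(2) homeomorphic_map_maps by blast
 have gc: "cmap (subtop X ?C) (top_of_set (odisc n)) g"
  using g by (simp add: homeomorphic_maps_def)
 have "cmap (top_of_set ?s) (subtop X ?C) u"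
  using c im by (auto simp: cmap_in_sub)
 hence gs: "cmap (top_of_set ?s) (top_of_set (odisc n)) (g \<circ> u)"
  using gc cmap_comp by blast
 let ?u' = "restrict (g \<circ> u) ?s"
 have im': "?u' ` ?s \<subseteq> odisc n"
  using gs by (auto simp: cmap_def)
 have "cmap (top_of_set ?s) (disc n) (g \<circ> u)"
  using gs open_sub_disc[of n] unfolding cmap_in_sub by auto
 hence s': "sing p (disc n) ?u'"
  by (rule singular_simplex_restrict)
 have "u = simplex_map p (ch i) ?u'"
  unfolding simplex_map_def
 proof (rule extensionalityI[OF ext])
  fix x assume x: "x \<in> ?s"
  have "u x \<in> topspace (subtop X ?C)"
   using im x C openin_subset[OF open_top_part] by auto
  hence "ch i (g (u x)) = u x"
   using g by (simp add: homeomorphic_maps_def)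
  thus "u x = restrict (ch i \<circ> ?u') ?s x" using x by simp
 qed auto
 thus thesis
  using that[OF i(1,2) s' im'] by simp
qed

text \<open>Normalised on the boundary spheres, the primitives on the discs fit together with the
  trivial function on the skeleton. The remaining cocycle is trivial on edges inside closed top
  cells and inside the skeleton; radial deformation extends this to the punctured complex, and the
  open cover extends it to all edges.\<close>

lemma cocycle_1_cobounds:
 fixes A :: "('c, 'b) monoid_scheme" (structure)
 assumes A: "comm_group A" and q: "cocycle A 1 X q"
  and skel: "!!w. sing 1 (subtop X (skel n)) w ==> q w = \<one>"
  and cells: "!!i. [|i \<in> I; d i = n|] ==> \<exists>F. cobounds A 1 (disc n) F (%w. q (simplex_map 1 (ch i) w)) \<and>
    (\<forall>y\<in>disc_sphere n. F (csimp 0 y) = \<one>)"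
 obtains f where "cobounds A 1 X f q" "!!x. x \<in> skel n ==> f (csimp 0 x) = \<one>"
proof -
 interpret A: comm_group A by (fact A)
 note \<eta>f = A.cocycle_fun[OF q]
 obtain F where F: "!!i. [|i \<in> I; d i = n|] ==> cobounds A 1 (disc n) (F i) (%w. q (simplex_map 1 (ch i) w))"
  "!!i y. [|i \<in> I; d i = n; y \<in> disc_sphere n|] ==> F i (csimp 0 y) = \<one>"
  using cells by metis
 define g where "g x = (if x \<in> skel n \<or> x \<notin> topspace X then \<one> else F (cidx x) (csimp 0 (ccoord x)))" for x
 define f where "f u = g (u (vert 0))" for u
 have gF: "g (ch i y) = F i (csimp 0 y)" if i: "i \<in> I" "d i = n" and y: "y \<in> cdisc n" for i y
 proof (cases "y \<in> disc_sphere n")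
  case True
  thus ?thesis using F(2)[OF i True] skel_n_iff[OF i(1), of y] i y by (simp add: g_def)
 next
  case False
  hence "y \<in> odisc (d i)" using y i by (simp add: disc_sphere_def)
  thus ?thesis
   using False skel_n_iff[OF i(1), of y] i y in_X[OF i(1), of y] by (simp add: g_def)
 qed
 have gc: "g x \<in> carrier A" for x
 proof (cases "x \<in> skel n \<or> x \<notin> topspace X")
  case False
  hence "x \<in> top_part" by (auto simp: top_part_def)
  then obtain i y where i: "i \<in> I" "d i = n" "y \<in> odisc n" "x = ch i y"
   unfolding top_part_eq by blast
  thus ?thesis
   using gF[OF i(1,2), of y] cochainD[OF A.cobounds_fun[OF F(1)[OF i(1,2)]]] open_sub_disc[of n] by auto
 qed (auto simp: g_def)
 hence fc: "cochain A f" by (simp add: f_def cochain_def)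
 have fconst: "f (csimp 0 x) = g x" for x
  by (simp add: f_def csimp_def)
 define q' where "q' w = q w \<otimes> inv (cobd A 1 f w)" for w
 have q': "cocycle A 1 X q'"
  unfolding q'_def by (rule A.cocycle_diff[OF q A.cocycle_cobd[OF fc]])
 have e1: "q' (simplex_map 1 (ch i) w) = \<one>" if i: "i \<in> I" "d i = n" and w: "sing 1 (disc n) w" for i w
 proof -
  note Fc = A.cobounds_fun[OF F(1)[OF i]]
  have "w (vert k) \<in> cdisc n" if "k \<le> 1" for k
   using sing_maps[OF w, of "vert k"] that by simp
  hence "cobd A 1 f (simplex_map 1 (ch i) w) = cobd A 1 (F i) w"
   unfolding A.cobd_1_const[OF fc] A.cobd_1_const[OF Fc] fconst by (simp add: simplex_map_def gF[OF i])
  also have "\<dots> = q (simplex_map 1 (ch i) w)"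
   using F(1)[OF i] w by (simp add: cobounds_def)
  finally show ?thesis
   using cochainD[OF \<eta>f] by (simp add: q'_def)
 qed
 have e2: "q' w = \<one>" if w: "sing 1 (subtop X (skel n)) w" for w
 proof -
  have "w (vert k) \<in> skel n" if "k \<le> 1" for k
   using sing_maps[OF w, of "vert k"] that by simp
  hence "cobd A 1 f w = \<one>"
   unfolding A.cobd_1_const[OF fc] fconst by (simp add: g_def)
  thus ?thesis using skel[OF w] by (simp add: q'_def)
 qed
 have V: "q' w = \<one>" if w: "sing 1 (subtop X top_part) w" for w
  using simplex_top_part[OF w] e1 by metis
 have U: "q' w = \<one>" if w: "sing 1 (subtop X punctured) w" for w
 proof -
  obtain fU where fU: "cobounds A 1 (subtop X punctured) fU q'"
   and fU1: "!!u. u \<in> simplices_in X (skel n) 0 ==> fU u = \<one>"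
  proof (rule A.cobounds_acyclic_1[OF acyclic_punctured acyclic_punctured A.cocycle_subtopology[OF q']])
   show "q' u = \<one>" if "u \<in> simplices_in X (skel n) 1" for u
    using e2[of u] that by simp
  qed blast
  note fUc = A.cobounds_fun[OF fU]
  have skel1: "fU (csimp 0 x) = \<one>" if "x \<in> skel n" for x
   using fU1[of "csimp 0 x"] singular_simplex_const[of x "subtop X (skel n)" 0] that skel_subset[of n]
   by auto
  have one: "fU (csimp 0 x) = \<one>" if x: "x \<in> punctured" for x
  proof (cases "x \<in> skel n")
   case False
   hence "x \<in> top_part" using x by (auto simp: top_part_def punctured_def)
   then obtain i y where i: "i \<in> I" "d i = n" and y': "y \<in> odisc n" and xy: "x = ch i y"
    unfolding top_part_eq by blast
   have y: "y \<in> cdisc n" "y \<noteq> (%_. 0)"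
    using y' open_sub_disc[of n] punctured_iff[OF i(1), of y] x i xy by auto
   \<comment> \<open>The radial path from \<open>y\<close> to the sphere, inside the punctured cell.
     It carries the value of \<open>fU\<close> at \<open>x\<close> to its value at a point of the
     skeleton, which is trivial.\<close>
   let ?g = "%s::nat => real. (%k. ((1 - s 1) + s 1 / rad n y) * y k)"
   let ?w = "restrict ?g (splx 1)"
   have in1: "s 1 \<in> {0..1}" if "s \<in> splx 1" for s
    using that by (auto simp: standard_simplex_def)
   have gd: "?g s \<in> cdisc n - {%_. 0}" if "s \<in> splx 1" for s
    using radial_in_disc(1)[OF punctured_disc_rad[OF y], of "s 1"] in1[OF that] by auto
   have "continuous_on (splx 1) ?g"
    by (intro cont_prod continuous_on_mult continuous_on_add continuous_on_diff
      continuous_on_divide continuous_on_const continuous_on_coord[OF continuous_on_id])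
     (use punctured_disc_rad[OF y] in auto)
   hence "cmap (top_of_set (splx 1)) (disc n) ?g"
    using gd by (auto simp: cmap_in_sub)
   hence s: "sing 1 (disc n) ?w"
    by (rule singular_simplex_restrict)
   have m: "simplex_map 1 (ch i) ?w v = ch i (?g v)" if "v \<in> splx 1" for v
    using that by (simp add: simplex_map_def)
   have sX: "sing 1 X (simplex_map 1 (ch i) ?w)"
    using singular_simplex_simplex_map[OF s] cont[OF i(1)] i(2) by simp
   have "simplex_map 1 (ch i) ?w ` splx 1 \<subseteq> punctured"
   proof (clarify)
    fix v assume v: "v \<in> splx 1"
    show "simplex_map 1 (ch i) ?w v \<in> punctured"
     unfolding m[OF v] using punctured_iff[OF i(1), of "?g v"] gd[OF v] i by auto
   qed
   hence "sing 1 (subtop X punctured) (simplex_map 1 (ch i) ?w)"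
    using sX by (simp add: singular_simplex_subtopology)
   hence "q' (simplex_map 1 (ch i) ?w) = cobd A 1 fU (simplex_map 1 (ch i) ?w)"
    using fU by (simp add: cobounds_def)
   hence "cobd A 1 fU (simplex_map 1 (ch i) ?w) = \<one>"
    using e1[OF i s] by simp
   moreover have "simplex_map 1 (ch i) ?w (vert 0) = x"
    using m[of "vert 0"] xy by (simp add: vert_def)
   moreover have "simplex_map 1 (ch i) ?w (vert 1) \<in> skel n"
    using m[of "vert 1"] radial_in_disc(2)[OF punctured_disc_rad[OF y], of 1] gd[of "vert 1"] skel_n_iff[OF i(1), of "?g (vert 1)"] i
    by (simp add: vert_def)
   ultimately have "inv (fU (csimp 0 x)) = \<one>"
    using cochainD[OF fUc] unfolding A.cobd_1_const[OF fUc] by (simp add: skel1)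
   thus ?thesis using cochainD[OF fUc] by (metis A.inv_inv A.inv_one)
  qed (rule skel1)
  have "w (vert k) \<in> punctured" if "k \<le> 1" for k
   using sing_maps[OF w, of "vert k"] that by simp
  hence "cobd A 1 fU w = \<one>"
   unfolding A.cobd_1_const[OF fUc] by (simp add: one)
  thus ?thesis
   using fU w by (simp add: cobounds_def)
 qed
 have all: "q' w = \<one>" if "sing 1 X w" for w
  by (rule A.cocycle_small_1[OF open_punctured open_top_part punctured_top_part q' U V that])
 show thesis
 proof
  show "cobounds A 1 X f q"
   unfolding cobounds_def
  proof (intro conjI fc allI impI)
   fix w assume "sing 1 X w"
   thus "q w = cobd A 1 f w"
    using all[of w] cochainD[OF \<eta>f, of w] A.cobd_closed[OF fc, of 1 w] unfolding q'_def
    by (metis A.inv_closed A.inv_equality A.inv_inv)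
  qed
  show "f (csimp 0 x) = \<one>" if "x \<in> skel n" for x
   using that by (simp add: fconst g_def)
 qed
qed

text \<open>A primitive on the punctured complex and the primitives on the discs may disagree over
  the punctured discs. Their quotient there is a 1-cocycle, equal on the sphere to the inverse of
  the primitive on the disc. By the assumption \<open>cells\<close> this quotient is a coboundary,
  and changing the primitive on the disc by it removes the discrepancy.\<close>

lemma cocycle_2_cobounds:
 fixes A :: "('c, 'b) monoid_scheme" (structure)
 assumes A: "comm_group A" and z: "cocycle A 2 X z"
  and skel: "!!t. sing 2 (subtop X (skel n)) t ==> z t = \<one>"
  and cells: "!!i. [|i \<in> I; d i = n|] ==> \<exists>b. cobounds A 2 (disc n) b (%t. z (simplex_map 2 (ch i) t)) \<and>
    (\<forall>w. cocycle A 1 (top_of_set (cdisc n - {%_. 0})) w -->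
     (\<forall>v. sing 1 (top_of_set (disc_sphere n)) v --> w v = inv (b v)) -->
     (\<exists>f. cobounds A 1 (top_of_set (cdisc n - {%_. 0})) f w))"
 obtains b where "cobounds A 2 X b z"
proof -
 interpret A: comm_group A by (fact A)
 let ?U = "subtop X punctured" and ?Dp = "top_of_set (cdisc n - {%_. 0::real})"
 note zf = A.cocycle_fun[OF z]
 obtain bU where bU: "cobounds A 2 ?U bU z"
   and bU1: "!!u. u \<in> simplices_in X (skel n) 1 ==> bU u = \<one>"
 proof (rule A.cobounds_acyclic_2[OF acyclic_punctured acyclic_punctured acyclic_punctured _ A.cocycle_subtopology[OF z]])
  show "Poly_Mapping.keys (chain_boundary 1 (frag_of u)) \<subseteq> simplices_in X (skel n) 0" if "u \<in> simplices_in X (skel n) 1" for u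
   using keys_face_simplices_in[of 1 X "skel n" u] that by simp
  show "z u = \<one>" if "u \<in> simplices_in X (skel n) 2" for u
   using skel[of u] that by simp
 qed blast
 note bUc = A.cobounds_fun[OF bU]
 have sub: "sing p (top_of_set S) u \<longleftrightarrow> sing p euclidean u \<and> u ` splx p \<subseteq> S" for p S and u :: "(nat => real) => nat => real"
  using singular_simplex_subtopology[of p euclidean S u] by simp
 have mapU: "sing p ?U (simplex_map p (ch i) u)"
  if i: "i \<in> I" "d i = n" and u: "sing p ?Dp u" for i p u
 proof -
  have "cmap ?Dp ?U (ch i)"
   using cont[OF i(1)] punctured_iff[OF i(1)] i(2)
   by (auto simp: cmap_in_sub intro: cmap_mono)
  thus ?thesis by (rule singular_simplex_simplex_map[OF u])
 qed
 have "\<exists>b. cochain A b \<and> (\<forall>t. sing 2 (disc n) t --> cobd A 2 b t = z (simplex_map 2 (ch i) t)) \<and>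
   (\<forall>v. sing 1 ?Dp v --> b v = bU (simplex_map 1 (ch i) v))" if i: "i \<in> I" "d i = n" for i
 proof -
  obtain B where B: "cobounds A 2 (disc n) B (%t. z (simplex_map 2 (ch i) t))"
   and Bw: "!!w. [|cocycle A 1 ?Dp w; \<forall>v. sing 1 (top_of_set (disc_sphere n)) v --> w v = inv (B v)|]
     ==> \<exists>f. cobounds A 1 ?Dp f w"
   using cells[OF i] by blast
  note Bc = A.cobounds_fun[OF B]
  define m where "m v = bU (simplex_map 1 (ch i) v)" for v
  have mc: "cochain A m" unfolding m_def by (rule cochain_comp[OF bUc])
  \<comment> \<open>The discrepancy of the two primitives over the punctured disc. It is a cocycle
    because both have coboundary \<open>z\<close> there.\<close>
  define w where "w v = m v \<otimes> inv (B v)" for v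
  have wc: "cochain A w" unfolding w_def by (intro A.cochain_mult A.cochain_inv mc Bc)
  have w: "cocycle A 1 ?Dp w"
   unfolding cocycle_def
  proof (intro conjI wc allI impI)
   fix t assume t: "sing (Suc 1) ?Dp t"
   hence t': "sing 2 ?Dp t" "sing 2 (disc n) t"
    by (auto simp: sub numeral_2_eq_2)
   have "cobd A 2 m t = cobd A 2 bU (simplex_map 2 (ch i) t)"
    using A.cobd_simplex_map[OF bUc t'(2), of "ch i"] by (simp add: m_def[abs_def])
   also have "\<dots> = z (simplex_map 2 (ch i) t)"
    using bU mapU[OF i t'(1)] by (simp add: cobounds_def)
   also have "\<dots> = cobd A 2 B t"
    using B t'(2) by (simp add: cobounds_def)
   finally have "cobd A 2 w t = \<one>"
    unfolding w_def A.cobd_mult[OF mc A.cochain_inv[OF Bc]] A.cobd_inv[OF Bc] using A.cobd_closed[OF Bc] by simp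
   thus "cobd A (Suc 1) w t = \<one>" by (simp add: numeral_2_eq_2)
  qed
  have "w v = inv (B v)" if v: "sing 1 (top_of_set (disc_sphere n)) v" for v
  proof -
   have "cmap (top_of_set (disc_sphere n)) (subtop X (skel n)) (ch i)"
    using cont[OF i(1)] skel_n_iff[OF i(1)] i(2)
    by (auto simp: cmap_in_sub disc_sphere_def intro: cmap_mono)
   hence "sing 1 (subtop X (skel n)) (simplex_map 1 (ch i) v)"
    by (rule singular_simplex_simplex_map[OF v])
   thus ?thesis
    using bU1[of "simplex_map 1 (ch i) v"] cochainD[OF Bc] by (simp add: w_def m_def)
  qed
  then obtain f where f: "cobounds A 1 ?Dp f w"
   using Bw[OF w] by blast
  note fc = A.cobounds_fun[OF f]
  show ?thesis
  proof (intro exI conjI allI impI)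
   show "cochain A (%v. B v \<otimes> cobd A 1 f v)"
    by (intro A.cochain_mult Bc A.cobd_fun fc)
   show "cobd A 2 (%v. B v \<otimes> cobd A 1 f v) t = z (simplex_map 2 (ch i) t)" if "sing 2 (disc n) t" for t
   proof -
    have "cobd A 2 (cobd A 1 f) t = \<one>"
     using A.cobd_cobd[OF fc, of 1 "disc n" t] that by (simp add: numeral_2_eq_2)
    moreover have "cobd A 2 B t = z (simplex_map 2 (ch i) t)"
     using B that by (simp add: cobounds_def)
    ultimately show ?thesis
     unfolding A.cobd_mult[OF Bc A.cobd_fun[OF fc]] using cochainD[OF zf] by simp
   qed
   show "B v \<otimes> cobd A 1 f v = bU (simplex_map 1 (ch i) v)" if "sing 1 ?Dp v" for v
   proof -
    have "cobd A 1 f v = m v \<otimes> inv (B v)"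
     using f that by (simp add: cobounds_def w_def)
    thus ?thesis
     using cochainD[OF Bc, of v] cochainD[OF mc, of v] A.m_lcomm[of "B v" "m v" "inv (B v)"]
     by (simp add: m_def)
   qed
  qed
 qed
 then obtain B where B: "!!i. [|i \<in> I; d i = n|] ==> cochain A (B i)"
   "!!i t. [|i \<in> I; d i = n; sing 2 (disc n) t|] ==> cobd A 2 (B i) t = z (simplex_map 2 (ch i) t)"
   "!!i v. [|i \<in> I; d i = n; sing 1 ?Dp v|] ==> B i v = bU (simplex_map 1 (ch i) v)"
  by metis
 \<comment> \<open>The primitive of the punctured complex has precedence; edges inside a cell that
   pass through the centre use the primitive of the cell. The value on edges that are small for
   neither set of the cover is arbitrary.\<close>
 define b where "b v = (if sing 1 ?U v then bU v
   else if cidx (v (vert 0)) \<in> I \<and> d (cidx (v (vert 0))) = n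
   then B (cidx (v (vert 0))) (restrict (ccoord \<circ> v) (splx 1)) else \<one>)" for v
 have bc: "cochain A b"
  by (rule cochainI) (simp add: b_def cochainD[OF bUc] cochainD[OF B(1)])
 have bB: "b (simplex_map 1 (ch i) v) = B i v"
  if i: "i \<in> I" "d i = n" and v: "sing 1 (top_of_set (odisc n)) v" for i v
 proof (cases "sing 1 ?U (simplex_map 1 (ch i) v)")
  case True
  have gx: "v x \<in> cdisc n - {%_. 0}" if x: "x \<in> splx 1" for x
  proof -
   have "v x \<in> odisc n" using sing_maps[OF v x] by simp
   moreover have "ch i (v x) \<in> punctured"
    using sing_maps[OF True x] x by (simp add: simplex_map_def)
   ultimately show ?thesis
    using punctured_iff[OF i(1), of "v x"] i open_sub_disc[of n] by auto
  qed
  have "sing 1 ?Dp v"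
   unfolding sub[of 1 "cdisc n - {%_. 0}"] using v gx unfolding sub[of 1 "odisc n"]
   by (intro conjI image_subsetI) auto
  thus ?thesis
   using B(3)[OF i] True by (simp add: b_def)
 next
  case False
  have g: "v x \<in> odisc (d i)" if "x \<in> splx 1" for x
   using sing_maps[OF v that] i by simp
  have "cidx (simplex_map 1 (ch i) v (vert 0)) = i"
   using g[of "vert 0"] i by (simp add: simplex_map_def)
  moreover have "restrict (ccoord \<circ> simplex_map 1 (ch i) v) (splx 1) = v"
  proof (rule extensionalityI[of _ "splx 1"])
   show "v \<in> extensional (splx 1)" using v by (simp add: singular_simplex_iff)
   show "restrict (ccoord \<circ> simplex_map 1 (ch i) v) (splx 1) x = v x" if "x \<in> splx 1" for x
    using that g[OF that] i by (simp add: simplex_map_def)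
  qed auto
  ultimately show ?thesis
   using False i by (simp add: b_def)
 qed
 define z' where "z' t = z t \<otimes> inv (cobd A 2 b t)" for t
 have z': "cocycle A 2 X z'"
  unfolding z'_def using A.cocycle_diff[OF z A.cocycle_cobd[OF bc]] by simp
 have U: "z' t = \<one>" if t: "sing 2 ?U t" for t
 proof -
  have "cobd A 2 b t = cobd A 2 bU t"
   by (rule A.cobd_cong[OF bc bUc t]) (simp add: b_def)
  thus ?thesis
   using bU t A.cobd_closed[OF bUc] by (simp add: z'_def cobounds_def)
 qed
 have V: "z' t = \<one>" if t: "sing 2 (subtop X top_part) t" for t
 proof -
  obtain i t' where i: "i \<in> I" "d i = n" and t': "sing 2 (disc n) t'" "t' ` splx 2 \<subseteq> odisc n"
   and eq: "t = simplex_map 2 (ch i) t'"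
   using simplex_top_part[OF t] by metis
  have o: "sing 2 (top_of_set (odisc n)) t'"
   using t' by (simp add: sub)
  have "cobd A 2 b t = cobd A 2 (%u. b (simplex_map 1 (ch i) u)) t'"
   unfolding eq using A.cobd_simplex_map[OF bc t'(1), of "ch i"] by simp
  also have "\<dots> = cobd A 2 (B i) t'"
   by (rule A.cobd_cong[OF cochain_comp[OF bc] B(1)[OF i] o]) (simp add: bB[OF i, unfolded One_nat_def])
  also have "\<dots> = z t"
   unfolding eq by (rule B(2)[OF i t'(1)])
  finally show ?thesis
   using cochainD[OF zf] by (simp add: z'_def)
 qed
 obtain b' where b': "cobounds A 2 X b' z'"
  using A.cobounds_small_2[OF open_punctured open_top_part punctured_top_part z' U V] by blast
 note b'c = A.cobounds_fun[OF b']
 show thesis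
 proof
  show "cobounds A 2 X (%x. b x \<otimes> b' x) z"
   unfolding cobounds_def
  proof (intro conjI allI impI A.cochain_mult bc b'c)
   fix t assume "sing 2 X t"
   thus "z t = cobd A 2 (%x. b x \<otimes> b' x) t"
    using A.cobounds_diffD[OF b'[unfolded z'_def] zf A.cobd_fun[OF bc]] by (simp add: A.cobd_mult bc b'c)
  qed
 qed
qed

end

section \<open>Cocycles on discs\<close>

lemma acyclic_disc: "acyclic_mod p (disc n) (simplices_in (disc n) {%_. 0})"
proof (rule acyclic_mod_deformation)
 let ?H = "%(t, y :: nat => real). (%k. (1 - t) * y k)"
 have "continuous_on ({0..1::real} \<times> cdisc n) (%p. snd p k)" for k
  by (rule continuous_on_coord[OF continuous_on_snd[OF continuous_on_id]])
 moreover have "continuous_on ({0..1::real} \<times> cdisc n) fst"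
  by (rule continuous_on_fst[OF continuous_on_id])
 ultimately have "continuous_on ({0..1::real} \<times> cdisc n) ?H"
  unfolding case_prod_unfold
  by (intro cont_prod continuous_on_mult continuous_on_diff continuous_on_const)
 moreover have "?H p \<in> cdisc n" if "p \<in> {0..1::real} \<times> cdisc n" for p
  using that scale_in_closed_disc[of _ n "1 - fst p"] by (cases p) auto
 ultimately show "cmap (prod_topology (top_of_set {0..1::real}) (disc n)) (disc n) ?H"
  unfolding prod_topology_subtopology_eu by (simp add: cmap_in_sub image_subset_iff)
qed auto

lemma simplices_point_const:
 assumes "a \<in> topspace X" "sing p (subtop X {a}) u"
 shows "\<exists>b\<in>topspace X. u = csimp p b"
 using assms singular_simplex_point[OF assms(1)] by blast

lemma (in comm_group) cobounds_disc_1: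
 assumes "cocycle G 1 (disc n) z"
 obtains f where "cobounds G 1 (disc n) f z"
 by (rule cobounds_constant_1[OF acyclic_disc simplices_point_const assms]) auto

lemma (in comm_group) cobounds_disc_2:
 assumes "cocycle G 2 (disc n) z"
 obtains b where "cobounds G 2 (disc n) b z"
 by (rule cobounds_constant_2[OF acyclic_disc simplices_point_const assms]) auto

lemma singular_simplex_top_of_set:
 "sing p (top_of_set S) u \<longleftrightarrow> continuous_on (splx p) u \<and> u ` splx p \<subseteq> S \<and> u \<in> extensional (splx p)"
 by (auto simp: singular_simplex_iff cmap_in_sub)

lemma standard_simplex_1_iff: "s \<in> splx 1 \<longleftrightarrow> s 1 \<in> {0..1} \<and> s = (%k. if k = 0 then 1 - s 1 else if k = 1 then s 1 else 0)"
proof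
 assume s: "s \<in> splx 1"
 hence "s 0 + s 1 = 1" "0 \<le> s 1" "s 1 \<le> 1" "\<forall>i>1. s i = 0"
  by (auto simp: standard_simplex_def)
 thus "s 1 \<in> {0..1} \<and> s = (%k. if k = 0 then 1 - s 1 else if k = 1 then s 1 else 0)"
  by (auto simp: fun_eq_iff)
next
 assume *: "s 1 \<in> {0..1} \<and> s = (%k. if k = 0 then 1 - s 1 else if k = 1 then s 1 else 0)"
 hence "s 0 = 1 - s 1" "\<forall>i>1. s i = 0"
  by (metis, metis less_numeral_extra(3) less_one less_trans nat_less_le)
 moreover from this have "0 \<le> s i \<and> s i \<le> 1" for i
  using * by (cases "i = 0"; cases "i = 1") auto
 ultimately show "s \<in> splx 1"
  by (simp add: standard_simplex_def)
qed

section \<open>The boundary circle and a chain that fills it\<close>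

definition circ :: "real => nat => real" where
 "circ t = (%k. if k = 0 then cos (2 * pi * t) else if k = 1 then sin (2 * pi * t) else 0)"

definition circ_loop :: "(nat => real) => nat => real" where
 "circ_loop = (\<lambda>s\<in>standard_simplex 1. circ (s 1))"

lemma rad_2: "rad 2 y = sqrt ((y 0)\<^sup>2 + (y 1)\<^sup>2)"
 by (simp add: rad_def numeral_2_eq_2)

lemma circ_sphere: "circ t \<in> disc_sphere 2"
 by (auto simp: disc_sphere_iff rad_2 circ_def)

lemma circ_0: "circ 0 = vert 0" and circ_1: "circ 1 = vert 0"
 by (auto simp: circ_def vert_def fun_eq_iff)

lemma disc_sphere_circ:
 assumes "y \<in> disc_sphere 2" obtains t where "0 \<le> t" "t < 1" "y = circ t"
proof -
 have y: "\<forall>i\<ge>2. y i = 0" "(y 0)\<^sup>2 + (y 1)\<^sup>2 = 1"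
  using assms by (auto simp: disc_sphere_iff rad_2)
 then obtain \<theta> where \<theta>: "0 \<le> \<theta>" "\<theta> < 2 * pi" "y 0 = cos \<theta>" "y 1 = sin \<theta>"
  using sincos_total_2pi by metis
 have "y k = circ (\<theta> / (2 * pi)) k" for k
  using \<theta> y(1) by (cases "k = 0"; cases "k = 1") (auto simp: circ_def)
 thus thesis
  using \<theta> that[of "\<theta> / (2 * pi)"] by (auto simp: fun_eq_iff field_simps)
qed

lemma cont_if_const:
 "[|P ==> continuous_on S f; \<not> P ==> continuous_on S g|] ==> continuous_on S (%x. if P then f x else g x)"
 by (cases P) simp_all

lemma continuous_on_circ: "continuous_on S circ"
 unfolding circ_def by (intro cont_prod cont_if_const continuous_intros)

lemma cont_coord: "continuous_on S (%s::nat => real. s k)"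
 by (rule continuous_on_coord[OF continuous_on_id])

lemma simplex_1_coord: "s \<in> splx 1 ==> 0 \<le> s 1 \<and> s 1 \<le> 1"
 by (auto simp: standard_simplex_def)

lemma singular_simplex_path:
 assumes "continuous_on {0..1} p" "!!t. [|0 \<le> t; t \<le> 1|] ==> p t \<in> S"
 shows "sing 1 (top_of_set S) (\<lambda>s\<in>standard_simplex 1. p (s 1))"
proof -
 have "continuous_on (splx 1) (%s. p (s 1))"
  by (rule continuous_on_compose2[OF assms(1) cont_coord]) (use simplex_1_coord in auto)
 thus ?thesis
  using assms(2) simplex_1_coord
  by (intro singular_simplex_restrict) (auto simp: cmap_in_sub)
qed

lemma circ_loop_simplex: "sing 1 (top_of_set (disc_sphere 2)) circ_loop"
 unfolding circ_loop_def by (rule singular_simplex_path) (auto simp: continuous_on_circ circ_sphere)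

lemma disc_sphere_subset: "disc_sphere n \<subseteq> cdisc n"
 by (auto simp: disc_sphere_def)

lemma singular_simplex_top_of_set_mono:
 "[|singular_simplex p (top_of_set S) u; S \<subseteq> S'|] ==> sing p (top_of_set S') u"
 by (auto simp: singular_simplex_top_of_set)

text \<open>Up to constant edges at the centre the loop bounds in the disc. A constant edge is the
  boundary of the constant triangle, so these edges can be absorbed and the boundary becomes exactly
  one simplex.\<close>

lemma circ_loop_bounds: "\<exists>K. singular_chain 2 (disc 2) K \<and> chain_boundary 2 K = frag_of circ_loop"
proof -
 have l: "sing 1 (disc 2) circ_loop"
  using singular_simplex_top_of_set_mono[OF circ_loop_simplex disc_sphere_subset] .
 have "chain_boundary 1 (frag_of circ_loop) = 0"
  using singular_face_1[of circ_loop]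
  by (simp add: chain_boundary_of circ_loop_def) (simp add: vert_def circ_0 circ_1)
 then obtain d where d: "singular_chain (Suc 1) (disc 2) d"
   "Poly_Mapping.keys (frag_of circ_loop - chain_boundary (Suc 1) d) \<subseteq> simplices_in (disc 2) {%_. 0} 1"
  using acyclic_modD[OF acyclic_disc[of 1 2], of "frag_of circ_loop"] l by (auto simp: singular_chain_of)
 let ?c = "%p. csimp p (%_::nat. 0::real)"
 let ?x = "frag_of circ_loop - chain_boundary (Suc 1) d"
 let ?e = "frag_extend (%u. frag_of (?c 2)) ?x"
 have k: "Poly_Mapping.keys ?x \<subseteq> {?c 1}"
 proof
  fix u assume "u \<in> Poly_Mapping.keys ?x"
  hence "sing 1 (subtop (disc 2) {%_. 0}) u" using d(2) by auto
  thus "u \<in> {?c 1}"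
   using singular_simplex_point[of "%_. 0" "disc 2" 1 u] by simp
 qed
 have "chain_boundary 2 (frag_of (?c 2)) = frag_of (?c 1)"
  by (simp add: chain_boundary_of singular_face_const numeral_2_eq_2)
 hence "chain_boundary 2 ?e = frag_extend (%u. frag_of (?c 1)) ?x"
  by (simp add: frag_extend_boundary)
 also have "\<dots> = frag_extend frag_of ?x"
  using k by (intro frag_extend_eq) auto
 finally have "chain_boundary 2 ?e = ?x"
  by (simp flip: frag_expansion)
 hence "chain_boundary 2 (d + ?e) = frag_of circ_loop"
  by (simp add: chain_boundary_add numeral_2_eq_2)
 moreover have "singular_chain 2 (disc 2) (d + ?e)"
  using d(1) singular_simplex_const[of "%_. 0" "disc 2" 2]
  by (intro singular_chain_add singular_chain_extend) (auto simp: singular_chain_of numeral_2_eq_2)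
 ultimately show ?thesis by blast
qed

text \<open>A relative fundamental cycle of the disc: evaluation of a 2-cochain on its image under a
  characteristic map plays the role of the value on the 2-cell.\<close>

definition disc_chain :: "(nat => real) chain" where
 "disc_chain = (SOME K. singular_chain 2 (disc 2) K \<and> chain_boundary 2 K = frag_of circ_loop)"

lemma disc_chain: "singular_chain 2 (disc 2) disc_chain" "chain_boundary 2 disc_chain = frag_of circ_loop"
 using someI_ex[OF circ_loop_bounds] by (auto simp: disc_chain_def)

definition cochain0 :: "('a => 'c) => ((nat => real) => 'a) => 'c" where
 "cochain0 g u = g (u (vert 0))"

lemma cochain0_const [simp]: "cochain0 g (csimp 0 x) = g x"
 by (simp add: cochain0_def csimp_def)

lemma cochain_cochain0: "(!!x. g x \<in> carrier A) ==> cochain A (cochain0 g)"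
 by (simp add: cochain_def cochain0_def)

lemma (in comm_group) cobd_cochain0:
 "(!!x. g x \<in> carrier G) ==> cobd G 1 (cochain0 g) c = g (c (vert 1)) \<otimes> inv (g (c (vert 0)))"
 by (simp add: cobd_1_const cochain_cochain0 del: One_nat_def)

lemma (in comm_group) cobounds_1_fun:
 assumes "cobounds G 1 X F z"
 obtains g where "!!x. g x \<in> carrier G" "!!x. g x = F (csimp 0 x)"
   "!!c. sing 1 X c ==> z c = g (c (vert 1)) \<otimes> inv (g (c (vert 0)))"
proof (rule that[of "%x. F (csimp 0 x)"])
 note Fc = cobounds_fun[OF assms]
 show "F (csimp 0 x) \<in> carrier G" for x by (rule cochainD[OF Fc])
 show "z c = F (csimp 0 (c (vert 1))) \<otimes> inv (F (csimp 0 (c (vert 0))))"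
  if "sing 1 X c" for c
  using assms that cobd_1_const[OF Fc, of c] by (simp add: cobounds_def)
qed simp

text \<open>The exponential function, in coordinates. On the closed left half plane it is the
  universal cover of the closed unit disc without its centre.\<close>

definition half_exp :: "complex => nat => real" where
 "half_exp z = (%k. if k = 0 then Re (exp z) else if k = 1 then Im (exp z) else 0)"

lemma continuous_on_half_exp: "continuous_on S half_exp"
 unfolding half_exp_def by (intro cont_prod cont_if_const continuous_intros)

lemma half_exp_in: "Re z \<le> 0 ==> half_exp z \<in> cdisc 2 - {%_. 0}"
proof -
 assume "Re z \<le> 0"
 have "rad 2 (half_exp z) = exp (Re z)"
  by (simp add: rad_2 half_exp_def flip: cmod_def norm_exp_eq_Re)
 moreover from this have "half_exp z \<noteq> (%_. 0)"
  by (metis exp_not_eq_zero rad_zero)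
 ultimately show ?thesis
  using \<open>Re z \<le> 0\<close> by (auto simp: closed_disc_iff half_exp_def)
qed

lemma half_exp_eq_iff: "half_exp z = half_exp v \<longleftrightarrow> exp z = exp v"
proof
 assume "half_exp z = half_exp v"
 hence "half_exp z 0 = half_exp v 0" "half_exp z 1 = half_exp v 1"
  by simp_all
 thus "exp z = exp v"
  by (simp add: half_exp_def complex_eq_iff)
next
 assume e: "exp z = exp v"
 show "half_exp z = half_exp v"
  unfolding half_exp_def e ..
qed

text \<open>A path that avoids 0 has a continuous logarithm, because the interval is contractible;
  the real part is at most 0 since the path stays in the unit disc.\<close>

lemma lift_half_exp:
 assumes v: "sing 1 (top_of_set (cdisc 2 - {%_. 0})) v"
 obtains l where "sing 1 (top_of_set {z. Re z \<le> 0}) l" "v = simplex_map 1 half_exp l"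
proof -
 have g: "v s \<in> cdisc 2 - {%_. 0}" if "s \<in> splx 1" for s
  using sing_maps[OF v that] by simp
 have cg: "continuous_on (splx 1) v"
  using v by (simp add: singular_simplex_top_of_set)
 define q :: "real => nat => real" where "q u = (%k. if k = 0 then 1 - u else if k = 1 then u else 0)" for u
 have q: "q u \<in> splx 1" if "u \<in> {0..1}" for u
  unfolding standard_simplex_1_iff using that by (auto simp: q_def)
 have cq: "continuous_on {0..1} q"
  unfolding q_def by (intro cont_prod cont_if_const continuous_intros)
 have cgq: "continuous_on {0..1} (%u. v (q u))"
  by (rule continuous_on_compose2[OF cg cq]) (use q in auto)
 define c where "c u = Complex (v (q u) 0) (v (q u) 1)" for u
 have cc: "continuous_on {0..1} c"
  unfolding c_def Complex_eq
  by (intro continuous_intros) (rule continuous_on_coord[OF cgq])+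
 have cm: "cmod (c u) = rad 2 (v (q u))" for u
  by (simp add: c_def cmod_def rad_2)
 have nz: "c u \<noteq> 0" if "u \<in> {0..1}" for u
  using g[OF q[OF that]] punctured_disc_rad[of "v (q u)" 2] cm[of u] by auto
 obtain l where l: "continuous_on {0..1} l" "!!u. u \<in> {0..1} ==> c u = exp (l u)"
  using continuous_logarithm_on_contractible[OF cc _ nz] convex_imp_contractible[of "{0..1::real}"] by auto
 have Rl: "Re (l u) \<le> 0" if "0 \<le> u" "u \<le> 1" for u
 proof -
  have "exp (Re (l u)) = rad 2 (v (q u))"
   using l(2)[of u] cm[of u] that by simp
  also have "\<dots> \<le> 1"
   using g[OF q, of u] that by (auto simp: closed_disc_iff)
  finally show ?thesis by simp
 qed
 show thesis
 proof
  show "sing 1 (top_of_set {z. Re z \<le> 0}) (\<lambda>s\<in>standard_simplex 1. l (s 1))"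
   by (rule singular_simplex_path[OF l(1)]) (use Rl in auto)
  show "v = simplex_map 1 half_exp (\<lambda>s\<in>standard_simplex 1. l (s 1))"
  proof (rule extensionalityI[of _ "splx 1"])
   show "v \<in> extensional (splx 1)" using v by (simp add: singular_simplex_iff)
   fix s assume s: "s \<in> splx 1"
   hence u: "s 1 \<in> {0..1}" and sq: "s = q (s 1)"
    unfolding standard_simplex_1_iff q_def by auto
   have e: "exp (l (s 1)) = Complex (v s 0) (v s 1)"
    using l(2)[OF u] sq by (simp add: c_def)
   have "v s k = half_exp (l (s 1)) k" for k
    using g[OF s] e by (cases "k = 0"; cases "k = 1") (auto simp: half_exp_def closed_disc_iff)
   thus "v s = simplex_map 1 half_exp (\<lambda>s\<in>standard_simplex 1. l (s 1)) s"
    using s by (simp add: simplex_map_def fun_eq_iff)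
  qed (simp add: simplex_map_def)
 qed
qed

lemma acyclic_half_plane: "acyclic_mod p (top_of_set {z. Re z \<le> 0}) (simplices_in (top_of_set {z. Re z \<le> 0}) {0})"
proof (rule acyclic_mod_deformation)
 let ?H = "%(t, z). of_real (1 - t) * z :: complex"
 show "cmap (prod_topology (top_of_set {0..1::real}) (top_of_set {z. Re z \<le> 0})) (top_of_set {z. Re z \<le> 0}) ?H"
  unfolding prod_topology_subtopology_eu
  by (auto simp: cmap_in_sub case_prod_unfold intro!: continuous_intros mult_nonneg_nonpos)
qed auto

text \<open>On the contractible half plane the pulled back cocycle has a primitive \<open>g\<close>.
  Its increment over one period is the value of \<open>w\<close> on the boundary loop, which is
  trivial, so \<open>g\<close> is invariant under the deck transformations and descends.\<close>

lemma (in comm_group) cobounds_punctured_disc_2: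
 assumes w: "cocycle G 1 (top_of_set (cdisc 2 - {%_. 0})) w" and loop: "w circ_loop = \<one>"
 obtains f where "cobounds G 1 (top_of_set (cdisc 2 - {%_. 0})) f w"
proof -
 let ?L = "top_of_set {z. Re z \<le> 0}" and ?D = "top_of_set (cdisc 2 - {%_. 0::real})"
 have ce: "cmap ?L ?D half_exp"
  using half_exp_in by (auto simp: cmap_in_sub continuous_on_half_exp)
 have c: "cocycle G 1 ?L (%v. w (simplex_map 1 half_exp v))"
  by (rule cocycle_pullback[OF w ce])
 obtain F where F: "cobounds G 1 ?L F (%v. w (simplex_map 1 half_exp v))"
  by (rule cobounds_constant_1[OF acyclic_half_plane simplices_point_const c]) auto
 obtain g where gc: "!!x. g x \<in> carrier G"
   and g: "!!q. sing 1 ?L q ==> w (simplex_map 1 half_exp q) = g (q (vert 1)) \<otimes> inv (g (q (vert 0)))"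
  by (rule cobounds_1_fun[OF F]) (rule that)
 \<comment> \<open>Straight segments; the half plane is convex and contains them.\<close>
 define pth where "pth a b = (\<lambda>s\<in>standard_simplex 1. of_real (1 - s 1) * a + of_real (s 1) * b)" for a b :: complex
 have pth: "sing 1 ?L (pth a b)" if "Re a \<le> 0" "Re b \<le> 0" for a b
  unfolding pth_def
 proof (rule singular_simplex_path)
  show "continuous_on {0..1} (%u. of_real (1 - u) * a + of_real u * b)"
   by (intro continuous_intros)
  show "of_real (1 - u) * a + of_real u * b \<in> {z. Re z \<le> 0}" if "0 \<le> u" "u \<le> 1" for u
   using that \<open>Re a \<le> 0\<close> \<open>Re b \<le> 0\<close> add_nonpos_nonpos[OF mult_nonneg_nonpos mult_nonneg_nonpos, of "1 - u" "Re a" u "Re b"]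
   by simp
 qed
 have ends: "pth a b (vert 0) = a" "pth a b (vert 1) = b" for a b
  by (simp_all add: pth_def, simp_all add: vert_def)
 note ends = ends ends[unfolded One_nat_def]
 let ?p = "2 * of_real pi * \<i> :: complex"
 have per0: "g ?p = g 0"
 proof -
  have "simplex_map 1 half_exp (pth 0 ?p) = circ_loop"
  proof (rule extensionalityI[of _ "splx 1"])
   fix s :: "nat => real" assume s: "s \<in> splx 1"
   have "half_exp (of_real (s 1) * ?p) = circ (s 1)"
    by (auto simp: half_exp_def circ_def fun_eq_iff Re_exp Im_exp mult_ac)
   thus "simplex_map 1 half_exp (pth 0 ?p) s = circ_loop s"
    using s by (simp add: simplex_map_def pth_def circ_loop_def)
  qed (auto simp: simplex_map_def circ_loop_def)
  hence "g ?p \<otimes> inv (g 0) = \<one>"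
   using g[OF pth[of 0 ?p]] loop by (simp add: ends)
  thus ?thesis using gc by (metis inv_closed inv_equality inv_inv)
 qed
 \<comment> \<open>Translating a segment by the period does not change its image under
   \<open>half_exp\<close>, so \<open>g\<close> has the same increment along both segments. Together
   with \<open>per0\<close> this moves the invariance from 0 to \<open>z\<close>.\<close>
 have per1: "g (z + ?p) = g z" if z: "Re z \<le> 0" for z
 proof -
  have "half_exp (r + ?p) = half_exp r" for r
   unfolding half_exp_eq_iff by (simp add: exp_add mult_ac)
  moreover have "pth ?p (z + ?p) s = pth 0 z s + ?p" if "s \<in> splx 1" for s
   using that by (simp add: pth_def algebra_simps)
  ultimately have "simplex_map 1 half_exp (pth ?p (z + ?p)) = simplex_map 1 half_exp (pth 0 z)"
   by (auto simp: simplex_map_def intro!: restrict_ext)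
  hence "g (z + ?p) \<otimes> inv (g ?p) = g z \<otimes> inv (g 0)"
   using g[OF pth[of ?p "z + ?p"]] g[OF pth[of 0 z]] z by (simp add: ends)
  thus ?thesis
   using gc per0 by (metis inv_closed right_cancel)
 qed
 have pern: "g (z + of_nat k * ?p) = g z" if z: "Re z \<le> 0" for z k
 proof (induction k)
  case (Suc k)
  have "g (z + of_nat k * ?p + ?p) = g (z + of_nat k * ?p)"
   by (rule per1) (use z in simp)
  thus ?case using Suc by (simp add: algebra_simps)
 qed simp
 have ge: "g z = g r" if eq: "half_exp z = half_exp r" and "Re z \<le> 0" "Re r \<le> 0" for z r
 proof -
  obtain m :: int where m: "z = r + of_int m * ?p"
  proof -
   have "exp z = exp r"
    using eq by (simp add: half_exp_eq_iff)
   then obtain m :: int where "z = r + (of_int (2 * m) * pi) * \<i>"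
    using exp_eq by blast
   thus thesis
    using that[of m] by (simp add: algebra_simps)
  qed
  show ?thesis
  proof (cases "m \<ge> 0")
   case True
   hence "z = r + of_nat (nat m) * ?p" using m by simp
   thus ?thesis using pern[OF \<open>Re r \<le> 0\<close>] by metis
  next
   case False
   hence "r = z + of_nat (nat (- m)) * ?p" using m by simp
   thus ?thesis using pern[OF \<open>Re z \<le> 0\<close>] by metis
  qed
 qed
 define h where "h y = g (SOME z. Re z \<le> 0 \<and> half_exp z = y)" for y
 have h: "h (half_exp z) = g z" if "Re z \<le> 0" for z
 proof -
  have "Re (SOME r. Re r \<le> 0 \<and> half_exp r = half_exp z) \<le> 0 \<and> half_exp (SOME r. Re r \<le> 0 \<and> half_exp r = half_exp z) = half_exp z"
   by (rule someI[of _ z]) (use that in simp)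
  thus ?thesis unfolding h_def using ge that by blast
 qed
 have hc: "h y \<in> carrier G" for y by (simp add: h_def gc)
 show thesis
 proof
  show "cobounds G 1 ?D (cochain0 h) w"
   unfolding cobounds_def
  proof (intro conjI allI impI cochain_cochain0 hc)
   fix q assume q: "sing 1 ?D q"
   then obtain l where l: "sing 1 ?L l" "q = simplex_map 1 half_exp l"
    using lift_half_exp by metis
   have lv: "Re (l (vert k)) \<le> 0" if "k \<le> 1" for k
    using sing_maps[OF l(1), of "vert k"] that by simp
   have "w q = g (l (vert 1)) \<otimes> inv (g (l (vert 0)))"
    using g[OF l(1)] l(2) by simp
   also have "\<dots> = cobd G 1 (cochain0 h) q"
    unfolding cobd_cochain0[OF hc] l(2) using lv[of 0] lv[of 1] by (simp add: simplex_map_def h)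
   finally show "w q = cobd G 1 (cochain0 h) q" .
  qed
 qed
qed

lemma disc_sphere_1: "disc_sphere 1 = {vert 0, (%k. - vert 0 k)}"
proof -
 have "y \<in> disc_sphere 1 \<longleftrightarrow> y = vert 0 \<or> y = (%k. - vert 0 k)" for y
 proof -
  have "y \<in> disc_sphere 1 \<longleftrightarrow> (\<forall>i\<ge>1. y i = 0) \<and> \<bar>y 0\<bar> = 1"
   by (simp add: disc_sphere_iff rad_def)
  also have "\<dots> \<longleftrightarrow> y = vert 0 \<or> y = (%k. - vert 0 k)"
   by (auto simp: fun_eq_iff vert_def abs_if split: if_splits)
  finally show ?thesis .
 qed
 thus ?thesis by blast
qed

text \<open>The interval without its centre deforms onto its two end points, a discrete set, whose
  simplices are constant.\<close>

lemma (in comm_group) cobounds_punctured_disc_1: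
 assumes w: "cocycle G 1 (top_of_set (cdisc 1 - {%_. 0})) w"
 obtains f where "cobounds G 1 (top_of_set (cdisc 1 - {%_. 0})) f w"
proof -
 let ?D = "top_of_set (cdisc 1 - {%_. 0::real})"
 have S: "disc_sphere 1 \<subseteq> cdisc 1 - {%_. 0}"
  by (auto simp: disc_sphere_iff closed_disc_iff)
 have acy: "acyclic_mod p ?D (simplices_in ?D (disc_sphere 1))" for p
 proof (rule acyclic_mod_deformation)
  let ?H = "%(t, y). (%k. ((1 - t) + t / rad 1 y) * y k)"
  show "cmap (prod_topology (top_of_set {0..1::real}) ?D) ?D ?H"
   unfolding prod_topology_subtopology_eu
   using continuous_on_radial[of 1] radial_in_disc(1)[OF punctured_disc_rad]
   by (auto simp: cmap_in_sub)
  show "?H (1, y) \<in> disc_sphere 1" if "y \<in> topspace ?D" for y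
   using radial_in_disc(2)[OF punctured_disc_rad, of y 1 1] that by auto
  show "?H (t, y) \<in> disc_sphere 1" if "y \<in> disc_sphere 1" for t y
   using that by (auto simp: disc_sphere_iff)
 qed auto
 have const: "\<exists>a\<in>topspace ?D. u = csimp p a" if u: "sing p (subtop ?D (disc_sphere 1)) u" for p u
 proof -
  let ?s = "splx p"
  have u': "continuous_on ?s u" "u ` ?s \<subseteq> disc_sphere 1" "u \<in> extensional ?s"
   using u S by (auto simp: subtop_subtop Int_absorb1 singular_simplex_top_of_set)
  have "connected ?s"
   using connectedin_standard_simplex[of p] by (simp add: powertop_eq)
  hence "connected (u ` ?s)"
   by (rule connected_continuous_image[OF u'(1)])
  moreover have "finite (u ` ?s)"
   by (rule finite_subset[OF u'(2)]) (simp add: disc_sphere_1[unfolded One_nat_def])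
  moreover have "u ` ?s \<noteq> {}"
   using nonempty_standard_simplex by simp
  ultimately obtain a where a: "u ` ?s = {a}"
   using connected_finite_iff_sing by metis
  hence "u = csimp p a"
   unfolding csimp_def by (intro extensionalityI[OF u'(3)]) auto
  moreover have "a \<in> topspace ?D" using a u'(2) S by auto
  ultimately show ?thesis by blast
 qed
 show thesis
  by (rule cobounds_constant_1[OF acy const w]) (use that in blast)+
qed

section \<open>Vanishing criteria in dimensions one and two\<close>

definition edge_path :: "(nat => real) => nat => real" where
 "edge_path = (\<lambda>s\<in>standard_simplex 1. (%k. if k = 0 then 2 * s 1 - 1 else 0))"

lemma edge_path_simplex: "sing 1 (disc 1) edge_path"
proof -
 have "sing 1 (disc 1) (\<lambda>s\<in>standard_simplex 1. (%u k. if k = 0 then 2 * u - 1 else 0) (s 1))"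
  by (rule singular_simplex_path)
   (auto simp: closed_disc_iff rad_def intro!: cont_prod cont_if_const continuous_intros)
 thus ?thesis by (simp add: edge_path_def)
qed

lemma edge_path_ends: "edge_path (vert 0) = (%k. - vert 0 k)" "edge_path (vert 1) = vert 0"
 by (auto simp: edge_path_def fun_eq_iff, auto simp: vert_def)

text \<open>The primitive on the interval, divided by its value at the left end, is trivial at the
  right end as well, because the cocycle is trivial on the whole edge. This is the normalisation on
  the sphere that gluing requires.\<close>

lemma (in cw_dim) graph_cobounds_1:
 fixes A :: "('c, 'b) monoid_scheme" (structure)
 assumes "n = 1" and A: "comm_group A" and e: "cocycle A 1 X e"
  and edges: "!!i. [|i \<in> I; d i = 1|] ==> e (simplex_map 1 (ch i) edge_path) = \<one>"
 obtains f where "cobounds A 1 X f e"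
proof -
 interpret A: comm_group A by (fact A)
 show thesis
 proof (rule cocycle_1_cobounds[OF A e])
  show "e v = \<one>" if "sing 1 (subtop X (skel n)) v" for v
   using path_component_cell_skel1[of 1 v] that A.cocycle_1_const[OF e] skel_subset[of 1] \<open>n = 1\<close> by auto
 next
  fix i assume i: "i \<in> I" "d i = n"
  have "cocycle A 1 (disc n) (%v. e (simplex_map 1 (ch i) v))"
   using A.cocycle_pullback[OF e cont[OF i(1)]] i by simp
  then obtain F where F: "cobounds A 1 (disc n) F (%v. e (simplex_map 1 (ch i) v))"
   using A.cobounds_disc_1 by blast
  obtain g where gc: "!!x. g x \<in> carrier A"
   and g: "!!v. sing 1 (disc n) v ==> e (simplex_map 1 (ch i) v) = g (v (vert 1)) \<otimes> inv (g (v (vert 0)))"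
   using A.cobounds_1_fun[OF F] by metis
  let ?a = "%k. - vert 0 k"
  define h where "h x = g x \<otimes> inv (g ?a)" for x
  have hc: "h x \<in> carrier A" for x by (simp add: h_def gc)
  have "\<one> = g (vert 0) \<otimes> inv (g ?a)"
   using g[of edge_path] edge_path_simplex edges[of i] i \<open>n = 1\<close> by (simp add: edge_path_ends edge_path_ends[unfolded One_nat_def])
  hence "h y = \<one>" if "y \<in> disc_sphere n" for y
  proof -
   have "y = vert 0 \<or> y = (%k. - vert 0 k)"
    using that \<open>n = 1\<close> disc_sphere_1 by auto
   thus ?thesis
    using \<open>\<one> = g (vert 0) \<otimes> inv (g ?a)\<close>[symmetric] A.r_inv[OF gc[of ?a]] unfolding h_def by metis
  qed
  moreover have "h x \<otimes> inv (h y) = g x \<otimes> inv (g y)" for x y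
  proof -
   have "h x \<otimes> inv (h y) = g x \<otimes> (inv (g ?a) \<otimes> g ?a) \<otimes> inv (g y)"
    by (simp only: h_def A.inv_mult gc A.inv_closed A.inv_inv A.m_assoc A.m_closed A.m_comm[of "inv (g y)"] A.m_lcomm)
   thus ?thesis by (simp add: gc)
  qed
  ultimately show "\<exists>F. cobounds A 1 (disc n) F (%v. e (simplex_map 1 (ch i) v)) \<and>
    (\<forall>y\<in>disc_sphere n. F (csimp 0 y) = \<one>)"
   using g hc by (intro exI[of _ "cochain0 h"]) (auto simp: cobounds_def A.cobd_cochain0[unfolded One_nat_def] cochain_cochain0)
 qed (use that in blast)
qed

text \<open>A graph has no second cohomology: once \<open>b0\<close> has removed the values on
  constant triangles the cocycle is trivial on the vertices, and on a punctured interval every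
  1-cocycle is a coboundary.\<close>

lemma (in cw_dim) graph_cobounds_2:
 fixes A :: "('c, 'b) monoid_scheme" (structure)
 assumes "n = 1" and A: "comm_group A" and z: "cocycle A 2 X z"
 obtains b where "cobounds A 2 X b z"
proof -
 interpret A: comm_group A by (fact A)
 note zf = A.cocycle_fun[OF z]
 define b0 where "b0 v = (if \<exists>a. v = csimp 1 a then z (csimp 2 (THE a. v = csimp 1 a)) else \<one>)" for v
 have b0c: "b0 (csimp 1 a) = z (csimp 2 a)" for a
  unfolding b0_def by (auto simp: const_simplex_eq_iff)
 have b0: "cochain A b0"
  by (rule cochainI) (simp add: b0_def cochainD[OF zf])
 define w where "w u = z u \<otimes> inv (cobd A 2 b0 u)" for u
 have w: "cocycle A 2 X w"
  unfolding w_def using A.cocycle_diff[OF z A.cocycle_cobd[OF b0]] by simp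
 have one: "w u = \<one>" if u: "sing 2 (subtop X (skel n)) u" for u
 proof -
  obtain a where a: "u = csimp 2 a"
   using path_component_cell_skel1[of 2 u] u \<open>n = 1\<close> by auto
  have "cobd A 2 b0 u = z u"
   by (simp add: A.cobd_2[OF b0] a singular_face_const b0c[unfolded One_nat_def] cochainD[OF zf])
  thus ?thesis
   by (simp add: w_def cochainD[OF zf])
 qed
 obtain b where b: "cobounds A 2 X b w"
 proof (rule cocycle_2_cobounds[OF A w one])
  fix i assume i: "i \<in> I" "d i = n"
  have "cocycle A 2 (disc n) (%t. w (simplex_map 2 (ch i) t))"
   using A.cocycle_pullback[OF w cont[OF i(1)]] i by simp
  then obtain B where "cobounds A 2 (disc n) B (%t. w (simplex_map 2 (ch i) t))"
   using A.cobounds_disc_2 by blast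
  moreover have "\<exists>f. cobounds A 1 (top_of_set (cdisc n - {%_. 0})) f w"
   if "cocycle A 1 (top_of_set (cdisc n - {%_. 0})) w" for w
   using A.cobounds_punctured_disc_1[of w] that \<open>n = 1\<close> by metis
  ultimately show "\<exists>b. cobounds A 2 (disc n) b (%t. w (simplex_map 2 (ch i) t)) \<and>
    (\<forall>w. cocycle A 1 (top_of_set (cdisc n - {%_. 0})) w -->
     (\<forall>v. sing 1 (top_of_set (disc_sphere n)) v --> w v = inv (b v)) -->
     (\<exists>f. cobounds A 1 (top_of_set (cdisc n - {%_. 0})) f w))"
   by blast
 qed blast+
 note bf = A.cobounds_fun[OF b]
 show thesis
 proof
  show "cobounds A 2 X (%x. b0 x \<otimes> b x) z"
   unfolding cobounds_def
  proof (intro conjI allI impI A.cochain_mult b0 bf)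
   fix t assume "sing 2 X t"
   thus "z t = cobd A 2 (%x. b0 x \<otimes> b x) t"
    using A.cobounds_diffD[OF b[unfolded w_def] zf A.cobd_fun[OF b0]] by (simp add: A.cobd_mult b0 bf)
  qed
 qed
qed

text \<open>The boundary circle is mapped into the graph, where the cocycle is trivial. So the
  primitive on the disc is constant along the circle and can be normalised to be trivial
  there.\<close>

lemma (in cw_dim) surface_cobounds_1:
 fixes A :: "('c, 'b) monoid_scheme" (structure)
 assumes "n = 2" and A: "comm_group A" and e: "cocycle A 1 X e"
  and skel: "!!v. sing 1 (subtop X (skel 2)) v ==> e v = \<one>"
 obtains f where "cobounds A 1 X f e" "!!x. x \<in> skel 2 ==> f (csimp 0 x) = \<one>"
proof -
 interpret A: comm_group A by (fact A)
 show thesis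
 proof (rule cocycle_1_cobounds[OF A e])
  show "e v = \<one>" if "sing 1 (subtop X (skel n)) v" for v
   using skel that \<open>n = 2\<close> by simp
 next
  fix i assume i: "i \<in> I" "d i = n"
  have "cocycle A 1 (disc n) (%v. e (simplex_map 1 (ch i) v))"
   using A.cocycle_pullback[OF e cont[OF i(1)]] i by simp
  then obtain F where F: "cobounds A 1 (disc n) F (%v. e (simplex_map 1 (ch i) v))"
   using A.cobounds_disc_1 by blast
  obtain g where gc: "!!x. g x \<in> carrier A"
   and g: "!!v. sing 1 (disc n) v ==> e (simplex_map 1 (ch i) v) = g (v (vert 1)) \<otimes> inv (g (v (vert 0)))"
   using A.cobounds_1_fun[OF F] by metis
  let ?a = "vert 0"
  define h where "h x = g x \<otimes> inv (g ?a)" for x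
  have hc: "h x \<in> carrier A" for x by (simp add: h_def gc)
  have h1: "h y = \<one>" if y: "y \<in> disc_sphere n" for y
  proof -
   obtain t where t: "0 \<le> t" "y = circ t"
    using disc_sphere_circ y \<open>n = 2\<close> by metis
   \<comment> \<open>The arc of the circle from its base point to \<open>y\<close>.\<close>
   let ?v = "\<lambda>s\<in>standard_simplex 1. circ (t * s 1)"
   have "sing 1 (top_of_set (disc_sphere 2)) (\<lambda>s\<in>standard_simplex 1. (%u. circ (t * u)) (s 1))"
   proof (rule singular_simplex_path)
    show "continuous_on {0..1} (%u. circ (t * u))"
     by (rule continuous_on_compose2[OF continuous_on_circ[of UNIV]]) (auto intro!: continuous_intros)
   qed (rule circ_sphere)
   hence s: "sing 1 (top_of_set (disc_sphere n)) ?v" using \<open>n = 2\<close> by simp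
   have "cmap (top_of_set (disc_sphere n)) (subtop X (skel 2)) (ch i)"
    using cont[OF i(1)] skel_n_iff[OF i(1)] i(2) \<open>n = 2\<close>
    by (auto simp: cmap_in_sub disc_sphere_def intro: cmap_mono)
   hence "e (simplex_map 1 (ch i) ?v) = \<one>"
    using skel singular_simplex_simplex_map[OF s] by blast
   moreover have "sing 1 (disc n) ?v"
    using singular_simplex_top_of_set_mono[OF s disc_sphere_subset] .
   moreover have "?v (vert 1) = y" "?v (vert 0) = ?a"
    using t by (simp_all, simp_all add: vert_def) (simp add: circ_0 flip: vert_def)
   ultimately show ?thesis
    using g[of ?v] by (simp add: h_def)
  qed
  moreover have "h x \<otimes> inv (h y) = g x \<otimes> inv (g y)" for x y
  proof -
   have "h x \<otimes> inv (h y) = g x \<otimes> (inv (g ?a) \<otimes> g ?a) \<otimes> inv (g y)"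
    by (simp only: h_def A.inv_mult gc A.inv_closed A.inv_inv A.m_assoc A.m_closed A.m_comm[of "inv (g y)"] A.m_lcomm)
   thus ?thesis by (simp add: gc)
  qed
  ultimately show "\<exists>F. cobounds A 1 (disc n) F (%v. e (simplex_map 1 (ch i) v)) \<and>
    (\<forall>y\<in>disc_sphere n. F (csimp 0 y) = \<one>)"
   using g hc by (intro exI[of _ "cochain0 h"]) (auto simp: cobounds_def A.cobd_cochain0[unfolded One_nat_def] cochain_cochain0)
 qed (use that \<open>n = 2\<close> in simp)
qed

text \<open>By Stokes' formula the primitive on the disc takes on the boundary loop the value of
  \<open>z\<close> on the disc chain, which is trivial. A 1-cocycle on the punctured disc that is
  inverse to it on the circle is then trivial on the loop, hence a coboundary.\<close>

lemma (in cw_dim) surface_cobounds_2: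
 fixes A :: "('c, 'b) monoid_scheme" (structure)
 assumes "n = 2" and A: "comm_group A" and z: "cocycle A 2 X z"
  and skel: "!!t. sing 2 (subtop X (skel 2)) t ==> z t = \<one>"
  and cells: "!!i. [|i \<in> I; d i = 2|] ==> chain_eval A z (chain_map 2 (ch i) disc_chain) = \<one>"
 obtains b where "cobounds A 2 X b z"
proof -
 interpret A: comm_group A by (fact A)
 note zf = A.cocycle_fun[OF z]
 show thesis
 proof (rule cocycle_2_cobounds[OF A z])
  show "z t = \<one>" if "sing 2 (subtop X (skel n)) t" for t
   using skel that \<open>n = 2\<close> by simp
 next
  fix i assume i: "i \<in> I" "d i = n"
  have zc: "cocycle A 2 (disc n) (%t. z (simplex_map 2 (ch i) t))"
   using A.cocycle_pullback[OF z cont[OF i(1)]] i by simp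
  then obtain B where B: "cobounds A 2 (disc n) B (%t. z (simplex_map 2 (ch i) t))"
   using A.cobounds_disc_2 by blast
  note Bc = A.cobounds_fun[OF B]
  have "chain_eval A (%t. z (simplex_map 2 (ch i) t)) disc_chain = chain_eval A B (chain_boundary 2 disc_chain)"
   using disc_chain(1) \<open>n = 2\<close> by (intro A.cobounds_chain[OF B cochain_comp[OF zf]]) simp
  hence B1: "B circ_loop = \<one>"
   using cells[of i] i \<open>n = 2\<close> by (simp add: disc_chain(2) Bc A.chain_eval_chain_map[OF zf])
  have "\<exists>f. cobounds A 1 (top_of_set (cdisc n - {%_. 0})) f w"
   if "cocycle A 1 (top_of_set (cdisc n - {%_. 0})) w"
    "\<forall>v. sing 1 (top_of_set (disc_sphere n)) v --> w v = inv (B v)" for w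
   using that A.cobounds_punctured_disc_2[of w] circ_loop_simplex B1 \<open>n = 2\<close> by auto
  thus "\<exists>b. cobounds A 2 (disc n) b (%t. z (simplex_map 2 (ch i) t)) \<and>
    (\<forall>w. cocycle A 1 (top_of_set (cdisc n - {%_. 0})) w -->
     (\<forall>v. sing 1 (top_of_set (disc_sphere n)) v --> w v = inv (b v)) -->
     (\<exists>f. cobounds A 1 (top_of_set (cdisc n - {%_. 0})) f w))"
   using B by blast
 qed (use that in blast)
qed

section \<open>The fundamental group of a topological group\<close>

declare One_nat_def [simp del]

lemma cmap_into:
 assumes "cmap (top_of_set A) Z f" "continuous_on S g" "!!x. x \<in> S ==> g x \<in> A"
 shows "cmap (top_of_set S) Z (%x. f (g x))"
proof -
 have "cmap (top_of_set S) (top_of_set A) g"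
  using assms(2,3) by (auto simp: cmap_in_sub)
 hence "cmap (top_of_set S) Z (f \<circ> g)"
  by (rule cmap_comp[OF _ assms(1)])
 thus ?thesis
  by (simp add: o_def)
qed

lemma continuous_on_snd_coordinate: "continuous_on S (%p :: real \<times> (nat => real). snd p k)"
 by (rule continuous_on_coord[OF continuous_on_snd[OF continuous_on_id]])

definition cube1 :: "(nat => real) set" where
 "cube1 = {s. (\<forall>i\<ge>1. s i = 0) \<and> 0 \<le> s 0 \<and> s 0 \<le> 1}"

lemma cube_1: "cube 1 = top_of_set cube1"
proof -
 have "{x. \<forall>i\<ge>1. x i = 0} \<inter> {s. \<forall>i<1. 0 \<le> s i \<and> s i \<le> (1::real)} = cube1"
  by (auto simp: cube1_def)
 thus ?thesis
  by (simp add: cube_def Euclidean_space_def powertop_eq subtop_subtop)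
qed

lemma cube_boundary_1: "cube_boundary 1 = {s \<in> cube1. s 0 = 0 \<or> s 0 = 1}"
 by (auto simp: cube_boundary_def cube_1)

lemma cube1_upd: "[|s \<in> cube1; 0 \<le> u; u \<le> 1|] ==> s(0 := u) \<in> cube1"
 by (auto simp: cube1_def)

text \<open>The 1-simplex and the 1-cube are identified through their free coordinate, which has
  index 1 in the simplex and index 0 in the cube.\<close>

definition to_simplex :: "(nat => real) => nat => real" where
 "to_simplex s = (%k. if k = 0 then 1 - s 0 else if k = 1 then s 0 else 0)"

definition to_cube :: "(nat => real) => nat => real" where
 "to_cube s = (%k. if k = 0 then s 1 else 0)"

lemma to_simplex: "s \<in> cube1 ==> to_simplex s \<in> splx 1"
 by (auto simp: standard_simplex_1_iff to_simplex_def cube1_def)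

lemma to_cube: "s \<in> splx 1 ==> to_cube s \<in> cube1"
 using simplex_1_coord[of s] by (auto simp: to_cube_def cube1_def)

lemma to_simplex_to_cube: "s \<in> splx 1 ==> to_simplex (to_cube s) = s"
 unfolding standard_simplex_1_iff to_simplex_def to_cube_def by simp

lemma to_cube_to_simplex: "s \<in> cube1 ==> to_cube (to_simplex s) = s"
 by (auto simp: to_simplex_def to_cube_def cube1_def fun_eq_iff)

lemma to_simplex_end: "s \<in> cube_boundary 1 ==> to_simplex s = vert 0 \<or> to_simplex s = vert 1"
 by (auto simp: cube_boundary_1 to_simplex_def vert_def fun_eq_iff)

lemma to_cube_end: "to_cube (vert k) \<in> cube_boundary 1" if "k \<le> 1"
 using that to_cube[of "vert k"] by (auto simp: cube_boundary_1 le_Suc_eq) (auto simp: to_cube_def vert_def)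

lemma continuous_to_simplex: "continuous_on S to_simplex"
 unfolding to_simplex_def
 by (intro cont_prod cont_if_const continuous_intros cont_coord)

lemma continuous_to_cube: "continuous_on S to_cube"
 unfolding to_cube_def
 by (intro cont_prod cont_if_const continuous_on_const cont_coord)

section \<open>Loops in a topological group under pointwise multiplication\<close>

context topological_group begin

lemma cm_mult:
 assumes "cmap Y T f" "cmap Y T g" shows "cmap Y T (%y. f y \<otimes> g y)"
proof -
 have "cmap Y (prod_topology T T) (%y. (f y, g y))"
  using assms by (rule continuous_map_pairedI)
 hence "cmap Y T ((%(g, h). g \<otimes> h) \<circ> (%y. (f y, g y)))"
  using continuous_mult cmap_comp by blast
 thus ?thesis by (simp add: o_def)
qed

lemma cm_inv:
 assumes "cmap Y T f" shows "cmap Y T (%y. inv (f y))"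
 using cmap_comp[OF assms continuous_inv] by (simp add: o_def)

lemma cm_carrier: "cmap Y T f ==> y \<in> topspace Y ==> f y \<in> carrier G"
 using topspace_eq by (auto simp: cmap_def)

lemma cm_const: "c \<in> carrier G ==> cmap Y T (%_. c)"
 using topspace_eq by simp

abbreviation pi1 :: "((nat => real) => 'a) set monoid" where
 "pi1 \<equiv> homotopy_group 1 T \<one>"

abbreviation mult_pi1 (infixl "\<cdot>" 70) where "x \<cdot> y \<equiv> x \<otimes>\<^bsub>pi1\<^esub> y"
abbreviation inv_pi1 ("inv1 _" [81] 80) where "inv1 x \<equiv> inv\<^bsub>pi1\<^esub> x"
abbreviation one_pi1 ("one1") where "one1 \<equiv> \<one>\<^bsub>pi1\<^esub>"

abbreviation cls :: "((nat => real) => 'a) => ((nat => real) => 'a) set" where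
 "cls \<equiv> pi_class 1 T \<one>"

abbreviation loops :: "((nat => real) => 'a) set" where
 "loops \<equiv> pi_maps 1 T \<one>"

abbreviation bdp :: "((nat => real) => 'a) => bool" where
 "bdp h \<equiv> \<forall>s\<in>cube_boundary 1. h s = \<one>"

lemma loops_iff: "f \<in> loops \<longleftrightarrow> cmap (top_of_set cube1) T f \<and> bdp f"
 by (simp add: pi_maps_def cube_1)

lemma cls_eq_iff:
 assumes "f \<in> loops" "g \<in> loops"
 shows "cls f = cls g \<longleftrightarrow> homotopic_with bdp (cube 1) T f g"
proof
 assume "cls f = cls g"
 moreover have "g \<in> cls g"
  using assms by (simp add: pi_class_def pi_maps_def)
 ultimately show "homotopic_with bdp (cube 1) T f g"
  by (auto simp: pi_class_def)
next
 assume fg: "homotopic_with bdp (cube 1) T f g"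
 thus "cls f = cls g"
  unfolding pi_class_def
  by (intro Collect_cong iffI) (erule homotopic_with_trans[OF homotopic_with_symD[OF fg]], erule homotopic_with_trans[OF fg])
qed

lemma homotopic_loops:
 assumes "homotopic_with bdp (cube 1) T f g" shows "f \<in> loops" "g \<in> loops"
 using homotopic_with_imp_continuous_maps[OF assms] homotopic_with_imp_property[OF assms]
 by (simp_all add: pi_maps_def)

lemma cls_mem:
 assumes "g \<in> cls f" shows "g \<in> loops" "homotopic_with bdp (cube 1) T f g"
 using assms homotopic_loops(2)[of f g] by (simp_all add: pi_class_def)

lemma homotopicI:
 assumes H: "cmap (top_of_set ({0..1::real} \<times> cube1)) T H"
  and "!!s. s \<in> cube1 ==> H (0, s) = f s" "!!s. s \<in> cube1 ==> H (1, s) = g s"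
  and "!!t s. [|0 \<le> t; t \<le> 1; s \<in> cube_boundary 1|] ==> H (t, s) = \<one>"
 shows "homotopic_with bdp (cube 1) T f g"
proof -
 have P: "bdp h = bdp k" if "!!x. x \<in> topspace (cube 1) ==> h x = k x" for h k
  using that by (auto simp: cube_boundary_def)
 have eq: "homotopic_with bdp (cube 1) T f g \<longleftrightarrow> (\<exists>h. cmap (prod_topology (top_of_set {0..1::real}) (cube 1)) T h \<and>
   (\<forall>x \<in> topspace (cube 1). h (0, x) = f x) \<and> (\<forall>x \<in> topspace (cube 1). h (1, x) = g x) \<and> (\<forall>t \<in> {0..1}. bdp (%x. h (t, x))))"
  by (rule homotopic_with[OF P])
 show ?thesis
  unfolding eq using assms by (intro exI[of _ H]) (auto simp: cube_1)
qed

lemma homotopic_mult: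
 assumes "homotopic_with bdp (cube 1) T f f'" "homotopic_with bdp (cube 1) T g g'"
 shows "homotopic_with bdp (cube 1) T (%s. f s \<otimes> g s) (%s. f' s \<otimes> g' s)"
proof -
 obtain h k where "cmap (prod_topology (top_of_set {0..1::real}) (cube 1)) T h" "\<forall>x. h (0, x) = f x" "\<forall>x. h (1, x) = f' x" "\<forall>t\<in>{0..1}. bdp (%x. h (t, x))"
  "cmap (prod_topology (top_of_set {0..1::real}) (cube 1)) T k" "\<forall>x. k (0, x) = g x" "\<forall>x. k (1, x) = g' x" "\<forall>t\<in>{0..1}. bdp (%x. k (t, x))"
  using assms unfolding homotopic_with_def by blast
 thus ?thesis
  unfolding homotopic_with_def by (intro exI[of _ "%p. h p \<otimes> k p"]) (auto intro: cm_mult)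
qed

lemma loops_mult: "f \<in> loops ==> g \<in> loops ==> (%s. f s \<otimes> g s) \<in> loops"
 by (auto simp: loops_iff intro: cm_mult)

lemma loops_inv: "f \<in> loops ==> (%s. inv (f s)) \<in> loops"
 by (auto simp: loops_iff intro: cm_inv)

lemma loops_one: "(%s. \<one>) \<in> loops"
 by (auto simp: loops_iff topspace_eq)

text \<open>The Eckmann-Hilton argument.\<close>

lemma concat_homotopic_mult:
 assumes f: "f \<in> loops" and g: "g \<in> loops"
 shows "homotopic_with bdp (cube 1) T (pi_concat f g) (%s. f s \<otimes> g s)"
proof -
 \<comment> \<open>At time 0 the loops \<open>f\<close> and \<open>g\<close> run one after the
   other, each resting at an end, with value 1, while the other moves; at time 1 they run
   simultaneously. Both parameters fix the ends of the interval throughout.\<close>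
 define a where "a = (%p :: real \<times> (nat => real). (1 - fst p) * min (2 * snd p 0) 1 + fst p * snd p 0)"
 define b where "b = (%p :: real \<times> (nat => real). (1 - fst p) * max (2 * snd p 0 - 1) 0 + fst p * snd p 0)"
 have conv: "0 \<le> (1 - t) * x + t * y \<and> (1 - t) * x + t * y \<le> 1"
  if "0 \<le> t" "t \<le> 1" "0 \<le> x" "x \<le> 1" "0 \<le> y" "y \<le> 1" for t x y :: real
  using that by (auto intro: convex_bound_le)
 have a01: "0 \<le> a (t, s) \<and> a (t, s) \<le> 1" and b01: "0 \<le> b (t, s) \<and> b (t, s) \<le> 1"
  if "0 \<le> t" "t \<le> 1" "s \<in> cube1" for t s
  using that conv[of t "min (2 * s 0) 1" "s 0"] conv[of t "max (2 * s 0 - 1) 0" "s 0"]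
  by (auto simp: a_def b_def cube1_def)
 let ?S = "{0..1::real} \<times> cube1"
 have ca: "continuous_on ?S a" and cb: "continuous_on ?S b"
  unfolding a_def b_def
  by (intro continuous_on_add continuous_on_mult continuous_on_diff continuous_on_const continuous_on_fst continuous_on_id
    continuous_on_min continuous_on_max continuous_on_snd_coordinate)+
 have cu: "continuous_on ?S (%p. (snd p)(0 := c p))" if "continuous_on ?S c" for c :: "real \<times> (nat => real) => real"
 proof (rule cont_prod)
  show "continuous_on ?S (%p. ((snd p)(0 := c p)) k)" for k
   using that continuous_on_snd_coordinate[of ?S k] by (cases "k = 0") auto
 qed
 have fc: "cmap (top_of_set cube1) T f" and gc: "cmap (top_of_set cube1) T g"
  and fb: "!!s. s \<in> cube1 ==> s 0 = 0 \<or> s 0 = 1 ==> f s = \<one>" and gb: "!!s. s \<in> cube1 ==> s 0 = 0 \<or> s 0 = 1 ==> g s = \<one>"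
  using f g by (auto simp: loops_iff cube_boundary_1)
 let ?H = "%p. f ((snd p)(0 := a p)) \<otimes> g ((snd p)(0 := b p))"
 show ?thesis
 proof (rule homotopicI[of ?H])
  show "cmap (top_of_set ?S) T ?H"
   using a01 b01
   by (intro cm_mult cmap_into[OF fc cu[OF ca]] cmap_into[OF gc cu[OF cb]])
    (auto intro: cube1_upd)
  show "?H (0, s) = pi_concat f g s" if s: "s \<in> cube1" for s
  proof (cases "s 0 \<le> 1/2")
   case True
   have "g (s(0 := 0)) = \<one>" by (rule gb) (use cube1_upd[OF s, of 0] in auto)
   moreover have "s(0 := 2 * s 0) \<in> cube1"
    by (rule cube1_upd[OF s]) (use True s in \<open>auto simp: cube1_def\<close>)
   hence "f (s(0 := 2 * s 0)) \<in> carrier G"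
    using cm_carrier[OF fc] by simp
   ultimately show ?thesis using True by (simp add: a_def b_def pi_concat_def)
  next
   case False
   have "f (s(0 := 1)) = \<one>" by (rule fb) (use cube1_upd[OF s, of 1] in auto)
   moreover have "s(0 := 2 * s 0 - 1) \<in> cube1"
    by (rule cube1_upd[OF s]) (use False s in \<open>auto simp: cube1_def\<close>)
   hence "g (s(0 := 2 * s 0 - 1)) \<in> carrier G"
    using cm_carrier[OF gc] by simp
   ultimately show ?thesis using False by (simp add: a_def b_def pi_concat_def)
  qed
  show "?H (1, s) = f s \<otimes> g s" for s
   by (simp add: a_def b_def)
  show "?H (t, s) = \<one>" if t: "0 \<le> t" "t \<le> 1" and s: "s \<in> cube_boundary 1" for t s
  proof -
   have s': "s \<in> cube1" "s 0 = 0 \<or> s 0 = 1" using s by (auto simp: cube_boundary_1)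
   have "a (t, s) = s 0" "b (t, s) = s 0"
    using s'(2) by (auto simp: a_def b_def)
   thus ?thesis
    using fb[OF s'] gb[OF s'] by simp
  qed
 qed
qed

text \<open>The product f g is g times the conjugate of f by g. Shrinking the argument of the
  conjugating factor to 0, where \<open>g\<close> is 1, removes the conjugation and leaves g f; at
  the ends \<open>f\<close> is 1 and conjugation has no effect.\<close>

lemma mult_homotopic_comm:
 assumes f: "f \<in> loops" and g: "g \<in> loops"
 shows "homotopic_with bdp (cube 1) T (%s. f s \<otimes> g s) (%s. g s \<otimes> f s)"
proof -
 let ?S = "{0..1::real} \<times> cube1"
 have fc: "cmap (top_of_set cube1) T f" and gc: "cmap (top_of_set cube1) T g"
  and fb: "bdp f" and gb: "bdp g"
  using f g by (auto simp: loops_iff)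
 have c: "f s \<in> carrier G" "g s \<in> carrier G" if "s \<in> cube1" for s
  using cm_carrier[OF fc] cm_carrier[OF gc] that by auto
 define r where "r = (%p :: real \<times> (nat => real). (%k. (1 - fst p) * snd p k))"
 have rin: "r (t, s) \<in> cube1" if "0 \<le> t" "t \<le> 1" "s \<in> cube1" for t s
  using that mult_le_one[of "1 - t" "s 0"] by (auto simp: r_def cube1_def)
 have rc: "continuous_on ?S r"
  unfolding r_def
  by (intro cont_prod continuous_on_mult continuous_on_diff continuous_on_const
    continuous_on_fst continuous_on_id continuous_on_snd_coordinate)
 have gz: "g (%_. 0) = \<one>"
  using gb by (auto simp: cube_boundary_1 cube1_def)
 let ?H = "%p. g (snd p) \<otimes> (inv (g (r p)) \<otimes> f (snd p) \<otimes> g (r p))"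
 show ?thesis
 proof (rule homotopicI[of ?H])
  have g': "cmap (top_of_set ?S) T (%p. g (r p))"
   by (rule cmap_into[OF gc rc]) (use rin in auto)
  have s': "cmap (top_of_set ?S) T (%p. h (snd p))" if "cmap (top_of_set cube1) T h" for h
   by (rule cmap_into[OF that continuous_on_snd[OF continuous_on_id]]) auto
  show "cmap (top_of_set ?S) T ?H"
   by (intro cm_mult cm_inv g' s' fc gc)
  show "?H (0, s) = f s \<otimes> g s" if "s \<in> cube1" for s
   using c[OF that] by (simp add: r_def m_assoc[symmetric])
  show "?H (1, s) = g s \<otimes> f s" if "s \<in> cube1" for s
   using c[OF that] by (simp add: r_def gz)
  show "?H (t, s) = \<one>" if t: "0 \<le> t" "t \<le> 1" and s: "s \<in> cube_boundary 1" for t s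
  proof -
   have "s \<in> cube1" "f s = \<one>" "g s = \<one>"
    using s fb gb by (auto simp: cube_boundary_1)
   thus ?thesis
    using c[OF rin[OF t]] by simp
  qed
 qed
qed

text \<open>The product of classes is a union over all representatives. Its members coincide,
  because concatenation is homotopic to the pointwise product and the latter respects
  homotopies.\<close>

lemma pi1_mult:
 assumes f: "f \<in> loops" and g: "g \<in> loops"
 shows "cls f \<cdot> cls g = cls (%s. f s \<otimes> g s)"
proof -
 have self: "f \<in> cls f" if "f \<in> loops" for f
  using that by (simp add: pi_class_def pi_maps_def)
 have "cls (pi_concat f' g') = cls (%s. f s \<otimes> g s)" if f': "f' \<in> cls f" and g': "g' \<in> cls g" for f' g'
 proof -
  note m = cls_mem[OF f'] cls_mem[OF g']
  have "homotopic_with bdp (cube 1) T (pi_concat f' g') (%s. f' s \<otimes> g' s)"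
   using m by (intro concat_homotopic_mult) auto
  moreover have "homotopic_with bdp (cube 1) T (%s. f' s \<otimes> g' s) (%s. f s \<otimes> g s)"
   using m by (intro homotopic_mult) (auto dest: homotopic_with_symD)
  ultimately have "homotopic_with bdp (cube 1) T (pi_concat f' g') (%s. f s \<otimes> g s)"
   by (rule homotopic_with_trans)
  moreover from this have "pi_concat f' g' \<in> loops"
   by (rule homotopic_loops)
  ultimately show ?thesis
   using cls_eq_iff loops_mult[OF f g] by blast
 qed
 hence "(\<Union>f'\<in>cls f. \<Union>g'\<in>cls g. cls (pi_concat f' g')) = (\<Union>f'\<in>cls f. \<Union>g'\<in>cls g. cls (%s. f s \<otimes> g s))"
  by blast
 also have "\<dots> = cls (%s. f s \<otimes> g s)"
  using self[OF f] self[OF g] by blast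
 finally show ?thesis
  by (simp add: homotopy_group_def)
qed

lemma carrier_pi1: "carrier pi1 = cls ` loops"
 by (simp add: homotopy_group_def)

lemma one_pi1: "one1 = cls (%s. \<one>)"
 by (simp add: homotopy_group_def)

lemma cls_cong:
 assumes "f \<in> loops" "!!s. s \<in> cube1 ==> f s = g s"
 shows "g \<in> loops" "cls f = cls g"
proof -
 show g: "g \<in> loops"
  using assms by (auto simp: loops_iff cube_boundary_1 intro: cmap_eq)
 have "homotopic_with bdp (cube 1) T f g"
  by (rule homotopic_with_equal) (use assms g in \<open>auto simp: loops_iff cube_1\<close>)
 thus "cls f = cls g"
  using cls_eq_iff[OF assms(1) g] by simp
qed

lemma comm_group_pi1: "comm_group pi1"
proof (rule comm_groupI)
 have l: "\<exists>f. f \<in> loops \<and> x = cls f" if "x \<in> carrier pi1" for x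
  using that by (auto simp: carrier_pi1)
 have c: "f s \<in> carrier G" if "f \<in> loops" "s \<in> cube1" for f s
  using that cm_carrier[of "top_of_set cube1" f] by (auto simp: loops_iff)
 show "x \<cdot> y \<in> carrier pi1" if "x \<in> carrier pi1" "y \<in> carrier pi1" for x y
  using l[OF that(1)] l[OF that(2)] by (auto simp: pi1_mult carrier_pi1 loops_mult)
 show "one1 \<in> carrier pi1"
  by (simp add: one_pi1 carrier_pi1 loops_one)
 show "x \<cdot> y \<cdot> z = x \<cdot> (y \<cdot> z)" if xyz: "x \<in> carrier pi1" "y \<in> carrier pi1" "z \<in> carrier pi1" for x y z
 proof -
  obtain f g h where f: "f \<in> loops" "x = cls f" and g: "g \<in> loops" "y = cls g" and h: "h \<in> loops" "z = cls h"
   using l[OF xyz(1)] l[OF xyz(2)] l[OF xyz(3)] by blast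
  show ?thesis
   unfolding f(2) g(2) h(2) pi1_mult[OF f(1) g(1)] pi1_mult[OF g(1) h(1)]
    pi1_mult[OF loops_mult[OF f(1) g(1)] h(1)] pi1_mult[OF f(1) loops_mult[OF g(1) h(1)]]
   by (rule cls_cong(2)) (use c f g h in \<open>auto simp: loops_mult m_assoc\<close>)
 qed
 show "x \<cdot> y = y \<cdot> x" if xy: "x \<in> carrier pi1" "y \<in> carrier pi1" for x y
 proof -
  obtain f g where f: "f \<in> loops" "x = cls f" and g: "g \<in> loops" "y = cls g"
   using l[OF xy(1)] l[OF xy(2)] by blast
  show ?thesis
   unfolding f(2) g(2) pi1_mult[OF f(1) g(1)] pi1_mult[OF g(1) f(1)] cls_eq_iff[OF loops_mult[OF f(1) g(1)] loops_mult[OF g(1) f(1)]]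
   by (rule mult_homotopic_comm[OF f(1) g(1)])
 qed
 show "one1 \<cdot> x = x" if x: "x \<in> carrier pi1" for x
 proof -
  obtain f where f: "f \<in> loops" "x = cls f" using l[OF x] by blast
  show ?thesis
   unfolding one_pi1 f(2) pi1_mult[OF loops_one f(1)]
   by (rule cls_cong(2)) (use c f in \<open>auto simp: loops_mult loops_one\<close>)
 qed
 show "\<exists>y\<in>carrier pi1. y \<cdot> x = one1" if x: "x \<in> carrier pi1" for x
 proof -
  obtain f where f: "f \<in> loops" "x = cls f" using l[OF x] by blast
  have "cls (%s. inv (f s)) \<cdot> x = one1"
   unfolding one_pi1 f(2) pi1_mult[OF loops_inv[OF f(1)] f(1)]
   by (rule cls_cong(2)) (use c f in \<open>auto simp: loops_mult loops_inv\<close>)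
  thus ?thesis
   using f(1) by (auto simp: carrier_pi1 loops_inv)
 qed
qed

section \<open>Loops parametrised by the standard 1-simplex\<close>

abbreviation gpath :: "((nat => real) => 'a) => bool" where
 "gpath p \<equiv> cmap (top_of_set (splx 1)) T p"

definition gloop :: "((nat => real) => 'a) => bool" where
 "gloop p \<longleftrightarrow> gpath p \<and> p (vert 0) = \<one> \<and> p (vert 1) = \<one>"

definition loop_class :: "((nat => real) => 'a) => ((nat => real) => 'a) set" where
 "loop_class p = cls (%s. p (to_simplex s))"

lemma gloop_loops:
 assumes "gloop p" shows "(%s. p (to_simplex s)) \<in> loops"
proof -
 have "p (to_simplex s) = \<one>" if "s \<in> cube_boundary 1" for s
  using to_simplex_end[OF that] assms by (auto simp: gloop_def)
 thus ?thesis
  using assms cmap_into[of "splx 1" T p cube1 to_simplex] to_simplex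
  by (auto simp: continuous_to_simplex loops_iff gloop_def)
qed

lemma gpath_carrier: "gpath p ==> s \<in> splx 1 ==> p s \<in> carrier G"
 using cm_carrier by fastforce

lemma gloop_mult: "gloop p ==> gloop p' ==> gloop (%s. p s \<otimes> p' s)"
 by (auto simp: gloop_def intro: cm_mult)

lemma gloop_inv: "gloop p ==> gloop (%s. inv (p s))"
 by (auto simp: gloop_def intro: cm_inv)

lemma loop_class_closed [simp]: "gloop p ==> loop_class p \<in> carrier pi1"
 by (simp add: carrier_pi1 loop_class_def gloop_loops)

lemma loop_class_mult: "gloop p ==> gloop p' ==> loop_class (%s. p s \<otimes> p' s) = loop_class p \<cdot> loop_class p'"
 unfolding loop_class_def using pi1_mult[OF gloop_loops gloop_loops] by simp

lemma loop_class_one: "loop_class (%s. \<one>) = one1"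
 by (simp add: loop_class_def one_pi1)

lemma loop_class_cong: "gloop p ==> (!!s. s \<in> splx 1 ==> p s = p' s) ==> loop_class p = loop_class p'"
 unfolding loop_class_def by (rule cls_cong(2)[OF gloop_loops]) (auto simp: to_simplex)

lemma loop_class_inv:
 assumes "gloop p" shows "loop_class (%s. inv (p s)) = inv1 (loop_class p)"
proof -
 interpret P: comm_group pi1 by (rule comm_group_pi1)
 have "loop_class (%s. inv (p s)) \<cdot> loop_class p = loop_class (%s. inv (p s) \<otimes> p s)"
  by (rule loop_class_mult[OF gloop_inv[OF assms] assms, symmetric])
 also have "\<dots> = loop_class (%s. \<one>)"
  by (rule loop_class_cong[OF gloop_mult[OF gloop_inv[OF assms] assms]])
   (use gpath_carrier assms in \<open>auto simp: gloop_def\<close>)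
 finally show ?thesis
  using assms gloop_inv by (metis P.inv_equality loop_class_closed loop_class_one)
qed

lemma loop_class_surj:
 assumes "a \<in> carrier pi1" obtains p where "gloop p" "loop_class p = a"
proof -
 obtain f where f: "f \<in> loops" "a = cls f"
  using assms by (auto simp: carrier_pi1)
 let ?p = "%s. f (to_cube s)"
 have "gloop ?p"
  unfolding gloop_def
  using f(1) cmap_into[of cube1 T f "splx 1" to_cube] to_cube to_cube_end
  by (auto simp: loops_iff continuous_to_cube)
 moreover have "loop_class ?p = cls f"
  unfolding loop_class_def
  by (rule cls_cong(2)[OF f(1), symmetric]) (simp add: to_cube_to_simplex)
 ultimately show thesis
  using that f(2) by simp
qed

lemma loop_class_eqI:
 assumes H: "cmap (top_of_set ({0..1::real} \<times> splx 1)) T H"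
  and p: "!!s. s \<in> splx 1 ==> H (0, s) = p s" and p': "!!s. s \<in> splx 1 ==> H (1, s) = p' s"
  and ends: "!!t. [|0 \<le> t; t \<le> 1|] ==> H (t, vert 0) = \<one> \<and> H (t, vert 1) = \<one>"
 shows "gloop p" "gloop p'" "loop_class p = loop_class p'"
proof -
 have sl: "gpath (%s. H (t, s))" if "0 \<le> t" "t \<le> 1" for t
  by (rule cmap_into[OF H]) (use that in \<open>auto intro!: continuous_intros\<close>)
 have e: "H (0, vert 0) = \<one> \<and> H (0, vert 1) = \<one>" "H (1, vert 0) = \<one> \<and> H (1, vert 1) = \<one>"
  by (rule ends; simp)+
 have s0: "gpath (%s. H (0, s))" and s1: "gpath (%s. H (1, s))"
  by (rule sl; simp)+
 have v: "vert 0 \<in> splx 1" "vert 1 \<in> splx 1" by auto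
 show gp: "gloop p"
  unfolding gloop_def using cmap_eq[OF s0, of p] p e(1) p[OF v(1)] p[OF v(2)] by auto
 show gp': "gloop p'"
  unfolding gloop_def using cmap_eq[OF s1, of p'] p' e(2) p'[OF v(1)] p'[OF v(2)] by auto
 have "homotopic_with bdp (cube 1) T (%s. p (to_simplex s)) (%s. p' (to_simplex s))"
 proof (rule homotopicI[of "%q. H (fst q, to_simplex (snd q))"])
  have "continuous_on ({0..1::real} \<times> cube1) (%q :: real \<times> (nat => real). (fst q, to_simplex (snd q)))"
   by (intro continuous_intros continuous_on_compose2[OF continuous_to_simplex[of UNIV]]) auto
  thus "cmap (top_of_set ({0..1::real} \<times> cube1)) T (%q. H (fst q, to_simplex (snd q)))"
   by (rule cmap_into[OF H]) (auto simp: to_simplex)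
  show "H (fst (t, s), to_simplex (snd (t, s))) = \<one>" if "0 \<le> t" "t \<le> 1" "s \<in> cube_boundary 1" for t s
   using to_simplex_end[OF that(3)] ends[OF that(1,2)] by auto
 qed (simp_all add: p p' to_simplex)
 thus "loop_class p = loop_class p'"
  unfolding loop_class_def using cls_eq_iff[OF gloop_loops[OF gp] gloop_loops[OF gp']] by simp
qed

text \<open>Turns an equation in \<open>pi1\<close> into a filling, for the extension of maps over
  2-cells.\<close>

lemma loop_class_null:
 assumes p: "gloop p" and one: "loop_class p = one1"
 obtains H where "cmap (top_of_set ({0..1::real} \<times> splx 1)) T H"
   "!!s. s \<in> splx 1 ==> H (0, s) = p s" "!!s. s \<in> splx 1 ==> H (1, s) = \<one>"
   "!!t. [|0 \<le> t; t \<le> 1|] ==> H (t, vert 0) = \<one> \<and> H (t, vert 1) = \<one>"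
proof -
 have "homotopic_with bdp (cube 1) T (%s. p (to_simplex s)) (%s. \<one>)"
  using cls_eq_iff[OF gloop_loops[OF p] loops_one] one by (simp add: loop_class_def one_pi1)
 then obtain h where h: "cmap (prod_topology (top_of_set {0..1::real}) (cube 1)) T h"
   "\<forall>x. h (0, x) = p (to_simplex x)" "\<forall>x. h (1, x) = \<one>" "\<forall>t\<in>{0..1}. bdp (%x. h (t, x))"
  unfolding homotopic_with_def by blast
 have h1: "cmap (top_of_set ({0..1::real} \<times> cube1)) T h"
  using h(1) by (simp add: cube_1)
 let ?H = "%q. h (fst q, to_cube (snd q))"
 show thesis
 proof
  have "continuous_on ({0..1::real} \<times> splx 1) (%q :: real \<times> (nat => real). (fst q, to_cube (snd q)))"
   by (intro continuous_intros continuous_on_compose2[OF continuous_to_cube[of UNIV]]) auto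
  thus "cmap (top_of_set ({0..1::real} \<times> splx 1)) T ?H"
   by (rule cmap_into[OF h1]) (auto simp: to_cube)
  show "?H (t, vert 0) = \<one> \<and> ?H (t, vert 1) = \<one>" if "0 \<le> t" "t \<le> 1" for t
   using h(4) to_cube_end[of 0] to_cube_end[of 1] that by auto
 qed (simp_all add: h to_simplex_to_cube)
qed

end

section \<open>The class of a path in the unit component\<close>

abbreviation slide :: "real => (nat => real) => (nat => real) => nat => real" where
 "slide t x y \<equiv> (%k. (1 - t) * x k + t * y k)"

lemma slide_in_simplex:
 assumes "x \<in> splx p" "y \<in> splx p" "0 \<le> t" "t \<le> 1"
 shows "slide t x y \<in> splx p"
 by (rule convex_standard_simplex[OF assms(1,2,3,4)])

lemma continuous_on_slide:
 fixes f g :: "'z::topological_space => nat => real"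
 assumes "continuous_on S h" "continuous_on S f" "continuous_on S g"
 shows "continuous_on S (%p. slide (h p) (f p) (g p))"
 by (intro cont_prod continuous_on_add continuous_on_mult continuous_on_diff
   continuous_on_const assms(1) continuous_on_coord[OF assms(2)] continuous_on_coord[OF assms(3)])

lemma continuous_on_face: "continuous_on S (simplical_face k :: (nat => real) => nat => real)"
 unfolding simplical_face_def
 by (intro cont_prod cont_if_const continuous_on_const)
  (rule cont_coord)+

lemma simplex_1_as_slide:
 assumes "s \<in> splx 1"
 shows "s = slide (s 1) (vert 0) (vert 1)"
proof
 fix k
 have "s = (%k. if k = 0 then 1 - s 1 else if k = 1 then s 1 else 0)"
  using assms unfolding standard_simplex_1_iff by blast
 hence "s k = (if k = 0 then 1 - s 1 else if k = 1 then s 1 else 0)"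
  by (rule fun_cong)
 thus "s k = slide (s 1) (vert 0) (vert 1) k"
  by (simp add: vert_def)
qed

locale structure_group = topological_group G T for G :: "'a monoid" (structure) and T :: "'a topology" +
 assumes pi0_comm: "comm_group (pi0_group G T)"
begin

abbreviation K :: "'a set" where "K \<equiv> unit_component G T"

lemma K_iff: "k \<in> K \<longleftrightarrow> (\<exists>p. gpath p \<and> p (vert 0) = \<one> \<and> p (vert 1) = k)"
proof
 assume "k \<in> K"
 then obtain g where g: "pathin T g" "g 0 = \<one>" "g 1 = k"
  by (auto simp: unit_component_def path_component_of_def)
 have "gpath (%s. g (s 1))"
  using g(1) unfolding pathin_def
  by (rule cmap_into) (auto simp: simplex_1_coord cont_coord)
 thus "\<exists>p. gpath p \<and> p (vert 0) = \<one> \<and> p (vert 1) = k"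
  using g by (intro exI[of _ "%s. g (s 1)"]) (simp add: vert_def)
next
 assume "\<exists>p. gpath p \<and> p (vert 0) = \<one> \<and> p (vert 1) = k"
 then obtain p where p: "gpath p" "p (vert 0) = \<one>" "p (vert 1) = k" by blast
 have v: "slide 0 (vert 0) (vert 1) = vert 0" "slide 1 (vert 0) (vert 1) = vert 1" by auto
 have "pathin T (%t. p (slide t (vert 0) (vert 1)))"
  unfolding pathin_def using p(1)
  by (rule cmap_into)
   (auto intro!: continuous_on_slide continuous_intros slide_in_simplex)
 thus "k \<in> K"
  unfolding unit_component_def path_component_of_def
  using p v by (intro CollectI exI[of _ "%t. p (slide t (vert 0) (vert 1))"]) simp
qed

lemma K_carrier: "k \<in> K ==> k \<in> carrier G"
 unfolding K_iff using gpath_carrier by fastforce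

lemma K_one: "\<one> \<in> K"
 unfolding K_iff by (intro exI[of _ "%_. \<one>"]) (simp add: topspace_eq)

lemma K_mult:
 assumes "a \<in> K" "b \<in> K" shows "a \<otimes> b \<in> K"
proof -
 obtain p p' where "gpath p" "p (vert 0) = \<one>" "p (vert 1) = a" "gpath p'" "p' (vert 0) = \<one>" "p' (vert 1) = b"
  using assms by (auto simp: K_iff)
 thus ?thesis
  unfolding K_iff by (intro exI[of _ "%s. p s \<otimes> p' s"]) (simp add: cm_mult)
qed

lemma K_inv:
 assumes "a \<in> K" shows "inv a \<in> K"
proof -
 obtain p where "gpath p" "p (vert 0) = \<one>" "p (vert 1) = a"
  using assms by (auto simp: K_iff)
 thus ?thesis
  unfolding K_iff by (intro exI[of _ "%s. inv (p s)"]) (simp add: cm_inv)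
qed

lemma K_conj:
 assumes "a \<in> K" "g \<in> carrier G" shows "g \<otimes> a \<otimes> inv g \<in> K"
proof -
 obtain p where "gpath p" "p (vert 0) = \<one>" "p (vert 1) = a"
  using assms by (auto simp: K_iff)
 thus ?thesis
  unfolding K_iff using assms(2) by (intro exI[of _ "%s. g \<otimes> p s \<otimes> inv g"]) (simp add: cm_mult cm_const topspace_eq)
qed

lemma K_normal: "K \<lhd> G"
 unfolding normal_inv_iff
proof (intro conjI ballI)
 show "subgroup K G"
  by (rule subgroupI) (use K_one K_carrier K_mult K_inv in auto)
qed (rule K_conj)

lemma K_path:
 assumes "gpath p" shows "p (vert 1) \<otimes> inv (p (vert 0)) \<in> K" "inv (p (vert 0)) \<otimes> p (vert 1) \<in> K"
proof -
 have c: "p (vert 0) \<in> carrier G" "p (vert 1) \<in> carrier G"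
  using gpath_carrier[OF assms] by simp_all
 show "p (vert 1) \<otimes> inv (p (vert 0)) \<in> K"
  unfolding K_iff using assms c by (intro exI[of _ "%s. p s \<otimes> inv (p (vert 0))"]) (simp add: cm_mult cm_const topspace_eq)
 show "inv (p (vert 0)) \<otimes> p (vert 1) \<in> K"
  unfolding K_iff using assms c by (intro exI[of _ "%s. inv (p (vert 0)) \<otimes> p s"]) (simp add: cm_mult cm_const topspace_eq)
qed

definition kpath :: "((nat => real) => 'a) => bool" where
 "kpath p \<longleftrightarrow> gpath p \<and> p (vert 0) \<in> K"

lemma kpath_gpath: "kpath p ==> gpath p"
 by (simp add: kpath_def)

lemma kpath_ends:
 assumes "kpath p" shows "p (vert 0) \<in> K" "p (vert 1) \<in> K"
proof -
 show "p (vert 0) \<in> K" using assms by (simp add: kpath_def)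
 have "gpath p" using assms by (simp add: kpath_def)
 from gpath_carrier[OF this, of "vert 0"] gpath_carrier[OF this, of "vert 1"]
 have "p (vert 1) \<otimes> inv (p (vert 0)) \<otimes> p (vert 0) = p (vert 1)"
  by (simp add: m_assoc)
 thus "p (vert 1) \<in> K"
  using K_mult[OF K_path(1)[OF \<open>gpath p\<close>] \<open>p (vert 0) \<in> K\<close>] by simp
qed

text \<open>For the unit the constant path is prescribed, so that closing up a loop at 1 returns the
  loop itself.\<close>

definition to_one :: "'a => (nat => real) => 'a" where
 "to_one k = (if k = \<one> then (%_. \<one>) else (SOME p. gpath p \<and> p (vert 0) = \<one> \<and> p (vert 1) = k))"

lemma to_one:
 assumes "k \<in> K" shows "gpath (to_one k)" "to_one k (vert 0) = \<one>" "to_one k (vert 1) = k"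
proof -
 have "gpath (to_one k) \<and> to_one k (vert 0) = \<one> \<and> to_one k (vert 1) = k"
 proof (cases "k = \<one>")
  case True thus ?thesis by (simp add: to_one_def topspace_eq)
 next
  case False
  thus ?thesis
   unfolding to_one_def using someI_ex[OF assms[unfolded K_iff]] by simp
 qed
 thus "gpath (to_one k)" "to_one k (vert 0) = \<one>" "to_one k (vert 1) = k" by auto
qed

lemma to_one_one [simp]: "to_one \<one> = (%_. \<one>)"
 by (simp add: to_one_def)

text \<open>The pointwise counterpart of going from 1 to the start of \<open>p\<close>, along
  \<open>p\<close>, and back to 1. At the start the factors cancel to 1; at the end the chosen paths
  have reached \<open>p (vert 0)\<close> and \<open>p (vert 1)\<close> and cancel against the other
  factors.\<close>

definition closeup :: "((nat => real) => 'a) => (nat => real) => 'a" where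
 "closeup p = (%s. to_one (p (vert 0)) s \<otimes> inv (p (vert 0)) \<otimes> p s \<otimes> inv (to_one (p (vert 1)) s))"

definition path_class :: "((nat => real) => 'a) => ((nat => real) => 'a) set" where
 "path_class p = (if kpath p then loop_class (closeup p) else one1)"

text \<open>Measures the failure of the chosen paths to be multiplicative: the path chosen for a
  product against the product of the chosen paths.\<close>

definition mult_defect :: "'a => 'a => ((nat => real) => 'a) set" where
 "mult_defect a b = (if a \<in> K \<and> b \<in> K then loop_class (%s. to_one (a \<otimes> b) s \<otimes> inv (to_one a s \<otimes> to_one b s)) else one1)"

lemma gloop_closeup:
 assumes "kpath p" shows "gloop (closeup p)"
proof -
 note e = kpath_ends[OF assms]
 note c = K_carrier[OF e(1)] K_carrier[OF e(2)]
 show ?thesis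
  unfolding gloop_def closeup_def
  using kpath_gpath[OF assms] to_one[OF e(1)] to_one[OF e(2)] c
  by (simp add: cm_mult cm_inv cm_const topspace_eq)
qed

lemma path_class_closed [simp]: "path_class p \<in> carrier pi1"
 using group.is_monoid[OF comm_group.axioms(2)[OF comm_group_pi1]] by (simp add: path_class_def gloop_closeup monoid.one_closed)

lemma cochain_path_class: "cochain pi1 path_class"
 by (rule cochainI) simp

lemma path_class_cong:
 assumes "kpath p" "!!s. s \<in> splx 1 ==> p s = p' s"
 shows "kpath p'" "path_class p = path_class p'"
proof -
 have e: "p (vert 0) = p' (vert 0)" "p (vert 1) = p' (vert 1)" by (rule assms(2); simp)+
 show k: "kpath p'"
  using assms cmap_eq[of "top_of_set (splx 1)" T p p'] by (simp add: kpath_def e)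
 show "path_class p = path_class p'"
  using k assms(1) loop_class_cong[OF gloop_closeup[OF assms(1)], of "closeup p'"]
  by (simp add: path_class_def closeup_def e assms(2))
qed

lemma gloop_kpath: "gloop p ==> kpath p"
 by (simp add: gloop_def kpath_def K_one)

lemma path_class_gloop:
 assumes "gloop p" shows "path_class p = loop_class p"
proof -
 have "loop_class p = loop_class (closeup p)"
  by (rule loop_class_cong[OF assms]) (use assms gpath_carrier in \<open>auto simp: closeup_def gloop_def\<close>)
 thus ?thesis
  using gloop_kpath[OF assms] by (simp add: path_class_def)
qed

lemma path_class_const:
 assumes "k \<in> K" shows "path_class (%_. k) = one1"
proof -
 have k: "kpath (%_. k)"
  using assms K_carrier by (simp add: kpath_def topspace_eq)
 have "loop_class (closeup (%_. k)) = loop_class (%_. \<one>)"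
  by (rule loop_class_cong[OF gloop_closeup[OF k]])
   (use to_one(1)[OF assms] gpath_carrier assms K_carrier in \<open>auto simp: closeup_def m_assoc\<close>)
 thus ?thesis
  using k by (simp add: path_class_def loop_class_one)
qed

lemma mult_defect_gloop:
 assumes "a \<in> K" "b \<in> K" shows "gloop (%s. to_one (a \<otimes> b) s \<otimes> inv (to_one a s \<otimes> to_one b s))"
 unfolding gloop_def
 using to_one[OF assms(1)] to_one[OF assms(2)] to_one[OF K_mult[OF assms]] assms K_carrier
 by (simp add: cm_mult cm_inv)

lemma mult_defect_closed [simp]: "mult_defect a b \<in> carrier pi1"
 using group.is_monoid[OF comm_group.axioms(2)[OF comm_group_pi1]] by (simp add: mult_defect_def mult_defect_gloop monoid.one_closed)

lemma kpath_mult: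
 assumes "kpath x" "kpath y" shows "kpath (%s. x s \<otimes> y s)"
 using assms by (simp add: kpath_def cm_mult K_mult)

lemma kpath_inv: "kpath x ==> kpath (%s. inv (x s))"
 by (simp add: kpath_def cm_inv K_inv)

text \<open>The correction terms depend on the end values only. When these are functions of the
  vertices of an edge, the correction is the coboundary of a 0-cochain and disappears over
  triangles.\<close>

lemma path_class_mult:
 assumes x: "kpath x" and y: "kpath y"
 shows "path_class (%s. x s \<otimes> y s) =
  path_class x \<cdot> path_class y \<cdot> mult_defect (x (vert 0)) (y (vert 0)) \<cdot> inv1 (mult_defect (x (vert 1)) (y (vert 1)))"
proof -
 interpret P: comm_group pi1 by (rule comm_group_pi1)
 let ?S = "{0..1::real} \<times> splx 1"
 define x0 x1 y0 y1 where "x0 = x (vert 0)" "x1 = x (vert 1)" "y0 = y (vert 0)" "y1 = y (vert 1)"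
 note xe = kpath_ends[OF x, folded x0_x1_y0_y1_def] and ye = kpath_ends[OF y, folded x0_x1_y0_y1_def]
 have [simp]: "x0 \<in> carrier G" "x1 \<in> carrier G" "y0 \<in> carrier G" "y1 \<in> carrier G"
  using xe ye K_carrier by auto
 note o = to_one[OF xe(1)] to_one[OF xe(2)] to_one[OF ye(1)] to_one[OF ye(2)]
 have cr [simp]: "to_one x0 s \<in> carrier G" "to_one x1 s \<in> carrier G" "to_one y0 s \<in> carrier G" "to_one y1 s \<in> carrier G"
  "x s \<in> carrier G" "y s \<in> carrier G" "to_one (x0 \<otimes> y0) s \<in> carrier G" "to_one (x1 \<otimes> y1) s \<in> carrier G"
  if "s \<in> splx 1" for s
  using gpath_carrier that o kpath_gpath x y to_one(1)[OF K_mult[OF xe(1) ye(1)]] to_one(1)[OF K_mult[OF xe(2) ye(2)]] by auto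
 define c where "c = (%s. to_one y0 s \<otimes> inv y0)"
 have c: "gpath c" unfolding c_def by (intro cm_mult o cm_const inv_closed) simp
 have c1: "c (vert 1) = \<one>" by (simp add: c_def o)
 have cc [simp]: "s \<in> splx 1 ==> c s \<in> carrier G" for s by (simp add: c_def)
 \<comment> \<open>The product of the two closed-up paths, with the middle of the first conjugated
   by \<open>c\<close> and the second conjugated by the path chosen for \<open>x1\<close>. At time 0
   the conjugations turn the product into \<open>?p\<close>. Sliding their arguments to
   \<open>vert 1\<close> and to \<open>vert 0\<close>, where the conjugating paths are 1, removes
   them at time 1.\<close>
 define H where "H = (%(t, s). to_one x0 s \<otimes> (c (slide t s (vert 1)) \<otimes> (inv x0 \<otimes> x s) \<otimes> inv (c (slide t s (vert 1)))) \<otimes> inv (to_one x1 s)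
   \<otimes> (to_one x1 (slide t s (vert 0)) \<otimes> closeup y s \<otimes> inv (to_one x1 (slide t s (vert 0)))))"
 have sl [simp]: "slide t s (vert 0) \<in> splx 1" "slide t s (vert 1) \<in> splx 1"
  if "0 \<le> t" "t \<le> 1" "s \<in> splx 1" for t s
  using that by (auto intro!: slide_in_simplex)
 have clos: "closeup y s = to_one y0 s \<otimes> inv y0 \<otimes> y s \<otimes> inv (to_one y1 s)" for s
  by (simp add: closeup_def x0_x1_y0_y1_def)
 have closx: "closeup x s = to_one x0 s \<otimes> inv x0 \<otimes> x s \<otimes> inv (to_one x1 s)" for s
  by (simp add: closeup_def x0_x1_y0_y1_def)
 have sn: "cmap (top_of_set ?S) T (%p. f (snd p))" if "gpath f" for f
  by (rule cmap_into[OF that]) (auto intro: continuous_intros)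
 have ss: "cmap (top_of_set ?S) T (%p. f (slide (fst p) (snd p) (vert k)))" if "gpath f" "k \<le> 1" for f k
  by (rule cmap_into[OF that(1)], intro continuous_on_slide continuous_intros continuous_on_snd_coordinate)
   (use that(2) in \<open>auto intro!: slide_in_simplex\<close>)
 have Hc: "cmap (top_of_set ?S) T H"
  unfolding H_def split_def
  using gloop_closeup[OF y] kpath_gpath[OF x]
  by (intro cm_mult cm_inv sn ss o c cm_const) (auto simp: gloop_def)
 let ?p = "%s. to_one x0 s \<otimes> to_one y0 s \<otimes> inv y0 \<otimes> inv x0 \<otimes> x s \<otimes> y s \<otimes> inv (to_one y1 s) \<otimes> inv (to_one x1 s)"
 have H0: "H (0, s) = ?p s" if s: "s \<in> splx 1" for s
  using s by (simp add: H_def clos c_def m_assoc inv_mult_group) (simp add: m_assoc[symmetric])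
 have "slide 1 s (vert 1) = vert 1" "slide 1 s (vert 0) = vert 0" for s by auto
 hence H1: "H (1, s) = closeup x s \<otimes> closeup y s" if s: "s \<in> splx 1" for s
  using s by (simp add: H_def clos closx c1 o m_assoc)
 have He: "H (t, vert 0) = \<one> \<and> H (t, vert 1) = \<one>" if t: "0 \<le> t" "t \<le> 1" for t
 proof -
  have "slide t (vert 1) (vert 1) = vert 1" "slide t (vert 0) (vert 0) = vert 0" by (auto simp: algebra_simps)
  moreover have "closeup y (vert 0) = \<one>" "closeup y (vert 1) = \<one>"
   using gloop_closeup[OF y] by (simp_all add: gloop_def)
  moreover have "x (vert 0) = x0" "x (vert 1) = x1" by (simp_all add: x0_x1_y0_y1_def)
  ultimately show ?thesis
   using t sl[OF t, of "vert 0"] sl[OF t, of "vert 1"] cr cc unfolding H_def by (simp add: c1 o m_assoc[symmetric])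
 qed
 note p = loop_class_eqI[OF Hc H0 H1 He]
 let ?m = "%a b s. to_one (a \<otimes> b) s \<otimes> inv (to_one a s \<otimes> to_one b s)"
 note m0 = mult_defect_gloop[OF xe(1) ye(1)] and m1 = mult_defect_gloop[OF xe(2) ye(2)]
 have "loop_class (closeup (%s. x s \<otimes> y s)) = loop_class (%s. ?m x0 y0 s \<otimes> ?p s \<otimes> inv (?m x1 y1 s))"
  by (rule loop_class_cong[OF gloop_closeup[OF kpath_mult[OF x y]]])
   (simp add: closeup_def x0_x1_y0_y1_def[symmetric] m_assoc inv_mult_group, simp add: m_assoc[symmetric])
 also have "\<dots> = loop_class (?m x0 y0) \<cdot> loop_class ?p \<cdot> inv1 loop_class (?m x1 y1)"
  by (simp only: loop_class_mult[OF gloop_mult[OF m0 p(1)] gloop_inv[OF m1]] loop_class_mult[OF m0 p(1)] loop_class_inv[OF m1])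
 also have "loop_class ?p = loop_class (closeup x) \<cdot> loop_class (closeup y)"
  by (simp only: p(3) loop_class_mult[OF gloop_closeup[OF x] gloop_closeup[OF y]])
 finally show ?thesis
  using x y kpath_mult[OF x y] xe ye loop_class_closed[OF m0] loop_class_closed[OF m1]
   loop_class_closed[OF gloop_closeup[OF x]] loop_class_closed[OF gloop_closeup[OF y]]
  by (simp add: path_class_def mult_defect_def x0_x1_y0_y1_def[symmetric] P.m_ac)
qed

text \<open>The closed-up paths of two consecutive edges of a triangle multiply to that of the third
  edge, up to a homotopy of loops obtained by moving inside the triangle.\<close>

lemma cocycle_path_class: "cocycle pi1 1 (subtop T K) path_class"
 unfolding cocycle_def
proof (intro conjI allI impI cochain_path_class)
 fix v :: "(nat => real) => 'a"
 interpret P: comm_group pi1 by (rule comm_group_pi1)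
 assume "sing (Suc 1) (subtop T K) v"
 hence v: "sing 2 (subtop T K) v" by (simp add: numeral_2_eq_2 One_nat_def)
 have \<tau>K: "v x \<in> K" if "x \<in> splx 2" for x
  using sing_maps[OF v that] by simp
 have \<tau>c: "cmap (top_of_set (splx 2)) T v"
  using v by (simp add: singular_simplex_iff cmap_in_sub)
 have fin: "simplical_face k s \<in> splx 2" if "s \<in> splx 1" "k \<le> 2" for k s
  using simplical_face_in_standard_simplex[of 2 k s] that by simp
 have e: "gpath (%s. v (simplical_face k s))" if "k \<le> 2" for k
  by (rule cmap_into[OF \<tau>c continuous_on_face]) (use fin that in auto)
 have f: "kpath (%s. v (simplical_face k s))" "path_class (singular_face 2 k v) = loop_class (closeup (%s. v (simplical_face k s)))" if "k \<le> 2" for k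
 proof -
  show k: "kpath (%s. v (simplical_face k s))"
   unfolding kpath_def using e[OF that] \<tau>K[OF fin[of "vert 0" k]] that by simp
  hence "path_class (%s. v (simplical_face k s)) = path_class (singular_face 2 k v)"
   by (rule path_class_cong) (simp add: singular_face_def One_nat_def[symmetric])
  thus "path_class (singular_face 2 k v) = loop_class (closeup (%s. v (simplical_face k s)))"
   using k by (simp add: path_class_def)
 qed
 let ?S = "{0..1::real} \<times> splx 1"
 define a b c where "a = v (vert 0)" "b = v (vert 1)" "c = v (vert 2)"
 have abc: "a \<in> K" "b \<in> K" "c \<in> K" by (auto simp: a_b_c_def intro!: \<tau>K)
 have [simp]: "a \<in> carrier G" "b \<in> carrier G" "c \<in> carrier G" using abc K_carrier by auto
 note o = to_one[OF abc(1)] to_one[OF abc(2)] to_one[OF abc(3)]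
 have fv: "simplical_face 0 (vert 0) = vert 1" "simplical_face 0 (vert 1) = vert 2" "simplical_face 1 (vert 0) = vert 0" "simplical_face 1 (vert 1) = vert 2"
   "simplical_face 2 (vert 0) = vert 0" "simplical_face 2 (vert 1) = vert 1"
  by (auto simp: simplical_face_def vert_def fun_eq_iff)
 \<comment> \<open>At time 0 the factors follow the edges 2 and 0, with the value at their common
   vertex divided out; at time 1 the last two factors cancel and \<open>A\<close> follows the edge
   1. At all times \<open>A\<close> and \<open>B\<close> start at the vertices 0 and 1 and end at a
   common point, which keeps the ends of the loop at 1.\<close>
 define A where "A = (%p. slide (fst p) (simplical_face 2 (snd p)) (simplical_face 1 (snd p)))"
 define B where "B = (%p. slide (fst p) (vert 1) (simplical_face 0 (snd p)))"
 have Ain: "A p \<in> splx 2" "B p \<in> splx 2" "simplical_face 0 (snd p) \<in> splx 2" if "p \<in> ?S" for p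
  using that by (auto simp: A_def B_def intro!: slide_in_simplex fin)
 have Ac: "continuous_on ?S A" "continuous_on ?S B" "continuous_on ?S (%p. simplical_face 0 (snd p))"
  unfolding A_def B_def
  by (intro continuous_on_slide continuous_intros continuous_on_compose2[OF continuous_on_face[of UNIV]]; simp)+
 define H where "H = (%p. to_one a (snd p) \<otimes> inv a \<otimes> (v (A p) \<otimes> inv (v (B p)) \<otimes> v (simplical_face 0 (snd p))) \<otimes> inv (to_one c (snd p)))"
 have sn: "cmap (top_of_set ?S) T (%p. f (snd p))" if "gpath f" for f
  by (rule cmap_into[OF that]) (auto intro: continuous_intros)
 have Hc: "cmap (top_of_set ?S) T H"
  unfolding H_def
  by (intro cm_mult cm_inv sn o cm_const cmap_into[OF \<tau>c] Ac Ain) auto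
 have cr: "v x \<in> carrier G" if "x \<in> splx 2" for x using K_carrier \<tau>K that by blast
 have cr1 [simp]: "to_one a s \<in> carrier G" "to_one b s \<in> carrier G" "to_one c s \<in> carrier G" if "s \<in> splx 1" for s
  using gpath_carrier that o by auto
 let ?c = "%k. closeup (%s. v (simplical_face k s))"
 have "loop_class (%s. ?c 2 s \<otimes> ?c 0 s) = loop_class (?c 1)"
 proof (rule loop_class_eqI(3)[OF Hc])
  fix s :: "nat => real" assume s: "s \<in> splx 1"
  have [simp]: "v (simplical_face 0 s) \<in> carrier G" "v (simplical_face 1 s) \<in> carrier G" "v (simplical_face 2 s) \<in> carrier G"
   using s by (auto intro!: cr fin)
  have "A (0, s) = simplical_face 2 s" "B (0, s) = vert 1" "A (1, s) = simplical_face 1 s" "B (1, s) = simplical_face 0 s"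
   by (auto simp: A_def B_def)
  thus "H (0, s) = ?c 2 s \<otimes> ?c 0 s" "H (1, s) = ?c 1 s"
   using s by (simp_all add: H_def closeup_def fv a_b_c_def[symmetric] m_assoc) (simp_all add: m_assoc[symmetric])
 next
  fix t :: real assume t: "0 \<le> t" "t \<le> 1"
  have s: "A (t, vert 0) = vert 0" "B (t, vert 0) = vert 1" "B (t, vert 1) = A (t, vert 1)"
   unfolding A_def B_def by (simp_all add: fv) (simp_all add: vert_def fun_eq_iff)
  have "v (A (t, vert 1)) \<in> carrier G" using t by (intro cr Ain) simp
  thus "H (t, vert 0) = \<one> \<and> H (t, vert 1) = \<one>"
   by (simp add: H_def s fv o a_b_c_def[symmetric] m_assoc)
 qed
 moreover have "loop_class (%s. ?c 2 s \<otimes> ?c 0 s) = loop_class (?c 2) \<cdot> loop_class (?c 0)"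
  by (rule loop_class_mult) (auto intro!: gloop_closeup f)
 moreover have cl: "loop_class (?c k) \<in> carrier pi1" if "k \<le> 2" for k
  using gloop_closeup[OF f(1)[OF that]] by simp
 ultimately have l1: "loop_class (?c 1) = loop_class (?c 2) \<cdot> loop_class (?c 0)"
  by simp
 have "cobd pi1 2 path_class v = one1"
  using cl[of 0] cl[of 2]
  by (simp add: P.cobd_2[OF cochain_path_class] f(2) l1 P.inv_mult_group P.m_assoc)
 thus "cobd pi1 (Suc 1) path_class v = one1"
  by (simp add: numeral_2_eq_2 One_nat_def)
qed

end

section \<open>Bundle atlases and sections\<close>

lemma continuous_map_local:
 assumes "!!y. y \<in> topspace Y ==> \<exists>W. openin Y W \<and> y \<in> W \<and> cmap (subtop Y W) Z f"
 shows "cmap Y Z f"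
 by (rule pasting_lemma[of "{W. openin Y W \<and> cmap (subtop Y W) Z f}" Y "%W. W" Z "%_. f"])
  (use assms in auto)

lemma subtop_topspace_Int: "subtop Y {y \<in> topspace Y. P y} = subtop Y {y. P y}"
 by (metis Collect_conj_eq Collect_mem_eq subtopology_restrict)

context structure_group begin

lemma div_mult: "[|a \<in> carrier G; b \<in> carrier G; c \<in> carrier G|] ==> (inv a \<otimes> b) \<otimes> (inv b \<otimes> c) = inv a \<otimes> c"
 by (simp add: m_assoc) (simp add: m_assoc[symmetric])

lemma mult_div: "[|a \<in> carrier G; b \<in> carrier G|] ==> a \<otimes> (inv a \<otimes> b) = b"
 by (simp add: m_assoc[symmetric])

text \<open>An atlas encodes a bundle by the coordinates, with respect to an arbitrary discontinuous global section,
 of its local sections; only the quotients of two coordinate functions are continuous.\<close>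

definition atlas :: "'m topology => ('m set \<times> ('m => 'a)) set => bool" where
 "atlas M A \<longleftrightarrow> (\<forall>(U, t)\<in>A. openin M U \<and> (\<forall>x. t x \<in> carrier G)) \<and> (\<forall>x\<in>topspace M. \<exists>(U, t)\<in>A. x \<in> U) \<and>
   (\<forall>(U, t)\<in>A. \<forall>(U', t')\<in>A. cmap (subtop M (U \<inter> U')) T (%x. inv (t x) \<otimes> t' x))"

text \<open>A section of the bundle pulled back along \<open>u\<close>. The coordinate function
  \<open>s\<close> is as discontinuous as the reference section; continuity is demanded of its
  quotients by chart coordinates.\<close>

definition sect :: "'m topology => ('m set \<times> ('m => 'a)) set => 'y topology => ('y => 'm) => ('y => 'a) => bool" where
 "sect M A Y u s \<longleftrightarrow> cmap Y M u \<and> (\<forall>y\<in>topspace Y. s y \<in> carrier G) \<and>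
   (\<forall>(U, t)\<in>A. cmap (subtop Y {y. u y \<in> U}) T (%y. inv (t (u y)) \<otimes> s y))"

text \<open>Isomorphisms act on coordinates from the left, the structure group acts from the right.
  Again continuity is demanded of the expression between two charts.\<close>

definition atlas_iso :: "'m topology => ('m set \<times> ('m => 'a)) set => ('m set \<times> ('m => 'a)) set => ('m => 'a) => bool" where
 "atlas_iso M A A' h \<longleftrightarrow> (\<forall>x. h x \<in> carrier G) \<and>
   (\<forall>(U, t)\<in>A. \<forall>(U', t')\<in>A'. cmap (subtop M (U \<inter> U')) T (%x. inv (t' x) \<otimes> h x \<otimes> t x))"

lemma atlasD:
 assumes "atlas M A" "(U, t) \<in> A"
 shows atlas_open: "openin M U" and atlas_carrier [simp]: "t x \<in> carrier G"
  and atlas_transition: "(U', t') \<in> A ==> cmap (subtop M (U \<inter> U')) T (%x. inv (t x) \<otimes> t' x)"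
 using assms by (auto simp: atlas_def)

lemma atlas_cover:
 assumes "atlas M A" "x \<in> topspace M" obtains U t where "(U, t) \<in> A" "x \<in> U"
 using assms unfolding atlas_def by blast

lemma sect_continuous: "sect M A Y u s ==> cmap Y M u"
 by (simp add: sect_def)

lemma sect_carrier: "sect M A Y u s ==> y \<in> topspace Y ==> s y \<in> carrier G"
 by (simp add: sect_def)

lemma sect_chartD:
 "[|sect M A Y u s; (U, t) \<in> A|] ==> cmap (subtop Y {y. u y \<in> U}) T (%y. inv (t (u y)) \<otimes> s y)"
 by (auto simp: sect_def)

lemma openin_chart_preimage:
 assumes "atlas M A" "(U, t) \<in> A" "cmap Y M u"
 shows "openin Y {y \<in> topspace Y. u y \<in> U}"
 using openin_cmap[OF assms(3) atlas_open[OF assms(1,2)]] .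

text \<open>Transition functions are continuous, so one chart near each point suffices.\<close>

lemma sect_coverI:
 assumes at: "atlas M A" and u: "cmap Y M u" and s: "!!y. y \<in> topspace Y ==> s y \<in> carrier G"
  and W: "!!y. y \<in> topspace Y ==> \<exists>W U t. openin Y W \<and> y \<in> W \<and> (U, t) \<in> A \<and> u ` W \<subseteq> U \<and>
    cmap (subtop Y W) T (%y. inv (t (u y)) \<otimes> s y)"
 shows "sect M A Y u s"
 unfolding sect_def
proof (intro conjI ballI u s)
 have "cmap (subtop Y {y. u y \<in> U'}) T (%y. inv (t' (u y)) \<otimes> s y)" if U': "(U', t') \<in> A" for U' t'
 proof -
 let ?Y = "subtop Y {y. u y \<in> U'}"
 show "cmap ?Y T (%y. inv (t' (u y)) \<otimes> s y)"
 proof (rule continuous_map_local)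
  fix y assume y: "y \<in> topspace ?Y"
  hence "y \<in> topspace Y" by simp
  from W[OF this] obtain W U t where W: "openin Y W" "y \<in> W" "(U, t) \<in> A" "u ` W \<subseteq> U"
   "cmap (subtop Y W) T (%y. inv (t (u y)) \<otimes> s y)" by blast
  let ?W = "W \<inter> {y. u y \<in> U'}"
  have WY: "W \<subseteq> topspace Y" using W(1) by (rule openin_subset)
  have eq: "subtop ?Y ?W = subtop Y ?W"
   unfolding subtop_subtop by (rule arg_cong[where f = "subtop Y"]) auto
  have "cmap (subtop Y ?W) (subtop M (U' \<inter> U)) u"
   using u W(4) WY by (auto simp: cmap_in_sub cmap_from_sub)
  hence tr: "cmap (subtop Y ?W) T ((%x. inv (t' x) \<otimes> t x) \<circ> u)"
   by (rule cmap_comp[OF _ atlas_transition[OF at U' W(3)]])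
  have "cmap (subtop Y ?W) T (%y. inv (t (u y)) \<otimes> s y)"
   using cmap_from_sub[OF W(5), of ?W] by (simp add: subtop_subtop)
  with tr have "cmap (subtop Y ?W) T (%y. ((%x. inv (t' x) \<otimes> t x) \<circ> u) y \<otimes> (inv (t (u y)) \<otimes> s y))"
   by (rule cm_mult)
  hence "cmap (subtop Y ?W) T (%y. inv (t' (u y)) \<otimes> s y)"
   by (rule cmap_eq) (use WY s in \<open>auto simp: div_mult atlas_carrier[OF at U'] atlas_carrier[OF at W(3)]\<close>)
  moreover have "openin ?Y ?W"
   using W(1) by (simp add: openin_subtopology_Int)
  ultimately show "\<exists>W. openin ?Y W \<and> y \<in> W \<and> cmap (subtop ?Y W) T (%y. inv (t' (u y)) \<otimes> s y)"
   using W(2) y eq by (intro exI[of _ ?W]) auto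
 qed
 qed
 thus "case p of (U, t) => cmap (subtop Y {y. u y \<in> U}) T (%y. inv (t (u y)) \<otimes> s y)" if "p \<in> A" for p
  using that by (cases p) simp
qed

text \<open>The chart coordinates cancel in the quotient of two sections. Comparisons of sections
  are thus genuine continuous maps to the group, although neither section is.\<close>

lemma sect_div:
 assumes at: "atlas M A" and s: "sect M A Y u s" and s': "sect M A Y u s'"
 shows "cmap Y T (%y. inv (s y) \<otimes> s' y)"
proof (rule continuous_map_local)
 fix y assume y: "y \<in> topspace Y"
 have "u y \<in> topspace M"
  using sect_continuous[OF s] y by (auto simp: cmap_def)
 then obtain U t where U: "(U, t) \<in> A" "u y \<in> U"
  by (rule atlas_cover[OF at])
 have "cmap (subtop Y {y. u y \<in> U}) T (%y. inv (inv (t (u y)) \<otimes> s y) \<otimes> (inv (t (u y)) \<otimes> s' y))"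
  by (intro cm_mult cm_inv sect_chartD[OF s U(1)] sect_chartD[OF s' U(1)])
 hence "cmap (subtop Y {y. u y \<in> U}) T (%y. inv (s y) \<otimes> s' y)"
  by (rule cmap_eq)
   (use sect_carrier[OF s] sect_carrier[OF s'] atlas_carrier[OF at U(1)] in \<open>simp add: inv_mult_group m_assoc mult_div\<close>)
 hence "cmap (subtop Y {y \<in> topspace Y. u y \<in> U}) T (%y. inv (s y) \<otimes> s' y)"
  by (simp add: subtop_topspace_Int)
 thus "\<exists>W. openin Y W \<and> y \<in> W \<and> cmap (subtop Y W) T (%y. inv (s y) \<otimes> s' y)"
  using openin_chart_preimage[OF at U(1) sect_continuous[OF s]] y U(2) by blast
qed

lemma sect_mult:
 assumes at: "atlas M A" and s: "sect M A Y u s" and k: "cmap Y T k"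
 shows "sect M A Y u (%y. s y \<otimes> k y)"
proof -
 have c: "y \<in> topspace Y ==> s y \<in> carrier G \<and> k y \<in> carrier G" for y
  using sect_carrier[OF s] cm_carrier[OF k] by simp
 have "cmap (subtop Y {y. u y \<in> U}) T (%y. inv (t (u y)) \<otimes> (s y \<otimes> k y))" if U: "(U, t) \<in> A" for U t
 proof -
  have "cmap (subtop Y {y. u y \<in> U}) T (%y. inv (t (u y)) \<otimes> s y \<otimes> k y)"
   by (intro cm_mult sect_chartD[OF s U] cmap_from_sub k)
  thus ?thesis
   by (rule cmap_eq) (use c atlas_carrier[OF at U] in \<open>simp add: m_assoc\<close>)
 qed
 thus ?thesis
  using c sect_continuous[OF s] by (auto simp: sect_def)
qed

lemma sect_compose:
 assumes s: "sect M A Y u s" and f: "cmap Z Y f"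
 shows "sect M A Z (%z. u (f z)) (%z. s (f z))"
proof -
 have fi: "z \<in> topspace Z ==> f z \<in> topspace Y" for z
  using f by (auto simp: cmap_def)
 have "cmap (subtop Z {z. u (f z) \<in> U}) T (%z. inv (t (u (f z))) \<otimes> s (f z))" if U: "(U, t) \<in> A" for U t
 proof -
  have "cmap (subtop Z {z. u (f z) \<in> U}) (subtop Y {y. u y \<in> U}) f"
   using f by (auto simp: cmap_in_sub cmap_from_sub)
  from cmap_comp[OF this sect_chartD[OF s U]] show ?thesis
   by (simp add: o_def)
 qed
 moreover have "cmap Z M (%z. u (f z))"
  using cmap_comp[OF f sect_continuous[OF s]] by (simp add: o_def)
 ultimately show ?thesis
  using sect_carrier[OF s] fi by (auto simp: sect_def)
qed

lemma sect_subtopology: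
 "sect M A Y u s ==> sect M A (subtop Y W) u s"
 using sect_compose[of M A Y u s "subtop Y W" "%y. y"] by simp

lemma sect_subset:
 "[|sect M A (top_of_set S) u s; S' \<subseteq> S|] ==> sect M A (top_of_set S') u s"
 using sect_subtopology[of M A "top_of_set S" u s S'] by (simp add: subtop_subtop Int_absorb1)

lemma sect_cong:
 assumes "sect M A Y u s" "!!y. y \<in> topspace Y ==> u' y = u y" "!!y. y \<in> topspace Y ==> s' y = s y"
 shows "sect M A Y u' s'"
proof -
 have "subtop Y {y. u' y \<in> U} = subtop Y {y. u y \<in> U}" for U
 proof -
  have "{y \<in> topspace Y. u' y \<in> U} = {y \<in> topspace Y. u y \<in> U}" using assms(2) by auto
  thus ?thesis
   using subtop_topspace_Int[of Y "%y. u' y \<in> U"] subtop_topspace_Int[of Y "%y. u y \<in> U"] by simp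
 qed
 hence "cmap (subtop Y {y. u' y \<in> U}) T (%y. inv (t (u' y)) \<otimes> s' y)" if "(U, t) \<in> A" for U t
  using cmap_eq[OF sect_chartD[OF assms(1) that], of "%y. inv (t (u' y)) \<otimes> s' y"] assms(2,3) by simp
 moreover have "cmap Y M u'"
  using cmap_eq[OF sect_continuous[OF assms(1)], of u'] assms(2) by simp
 ultimately show ?thesis
  using sect_carrier[OF assms(1)] assms(3) by (auto simp: sect_def)
qed

lemma sect_local:
 assumes at: "atlas M A"
  and W: "!!y. y \<in> topspace Y ==> \<exists>W. openin Y W \<and> y \<in> W \<and> sect M A (subtop Y W) u s"
 shows "sect M A Y u s"
proof -
 have u: "cmap Y M u"
 proof (rule continuous_map_local)
  fix y assume "y \<in> topspace Y"
  from W[OF this] obtain W where "openin Y W" "y \<in> W" "sect M A (subtop Y W) u s" by blast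
  thus "\<exists>W. openin Y W \<and> y \<in> W \<and> cmap (subtop Y W) M u"
   using sect_continuous by (intro exI[of _ W]) auto
 qed
 show ?thesis
 proof (rule sect_coverI[OF at u])
  fix y assume y: "y \<in> topspace Y"
  obtain W where W: "openin Y W" "y \<in> W" "sect M A (subtop Y W) u s"
   using W[OF y] by blast
  show "s y \<in> carrier G"
   using sect_carrier[OF W(3)] y W(2) by simp
  have "u y \<in> topspace M"
   using u y by (auto simp: cmap_def)
  then obtain U t where U: "(U, t) \<in> A" "u y \<in> U"
   by (rule atlas_cover[OF at])
  let ?W = "W \<inter> {y \<in> topspace Y. u y \<in> U}"
  have "subtop (subtop Y W) {y. u y \<in> U} = subtop Y ?W"
   using openin_subset[OF W(1)] by (auto simp: subtop_subtop intro: arg_cong[where f = "subtop Y"])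
  hence "cmap (subtop Y ?W) T (%y. inv (t (u y)) \<otimes> s y)"
   using sect_chartD[OF W(3) U(1)] by simp
  thus "\<exists>W U t. openin Y W \<and> y \<in> W \<and> (U, t) \<in> A \<and> u ` W \<subseteq> U \<and>
    cmap (subtop Y W) T (%y. inv (t (u y)) \<otimes> s y)"
   using W(1,2) U y openin_chart_preimage[OF at U(1) u]
   by (intro exI[of _ ?W] exI[of _ U] exI[of _ t]) auto
 qed
qed

lemma sect_chart:
 assumes at: "atlas M A" and U: "(U, t) \<in> A" and u: "cmap Y M u" and "!!y. y \<in> topspace Y ==> u y \<in> U"
 shows "sect M A Y u (%y. t (u y))"
proof (rule sect_coverI[OF at u])
 show "\<exists>W U' t'. openin Y W \<and> y \<in> W \<and> (U', t') \<in> A \<and> u ` W \<subseteq> U' \<and>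
    cmap (subtop Y W) T (%y. inv (t' (u y)) \<otimes> t (u y))" if "y \<in> topspace Y" for y
  using that assms(4) atlas_carrier[OF at U]
  by (intro exI[of _ "topspace Y"] exI[of _ U] exI[of _ t]) (auto simp: U topspace_eq)
qed (simp add: atlas_carrier[OF at U])

lemma sect_closed_Un:
 assumes A: "closedin Y A" and B: "closedin Y B" and AB: "topspace Y \<subseteq> A \<union> B"
  and sA: "sect M H (subtop Y A) u s" and sB: "sect M H (subtop Y B) u s"
 shows "sect M H Y u s"
proof -
 have past: "cmap (subtop Y S) Z f"
  if "cmap (subtop (subtop Y A) S) Z f" "cmap (subtop (subtop Y B) S) Z f" for S Z f
 proof (rule pasting_lemma_closed[of "{A, B}" _ "%C. S \<inter> C" _ "%_. f"])
  show "closedin (subtop Y S) (S \<inter> C)" if "C \<in> {A, B}" for C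
   using that A B by (auto intro: closedin_subtopology_Int_closed)
  show "cmap (subtop (subtop Y S) (S \<inter> C)) Z f" if "C \<in> {A, B}" for C
   using that \<open>continuous_map (subtopology (subtopology Y A) S) Z f\<close> \<open>continuous_map (subtopology (subtopology Y B) S) Z f\<close>
   by (auto simp: subtop_subtop Int_left_commute Int_commute)
 qed (use AB in auto)
 have "cmap Y M u"
  using past[of UNIV M u] sect_continuous[OF sA] sect_continuous[OF sB] by simp
 moreover have "s y \<in> carrier G" if "y \<in> topspace Y" for y
  using that AB sect_carrier[OF sA] sect_carrier[OF sB] by auto
 ultimately show ?thesis
  unfolding sect_def
 proof (intro conjI ballI)
  show "case p of (U, t) => cmap (subtop Y {y. u y \<in> U}) T (%y. inv (t (u y)) \<otimes> s y)" if "p \<in> H" for p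
   using that past[OF sect_chartD[OF sA, of "fst p" "snd p"] sect_chartD[OF sB, of "fst p" "snd p"]] by (simp add: split_def)
 qed
qed

section \<open>Existence of sections over boxes, simplices and discs\<close>

definition slab :: "nat => (nat => real) => (nat => real) => (nat => real) set" where
 "slab n a b = {x. (\<forall>i<n. a i \<le> x i \<and> x i \<le> b i) \<and> (\<forall>i\<ge>n. x i = 0)}"

lemma closed_slab_half: "closedin (top_of_set S) {x \<in> S. x (k::nat) \<le> (c::real)}" "closedin (top_of_set S) {x \<in> S. c \<le> x k}"
proof -
 have "cmap (top_of_set S) euclideanreal (%x. x k)"
  by (simp add: cont_coord)
 from closedin_continuous_map_preimage[OF this, of "{..c}"] closedin_continuous_map_preimage[OF this, of "{c..}"]
 show "closedin (top_of_set S) {x \<in> S. x k \<le> c}" "closedin (top_of_set S) {x \<in> S. c \<le> x k}" by simp_all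
qed

text \<open>Two sections over adjacent boxes differ on the common face by a continuous function.
  Extended constantly in the direction \<open>k\<close>, it corrects the second section.\<close>

lemma sect_slab_Un:
 assumes at: "atlas M H" and k: "k < n" and c: "a k \<le> c" "c \<le> b k"
  and s1: "sect M H (top_of_set (slab n a (b(k := c)))) u s\<^sub>1" and s2: "sect M H (top_of_set (slab n (a(k := c)) b)) u s\<^sub>2"
 shows "\<exists>s. sect M H (top_of_set (slab n a b)) u s"
proof -
 let ?A = "slab n a (b(k := c))" and ?B = "slab n (a(k := c)) b"
 define s where "s = (%x. if x k \<le> c then s\<^sub>1 x else s\<^sub>2 x \<otimes> (inv (s\<^sub>2 (x(k := c))) \<otimes> s\<^sub>1 (x(k := c))))"
 have up: "continuous_on S (%x::nat => real. x(k := c))" for S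
  unfolding fun_upd_def
  by (intro cont_prod cont_if_const continuous_on_const cont_coord)
 have A: "?A = {x \<in> slab n a b. x k \<le> c}" and B: "?B = {x \<in> slab n a b. c \<le> x k}"
  using k c by (auto simp: slab_def split: if_splits)
 have upA: "cmap (top_of_set ?B) (top_of_set ?A) (%x. x(k := c))" "cmap (top_of_set ?B) (top_of_set ?B) (%x. x(k := c))"
  using k c up by (auto simp: slab_def cmap_in_sub)
 have k: "cmap (top_of_set ?B) T (%x. inv (s\<^sub>2 (x(k := c))) \<otimes> s\<^sub>1 (x(k := c)))"
  by (rule sect_div[OF at sect_compose[OF s2 upA(2)] sect_compose[OF s1 upA(1)]])
 have B2: "sect M H (top_of_set ?B) u s"
 proof (rule sect_cong[OF sect_mult[OF at s2 k]])
  fix x assume x: "x \<in> topspace (top_of_set ?B)"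
  show "s x = s\<^sub>2 x \<otimes> (inv (s\<^sub>2 (x(k := c))) \<otimes> s\<^sub>1 (x(k := c)))"
  proof (cases "x k \<le> c")
   case True
   hence "x k = c" using x unfolding B by simp
   hence "x(k := c) = x" by auto
   have "x \<in> ?A" using x True unfolding A by (simp add: B)
   thus ?thesis
    using sect_carrier[OF s1, of x] sect_carrier[OF s2, of x] x True by (simp only: s_def \<open>x(k := c) = x\<close>) (simp add: mult_div)
  qed (simp add: s_def)
 qed simp
 have A2: "sect M H (top_of_set ?A) u s"
  by (rule sect_cong[OF s1]) (auto simp: s_def A)
 have "sect M H (top_of_set (slab n a b)) u s"
 proof (rule sect_closed_Un[of _ ?A ?B])
  show "closedin (top_of_set (slab n a b)) ?A" "closedin (top_of_set (slab n a b)) ?B"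
   unfolding A B by (rule closed_slab_half)+
  show "sect M H (subtop (top_of_set (slab n a b)) ?A) u s" "sect M H (subtop (top_of_set (slab n a b)) ?B) u s"
   using A2 B2 by (simp_all add: subtop_subtop A B Int_absorb1)
 qed (auto simp: A B)
 thus ?thesis by blast
qed

text \<open>A slab agrees with \<open>x\<close> in the coordinates from \<open>n\<close> on, so a
  product neighbourhood restricts it in finitely many directions and one bound on its side lengths
  suffices.\<close>

lemma slab_neighbourhood:
 assumes "open W" "x \<in> W" "\<forall>i\<ge>n. x i = 0"
 obtains v where "0 < v" "!!a b. (!!i. i < n ==> a i \<le> x i \<and> x i \<le> b i \<and> b i - a i < v) ==> slab n a b \<subseteq> W"
proof -
 have "openin (product_topology (%_. euclideanreal) UNIV) W"
  using assms(1) by (simp add: open_fun_def)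
 from product_topology_open_contains_basis[OF this assms(2)]
 obtain X where X: "x \<in> (\<Pi>\<^sub>E i\<in>UNIV. X i)" "!!i. open (X i)" "(\<Pi>\<^sub>E i\<in>UNIV. X i) \<subseteq> W"
  by (auto simp: PiE_UNIV_domain)
 have "\<exists>d>0. ball (x i) d \<subseteq> X i" for i
  using X(1) open_contains_ball[THEN iffD1, OF X(2)[of i]] by (auto simp: PiE_UNIV_domain)
 then obtain d where d: "!!i. d i > 0" "!!i. ball (x i) (d i) \<subseteq> X i" by metis
 define v where "v = Min (insert 1 (d ` {..<n}))"
 have v: "v > 0" "!!i. i < n ==> v \<le> d i"
  using d(1) by (auto simp: v_def)
 have box: "slab n a b \<subseteq> W" if ab: "!!i. i < n ==> a i \<le> x i \<and> x i \<le> b i \<and> b i - a i < v" for a b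
 proof
  fix y assume y: "y \<in> slab n a b"
  have "y i \<in> X i" for i
  proof (cases "i < n")
   case True
   hence "\<bar>x i - y i\<bar> < d i"
    using ab[OF True] y v(2)[OF True] by (auto simp: slab_def)
   thus ?thesis using d(2)[of i] by (auto simp: dist_real_def)
  next
   case False
   thus ?thesis using y assms(3) X(1) by (auto simp: slab_def PiE_UNIV_domain not_less Pi_iff) metis
  qed
  thus "y \<in> W" using X(3) by (auto simp: PiE_UNIV_domain)
 qed
 show thesis by (rule that[OF v(1) box])
qed

text \<open>Bisection in one coordinate after the other. The downward induction on \<open>k\<close>
  treats boxes that are small near \<open>x\<close> in the coordinates below \<open>k\<close> and
  extend over the full interval in the others: for \<open>k = n\<close> they fit into one chart, for
  \<open>k = 0\<close> only the whole cube is left.\<close>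

lemma sect_slab:
 assumes at: "atlas M A" and q: "cmap (euclidean :: (nat => real) topology) M q"
 shows "\<exists>s. sect M A (top_of_set (slab n (%_. -1) (%_. 1))) q s"
proof -
 define R where "R a b \<longleftrightarrow> (\<exists>s. sect M A (top_of_set (slab n a b)) q s)" for a b
 define small where "small k x r a b \<longleftrightarrow> (\<forall>i<k. a i \<le> x i \<and> x i \<le> b i \<and> b i - a i < r)" for k and x a b :: "nat => real" and r :: real
 define full where "full k a b \<longleftrightarrow> (\<forall>i. k \<le> i --> i < n --> a i = -1 \<and> b i = (1::real))" for k and a b :: "nat => real"
 have small_mono: "small k x r a b" if "small k x e a b" "e \<le> r" for k x e r a b
  using that by (auto simp: small_def intro: less_le_trans)
 have "\<forall>x. \<exists>r>0. \<forall>a b. small k x r a b \<and> full k a b --> R a b" if "k \<le> n" for k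
  using that
 proof (induction rule: inc_induct)
  case base
  show ?case
  proof
   fix x :: "nat => real"
   define x' where "x' = (%i. if i < n then x i else 0)"
   have "q x' \<in> topspace M" using q by (auto simp: cmap_def)
   then obtain U t where U: "(U, t) \<in> A" "q x' \<in> U" by (rule atlas_cover[OF at])
   have "open {y. q y \<in> U}"
    using openin_chart_preimage[OF at U(1) q] by simp
   then obtain r where r: "0 < r" "!!a b. (!!i. i < n ==> a i \<le> x' i \<and> x' i \<le> b i \<and> b i - a i < r) ==> slab n a b \<subseteq> {y. q y \<in> U}"
    by (rule slab_neighbourhood[where x = x' and n = n]) (use U in \<open>auto simp: x'_def\<close>)
   have "R a b" if "small n x r a b" for a b
   proof -
    have "slab n a b \<subseteq> {y. q y \<in> U}"
     by (rule r(2)) (use that in \<open>auto simp: small_def x'_def\<close>)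
    thus ?thesis
     unfolding R_def using sect_chart[OF at U(1) cmap_from_sub[OF q, of "slab n a b"]] by auto
   qed
   thus "\<exists>r>0. \<forall>a b. small n x r a b \<and> full n a b --> R a b"
    using r(1) by blast
  qed
 next
  case (step k)
  show ?case
  proof
   fix x :: "nat => real"
   \<comment> \<open>The bound \<open>r\<close> may depend on the interval; the minimum of two
     bounds then serves for the union of two adjacent intervals in the bisection.\<close>
   define P where "P u v \<longleftrightarrow> (\<exists>r>0. \<forall>a b. small k x r a b \<and> a k = u \<and> b k = v \<and> full (Suc k) a b --> R a b)" for u v
   have "P (-1) 1"
   proof (rule Bolzano)
    fix u w v :: real assume uw: "P u w" and wv: "P w v" and le: "u \<le> w" "w \<le> v"
    obtain r where r: "r > 0" "!!a b. [|small k x r a b; a k = u; b k = w; full (Suc k) a b|] ==> R a b"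
     using uw unfolding P_def by blast
    obtain e where e: "e > 0" "!!a b. [|small k x e a b; a k = w; b k = v; full (Suc k) a b|] ==> R a b"
     using wv unfolding P_def by blast
    have "R a b" if ab: "small k x (min r e) a b" "a k = u" "b k = v" "full (Suc k) a b" for a b
    proof -
     have "R a (b(k := w))"
      by (rule r(2)) (use ab small_mono[OF ab(1), of r] in \<open>auto simp: small_def full_def\<close>)
     moreover have "R (a(k := w)) b"
      by (rule e(2)) (use ab small_mono[OF ab(1), of e] in \<open>auto simp: small_def full_def\<close>)
     ultimately show "R a b"
      unfolding R_def using sect_slab_Un[OF at \<open>k < n\<close>, of a w b q] le ab by blast
    qed
    thus "P u v"
     unfolding P_def using r(1) e(1) by (intro exI[of _ "min r e"]) auto
   next
    fix y :: real
    obtain r where r: "r > 0" "!!a b. [|small (Suc k) (x(k := y)) r a b; full (Suc k) a b|] ==> R a b"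
     using step.IH by blast
    have "P u v" if "u \<le> y \<and> y \<le> v \<and> v - u < r" for u v
     unfolding P_def using that r(1)
     by (intro exI[of _ r] conjI allI impI r(2)) (auto simp: small_def less_Suc_eq)
    thus "\<exists>d>0. \<forall>u v. u \<le> y \<and> y \<le> v \<and> v - u < d --> P u v"
     using r(1) by blast
   qed simp
   then obtain r where r: "r > 0" "!!a b. [|small k x r a b; a k = -1; b k = 1; full (Suc k) a b|] ==> R a b"
    unfolding P_def by blast
   have "R a b" if "small k x r a b" "full k a b" for a b
    by (rule r(2)) (use that \<open>k < n\<close> in \<open>auto simp: full_def\<close>)
   thus "\<exists>r>0. \<forall>a b. small k x r a b \<and> full k a b --> R a b"
    using r(1) by blast
  qed
 qed
 from this[of 0] show ?thesis
  by (auto simp: small_def full_def R_def)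
qed

text \<open>It is enough that \<open>S\<close> is a retract: the cube carries a section along the
  map composed with the retraction.\<close>

lemma sect_exists:
 assumes at: "atlas M A" and u: "cmap (top_of_set S) M u"
  and S: "S \<subseteq> slab n (%_. -1) (%_. 1)" and r: "continuous_on UNIV r" "!!x. r x \<in> S" "!!x. x \<in> S ==> r x = x"
 obtains s where "sect M A (top_of_set S) u s"
proof -
 have "cmap euclidean M (%x. u (r x))"
  using cmap_into[OF u r(1)] r(2) by simp
 then obtain s where s: "sect M A (top_of_set (slab n (%_. -1) (%_. 1))) (%x. u (r x)) s"
  using sect_slab[OF at] by blast
 have "sect M A (top_of_set S) u s"
  by (rule sect_cong[OF sect_subset[OF s S]]) (simp_all add: r(3))
 thus thesis by (rule that)
qed

lemma sect_exists_simplex: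
 assumes at: "atlas M A" and u: "cmap (top_of_set (splx p)) M u"
 obtains s where "sect M A (top_of_set (splx p)) u s"
proof -
 define S where "S x = (\<Sum>i\<in>{1..p}. max 0 (x i))" for x :: "nat => real"
 \<comment> \<open>Negative coordinates are cut off, and those from 1 on are scaled down until their
   sum is at most 1. The coordinate 0 receives the remainder, so the result lies in the simplex
   whatever \<open>x 0\<close> was.\<close>
 define r where "r x = (%i. if i = 0 then 1 - S x / max 1 (S x) else if i \<le> p then max 0 (x i) / max 1 (S x) else 0)" for x :: "nat => real"
 have "S x \<ge> 0" for x by (auto simp: S_def intro: sum_nonneg)
 have cS: "continuous_on UNIV S"
  unfolding S_def by (intro continuous_intros cont_coord)
 have split: "(\<Sum>i\<le>p. x i) = x 0 + (\<Sum>i\<in>{1..p}. x i)" for x :: "nat => real"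
 proof -
  have "{..p} = insert 0 {1..p}" by auto
  thus ?thesis by simp
 qed
 have le: "max 0 (x i) \<le> S x" if "1 \<le> i" "i \<le> p" for x i
  unfolding S_def by (rule member_le_sum) (use that in auto)
 show thesis
 proof (rule sect_exists[OF at u, of "Suc p" r])
  show "splx p \<subseteq> slab (Suc p) (%_. -1) (%_. 1)"
   by (auto simp: standard_simplex_def slab_def intro: order_trans[of "-1::real" 0])
  show "continuous_on UNIV r"
   unfolding r_def
   by (intro cont_prod cont_if_const continuous_intros cont_coord cS) auto
  show "r x \<in> splx p" for x
  proof -
   have "(\<Sum>i\<in>{1..p}. r x i) = S x / max 1 (S x)"
    unfolding S_def sum_divide_distrib by (rule sum.cong) (auto simp: r_def S_def)
   hence "(\<Sum>i\<le>p. r x i) = 1" by (simp add: split) (simp add: r_def)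
   moreover have "0 \<le> r x i \<and> r x i \<le> 1" for i
    using \<open>S x \<ge> 0\<close> le[of i x] by (auto simp: r_def divide_simps max_def)
   ultimately show ?thesis by (auto simp: standard_simplex_def r_def)
  qed
  show "r x = x" if x: "x \<in> splx p" for x
  proof -
   have p: "x i \<ge> 0" for i using x by (simp add: standard_simplex_def)
   hence "S x = (\<Sum>i\<in>{1..p}. x i)" by (simp add: S_def max_def)
   moreover have "(\<Sum>i\<le>p. x i) = 1" using x by (simp add: standard_simplex_def)
   ultimately have "x 0 = 1 - S x" using split[of x] by simp
   moreover from this have "S x \<le> 1" using p[of 0] by simp
   moreover have "x i = 0" if "i > p" for i using x that by (simp add: standard_simplex_def)
   ultimately show ?thesis using p by (auto simp: r_def max_def fun_eq_iff)
  qed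
 qed (rule that)
qed

lemma sect_exists_disc:
 assumes at: "atlas M A" and u: "cmap (disc n) M u"
 obtains s where "sect M A (disc n) u s"
proof -
 \<comment> \<open>Projection to the first \<open>n\<close> coordinates followed by the radial
   retraction; \<open>max 1\<close> leaves the points of the disc untouched.\<close>
 define r where "r x = (%i. if i < n then x i / max 1 (rad n x) else 0)" for x :: "nat => real"
 show thesis
 proof (rule sect_exists[OF at u, of n r])
  show "continuous_on UNIV r"
   unfolding r_def
   by (intro cont_prod cont_if_const continuous_intros cont_coord continuous_on_rad) auto
  show "cdisc n \<subseteq> slab n (%_. -1) (%_. 1)"
  proof
   fix y assume y: "y \<in> cdisc n"
   have "\<bar>y i\<bar> \<le> 1" if "i < n" for i
   proof -
    have "(y i)\<^sup>2 \<le> (\<Sum>i<n. (y i)\<^sup>2)" by (rule member_le_sum) (use that in auto)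
    also have "\<dots> \<le> 1" using y by (simp add: closed_disc_def)
    finally show ?thesis by (simp add: abs_square_le_1)
   qed
   thus "y \<in> slab n (%_. -1) (%_. 1)"
    using y by (auto simp: slab_def closed_disc_iff abs_le_iff minus_le_iff)
  qed
  show "r x \<in> cdisc n" for x
  proof -
   have "rad n (r x) = rad n (%i. (1 / max 1 (rad n x)) * x i)"
    unfolding rad_def by (rule arg_cong[where f = sqrt], rule sum.cong) (auto simp: r_def rad_def)
   also have "\<dots> \<le> 1"
    unfolding rad_scale by (simp add: divide_simps max_def)
   finally show ?thesis by (auto simp: closed_disc_iff r_def)
  qed
  show "r x = x" if "x \<in> cdisc n" for x
   using that by (auto simp: closed_disc_iff r_def max_def fun_eq_iff)
 qed (rule that)
qed

end

section \<open>Principal bundles and atlases\<close>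

lemma continuous_map_image_in: "cmap Y Z f ==> y \<in> topspace Y ==> f y \<in> topspace Z"
 by (auto simp: cmap_def)

lemma cmap_comp2:
 "[|continuous_map X Y f; cmap Y Z g|] ==> cmap X Z (%x. g (f x))"
 using cmap_comp[of X Y f Z g] by (simp add: o_def)

context structure_group begin

text \<open>A local trivialisation, as a local section \<open>s\<close> together with the coordinate function \<open>k\<close>.\<close>

definition local_triv :: "'m topology => ('e, 'a, 'm) gbundle => 'm set => ('m => 'e) => ('e => 'a) => bool" where
 "local_triv M P U s k \<longleftrightarrow> openin M U \<and> cmap (subtop M U) (total P) s \<and>
   (\<forall>b\<in>U. \<forall>g\<in>carrier G. proj P (act P (s b) g) = b \<and> k (act P (s b) g) = g) \<and>
   cmap (subtop (total P) {e. proj P e \<in> U}) T k \<and>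
   (\<forall>e\<in>topspace (total P). proj P e \<in> U --> act P (s (proj P e)) (k e) = e)"

lemma act_continuous:
 assumes "cmap (prod_topology (total P) T) (total P) (%(e, g). act P e g)"
  and "cmap Y (total P) f" "cmap Y T g"
 shows "cmap Y (total P) (%y. act P (f y) (g y))"
 using cmap_comp[OF continuous_map_pairedI[OF assms(2,3)] assms(1)] by (simp add: o_def)

lemma principal_bundleI:
 assumes act: "cmap (prod_topology (total P) T) (total P) (%(e, g). act P e g)"
  and "!!e. e \<in> topspace (total P) ==> act P e \<one> = e"
  and "!!e g h. [|e \<in> topspace (total P); g \<in> carrier G; h \<in> carrier G|] ==> act P e (g \<otimes> h) = act P (act P e g) h"
  and proj: "cmap (total P) M (proj P)"
  and triv: "!!b. b \<in> topspace M ==> \<exists>U s k. b \<in> U \<and> local_triv M P U s k"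
 shows "principal_bundle G T M P"
proof -
 define \<U> where "\<U> = {U. \<exists>s k. local_triv M P U s k}"
 have "U \<subseteq> topspace M" if "U \<in> \<U>" for U
  using that openin_subset[of M U] by (auto simp: \<U>_def local_triv_def)
 moreover have "\<exists>U\<in>\<U>. b \<in> U" if "b \<in> topspace M" for b
  using triv[OF that] by (auto simp: \<U>_def)
 ultimately have "\<Union>\<U> = topspace M" by blast
 moreover have "\<exists>f. homeomorphic_map (prod_topology (subtop M U) T)
       (subtop (total P) {e \<in> topspace (total P). proj P e \<in> U}) f \<and>
      (\<forall>b\<in>U. \<forall>g\<in>carrier G. proj P (f (b, g)) = b \<and> f (b, g) = act P (f (b, \<one>)) g)" if U: "U \<in> \<U>" for U
 proof -
  obtain s k where sk: "local_triv M P U s k" using U by (auto simp: \<U>_def)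
  have s: "cmap (subtop M U) (total P) s" and k: "cmap (subtop (total P) {e. proj P e \<in> U}) T k"
   and pk: "!!b g. [|b \<in> U; g \<in> carrier G|] ==> proj P (act P (s b) g) = b \<and> k (act P (s b) g) = g"
   and e: "!!e. [|e \<in> topspace (total P); proj P e \<in> U|] ==> act P (s (proj P e)) (k e) = e"
   and UM: "U \<subseteq> topspace M"
   using sk openin_subset by (auto simp: local_triv_def)
  have sE: "s b \<in> topspace (total P)" if "b \<in> U" for b
   using s that UM by (auto simp: cmap_def)
  let ?f = "%p. act P (s (fst p)) (snd p)"
  let ?E = "subtop (total P) {e \<in> topspace (total P). proj P e \<in> U}"
  have \<phi>c: "cmap (prod_topology (subtop M U) T) (total P) ?f"
   by (rule act_continuous[OF act cmap_comp2[OF continuous_map_fst s] continuous_map_snd])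
  have "cmap (prod_topology (subtop M U) T) ?E ?f"
   unfolding cmap_in_sub
  proof (intro conjI Pi_I \<phi>c)
   fix x assume "x \<in> topspace (prod_topology (subtop M U) T)"
   then obtain b g where "b \<in> U" "g \<in> carrier G" "x = (b, g)" by (auto simp: topspace_eq)
   moreover have "act P (s b) g \<in> topspace (total P)"
    using continuous_map_image_in[OF \<phi>c, of "(b, g)"] calculation UM by (auto simp: topspace_eq)
   ultimately show "?f x \<in> {e \<in> topspace (total P). proj P e \<in> U}" using pk by simp
  qed
  moreover have "cmap ?E (prod_topology (subtop M U) T) (%e. (proj P e, k e))"
  proof (rule continuous_map_pairedI)
   show "cmap ?E (subtop M U) (proj P)"
    using proj by (auto simp: cmap_in_sub cmap_from_sub)
   show "cmap ?E T k"
    using k by (simp add: subtop_topspace_Int)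
  qed
  ultimately have "homeomorphic_maps (prod_topology (subtop M U) T) ?E ?f (%e. (proj P e, k e))"
   using pk e UM topspace_eq by (auto simp: homeomorphic_maps_def)
  hence "homeomorphic_map (prod_topology (subtop M U) T) ?E ?f"
   using homeomorphic_map_maps by blast
  thus ?thesis
   using pk sE assms(2) by (intro exI[of _ ?f]) auto
 qed
 moreover have "\<forall>U\<in>\<U>. openin M U" by (auto simp: \<U>_def local_triv_def)
 ultimately show ?thesis
  unfolding principal_bundle_def using assms by (intro conjI exI[of _ \<U>] ballI) auto
qed

text \<open>The translation function of a principal bundle: \<open>e'\<close> divided by
  \<open>e\<close> within a fibre.\<close>

definition fdiv :: "('e, 'a, 'm) gbundle => 'e => 'e => 'a" where
 "fdiv P e e' = (THE g. g \<in> carrier G \<and> act P e g = e')"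

text \<open>Here \<open>e\<close> is the arbitrary, in general discontinuous, global section over
  which coordinates are taken; with respect to it the charts become continuous local
  sections.\<close>

definition represents :: "'m topology => ('e, 'a, 'm) gbundle => ('m set \<times> ('m => 'a)) set => ('m => 'e) => bool" where
 "represents M P A e \<longleftrightarrow> (\<forall>b\<in>topspace M. e b \<in> topspace (total P) \<and> proj P (e b) = b) \<and>
   (\<forall>(U, t)\<in>A. cmap (subtop M U) (total P) (%b. act P (e b) (t b)))"

context
 fixes M :: "'m topology" and P :: "('e, 'a, 'm) gbundle"
 assumes P: "principal_bundle G T M P"
begin

lemma act_cont: "cmap (prod_topology (total P) T) (total P) (%(e, g). act P e g)"
 and act_one: "e \<in> topspace (total P) ==> act P e \<one> = e"
 and act_mult: "[|e \<in> topspace (total P); g \<in> carrier G; h \<in> carrier G|] ==> act P (act P e g) h = act P e (g \<otimes> h)"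
 and proj_cont: "cmap (total P) M (proj P)"
 using P by (auto simp: principal_bundle_def)

lemma act_closed [simp]: "[|e \<in> topspace (total P); g \<in> carrier G|] ==> act P e g \<in> topspace (total P)"
 using act_cont by (auto simp: cmap_def topspace_eq Pi_iff)

lemma bundle_local_triv:
 assumes "b \<in> topspace M" obtains U s k where "b \<in> U" "local_triv M P U s k"
proof -
 obtain \<U> where \<U>: "\<forall>U\<in>\<U>. openin M U" "\<Union>\<U> = topspace M"
   and triv: "\<forall>U\<in>\<U>. \<exists>v.
      homeomorphic_map (prod_topology (subtop M U) T)
       (subtop (total P) {e \<in> topspace (total P). proj P e \<in> U}) v \<and>
      (\<forall>b\<in>U. \<forall>g\<in>carrier G. proj P (v (b, g)) = b \<and> v (b, g) = act P (v (b, \<one>)) g)"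
  using P unfolding principal_bundle_def by (elim conjE exE)
 obtain U where U: "U \<in> \<U>" "b \<in> U" using assms \<U>(2) by blast
 let ?E = "subtop (total P) {e \<in> topspace (total P). proj P e \<in> U}"
 obtain v where h: "homeomorphic_map (prod_topology (subtop M U) T) ?E v"
  and v: "!!b g. [|b \<in> U; g \<in> carrier G|] ==> proj P (v (b, g)) = b \<and> v (b, g) = act P (v (b, \<one>)) g"
  using bspec[OF triv U(1)] by blast
 obtain w where "homeomorphic_maps (prod_topology (subtop M U) T) ?E v w"
  using h homeomorphic_map_maps by blast
 hence c\<phi>: "cmap (prod_topology (subtop M U) T) ?E v" and c\<psi>: "cmap ?E (prod_topology (subtop M U) T) w"
  and inv1: "!!x. x \<in> topspace (prod_topology (subtop M U) T) ==> w (v x) = x" and inv2: "!!e. e \<in> topspace ?E ==> v (w e) = e"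
  by (auto simp: homeomorphic_maps_def)
 have UM: "openin M U" "U \<subseteq> topspace M" using U \<U> by auto
 have "local_triv M P U (%b. v (b, \<one>)) (%e. snd (w e))"
  unfolding local_triv_def
 proof (intro conjI ballI impI UM(1))
  have "cmap (subtop M U) (prod_topology (subtop M U) T) (%b. (b, \<one>))"
   by (intro continuous_map_pairedI cm_const) auto
  from cmap_comp[OF this c\<phi>]
  show "cmap (subtop M U) (total P) (%b. v (b, \<one>))"
   by (simp add: o_def cmap_in_sub)
  show "cmap (subtop (total P) {e. proj P e \<in> U}) T (%e. snd (w e))"
   using cmap_comp[OF c\<psi> continuous_map_snd] by (simp add: subtop_topspace_Int o_def)
  fix b g assume b: "b \<in> U" "g \<in> carrier G"
  show "proj P (act P (v (b, \<one>)) g) = b" "snd (w (act P (v (b, \<one>)) g)) = g"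
   using v[OF b] inv1[of "(b, g)"] b UM(2) by (auto simp: topspace_eq)
 next
  fix e assume e: "e \<in> topspace (total P)" "proj P e \<in> U"
  obtain b g where bg: "w e = (b, g)" by (cases "w e")
  have "w e \<in> topspace (prod_topology (subtop M U) T)"
   using c\<psi> e by (auto simp: cmap_def)
  hence "b \<in> U" "g \<in> carrier G" by (auto simp: bg topspace_eq)
  note f = v[OF this]
  have "v (b, g) = e" using inv2[of e] e by (simp add: bg)
  hence "proj P e = b" "act P (v (b, \<one>)) g = e" using f by auto
  thus "act P (v (proj P e, \<one>)) (snd (w e)) = e"
   by (simp add: bg)
 qed
 thus thesis by (rule that[OF U(2)])
qed

lemma local_triv_section:
 assumes "local_triv M P U s k" "b \<in> U" shows "s b \<in> topspace (total P)" "proj P (s b) = b"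
proof -
 have "openin M U" "cmap (subtop M U) (total P) s" using assms(1) by (auto simp: local_triv_def)
 thus "s b \<in> topspace (total P)" using assms(2) openin_subset by (force simp: cmap_def)
 from act_one[OF this] show "proj P (s b) = b"
  using assms by (metis local_triv_def one_closed)
qed

lemma local_triv_coord:
 assumes "local_triv M P U s k" "e \<in> topspace (total P)" "proj P e \<in> U" shows "k e \<in> carrier G" "act P (s (proj P e)) (k e) = e"
 using assms cm_carrier[of "subtop (total P) {e. proj P e \<in> U}" k e] by (auto simp: local_triv_def)

text \<open>Everything is read in a local trivialisation, where the action is right multiplication
  of the coordinate \<open>k\<close>. Existence, uniqueness and later continuity of the translation
  function come from the quotient of two coordinates.\<close>

lemma fdiv_local:
 assumes L: "local_triv M P U s k"
  and e: "e \<in> topspace (total P)" "e' \<in> topspace (total P)" "proj P e = proj P e'" "proj P e \<in> U"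
 shows "fdiv P e e' = inv (k e) \<otimes> k e'" "g \<in> carrier G ==> act P e g = e' ==> fdiv P e e' = g" "act P e (inv (k e) \<otimes> k e') = e'"
proof -
 note ke = local_triv_coord[OF L e(1,4)] and ke' = local_triv_coord[OF L e(2) e(4)[unfolded e(3)]]
 have sE: "s (proj P e) \<in> topspace (total P)" by (rule local_triv_section[OF L e(4)])
 have "act P e (inv (k e) \<otimes> k e') = act P (act P (s (proj P e)) (k e)) (inv (k e) \<otimes> k e')"
  using ke(2) by simp
 also have "\<dots> = e'"
  using act_mult[OF sE ke(1), of "inv (k e) \<otimes> k e'"] ke(1) ke' by (simp add: mult_div e(3))
 finally show a: "act P e (inv (k e) \<otimes> k e') = e'" .
 have uniq: "g = inv (k e) \<otimes> k e'" if g: "g \<in> carrier G" "act P e g = e'" for g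
 proof -
  have "act P (s (proj P e)) (k e \<otimes> g) = e'"
   using act_mult[OF sE ke(1) g(1)] ke(2) g(2) by simp
  hence "k e' = k e \<otimes> g"
   using L e(4) ke(1) g(1) unfolding local_triv_def by (metis m_closed)
  thus ?thesis
   using ke(1) g(1) by (simp add: m_assoc[symmetric])
 qed
 show f: "fdiv P e e' = inv (k e) \<otimes> k e'"
  unfolding fdiv_def by (rule the_equality) (use a uniq ke(1) ke'(1) in auto)
 show "g \<in> carrier G ==> act P e g = e' ==> fdiv P e e' = g"
  using uniq f by simp
qed

lemma fdiv:
 assumes e: "e \<in> topspace (total P)" "e' \<in> topspace (total P)" "proj P e = proj P e'"
 shows "fdiv P e e' \<in> carrier G" "act P e (fdiv P e e') = e'" "g \<in> carrier G ==> act P e g = e' ==> fdiv P e e' = g"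
proof -
 have "proj P e \<in> topspace M" using proj_cont e(1) by (auto simp: cmap_def)
 then obtain U s k where L: "proj P e \<in> U" "local_triv M P U s k" by (rule bundle_local_triv)
 note f = fdiv_local[OF L(2) e L(1)]
 show "fdiv P e e' \<in> carrier G" "act P e (fdiv P e e') = e'" "g \<in> carrier G ==> act P e g = e' ==> fdiv P e e' = g"
  using f local_triv_coord[OF L(2) e(1) L(1)] local_triv_coord[OF L(2) e(2)] L(1) e(3) by auto
qed

lemma proj_act:
 assumes e: "e \<in> topspace (total P)" "g \<in> carrier G" shows "proj P (act P e g) = proj P e"
proof -
 have "proj P e \<in> topspace M" using proj_cont e(1) by (auto simp: cmap_def)
 then obtain U s k where L: "proj P e \<in> U" "local_triv M P U s k" by (rule bundle_local_triv)
 note ke = local_triv_coord[OF L(2) e(1) L(1)]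
 have "act P e g = act P (s (proj P e)) (k e \<otimes> g)"
  using act_mult[OF local_triv_section(1)[OF L(2,1)] ke(1) e(2)] ke(2) by simp
 thus ?thesis using L ke(1) e(2) by (auto simp: local_triv_def)
qed

lemma fdiv_act:
 assumes "e \<in> topspace (total P)" "g \<in> carrier G" shows "fdiv P e (act P e g) = g"
 by (rule fdiv(3)) (use assms proj_act in auto)

lemma fdiv_act_act:
 assumes e: "e \<in> topspace (total P)" "e' \<in> topspace (total P)" "proj P e = proj P e'" "g \<in> carrier G" "h \<in> carrier G"
 shows "fdiv P (act P e g) (act P e' h) = inv g \<otimes> fdiv P e e' \<otimes> h"
proof -
 note f = fdiv[OF e(1-3)]
 show ?thesis
 proof (rule fdiv(3))
 show "act P (act P e g) (inv g \<otimes> fdiv P e e' \<otimes> h) = act P e' h"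
 proof -
  have "act P (act P e g) (inv g \<otimes> fdiv P e e' \<otimes> h) = act P e (fdiv P e e' \<otimes> h)"
   using act_mult[OF e(1,4), of "inv g \<otimes> fdiv P e e' \<otimes> h"] f(1) e(4,5)
   by (simp add: m_assoc[of "inv g"] mult_div)
  thus ?thesis
   using act_mult[OF e(1) f(1) e(5)] f(2) by simp
 qed
 show "proj P (act P e g) = proj P (act P e' h)"
  using proj_act[OF e(1,4)] proj_act[OF e(2,5)] e(3) by simp
 qed (simp_all add: e f(1))
qed

lemma continuous_map_fdiv:
 assumes f: "cmap Y (total P) f" and f': "cmap Y (total P) f'"
  and eq: "!!y. y \<in> topspace Y ==> proj P (f y) = proj P (f' y)"
 shows "cmap Y T (%y. fdiv P (f y) (f' y))"
proof (rule continuous_map_local)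
 fix y assume y: "y \<in> topspace Y"
 have fE: "z \<in> topspace Y ==> f z \<in> topspace (total P) \<and> f' z \<in> topspace (total P)" for z
  using f f' by (auto simp: cmap_def)
 have pf: "cmap Y M (%y. proj P (f y))"
  using cmap_comp[OF f proj_cont] by (simp add: o_def)
 hence "proj P (f y) \<in> topspace M" using y by (auto simp: cmap_def)
 then obtain U s k where L: "proj P (f y) \<in> U" "local_triv M P U s k" by (rule bundle_local_triv)
 let ?W = "{y \<in> topspace Y. proj P (f y) \<in> U}"
 have W: "openin Y ?W"
  using openin_cmap[OF pf] L(2) by (auto simp: local_triv_def)
 have k: "cmap (subtop (total P) {e. proj P e \<in> U}) T k"
  using L(2) by (simp add: local_triv_def)
 have "cmap (subtop Y ?W) (subtop (total P) {e. proj P e \<in> U}) f"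
   "cmap (subtop Y ?W) (subtop (total P) {e. proj P e \<in> U}) f'"
  using f f' eq by (auto simp: cmap_in_sub cmap_from_sub)
 from cmap_comp[OF this(1) k] cmap_comp[OF this(2) k]
 have "cmap (subtop Y ?W) T (%y. inv (k (f y)) \<otimes> k (f' y))"
  by (auto simp: o_def intro: cm_mult cm_inv)
 hence "cmap (subtop Y ?W) T (%y. fdiv P (f y) (f' y))"
  by (rule cmap_eq) (use fdiv_local(1)[OF L(2)] fE eq in auto)
 thus "\<exists>W. openin Y W \<and> y \<in> W \<and> cmap (subtop Y W) T (%y. fdiv P (f y) (f' y))"
  using W y L(1) by (intro exI[of _ ?W]) auto
qed

lemma atlas_exists: obtains A e where "atlas M A" "represents M P A e"
proof -
 have "\<forall>b\<in>topspace M. \<exists>U s k. b \<in> U \<and> local_triv M P U s k"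
  using bundle_local_triv by metis
 then obtain U s k where L: "!!b. b \<in> topspace M ==> b \<in> U b \<and> local_triv M P (U b) (s b) (k b)"
  by metis
 \<comment> \<open>Each point uses the local section chosen for itself, so no continuity is to be
   expected of \<open>e\<close>.\<close>
 define e where "e b = s b b" for b
 have e: "e b \<in> topspace (total P)" "proj P (e b) = b" if "b \<in> topspace M" for b
  using local_triv_section L[OF that] by (auto simp: e_def)
 have UM: "openin M (U b)" "U b \<subseteq> topspace M" if "b \<in> topspace M" for b
  using L[OF that] openin_subset by (auto simp: local_triv_def)
 have sE: "s b x \<in> topspace (total P)" "proj P (s b x) = x" if "b \<in> topspace M" "x \<in> U b" for b x
  using local_triv_section L[OF that(1)] that(2) by auto
 define t where "t b x = (if x \<in> U b then fdiv P (e x) (s b x) else \<one>)" for b x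
 have eq: "proj P (e x) = proj P (s b x)" if "b \<in> topspace M" "x \<in> U b" for b x
  using e(2) sE(2)[OF that] UM(2) that by auto
 have tc: "t b x \<in> carrier G" if "b \<in> topspace M" for b x
  using fdiv(1)[of "e x" "s b x"] e(1)[of x] sE[OF that, of x] UM(2)[OF that] eq[OF that, of x] by (auto simp: t_def)
 have ts: "act P (e x) (t b x) = s b x" if "b \<in> topspace M" "x \<in> U b" for b x
  using fdiv(2)[of "e x" "s b x"] e(1)[of x] sE[OF that] UM(2)[OF that(1)] eq[OF that] that by (auto simp: t_def)
 define A where "A = (%b. (U b, t b)) ` topspace M"
 have sc: "cmap (subtop M (U b)) (total P) (s b)" if "b \<in> topspace M" for b
  using L[OF that] by (simp add: local_triv_def)
 have "atlas M A"
  unfolding atlas_def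
 proof (intro conjI)
  show "\<forall>(U, t)\<in>A. openin M U \<and> (\<forall>x. t x \<in> carrier G)"
   using UM(1) tc by (auto simp: A_def)
  show "\<forall>x\<in>topspace M. \<exists>(U, t)\<in>A. x \<in> U"
   using L by (auto simp: A_def)
  have "cmap (subtop M (U b \<inter> U c)) T (%x. inv (t b x) \<otimes> t c x)" if b: "b \<in> topspace M" and c: "c \<in> topspace M" for b c
  proof -
   have "cmap (subtop M (U b \<inter> U c)) T (%x. fdiv P (s b x) (s c x))"
    using sE b c cmap_from_sub[OF sc[OF b], of "U c"] cmap_from_sub[OF sc[OF c], of "U b"]
    by (intro continuous_map_fdiv) (auto simp: subtop_subtop Int_commute)
   thus ?thesis
   proof (rule cmap_eq)
    fix x assume x: "x \<in> topspace (subtop M (U b \<inter> U c))"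
    hence "fdiv P (act P (e x) (t b x)) (act P (e x) (t c x)) = inv (t b x) \<otimes> fdiv P (e x) (e x) \<otimes> t c x"
     by (intro fdiv_act_act tc b c e) auto
    moreover have "fdiv P (e x) (e x) = \<one>"
     using fdiv(3)[of "e x" "e x" \<one>] e[of x] act_one x by auto
    ultimately show "fdiv P (s b x) (s c x) = inv (t b x) \<otimes> t c x"
     using ts[of b x] ts[of c x] tc b c x by simp
   qed
  qed
  thus "\<forall>(U, t)\<in>A. \<forall>(U', t')\<in>A. cmap (subtop M (U \<inter> U')) T (%x. inv (t x) \<otimes> t' x)"
   by (auto simp: A_def)
 qed
 moreover have "cmap (subtop M (U b)) (total P) (%x. act P (e x) (t b x))" if "b \<in> topspace M" for b
  by (rule cmap_eq[OF sc[OF that]]) (use ts that in auto)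
 hence "represents M P A e"
  using e unfolding represents_def by (auto simp: A_def)
 ultimately show thesis by (rule that)
qed

end

end

section \<open>Isomorphisms of atlases and equivalence of bundles\<close>

context structure_group begin

lemma atlas_isoD:
 assumes "atlas_iso M A A' h"
 shows atlas_iso_carrier: "h x \<in> carrier G"
  and atlas_iso_cont: "[|(U, t) \<in> A; (U', t') \<in> A'|] ==> cmap (subtop M (U \<inter> U')) T (%x. inv (t' x) \<otimes> h x \<otimes> t x)"
 using assms by (auto simp: atlas_iso_def)

lemma atlas_isoI:
 assumes "!!x. h x \<in> carrier G"
  and "!!U t U' t'. [|(U, t) \<in> A; (U', t') \<in> A'|] ==> cmap (subtop M (U \<inter> U')) T (%x. inv (t' x) \<otimes> h x \<otimes> t x)"
 shows "atlas_iso M A A' h"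
 using assms by (auto simp: atlas_iso_def)

lemma atlas_iso_refl:
 assumes at: "atlas M A" shows "atlas_iso M A A (%_. \<one>)"
proof (rule atlas_isoI)
 fix U t U' t' assume U: "(U, t) \<in> A" and U': "(U', t') \<in> A"
 thus "cmap (subtop M (U \<inter> U')) T (%x. inv (t' x) \<otimes> \<one> \<otimes> t x)"
  using atlas_transition[OF at U' U] atlas_carrier[OF at U'] by (simp add: Int_commute)
qed simp

lemma atlas_iso_sym:
 assumes at: "atlas M A" and at': "atlas M A'" and h: "atlas_iso M A A' h" shows "atlas_iso M A' A (%x. inv (h x))"
proof (rule atlas_isoI)
 fix U t U' t' assume U: "(U, t) \<in> A'" and U': "(U', t') \<in> A"
 have "cmap (subtop M (U \<inter> U')) T (%x. inv (inv (t x) \<otimes> h x \<otimes> t' x))"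
  using cm_inv[OF atlas_iso_cont[OF h U' U]] by (simp add: Int_commute)
 thus "cmap (subtop M (U \<inter> U')) T (%x. inv (t' x) \<otimes> inv (h x) \<otimes> t x)"
  by (rule cmap_eq)
   (use atlas_carrier[OF at U'] atlas_carrier[OF at' U] atlas_iso_carrier[OF h] in \<open>simp add: inv_mult_group m_assoc\<close>)
qed (simp add: atlas_iso_carrier[OF h])

lemma sect_iso:
 assumes at: "atlas M A" and at': "atlas M A'" and h: "atlas_iso M A A' h" and s: "sect M A Y u s"
 shows "sect M A' Y u (%y. h (u y) \<otimes> s y)"
proof (rule sect_coverI[OF at' sect_continuous[OF s]])
 fix y assume y: "y \<in> topspace Y"
 note u = sect_continuous[OF s]
 have \<sigma>y: "u y \<in> topspace M" by (rule continuous_map_image_in[OF u y])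
 obtain U t where U: "(U, t) \<in> A" "u y \<in> U" by (rule atlas_cover[OF at \<sigma>y])
 obtain U' t' where U': "(U', t') \<in> A'" "u y \<in> U'" by (rule atlas_cover[OF at' \<sigma>y])
 let ?W = "{y \<in> topspace Y. u y \<in> U} \<inter> {y \<in> topspace Y. u y \<in> U'}"
 have W: "openin Y ?W"
  using openin_chart_preimage[OF at U(1) u] openin_chart_preimage[OF at' U'(1) u] by (rule openin_Int)
 have "cmap (subtop Y ?W) (subtop M (U \<inter> U')) u"
  using u by (auto simp: cmap_in_sub cmap_from_sub)
 from cmap_comp2[OF this atlas_iso_cont[OF h U(1) U'(1)]]
 have 1: "cmap (subtop Y ?W) T (%y. inv (t' (u y)) \<otimes> h (u y) \<otimes> t (u y))" .
 have eq: "subtop Y ?W = subtop (subtop Y {y. u y \<in> U}) {y \<in> topspace Y. u y \<in> U'}"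
  unfolding subtop_subtop by (rule arg_cong[where f = "subtop Y"]) auto
 have "cmap (subtop Y ?W) T (%y. inv (t (u y)) \<otimes> s y)"
  unfolding eq by (rule cmap_from_sub[OF sect_chartD[OF s U(1)]])
 from cm_mult[OF 1 this]
 have "cmap (subtop Y ?W) T (%y. inv (t' (u y)) \<otimes> (h (u y) \<otimes> s y))"
  by (rule cmap_eq)
   (use atlas_carrier[OF at U(1)] atlas_carrier[OF at' U'(1)] atlas_iso_carrier[OF h] sect_carrier[OF s] in \<open>simp add: m_assoc mult_div\<close>)
 thus "\<exists>W U t. openin Y W \<and> y \<in> W \<and> (U, t) \<in> A' \<and> u ` W \<subseteq> U \<and>
    cmap (subtop Y W) T (%y. inv (t (u y)) \<otimes> (h (u y) \<otimes> s y))"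
  using W y U(2) U' by (intro exI[of _ ?W] exI[of _ U'] exI[of _ t']) auto
 show "h (u y) \<otimes> s y \<in> carrier G"
  using sect_carrier[OF s y] atlas_iso_carrier[OF h] by simp
qed

text \<open>Chart coordinates are themselves sections over their domains, so it is enough that
  \<open>h\<close> takes these to sections.\<close>

lemma atlas_iso_sectI:
 assumes at': "atlas M A'" and h: "!!x. h x \<in> carrier G"
  and s: "!!U t. (U, t) \<in> A ==> sect M A' (subtop M U) (%x. x) (%x. h x \<otimes> t x)"
  and t: "!!U t x. (U, t) \<in> A ==> t x \<in> carrier G"
 shows "atlas_iso M A A' h"
proof (rule atlas_isoI)
 fix U t U' t' assume U: "(U, t) \<in> A" and U': "(U', t') \<in> A'"
 have "cmap (subtop M (U \<inter> U')) T (%x. inv (t' x) \<otimes> (h x \<otimes> t x))"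
  using sect_chartD[OF s[OF U] U'] by (simp add: subtop_subtop)
 thus "cmap (subtop M (U \<inter> U')) T (%x. inv (t' x) \<otimes> h x \<otimes> t x)"
  by (rule cmap_eq) (use t[OF U] h atlas_carrier[OF at' U'] in \<open>simp add: m_assoc\<close>)
qed (rule h)

lemma atlas_iso_trans:
 assumes at: "atlas M A" and at': "atlas M A'" and at'': "atlas M A''"
  and h: "atlas_iso M A A' h" and h': "atlas_iso M A' A'' h'"
 shows "atlas_iso M A A'' (%x. h' x \<otimes> h x)"
proof (rule atlas_iso_sectI[OF at''])
 fix U t assume U: "(U, t) \<in> A"
 have "sect M A (subtop M U) (%x. x) t"
  by (rule sect_chart[OF at U]) auto
 from sect_iso[OF at' at'' h' sect_iso[OF at at' h this]]
 show "sect M A'' (subtop M U) (%x. x) (%x. h' x \<otimes> h x \<otimes> t x)"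
  by (rule sect_cong) (simp_all add: m_assoc atlas_iso_carrier[OF h] atlas_iso_carrier[OF h'] atlas_carrier[OF at U])
qed (use atlas_iso_carrier[OF h] atlas_iso_carrier[OF h'] atlas_carrier[OF at] in auto)

lemma representsD:
 assumes "represents M P A e"
 shows "b \<in> topspace M ==> e b \<in> topspace (total P)" "b \<in> topspace M ==> proj P (e b) = b"
  "(U, t) \<in> A ==> cmap (subtop M U) (total P) (%b. act P (e b) (t b))"
 using assms by (auto simp: represents_def)

text \<open>In coordinates the equivalence is left multiplication by the quotient, in the fibre, of
  the image of \<open>e b\<close> by \<open>e' b\<close>.\<close>

lemma equivalent_imp_iso:
 assumes P: "principal_bundle G T M P" and Q: "principal_bundle G T M Q"
  and at: "atlas M A" and at': "atlas M A'" and e: "represents M P A e" and e': "represents M Q A' e'"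
  and eqv: "bundle_equivalent G P Q"
 obtains h where "atlas_iso M A A' h"
proof -
 obtain H where "homeomorphic_map (total P) (total Q) H"
  and pH: "!!x. x \<in> topspace (total P) ==> proj Q (H x) = proj P x"
  and aH: "!!x g. [|x \<in> topspace (total P); g \<in> carrier G|] ==> H (act P x g) = act Q (H x) g"
  using eqv unfolding bundle_equivalent_def by blast
 hence H: "cmap (total P) (total Q) H"
  using homeomorphic_imp_continuous_map by blast
 note eD = representsD[OF e] and eD' = representsD[OF e']
 define h where "h b = (if b \<in> topspace M then fdiv Q (e' b) (H (e b)) else \<one>)" for b
 have c: "H (e b) \<in> topspace (total Q)" "proj Q (e' b) = proj Q (H (e b))" if "b \<in> topspace M" for b
  using continuous_map_image_in[OF H] pH eD(1,2) eD'(2) that by auto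
 have "atlas_iso M A A' h"
 proof (rule atlas_isoI)
  show "h b \<in> carrier G" for b
   using fdiv(1)[OF Q eD'(1) c] by (simp add: h_def)
  fix U t U' t' assume U: "(U, t) \<in> A" and U': "(U', t') \<in> A'"
  have tc: "t x \<in> carrier G" "t' x \<in> carrier G" for x
   using atlas_carrier[OF at U] atlas_carrier[OF at' U'] by auto
  have "cmap (subtop M (U \<inter> U')) (total Q) (%b. H (act P (e b) (t b)))"
   using cmap_from_sub[OF cmap_comp2[OF eD(3)[OF U] H], of U'] by (simp add: subtop_subtop)
  moreover have "cmap (subtop M (U \<inter> U')) (total Q) (%b. act Q (e' b) (t' b))"
   using cmap_from_sub[OF eD'(3)[OF U'], of U] by (simp add: subtop_subtop Int_commute)
  ultimately have "cmap (subtop M (U \<inter> U')) T (%b. fdiv Q (act Q (e' b) (t' b)) (H (act P (e b) (t b))))"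
   using eD eD' tc by (intro continuous_map_fdiv[OF Q]) (auto simp: pH proj_act[OF P] proj_act[OF Q] act_closed[OF P])
  thus "cmap (subtop M (U \<inter> U')) T (%b. inv (t' b) \<otimes> h b \<otimes> t b)"
  proof (rule cmap_eq)
   fix b assume "b \<in> topspace (subtop M (U \<inter> U'))"
   hence b: "b \<in> topspace M" by simp
   show "fdiv Q (act Q (e' b) (t' b)) (H (act P (e b) (t b))) = inv (t' b) \<otimes> h b \<otimes> t b"
    using fdiv_act_act[OF Q eD'(1)[OF b] c[OF b] tc(2) tc(1)] b by (simp add: aH eD(1) tc h_def)
  qed
 qed
 thus thesis by (rule that)
qed

text \<open>The passage back from atlases to bundles: a point is read as its coordinate over the
  first reference section, multiplied by \<open>h\<close> from the left, and realised over the
  second reference section.\<close>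

definition iso_map :: "('e, 'a, 'm) gbundle => ('f, 'a, 'm) gbundle => ('m => 'e) => ('m => 'f) => ('m => 'a) => 'e => 'f" where
 "iso_map P Q e e' h x = act Q (e' (proj P x)) (h (proj P x) \<otimes> fdiv P (e (proj P x)) x)"

context
 fixes P :: "('e, 'a, 'm) gbundle" and Q :: "('f, 'a, 'm) gbundle" and M \<T> \<T>' e e' h
 assumes P: "principal_bundle G T M P" and Q: "principal_bundle G T M Q"
  and at: "atlas M \<T>" and at': "atlas M \<T>'" and e: "represents M P \<T> e" and e': "represents M Q \<T>' e'"
  and h: "atlas_iso M \<T> \<T>' h"
begin

lemma proj_in: "x \<in> topspace (total P) ==> proj P x \<in> topspace M"
 using continuous_map_image_in[OF proj_cont[OF P]] .

lemma fdiv_base: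
 assumes "x \<in> topspace (total P)"
 shows "fdiv P (e (proj P x)) x \<in> carrier G" "act P (e (proj P x)) (fdiv P (e (proj P x)) x) = x"
 using fdiv(1,2)[OF P representsD(1)[OF e proj_in[OF assms]] assms] representsD(2)[OF e proj_in[OF assms]] by auto

lemma iso_map_closed:
 assumes "x \<in> topspace (total P)"
 shows "iso_map P Q e e' h x \<in> topspace (total Q)" "proj Q (iso_map P Q e e' h x) = proj P x"
  "fdiv Q (e' (proj P x)) (iso_map P Q e e' h x) = h (proj P x) \<otimes> fdiv P (e (proj P x)) x"
 using fdiv_base(1)[OF assms] representsD(1,2)[OF e' proj_in[OF assms]] atlas_iso_carrier[OF h]
 by (auto simp: iso_map_def act_closed[OF Q] proj_act[OF Q] fdiv_act[OF Q])

lemma iso_map_act: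
 assumes x: "x \<in> topspace (total P)" "g \<in> carrier G"
 shows "iso_map P Q e e' h (act P x g) = act Q (iso_map P Q e e' h x) g"
proof -
 let ?b = "proj P x"
 have b: "?b \<in> topspace M" by (rule proj_in[OF x(1)])
 note f = fdiv_base(1)[OF x(1)]
 have eb: "e ?b \<in> topspace (total P)" "proj P (e ?b) = ?b" "e' ?b \<in> topspace (total Q)"
  using representsD[OF e] representsD[OF e'] b by auto
 have "fdiv P (e ?b) (act P x g) = fdiv P (e ?b) x \<otimes> g"
  using fdiv_act_act[OF P eb(1) x(1) eb(2) one_closed x(2)] act_one[OF P eb(1)] f x(2) by simp
 thus ?thesis
  using act_mult[OF Q eb(3), of "h ?b \<otimes> fdiv P (e ?b) x" g] f x atlas_iso_carrier[OF h]
  by (simp add: iso_map_def proj_act[OF P] m_assoc)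
qed

lemma continuous_iso_map: "cmap (total P) (total Q) (iso_map P Q e e' h)"
proof (rule continuous_map_local)
 fix x assume x: "x \<in> topspace (total P)"
 obtain U t where U: "(U, t) \<in> \<T>" "proj P x \<in> U" by (rule atlas_cover[OF at proj_in[OF x]])
 obtain U' t' where U': "(U', t') \<in> \<T>'" "proj P x \<in> U'" by (rule atlas_cover[OF at' proj_in[OF x]])
 let ?W = "{y \<in> topspace (total P). proj P y \<in> U \<inter> U'}"
 have W: "openin (total P) ?W"
  by (rule openin_cmap[OF proj_cont[OF P]]) (use atlas_open[OF at U(1)] atlas_open[OF at' U'(1)] in auto)
 have tc: "t x \<in> carrier G" "t' x \<in> carrier G" for x
  using atlas_carrier[OF at U(1)] atlas_carrier[OF at' U'(1)] by auto
 have p: "cmap (subtop (total P) ?W) (subtop M V) (proj P)" if "U \<inter> U' \<subseteq> V" for V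
  using proj_cont[OF P] that by (auto simp: cmap_in_sub cmap_from_sub)
 have 1: "cmap (subtop (total P) ?W) (total Q) (%y. act Q (e' (proj P y)) (t' (proj P y)))"
  by (rule cmap_comp2[OF p representsD(3)[OF e' U'(1)]]) auto
 have 2: "cmap (subtop (total P) ?W) (total P) (%y. act P (e (proj P y)) (t (proj P y)))"
  by (rule cmap_comp2[OF p representsD(3)[OF e U(1)]]) auto
 have 3: "cmap (subtop (total P) ?W) T (%y. inv (t' (proj P y)) \<otimes> h (proj P y) \<otimes> t (proj P y))"
  by (rule cmap_comp2[OF p atlas_iso_cont[OF h U(1) U'(1)]]) auto
 have 4: "cmap (subtop (total P) ?W) T (%y. fdiv P (act P (e (proj P y)) (t (proj P y))) y)"
  by (rule continuous_map_fdiv[OF P 2])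
   (use representsD[OF e] tc proj_in in \<open>auto simp: proj_act[OF P] cmap_from_sub\<close>)
 \<comment> \<open>Inserting the chart coordinates \<open>t\<close> and \<open>t'\<close> and their
   inverses splits an expression with discontinuous parts into continuous factors.\<close>
 have "cmap (subtop (total P) ?W) (total Q)
   (%y. act Q (act Q (e' (proj P y)) (t' (proj P y))) (inv (t' (proj P y)) \<otimes> h (proj P y) \<otimes> t (proj P y) \<otimes> fdiv P (act P (e (proj P y)) (t (proj P y))) y))"
  by (rule act_continuous[OF act_cont[OF Q] 1 cm_mult[OF 3 4]])
 hence "cmap (subtop (total P) ?W) (total Q) (iso_map P Q e e' h)"
 proof (rule cmap_eq)
  fix y assume "y \<in> topspace (subtop (total P) ?W)"
  hence y: "y \<in> topspace (total P)" by simp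
  let ?b = "proj P y"
  have eb: "e ?b \<in> topspace (total P)" "proj P (e ?b) = ?b" "e' ?b \<in> topspace (total Q)"
   using representsD[OF e] representsD[OF e'] proj_in[OF y] by auto
  note f = fdiv_base(1)[OF y]
  have "fdiv P (act P (e ?b) (t ?b)) y = inv (t ?b) \<otimes> fdiv P (e ?b) y"
   using fdiv_act_act[OF P eb(1) y eb(2) tc(1) one_closed] act_one[OF P y] f tc by simp
  thus "act Q (act Q (e' ?b) (t' ?b)) (inv (t' ?b) \<otimes> h ?b \<otimes> t ?b \<otimes> fdiv P (act P (e ?b) (t ?b)) y) = iso_map P Q e e' h y"
   using f tc eb atlas_iso_carrier[OF h] by (simp add: iso_map_def act_mult[OF Q] m_assoc mult_div)
 qed
 thus "\<exists>W. openin (total P) W \<and> x \<in> W \<and> cmap (subtop (total P) W) (total Q) (iso_map P Q e e' h)"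
  using W x U(2) U'(2) by (intro exI[of _ ?W]) auto
qed

end

lemma iso_imp_equivalent:
 assumes P: "principal_bundle G T M P" and Q: "principal_bundle G T M Q"
  and at: "atlas M H" and at': "atlas M H'" and e: "represents M P H e" and e': "represents M Q H' e'"
  and h: "atlas_iso M H H' h"
 shows "bundle_equivalent G P Q"
proof -
 let ?h = "%x. inv (h x)"
 note A = P Q at at' e e' h
 note B = Q P at' at e' e atlas_iso_sym[OF at at' h]
 have "iso_map Q P e' e ?h (iso_map P Q e e' h x) = x" if x: "x \<in> topspace (total P)" for x
  unfolding iso_map_def[of Q P]
  using iso_map_closed[OF A x] fdiv_base[OF A x] atlas_iso_carrier[OF h] by (simp add: m_assoc[symmetric])
 moreover have "iso_map P Q e e' h (iso_map Q P e' e ?h x) = x" if x: "x \<in> topspace (total Q)" for x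
  unfolding iso_map_def[of P Q]
  using iso_map_closed[OF B x] fdiv_base[OF B x] atlas_iso_carrier[OF h] by (simp add: m_assoc[symmetric])
 ultimately have "homeomorphic_maps (total P) (total Q) (iso_map P Q e e' h) (iso_map Q P e' e ?h)"
  using continuous_iso_map[OF A] continuous_iso_map[OF B] by (auto simp: homeomorphic_maps_def)
 hence "homeomorphic_map (total P) (total Q) (iso_map P Q e e' h)"
  using homeomorphic_map_maps by blast
 thus ?thesis
  unfolding bundle_equivalent_def using iso_map_closed(2)[OF A] iso_map_act[OF A] by blast
qed

text \<open>As a set the total space is the product, and the second component is the coordinate over
  the reference section. That section is discontinuous, so in place of the product topology the
  final topology for the chart maps is used.\<close>

definition atlas_bundle :: "'m topology => ('m set \<times> ('m => 'a)) set => ('m \<times> 'a, 'a, 'm) gbundle" where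
 "atlas_bundle M A = \<lparr>total = topology (%W. W \<subseteq> topspace M \<times> carrier G \<and>
    (\<forall>(U, t)\<in>A. openin (prod_topology (subtop M U) T) {p \<in> (topspace M \<inter> U) \<times> carrier G. (fst p, t (fst p) \<otimes> snd p) \<in> W})),
   act = (%(b, g) h. (b, g \<otimes> h)), proj = fst\<rparr>"

lemma openin_atlas_bundle:
 "openin (total (atlas_bundle M A)) W \<longleftrightarrow> W \<subseteq> topspace M \<times> carrier G \<and>
    (\<forall>(U, t)\<in>A. openin (prod_topology (subtop M U) T) {p \<in> (topspace M \<inter> U) \<times> carrier G. (fst p, t (fst p) \<otimes> snd p) \<in> W})"
proof -
 let ?S = "%U t W. {p \<in> (topspace M \<inter> U) \<times> carrier G. (fst p, t (fst p) \<otimes> snd p) \<in> W}"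
 have 1: "?S U t (V \<inter> W) = ?S U t V \<inter> ?S U t W" "?S U t (\<Union>\<K>) = (\<Union>W\<in>\<K>. ?S U t W)" for U t V W \<K> by auto
 have "istopology (%W. W \<subseteq> topspace M \<times> carrier G \<and> (\<forall>(U, t)\<in>A. openin (prod_topology (subtop M U) T) (?S U t W)))"
  unfolding istopology_def 1 by (auto simp: split_def intro!: openin_Int openin_Union)
 from topology_inverse'[OF this] show ?thesis
  by (simp add: atlas_bundle_def)
qed

context
 fixes M :: "'m topology" and \<T>
 assumes at: "atlas M \<T>"
begin

lemma top_atlas_bundle: "topspace (total (atlas_bundle M \<T>)) = topspace M \<times> carrier G"
proof -
 have "openin (total (atlas_bundle M \<T>)) (topspace M \<times> carrier G)"
 proof -
  have "openin (prod_topology (subtop M U) T) {p \<in> (topspace M \<inter> U) \<times> carrier G. (fst p, t (fst p) \<otimes> snd p) \<in> topspace M \<times> carrier G}"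
   if "(U, t) \<in> \<T>" for U t
  proof -
   have "{p \<in> (topspace M \<inter> U) \<times> carrier G. (fst p, t (fst p) \<otimes> snd p) \<in> topspace M \<times> carrier G} = topspace (prod_topology (subtop M U) T)"
    using atlas_carrier[OF at that] by (auto simp: topspace_eq)
   thus ?thesis by (simp only: openin_topspace)
  qed
  thus ?thesis
   unfolding openin_atlas_bundle by blast
 qed
 hence "topspace M \<times> carrier G \<subseteq> topspace (total (atlas_bundle M \<T>))"
  by (rule openin_subset)
 moreover have "topspace (total (atlas_bundle M \<T>)) \<subseteq> topspace M \<times> carrier G"
  using openin_topspace[of "total (atlas_bundle M \<T>)"] unfolding openin_atlas_bundle by blast
 ultimately show ?thesis by blast
qed

lemma act_atlas_bundle [simp]: "act (atlas_bundle M \<T>) (b, g) h = (b, g \<otimes> h)"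
 and proj_atlas_bundle [simp]: "proj (atlas_bundle M \<T>) = fst"
 by (simp_all add: atlas_bundle_def)

lemma chart_continuous:
 assumes U: "(U, t) \<in> \<T>"
 shows "cmap (prod_topology (subtop M U) T) (total (atlas_bundle M \<T>)) (%p. (fst p, t (fst p) \<otimes> snd p))"
 unfolding continuous_map top_atlas_bundle
proof (intro conjI allI impI)
 show "(%p. (fst p, t (fst p) \<otimes> snd p)) ` topspace (prod_topology (subtop M U) T) \<subseteq> topspace M \<times> carrier G"
  using atlas_carrier[OF at U] by (auto simp: topspace_eq)
 fix W assume "openin (total (atlas_bundle M \<T>)) W"
 hence "openin (prod_topology (subtop M U) T) {p \<in> (topspace M \<inter> U) \<times> carrier G. (fst p, t (fst p) \<otimes> snd p) \<in> W}"
  unfolding openin_atlas_bundle using U by auto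
 thus "openin (prod_topology (subtop M U) T) {p \<in> topspace (prod_topology (subtop M U) T). (fst p, t (fst p) \<otimes> snd p) \<in> W}"
  by (simp add: topspace_eq)
qed

lemma proj_atlas_bundle_continuous: "cmap (total (atlas_bundle M \<T>)) M fst"
 unfolding continuous_map top_atlas_bundle
proof (intro conjI allI impI)
 fix V assume V: "openin M V"
 have "openin (prod_topology (subtop M U) T) {p \<in> (topspace M \<inter> U) \<times> carrier G. (fst p, t (fst p) \<otimes> snd p) \<in> {x \<in> topspace M \<times> carrier G. fst x \<in> V}}"
  if U: "(U, t) \<in> \<T>" for U t
 proof -
  have "{p \<in> (topspace M \<inter> U) \<times> carrier G. (fst p, t (fst p) \<otimes> snd p) \<in> {x \<in> topspace M \<times> carrier G. fst x \<in> V}} = (U \<inter> V) \<times> carrier G"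
   using atlas_carrier[OF at U] openin_subset[OF V] by auto
  moreover have "openin (subtop M U) (U \<inter> V)"
   using V by (rule openin_subtopology_Int2)
  ultimately show ?thesis
   using openin_topspace[of T] by (simp add: openin_prod_Times_iff topspace_eq)
 qed
 thus "openin (total (atlas_bundle M \<T>)) {x \<in> topspace M \<times> carrier G. fst x \<in> V}"
  unfolding openin_atlas_bundle by auto
qed auto

text \<open>Openness in the total space is tested in every chart, and in another chart the
  coordinate differs by a continuous transition function.\<close>

lemma coord_atlas_bundle_continuous:
 assumes U: "(U, t) \<in> \<T>"
 shows "cmap (subtop (total (atlas_bundle M \<T>)) {p. fst p \<in> U}) T (%p. inv (t (fst p)) \<otimes> snd p)"
 unfolding continuous_map
proof (intro conjI allI impI)
 let ?E = "subtop (total (atlas_bundle M \<T>)) {p. fst p \<in> U}"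
 show "(%p. inv (t (fst p)) \<otimes> snd p) ` topspace ?E \<subseteq> topspace T"
  using atlas_carrier[OF at U] by (auto simp: topspace_eq top_atlas_bundle)
 fix N assume N: "openin T N"
 let ?B = "{x \<in> topspace M \<times> carrier G. fst x \<in> U \<and> inv (t (fst x)) \<otimes> snd x \<in> N}"
 have "openin (prod_topology (subtop M U') T) {p \<in> (topspace M \<inter> U') \<times> carrier G. (fst p, t' (fst p) \<otimes> snd p) \<in> ?B}"
  if U': "(U', t') \<in> \<T>" for U' t'
 proof -
  let ?P = "prod_topology (subtop M (U \<inter> U')) T"
  have "cmap ?P T (%p. inv (t (fst p)) \<otimes> t' (fst p) \<otimes> snd p)"
   by (intro cm_mult[OF cmap_comp2[OF continuous_map_fst atlas_transition[OF at U U']] continuous_map_snd])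
  from openin_cmap[OF this N]
  have 1: "openin ?P {p \<in> topspace ?P. inv (t (fst p)) \<otimes> t' (fst p) \<otimes> snd p \<in> N}" .
  have eq: "?P = subtop (prod_topology (subtop M U') T) (U \<times> UNIV)"
   unfolding prod_topology_subtopology subtop_subtop by (rule arg_cong[where f = "subtop _"]) auto
  have 2: "openin (prod_topology (subtop M U') T) ((U \<inter> U') \<times> carrier G)"
   using openin_subtopology_Int[OF atlas_open[OF at U], of U'] openin_topspace[of T] by (simp add: openin_prod_Times_iff topspace_eq)
  have "{p \<in> (topspace M \<inter> U') \<times> carrier G. (fst p, t' (fst p) \<otimes> snd p) \<in> ?B} = {p \<in> topspace ?P. inv (t (fst p)) \<otimes> t' (fst p) \<otimes> snd p \<in> N}"
   using atlas_carrier[OF at U] atlas_carrier[OF at U'] by (auto simp: topspace_eq m_assoc)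
  moreover have "openin (prod_topology (subtop M U') T) {p \<in> topspace ?P. inv (t (fst p)) \<otimes> t' (fst p) \<otimes> snd p \<in> N}"
  proof -
   obtain S where S: "openin (prod_topology (subtop M U') T) S" "{p \<in> topspace ?P. inv (t (fst p)) \<otimes> t' (fst p) \<otimes> snd p \<in> N} = S \<inter> (U \<times> UNIV)"
    using 1 unfolding eq openin_subtopology by blast
   have "S \<inter> (U \<times> UNIV) = S \<inter> ((U \<inter> U') \<times> carrier G)"
    using openin_subset[OF S(1)] by (auto simp: topspace_eq)
   thus ?thesis
    using openin_Int[OF S(1) 2] S(2) by simp
  qed
  ultimately show ?thesis by simp
 qed
 hence "openin (total (atlas_bundle M \<T>)) ?B"
  unfolding openin_atlas_bundle by auto
 hence "openin ?E ({p. fst p \<in> U} \<inter> ?B)"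
  by (rule openin_subtopology_Int2)
 moreover have "{p. fst p \<in> U} \<inter> ?B = {x \<in> topspace ?E. inv (t (fst x)) \<otimes> snd x \<in> N}"
  by (auto simp: top_atlas_bundle)
 ultimately show "openin ?E {x \<in> topspace ?E. inv (t (fst x)) \<otimes> snd x \<in> N}" by simp
qed

lemma principal_atlas_bundle: "principal_bundle G T M (atlas_bundle M \<T>)"
proof (rule principal_bundleI)
 let ?E = "total (atlas_bundle M \<T>)"
 show "cmap (prod_topology ?E T) ?E (%(e, g). act (atlas_bundle M \<T>) e g)"
 proof (rule continuous_map_local)
  fix y assume y: "y \<in> topspace (prod_topology ?E T)"
  hence "fst (fst y) \<in> topspace M" by (auto simp: top_atlas_bundle)
  then obtain U t where U: "(U, t) \<in> \<T>" "fst (fst y) \<in> U" by (rule atlas_cover[OF at])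
  let ?W = "{y \<in> topspace (prod_topology ?E T). fst (fst y) \<in> U}"
  have f: "cmap (prod_topology ?E T) M (%y. fst (fst y))"
   by (rule cmap_comp2[OF continuous_map_fst proj_atlas_bundle_continuous])
  have W: "openin (prod_topology ?E T) ?W"
   by (rule openin_cmap[OF f atlas_open[OF at U(1)]])
  have 1: "cmap (subtop (prod_topology ?E T) ?W) (subtop M U) (%y. fst (fst y))"
   using f by (auto simp: cmap_in_sub cmap_from_sub)
  have 2: "cmap (subtop (prod_topology ?E T) ?W) (subtop ?E {p. fst p \<in> U}) fst"
   by (auto simp: cmap_in_sub intro!: cmap_from_sub continuous_map_fst)
  have 3: "cmap (subtop (prod_topology ?E T) ?W) T snd"
   by (intro cmap_from_sub continuous_map_snd)
  from cmap_comp2[OF continuous_map_pairedI[OF 1 cm_mult[OF cmap_comp2[OF 2 coord_atlas_bundle_continuous[OF U(1)]] 3]] chart_continuous[OF U(1)]]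
  have "cmap (subtop (prod_topology ?E T) ?W) ?E (%(e, g). act (atlas_bundle M \<T>) e g)"
   by (rule cmap_eq)
    (use atlas_carrier[OF at U(1)] in \<open>auto simp: top_atlas_bundle topspace_eq m_assoc mult_div\<close>)
  thus "\<exists>W. openin (prod_topology ?E T) W \<and> y \<in> W \<and> cmap (subtop (prod_topology ?E T) W) ?E (%(e, g). act (atlas_bundle M \<T>) e g)"
   using W y U(2) by (intro exI[of _ ?W]) auto
 qed
 show "act (atlas_bundle M \<T>) e \<one> = e" if "e \<in> topspace ?E" for e
  using that by (auto simp: top_atlas_bundle)
 show "act (atlas_bundle M \<T>) e (g \<otimes> h) = act (atlas_bundle M \<T>) (act (atlas_bundle M \<T>) e g) h"
  if "e \<in> topspace ?E" "g \<in> carrier G" "h \<in> carrier G" for e g h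
  using that by (auto simp: top_atlas_bundle m_assoc)
 show "cmap ?E M (proj (atlas_bundle M \<T>))"
  using proj_atlas_bundle_continuous by simp
 show "\<exists>U s k. b \<in> U \<and> local_triv M (atlas_bundle M \<T>) U s k" if b: "b \<in> topspace M" for b
 proof -
  obtain U t where U: "(U, t) \<in> \<T>" "b \<in> U" by (rule atlas_cover[OF at b])
  have "cmap (subtop M U) (prod_topology (subtop M U) T) (%b. (b, \<one>))"
   by (intro continuous_map_pairedI cm_const) auto
  from cmap_comp2[OF this chart_continuous[OF U(1)]]
  have "cmap (subtop M U) ?E (%b. (b, t b))"
   using atlas_carrier[OF at U(1)] by simp
  hence "local_triv M (atlas_bundle M \<T>) U (%b. (b, t b)) (%p. inv (t (fst p)) \<otimes> snd p)"
   unfolding local_triv_def using atlas_open[OF at U(1)] coord_atlas_bundle_continuous[OF U(1)] atlas_carrier[OF at U(1)]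
   by (auto simp: top_atlas_bundle mult_div m_assoc[symmetric])
  thus ?thesis using U(2) by blast
 qed
qed

lemma represents_atlas_bundle: "represents M (atlas_bundle M \<T>) \<T> (%b. (b, \<one>))"
proof -
 have "cmap (subtop M U) (total (atlas_bundle M \<T>)) (%b. (b, t b))" if U: "(U, t) \<in> \<T>" for U t
 proof -
  have "cmap (subtop M U) (prod_topology (subtop M U) T) (%b. (b, \<one>))"
   by (intro continuous_map_pairedI cm_const) auto
  from cmap_comp2[OF this chart_continuous[OF U]] show ?thesis
   using atlas_carrier[OF at U] by simp
 qed
 thus ?thesis
  unfolding represents_def using atlas_carrier[OF at] by (auto simp: top_atlas_bundle)
qed

end

definition trivial_atlas :: "'m topology => ('m set \<times> ('m => 'a)) set" where
 "trivial_atlas M = {(topspace M, %_. \<one>)}"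

lemma atlas_trivial: "atlas M (trivial_atlas M)"
 by (auto simp: atlas_def trivial_atlas_def topspace_eq)

lemma principal_trivial_bundle: "principal_bundle G T M (trivial_bundle G T M)"
proof (rule principal_bundleI)
 have "cmap (prod_topology (prod_topology M T) T) (prod_topology M T) (%y. (fst (fst y), snd (fst y) \<otimes> snd y))"
  by (intro continuous_map_pairedI cm_mult cmap_comp2[OF continuous_map_fst] continuous_map_fst continuous_map_snd)
 thus "cmap (prod_topology (total (trivial_bundle G T M)) T) (total (trivial_bundle G T M)) (%(e, g). act (trivial_bundle G T M) e g)"
  by (simp add: trivial_bundle_def split_def)
 show "\<exists>U s k. b \<in> U \<and> local_triv M (trivial_bundle G T M) U s k" if "b \<in> topspace M" for b
  using that by (intro exI[of _ "topspace M"] exI[of _ "%b. (b, \<one>)"] exI[of _ snd])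
   (auto simp: local_triv_def trivial_bundle_def topspace_eq intro!: continuous_map_pairedI cmap_from_sub continuous_map_snd cm_const)
qed (auto simp: trivial_bundle_def topspace_eq m_assoc continuous_map_fst)

lemma represents_trivial_bundle: "represents M (trivial_bundle G T M) (trivial_atlas M) (%b. (b, \<one>))"
 by (auto simp: represents_def trivial_atlas_def trivial_bundle_def topspace_eq intro!: continuous_map_pairedI)

definition atlas_class :: "'m topology => ('m set \<times> ('m => 'a)) set => ('m \<times> 'a, 'a, 'm) gbundle set" where
 "atlas_class M A = bundle_rel G T M `` {atlas_bundle M A}"

lemma equivalent_iff_iso:
 assumes "principal_bundle G T M P" "principal_bundle G T M Q" "atlas M A" "atlas M A'" "represents M P A e" "represents M Q A' e'"
 shows "bundle_equivalent G P Q \<longleftrightarrow> (\<exists>h. atlas_iso M A A' h)"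
 using equivalent_imp_iso[OF assms] iso_imp_equivalent[OF assms] by metis

text \<open>Every bundle has an atlas, so the three properties are those of isomorphisms of
  atlases.\<close>

lemma equiv_bundle_rel: "equiv {P. principal_bundle G T M P} (bundle_rel G T M)"
proof (rule equivI)
 show "bundle_rel G T M \<subseteq> {P. principal_bundle G T M P} \<times> {P. principal_bundle G T M P}"
  by (auto simp: bundle_rel_def)
 show "refl_on {P. principal_bundle G T M P} (bundle_rel G T M)"
 proof (rule refl_onI)
  fix P :: "('b \<times> 'a, 'a, 'b) gbundle" assume P: "P \<in> {P. principal_bundle G T M P}"
  then obtain A e where "atlas M A" "represents M P A e" using atlas_exists by blast
  thus "(P, P) \<in> bundle_rel G T M"
   using P equivalent_iff_iso[of M P P A A e e] atlas_iso_refl by (auto simp: bundle_rel_def)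
 qed
 show "sym (bundle_rel G T M)"
 proof (rule symI)
  fix P Q :: "('b \<times> 'a, 'a, 'b) gbundle" assume "(P, Q) \<in> bundle_rel G T M"
  hence P: "principal_bundle G T M P" and Q: "principal_bundle G T M Q" and PQ: "bundle_equivalent G P Q"
   by (auto simp: bundle_rel_def)
  obtain A e where t: "atlas M A" "represents M P A e" using P by (rule atlas_exists)
  obtain A' e' where t': "atlas M A'" "represents M Q A' e'" using Q by (rule atlas_exists)
  show "(Q, P) \<in> bundle_rel G T M"
   using PQ P Q atlas_iso_sym[OF t(1) t'(1)]
   unfolding bundle_rel_def equivalent_iff_iso[OF P Q t(1) t'(1) t(2) t'(2)]
   by (auto simp: equivalent_iff_iso[OF Q P t'(1) t(1) t'(2) t(2)])
 qed
 show "trans (bundle_rel G T M)"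
 proof (rule transI)
  fix P Q R :: "('b \<times> 'a, 'a, 'b) gbundle" assume "(P, Q) \<in> bundle_rel G T M" "(Q, R) \<in> bundle_rel G T M"
  hence P: "principal_bundle G T M P" and Q: "principal_bundle G T M Q" and R: "principal_bundle G T M R"
   and PQ: "bundle_equivalent G P Q" "bundle_equivalent G Q R"
   by (auto simp: bundle_rel_def)
  obtain A e where t: "atlas M A" "represents M P A e" using P by (rule atlas_exists)
  obtain A' e' where t': "atlas M A'" "represents M Q A' e'" using Q by (rule atlas_exists)
  obtain A'' e'' where t'': "atlas M A''" "represents M R A'' e''" using R by (rule atlas_exists)
  show "(P, R) \<in> bundle_rel G T M"
   using PQ P R atlas_iso_trans[OF t(1) t'(1) t''(1)]
   unfolding bundle_rel_def equivalent_iff_iso[OF P Q t(1) t'(1) t(2) t'(2)] equivalent_iff_iso[OF Q R t'(1) t''(1) t'(2) t''(2)]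
   by (auto simp: equivalent_iff_iso[OF P R t(1) t''(1) t(2) t''(2)])
 qed
qed

lemma bundle_rel_atlas:
 assumes P: "principal_bundle G T M P" and t: "atlas M A" "represents M P A e"
 shows "bundle_rel G T M `` {P} = atlas_class M A"
proof -
 have "(P, atlas_bundle M A) \<in> bundle_rel G T M"
  using P principal_atlas_bundle[OF t(1)] atlas_iso_refl[OF t(1)]
   equivalent_iff_iso[OF P principal_atlas_bundle[OF t(1)] t(1) t(1) t(2) represents_atlas_bundle[OF t(1)]]
  by (auto simp: bundle_rel_def)
 from equiv_class_eq[OF equiv_bundle_rel this] show ?thesis
  by (simp add: atlas_class_def)
qed

lemma atlas_class_eq_iff:
 assumes t: "atlas M A" and t': "atlas M A'"
 shows "atlas_class M A = atlas_class M A' \<longleftrightarrow> (\<exists>h. atlas_iso M A A' h)"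
proof -
 note p = principal_atlas_bundle[OF t] principal_atlas_bundle[OF t']
 have "atlas_class M A = atlas_class M A' \<longleftrightarrow> (atlas_bundle M A, atlas_bundle M A') \<in> bundle_rel G T M"
  unfolding atlas_class_def by (rule eq_equiv_class_iff[OF equiv_bundle_rel]) (use p in auto)
 also have "\<dots> \<longleftrightarrow> (\<exists>h. atlas_iso M A A' h)"
  using p equivalent_iff_iso[OF p t t' represents_atlas_bundle[OF t] represents_atlas_bundle[OF t']]
  by (auto simp: bundle_rel_def)
 finally show ?thesis .
qed

lemma bundle_classes_eq: "bundle_classes G T M = {atlas_class M A | A. atlas M A}"
proof (intro equalityI subsetI)
 fix y assume "y \<in> bundle_classes G T M"
 then obtain P where P: "principal_bundle G T M P" "y = bundle_rel G T M `` {P}"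
  by (auto simp: bundle_classes_def quotient_def)
 obtain A e where t: "atlas M A" "represents M P A e" using P(1) by (rule atlas_exists)
 thus "y \<in> {atlas_class M A | A. atlas M A}"
  using bundle_rel_atlas[OF P(1) t] P(2) by blast
next
 fix y assume "y \<in> {atlas_class M A | A. atlas M A}"
 thus "y \<in> bundle_classes G T M"
  using principal_atlas_bundle by (auto simp: bundle_classes_def quotient_def atlas_class_def)
qed

lemma trivial_class_eq: "trivial_class G T M = atlas_class M (trivial_atlas M)"
 unfolding trivial_class_def
 by (rule bundle_rel_atlas[OF principal_trivial_bundle atlas_trivial represents_trivial_bundle])

end

section \<open>The two cocycles of a bundle\<close>

declare One_nat_def [symmetric, simp]

sublocale structure_group \<subseteq> P0: comm_group "pi0_group G T"
 by (rule pi0_comm)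

sublocale structure_group \<subseteq> P1: comm_group "homotopy_group 1 T \<one>"
 by (rule comm_group_pi1)

text \<open>The universal simplex: by naturality along \<open>t\<close>, a statement about a simplex
  \<open>t\<close> of \<open>M\<close> becomes one about this simplex of the standard simplex, over
  which sections exist.\<close>

definition id_simplex :: "nat => (nat => real) => nat => real" where
 "id_simplex p = (\<lambda>x\<in>standard_simplex p. x)"

lemma id_simplex: "sing p (top_of_set (splx p)) (id_simplex p)"
 unfolding id_simplex_def by (rule singular_simplex_restrict) simp

lemma simplex_map_id_simplex: "sing p X t ==> simplex_map p t (id_simplex p) = t"
 by (auto simp: simplex_map_def id_simplex_def singular_simplex_def extensional_def fun_eq_iff)

lemma simplex_map_apply: "x \<in> splx p ==> simplex_map p f u x = f (u x)"
 by (simp add: simplex_map_def)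

lemma simplex_cont: "sing p X u ==> cmap (top_of_set (splx p)) X u"
 by (simp add: singular_simplex_iff)

lemma simplex_map_cong: "(!!x. x \<in> splx p ==> f (u x) = g (t x)) ==> simplex_map p f u = simplex_map p g t"
 by (auto simp: simplex_map_def fun_eq_iff)

section \<open>Components of the group, and path classes over triangles\<close>

context structure_group begin

abbreviation pi0 :: "'a set monoid" where "pi0 \<equiv> pi0_group G T"

abbreviation mult_pi0 (infixl "\<star>" 70) where "x \<star> y \<equiv> x \<otimes>\<^bsub>pi0\<^esub> y"
abbreviation inv_pi0 ("inv0 _" [81] 80) where "inv0 x \<equiv> inv\<^bsub>pi0\<^esub> x"
abbreviation one_pi0 ("one0") where "one0 \<equiv> \<one>\<^bsub>pi0\<^esub>"

abbreviation pc :: "'a => 'a set" where "pc g \<equiv> K #> g"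

lemma pc_hom: "group_hom G pi0 (%g. pc g)"
 by unfold_locales (use normal.r_coset_hom_Mod[OF K_normal] in \<open>simp add: pi0_group_def\<close>)

lemma pc_closed [simp]: "g \<in> carrier G ==> pc g \<in> carrier pi0"
 using group_hom.hom_closed[OF pc_hom] .

lemma pc_mult: "[|g \<in> carrier G; h \<in> carrier G|] ==> pc (g \<otimes> h) = pc g \<star> pc h"
 using group_hom.hom_mult[OF pc_hom] .

lemma pc_inv: "g \<in> carrier G ==> pc (inv g) = inv0 pc g"
 using group_hom.hom_inv[OF pc_hom] .

lemma pc_eq_one_iff: "g \<in> carrier G ==> pc g = one0 \<longleftrightarrow> g \<in> K"
 using coset_join1[of K g] coset_join2[of g K] K_normal normal_imp_subgroup[of K] K_carrier
 by (auto simp: pi0_group_def)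

lemma pc_K: "g \<in> K ==> pc g = one0"
 using pc_eq_one_iff K_carrier by blast

lemma pc_path:
 assumes "gpath p" shows "pc (p (vert 1)) = pc (p (vert 0))"
proof -
 have c: "p (vert 0) \<in> carrier G" "p (vert 1) \<in> carrier G" using gpath_carrier[OF assms] by simp_all
 have "pc (p (vert 1) \<otimes> inv (p (vert 0))) = one0"
  by (rule pc_K[OF K_path(1)[OF assms]])
 thus ?thesis
  using c by (simp add: pc_mult pc_inv) (metis P0.inv_equality P0.inv_inv P0.inv_closed pc_closed)
qed

lemma pc_surj:
 assumes "a \<in> carrier pi0" obtains g where "g \<in> carrier G" "pc g = a"
 using assms by (auto simp: pi0_group_def carrier_FactGroup)

text \<open>The end values are functions \<open>a\<close> and \<open>b\<close> of the vertices, so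
  the defects in \<open>path_class_mult\<close> form the coboundary of a 0-cochain; the second
  coboundary kills them.\<close>

lemma cobd_path_class_mult:
 assumes t: "sing 2 Y t"
  and p: "!!e. sing 1 Y e ==> kpath (p e) \<and> p e (vert 0) = a (e (vert 0)) \<and> p e (vert 1) = a (e (vert 1))"
  and q: "!!e. sing 1 Y e ==> kpath (q e) \<and> q e (vert 0) = b (e (vert 0)) \<and> q e (vert 1) = b (e (vert 1))"
 shows "cobd pi1 2 (%e. path_class (%x. p e x \<otimes> q e x)) t =
  cobd pi1 2 (%e. path_class (p e)) t \<cdot> cobd pi1 2 (%e. path_class (q e)) t"
proof -
 define g where "g y = mult_defect (a y) (b y)" for y
 define m where "m = cobd pi1 1 (cochain0 g)"
 have gc: "g x \<in> carrier pi1" for x by (simp add: g_def)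
 have mc: "cochain pi1 m" unfolding m_def by (rule P1.cobd_fun[OF cochain_cochain0[of g, OF gc]])
 have L: "cochain pi1 (%e. path_class (r e))" for r :: "((nat => real) => 'y) => (nat => real) => 'a"
  by (simp add: cochainI)
 have "cobd pi1 2 (%e. path_class (%x. p e x \<otimes> q e x)) t =
   cobd pi1 2 (%e. path_class (p e) \<cdot> path_class (q e) \<cdot> inv1 (m e)) t"
 proof (rule P1.cobd_cong[OF L _ t])
  show "cochain pi1 (%e. path_class (p e) \<cdot> path_class (q e) \<cdot> inv1 (m e))"
   by (intro P1.cochain_mult P1.cochain_inv L mc)
  fix e assume "sing (2 - 1) Y e"
  hence "sing 1 Y e" by simp
  note pq = p[OF this] q[OF this]
  show "path_class (%x. p e x \<otimes> q e x) = path_class (p e) \<cdot> path_class (q e) \<cdot> inv1 (m e)"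
   using path_class_mult[of "p e" "q e"] pq
   by (simp add: m_def P1.cobd_cochain0[of g, OF gc] g_def P1.inv_mult P1.m_ac)
 qed
 also have "\<dots> = cobd pi1 2 (%e. path_class (p e)) t \<cdot> cobd pi1 2 (%e. path_class (q e)) t \<cdot> inv1 (cobd pi1 2 m t)"
  by (simp add: P1.cobd_mult P1.cobd_inv P1.cochain_mult P1.cochain_inv L mc)
 also have "cobd pi1 2 m t = one1"
  using P1.cobd_cobd[OF cochain_cochain0[of g, OF gc], of 1 Y t] t by (simp add: m_def)
 finally show ?thesis by (simp add: P1.cobd_closed[OF L])
qed

lemma cobd_path_class_cong:
 assumes t: "sing 2 Y t"
  and p: "!!e. sing 1 Y e ==> kpath (p e)"
  and q: "!!e x. [|singular_simplex 1 Y e; x \<in> splx 1|] ==> p e x = q e x"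
 shows "cobd pi1 2 (%e. path_class (p e)) t = cobd pi1 2 (%e. path_class (q e)) t"
proof (rule P1.cobd_cong[OF _ _ t])
 fix e assume "sing (2 - 1) Y e"
 hence "sing 1 Y e" by simp
 thus "path_class (p e) = path_class (q e)"
  using path_class_cong(2)[OF p] q by blast
qed (simp_all add: cochainI)

lemma cobd_path_class_inv:
 assumes t: "sing 2 Y t"
  and p: "!!e. sing 1 Y e ==> kpath (p e) \<and> p e (vert 0) = a (e (vert 0)) \<and> p e (vert 1) = a (e (vert 1))"
 shows "cobd pi1 2 (%e. path_class (%x. inv (p e x))) t = inv1 cobd pi1 2 (%e. path_class (p e)) t"
proof (rule P1.inv_equality[symmetric])
 have k: "kpath (%x. inv (p e x)) \<and> inv (p e (vert 0)) = inv (a (e (vert 0))) \<and> inv (p e (vert 1)) = inv (a (e (vert 1)))"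
  if "sing 1 Y e" for e
  using p[OF that] kpath_inv by simp
 have "cobd pi1 2 (%e. path_class (%x. inv (p e x) \<otimes> p e x)) t = cobd pi1 2 (%e. path_class (%x. \<one>)) t"
  using p k kpath_mult l_inv[OF gpath_carrier[OF kpath_gpath]] by (intro cobd_path_class_cong[OF t]) blast+
 also have "\<dots> = one1"
  by (simp add: P1.cobd_2 cochainI path_class_const K_one)
 finally show "cobd pi1 2 (%e. path_class (%x. inv (p e x))) t \<cdot> cobd pi1 2 (%e. path_class (p e)) t = one1"
  using cobd_path_class_mult[OF t, of "%e x. inv (p e x)" "%y. inv (a y)" p a] k p by simp
qed (simp_all add: P1.cobd_closed cochainI)

text \<open>For paths with equal end values the two defects cancel.\<close>

lemma path_class_mult_closed:
 assumes "kpath x" "kpath y" "x (vert 0) = x (vert 1)" "y (vert 0) = y (vert 1)"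
 shows "path_class (%s. x s \<otimes> y s) = path_class x \<cdot> path_class y"
 unfolding path_class_mult[OF assms(1,2)] assms(3,4)[symmetric] by (simp add: P1.m_assoc)

lemma kpath_map:
 assumes k: "cmap Y (subtop T K) k" and e: "sing 1 Y e" shows "kpath (%x. k (e x))"
 using cmap_comp2[OF simplex_cont[OF e] k] continuous_map_image_in[OF k sing_maps[OF e, of "vert 0"]]
 by (simp add: kpath_def cmap_in_sub)

lemma path_class_map:
 assumes k: "cmap Y (subtop T K) k" and e: "sing 1 Y e"
 shows "path_class (%x. k (e x)) = path_class (simplex_map 1 k e)"
 by (rule path_class_cong(2)[OF kpath_map[OF k e]]) (simp add: simplex_map_apply)

lemma cobd_path_class_map:
 assumes k: "cmap Y (subtop T K) k" and t: "sing 2 Y t"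
 shows "cobd pi1 2 (%e. path_class (%x. k (e x))) t = one1"
proof -
 have "cobd pi1 2 (%e. path_class (%x. k (e x))) t = cobd pi1 2 (%e. path_class (simplex_map 1 k e)) t"
  by (rule cobd_path_class_cong[OF t kpath_map[OF k]]) (simp_all add: simplex_map_apply)
 also have "\<dots> = one1"
  using P1.cocycle_pullback[OF cocycle_path_class k] t by (simp add: cocycle_def)
 finally show ?thesis .
qed

section \<open>The 1-cocycle with values in pi_0\<close>

abbreviation psect :: "'m topology => ('m set \<times> ('m => 'a)) set => ((nat => real) => 'm) => ((nat => real) => 'a) => bool" where
 "psect M A \<equiv> sect M A (top_of_set (splx 1))"

definition jump :: "'m topology => ('m set \<times> ('m => 'a)) set => ((nat => real) => 'm) => 'a set" where
 "jump M A c = (if sing 1 M c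
   then let s = (SOME s. psect M A c s) in pc (s (vert 1)) \<star> inv0 pc (s (vert 0)) else one0)"

lemma sect_simplex:
 assumes s: "sect M A Y f s" and e: "sing p Y e"
 shows "sing p M (simplex_map p f e)"
  "sect M A (top_of_set (splx p)) (simplex_map p f e) (%x. s (e x))"
proof -
 show "sing p M (simplex_map p f e)"
  by (rule singular_simplex_simplex_map[OF e sect_continuous[OF s]])
 show "sect M A (top_of_set (splx p)) (simplex_map p f e) (%x. s (e x))"
  by (rule sect_cong[OF sect_compose[OF s simplex_cont[OF e]]]) (simp_all add: simplex_map_apply)
qed

text \<open>The quotient of two sections along the same edge is a path in the group, so its class in
  \<open>pi0\<close> is the same at both ends and cancels in the change of class.\<close>

lemma jump_eq:
 assumes at: "atlas M A" and v: "sing 1 M v" and s: "psect M A v s"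
 shows "jump M A v = pc (s (vert 1)) \<star> inv0 pc (s (vert 0))"
proof -
 define s' where "s' = (SOME s. psect M A v s)"
 have s': "psect M A v s'" unfolding s'_def using someI[of "psect M A v", OF s] .
 have c: "s (vert k) \<in> carrier G" "s' (vert k) \<in> carrier G" if "k \<le> 1" for k
  using sect_carrier[OF s] sect_carrier[OF s'] that by auto
 have "pc (inv (s (vert 1)) \<otimes> s' (vert 1)) = pc (inv (s (vert 0)) \<otimes> s' (vert 0))"
  using pc_path[OF sect_div[OF at s s']] .
 hence e: "inv0 pc (s (vert 1)) \<star> pc (s' (vert 1)) = inv0 pc (s (vert 0)) \<star> pc (s' (vert 0))" (is "?l = ?r")
  using c[of 0] c[of 1] by (simp add: pc_mult pc_inv)
 have "pc (s' (vert k)) = pc (s (vert k)) \<star> (inv0 pc (s (vert k)) \<star> pc (s' (vert k)))" if "k \<le> 1" for k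
  using c[OF that] by (simp add: P0.m_assoc[symmetric])
 from this[of 0] this[of 1]
 have "pc (s' (vert 1)) \<star> inv0 pc (s' (vert 0)) = pc (s (vert 1)) \<star> ?r \<star> inv0 (pc (s (vert 0)) \<star> ?r)"
  by (simp add: e)
 also have "\<dots> = pc (s (vert 1)) \<star> inv0 pc (s (vert 0))"
 proof -
  have r: "?r \<in> carrier pi0" using c[of 0] by simp
  have "x \<star> r \<star> inv0 (y \<star> r) = x \<star> inv0 y"
   if "x \<in> carrier pi0" "y \<in> carrier pi0" "r \<in> carrier pi0" for x y r
   using that by (simp add: P0.inv_mult_group P0.m_assoc) (simp add: P0.m_assoc[symmetric])
  thus ?thesis using c[of 0] c[of 1] r by simp
 qed
 finally show ?thesis
  using v by (simp add: jump_def s'_def[symmetric])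
qed

lemma jump_map:
 assumes at: "atlas M A" and s: "sect M A Y f s" and e: "sing 1 Y e"
 shows "jump M A (simplex_map 1 f e) = pc (s (e (vert 1))) \<star> inv0 pc (s (e (vert 0)))"
 by (rule jump_eq[OF at sect_simplex[OF s e]])

lemma cochain_jump: 
 assumes at: "atlas M A" shows "cochain pi0 (jump M A)"
proof (rule cochainI)
 fix c :: "(nat => real) => 'b"
 show "jump M A c \<in> carrier pi0"
 proof (cases "sing 1 M c")
  case True
  obtain s where s: "psect M A c s"
   by (rule sect_exists_simplex[OF at simplex_cont[OF True]])
  show ?thesis
   using jump_eq[OF at True s] sect_carrier[OF s] by simp
 qed (simp add: jump_def)
qed

text \<open>A section over the whole triangle shows that on its edges the jump is the coboundary of
  the class of the section.\<close>

lemma cocycle_jump: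
 assumes at: "atlas M A" shows "cocycle pi0 1 M (jump M A)"
 unfolding cocycle_def
proof (intro conjI allI impI cochain_jump[OF at])
 fix t :: "(nat => real) => 'b" assume "sing (Suc 1) M t"
 hence t: "sing 2 M t" by simp
 let ?Y = "top_of_set (splx 2)"
 obtain s where s: "sect M A ?Y t s"
  by (rule sect_exists_simplex[OF at simplex_cont[OF t]])
 define g where "g x = (if x \<in> splx 2 then pc (s x) else one0)" for x
 have gc: "g x \<in> carrier pi0" for x using sect_carrier[OF s, of x] by (simp add: g_def)
 have "cobd pi0 2 (jump M A) (simplex_map 2 t (id_simplex 2)) = cobd pi0 2 (%e. jump M A (simplex_map (2 - 1) t e)) (id_simplex 2)"
  by (rule P0.cobd_simplex_map[OF cochain_jump[OF at] id_simplex])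
 also have "\<dots> = cobd pi0 2 (cobd pi0 1 (cochain0 g)) (id_simplex 2)"
 proof (rule P0.cobd_cong[OF cochain_comp[OF cochain_jump[OF at]] P0.cobd_fun[OF cochain_cochain0[of g, OF gc]] id_simplex])
  fix e assume "sing (2 - 1) ?Y e"
  hence e: "sing 1 ?Y e" by simp
  have "e (vert 0) \<in> splx 2" "e (vert 1) \<in> splx 2"
   using sing_maps[OF e, of "vert 0"] sing_maps[OF e, of "vert 1"] by simp_all
  thus "jump M A (simplex_map (2 - 1) t e) = cobd pi0 1 (cochain0 g) e"
   using jump_map[OF at s e] P0.cobd_cochain0[of g, OF gc] by (simp add: g_def)
 qed
 also have "\<dots> = one0"
  using P0.cobd_cobd[OF cochain_cochain0[of g, OF gc], of 1 ?Y "id_simplex 2"] id_simplex[of 2] by simp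
 finally show "cobd pi0 (Suc 1) (jump M A) t = one0"
  using simplex_map_id_simplex[OF t] by simp
qed

text \<open>As \<open>pi0\<close> is commutative, the classes of the left factor \<open>h\<close> at
  the two ends can be collected into a coboundary.\<close>

lemma jump_iso:
 assumes at: "atlas M A" and at': "atlas M A'" and h: "atlas_iso M A A' h" and v: "sing 1 M v"
 shows "jump M A' v = pc (h (v (vert 1))) \<star> inv0 pc (h (v (vert 0))) \<star> jump M A v"
proof -
 obtain s where s: "psect M A v s"
  by (rule sect_exists_simplex[OF at simplex_cont[OF v]])
 have c: "s (vert k) \<in> carrier G" if "k \<le> 1" for k
  using sect_carrier[OF s] that by auto
 show ?thesis
  using jump_eq[OF at' v sect_iso[OF at at' h s]] jump_eq[OF at v s] c[of 0] c[of 1] atlas_iso_carrier[OF h]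
  by (simp add: pc_mult P0.inv_mult P0.m_ac)
qed

lemma atlas_translate:
 assumes at: "atlas M A" and k: "!!x. k x \<in> carrier G"
 shows "atlas M ((%(U, t). (U, %x. k x \<otimes> t x)) ` A)" (is "atlas M ?A") "atlas_iso M A ((%(U, t). (U, %x. k x \<otimes> t x)) ` A) k"
proof -
 have eq: "inv (k x \<otimes> t x) \<otimes> (k x \<otimes> t' x) = inv (t x) \<otimes> t' x" if "(U, t) \<in> A" "(U', t') \<in> A" for U t U' t' x
  using atlas_carrier[OF at that(1)] atlas_carrier[OF at that(2)] k by (simp add: inv_mult_group m_assoc) (simp add: m_assoc[symmetric])
 show "atlas M ?A"
  unfolding atlas_def
 proof (intro conjI)
  show "\<forall>(U, t)\<in>?A. openin M U \<and> (\<forall>x. t x \<in> carrier G)"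
   using atlas_open[OF at] atlas_carrier[OF at] k by auto
  show "\<forall>x\<in>topspace M. \<exists>(U, t)\<in>?A. x \<in> U"
   using at unfolding atlas_def by fastforce
  show "\<forall>(U, t)\<in>?A. \<forall>(U', t')\<in>?A. cmap (subtop M (U \<inter> U')) T (%x. inv (t x) \<otimes> t' x)"
   using atlas_transition[OF at] eq by auto
 qed
 show "atlas_iso M A ?A k"
 proof (rule atlas_isoI[OF k])
  fix U t U' t' assume U: "(U, t) \<in> A" and "(U', t') \<in> ?A"
  then obtain t'' where U': "(U', t'') \<in> A" "t' = (%x. k x \<otimes> t'' x)" by auto
  have "cmap (subtop M (U \<inter> U')) T (%x. inv (t'' x) \<otimes> t x)"
   using atlas_transition[OF at U'(1) U] by (simp add: Int_commute)
  thus "cmap (subtop M (U \<inter> U')) T (%x. inv (t' x) \<otimes> k x \<otimes> t x)"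
   using eq[OF U'(1) U] by (simp add: U'(2) k atlas_carrier[OF at U] atlas_carrier[OF at U'(1)] m_assoc)
 qed
qed

text \<open>A reduction of the structure group to the unit component, expressed by the choice of the
  reference section: sections along paths stay in one component. Sections with values in
  \<open>K\<close> are those of the reduced bundle.\<close>

definition flat :: "'m topology => ('m set \<times> ('m => 'a)) set => bool" where
 "flat M A \<longleftrightarrow> atlas M A \<and> (\<forall>c. sing 1 M c --> jump M A c = one0)"

lemma flat_atlas: "flat M A ==> atlas M A"
 by (simp add: flat_def)

text \<open>Changing the reference section by elements \<open>k\<close> whose classes are inverse to
  the primitive cancels the jump.\<close>

lemma flat_exists:
 assumes at: "atlas M A" and f: "cobounds pi0 1 M f (jump M A)"
 obtains A' h where "flat M A'" "atlas_iso M A A' h"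
proof -
 obtain g where g: "!!x. g x \<in> carrier pi0"
  "!!c. sing 1 M c ==> jump M A c = g (c (vert 1)) \<star> inv0 (g (c (vert 0)))"
  using P0.cobounds_1_fun[OF f] by metis
 have "\<exists>k\<in>carrier G. pc k = inv0 g x" for x
  by (rule pc_surj[of "inv0 g x"]) (use g(1) in auto)
 then obtain k where k: "!!x. k x \<in> carrier G" "!!x. pc (k x) = inv0 g x" by metis
 note tr = atlas_translate[OF at, of k, OF k(1)]
 have "jump M ((%(U, t). (U, %x. k x \<otimes> t x)) ` A) c = one0" if "sing 1 M c" for c
  unfolding jump_iso[OF at tr that] g(2)[OF that] k(2) P0.inv_mult[OF g(1) P0.inv_closed[OF g(1)], symmetric]
  using g(1) by simp
 hence "flat M ((%(U, t). (U, %x. k x \<otimes> t x)) ` A)"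
  using tr(1) by (simp add: flat_def)
 thus thesis using tr(2) by (rule that)
qed

definition ksect :: "'m topology => ('m set \<times> ('m => 'a)) set => 'y topology => ('y => 'm) => ('y => 'a) => bool" where
 "ksect M A Y u s \<longleftrightarrow> sect M A Y u s \<and> (\<forall>y\<in>topspace Y. s y \<in> K)"

lemma ksect_sect: "ksect M A Y u s ==> sect M A Y u s"
 by (simp add: ksect_def)

lemma ksect_K: "ksect M A Y u s ==> y \<in> topspace Y ==> s y \<in> K"
 by (simp add: ksect_def)

lemma ksect_simplex:
 assumes s: "ksect M A Y f s" and e: "sing p Y e"
 shows "ksect M A (top_of_set (splx p)) (simplex_map p f e) (%x. s (e x))"
 using sect_simplex(2)[OF ksect_sect[OF s] e] ksect_K[OF s sing_maps[OF e]] by (simp add: ksect_def)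

text \<open>Right division by a constant makes the value at \<open>a\<close> equal to 1, and
  flatness keeps the class in \<open>pi0\<close> unchanged along the paths from
  \<open>a\<close>.\<close>

lemma ksect_translate:
 assumes fl: "flat M A" and s: "sect M A Y f s" and a: "a \<in> topspace Y"
  and path: "!!y. y \<in> topspace Y ==> \<exists>c. sing 1 Y c \<and> c (vert 0) = a \<and> c (vert 1) = y"
 shows "ksect M A Y f (%y. s y \<otimes> inv (s a))"
 unfolding ksect_def
proof (intro conjI ballI)
 note at = flat_atlas[OF fl]
 have sa: "s a \<in> carrier G" using sect_carrier[OF s a] .
 show "sect M A Y f (%y. s y \<otimes> inv (s a))"
  by (rule sect_mult[OF at s cm_const]) (simp add: sa)
 fix y assume y: "y \<in> topspace Y"
 obtain c where c: "sing 1 Y c" "c (vert 0) = a" "c (vert 1) = y" using path[OF y] by blast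
 have "jump M A (simplex_map 1 f c) = one0"
  using fl sect_simplex(1)[OF s c(1)] by (simp add: flat_def)
 hence "pc (s y \<otimes> inv (s a)) = one0"
  using jump_map[OF at s c(1)] c sect_carrier[OF s y] sa by (simp add: pc_mult pc_inv)
 thus "s y \<otimes> inv (s a) \<in> K"
  using pc_eq_one_iff sect_carrier[OF s y] sa by simp
qed

lemma star_path:
 assumes y: "y \<in> S" and path: "!!t. [|0 \<le> t; t \<le> 1|] ==> slide t a y \<in> S"
 shows "\<exists>c. sing 1 (top_of_set S) c \<and> c (vert 0) = a \<and> c (vert 1) = y"
proof (intro exI conjI)
 show "sing 1 (top_of_set S) (\<lambda>x\<in>standard_simplex 1. (%t. slide t a y) (x 1))"
  by (rule singular_simplex_path) (auto intro!: continuous_on_slide continuous_intros path)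
qed (simp_all, simp_all add: vert_def)

lemma map_to_K:
 assumes p: "cmap (top_of_set S) T p" and a: "a \<in> S" "p a \<in> K" and y: "y \<in> S" "!!t. [|0 \<le> t; t \<le> 1|] ==> slide t a y \<in> S"
 shows "p y \<in> K"
proof -
 obtain c where c: "sing 1 (top_of_set S) c" "c (vert 0) = a" "c (vert 1) = y"
  using star_path[OF y] by blast
 have "kpath (%x. p (c x))"
  using cmap_comp2[OF simplex_cont[OF c(1)] p] a(2) c(2) by (simp add: kpath_def)
 thus ?thesis using kpath_ends(2) c(3) by fastforce
qed

lemma ksect_star:
 assumes fl: "flat M A" and s: "sect M A (top_of_set S) f s" and a: "a \<in> S"
  and path: "!!y t. [|y \<in> S; 0 \<le> t; t \<le> 1|] ==> slide t a y \<in> S"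
 shows "ksect M A (top_of_set S) f (%y. s y \<otimes> inv (s a))"
 by (intro ksect_translate[OF fl s]) (use a star_path path in auto)

lemma ksect_exists_simplex:
 assumes fl: "flat M A" and u: "sing p M u"
 obtains s where "ksect M A (top_of_set (splx p)) u s"
proof -
 obtain s where s: "sect M A (top_of_set (splx p)) u s"
  by (rule sect_exists_simplex[OF flat_atlas[OF fl] simplex_cont[OF u]])
 show thesis
  by (rule that[OF ksect_star[OF fl s, of "vert 0"]]) (auto intro: slide_in_simplex)
qed

lemma ksect_exists_disc:
 assumes fl: "flat M A" and u: "cmap (disc n) M u"
 obtains s where "ksect M A (disc n) u s"
proof -
 obtain s where s: "sect M A (disc n) u s"
  by (rule sect_exists_disc[OF flat_atlas[OF fl] u])
 show thesis
  by (rule that[OF ksect_star[OF fl s, of "%_. 0"]]) (auto intro: scale_in_closed_disc)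
qed

section \<open>Normalised edge sections and the obstruction cocycle\<close>

lemma sect_const:
 assumes at: "atlas M A" and u: "cmap Y M u" "!!y. y \<in> topspace Y ==> u y = a" and c: "c \<in> carrier G"
 shows "sect M A Y u (%_. c)"
 unfolding sect_def
proof (intro conjI ballI u(1) c)
 show "case p of (U, t) => cmap (subtop Y {y. u y \<in> U}) T (%y. inv (t (u y)) \<otimes> c)" if "p \<in> A" for p
 proof -
  obtain U t where p: "p = (U, t)" by (cases p)
  have "cmap (subtop Y {y. u y \<in> U}) T (%y. inv (t a) \<otimes> c)"
   by (rule cm_const) (use atlas_carrier[OF at] that p c in auto)
  thus ?thesis
   unfolding p prod.case by (rule cmap_eq) (simp add: u(2))
 qed
qed

text \<open>On constant edges the constant section is prescribed, so that the obstruction is trivial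
  on constant triangles, as a cocycle of the pair with the base point must be.\<close>

definition edge :: "'m topology => ('m set \<times> ('m => 'a)) set => ((nat => real) => 'm) => (nat => real) => 'a" where
 "edge M A c = (if \<exists>a. c = csimp 1 a then (%_. \<one>)
   else SOME s. psect M A c s \<and> s (vert 0) = \<one> \<and> s (vert 1) = \<one>)"

lemma edge:
 assumes fl: "flat M A" and v: "sing 1 M v"
 shows "psect M A v (edge M A v)" "edge M A v (vert 0) = \<one>" "edge M A v (vert 1) = \<one>"
proof -
 note at = flat_atlas[OF fl]
 have "psect M A v (edge M A v) \<and> edge M A v (vert 0) = \<one> \<and> edge M A v (vert 1) = \<one>"
 proof (cases "\<exists>a. v = csimp 1 a")
  case True
  then obtain a where "v = csimp 1 a" by blast
  hence "psect M A v (%_. \<one>)"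
   by (intro sect_const[OF at simplex_cont[OF v], of a]) (simp_all add: csimp_def)
  thus ?thesis using True by (simp add: edge_def)
 next
  case False
  obtain s where s: "ksect M A (top_of_set (splx 1)) v s"
   by (rule ksect_exists_simplex[OF fl v])
  have sK: "s (vert 0) \<in> K" "s (vert 1) \<in> K" using ksect_K[OF s] by simp_all
  note c = K_carrier[OF sK(1)] K_carrier[OF sK(2)]
  define k where "k = (%x. inv (s (vert 0)) \<otimes> to_one (s (vert 0) \<otimes> inv (s (vert 1))) x)"
  note o = to_one[OF K_mult[OF sK(1) K_inv[OF sK(2)]]]
  have "gpath k" unfolding k_def by (intro cm_mult cm_const o) (simp add: c)
  hence "psect M A v (%x. s x \<otimes> k x)"
   by (rule sect_mult[OF at ksect_sect[OF s]])
  moreover have "s (vert 0) \<otimes> k (vert 0) = \<one>" "s (vert 1) \<otimes> k (vert 1) = \<one>"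
   using c by (simp_all add: k_def o m_assoc[symmetric])
  ultimately have "\<exists>s. psect M A v s \<and> s (vert 0) = \<one> \<and> s (vert 1) = \<one>" by blast
  from someI_ex[OF this] show ?thesis
   using False by (simp add: edge_def)
 qed
 thus "psect M A v (edge M A v)" "edge M A v (vert 0) = \<one>" "edge M A v (vert 1) = \<one>" by auto
qed

lemma ksect_edge:
 assumes fl: "flat M A" and c: "sing 1 M c"
 shows "ksect M A (top_of_set (splx 1)) c (edge M A c)"
proof -
 have "ksect M A (top_of_set (splx 1)) c (%y. edge M A c y \<otimes> inv (edge M A c (vert 0)))"
  by (rule ksect_star[OF fl edge(1)[OF fl c]]) (auto intro: slide_in_simplex)
 thus ?thesis
  using edge(1,2)[OF fl c] sect_carrier[OF edge(1)[OF fl c]] by (simp add: ksect_def)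
qed

text \<open>Compares the edge section with a given section \<open>s\<close> with values in
  \<open>K\<close>. The quotient is a path in the unit component, and its class still depends on
  \<open>s\<close>.\<close>

definition edge_class :: "'m topology => ('m set \<times> ('m => 'a)) set => ('y => 'm) => ('y => 'a) => ((nat => real) => 'y) => ((nat => real) => 'a) set" where
 "edge_class M A f s e = path_class (%x. inv (s (e x)) \<otimes> edge M A (simplex_map 1 f e) x)"

lemma cochain_edge_class: "cochain pi1 (edge_class M A f s)"
 by (rule cochainI) (simp add: edge_class_def)

definition obstruction :: "'m topology => ('m set \<times> ('m => 'a)) set => ((nat => real) => 'm) => ((nat => real) => 'a) set" where
 "obstruction M A t = (if sing 2 M t
   then cobd pi1 2 (edge_class M A t (SOME s. ksect M A (top_of_set (splx 2)) t s)) (id_simplex 2) else one1)"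

context
 fixes M :: "'m topology" and \<T> assumes fl: "flat M \<T>"
begin

lemma kpath_edge:
 assumes s: "ksect M \<T> Y f s" and v: "sing 1 Y v"
 shows "kpath (%x. inv (s (v x)) \<otimes> edge M \<T> (simplex_map 1 f v) x)"
proof -
 note e = edge[OF fl sect_simplex(1)[OF ksect_sect[OF s] v]]
 have "gpath (%x. inv (s (v x)) \<otimes> edge M \<T> (simplex_map 1 f v) x)"
  by (rule sect_div[OF flat_atlas[OF fl] sect_simplex(2)[OF ksect_sect[OF s] v] e(1)])
 moreover have "s (v (vert 0)) \<in> K"
  using ksect_K[OF s] sing_maps[OF v, of "vert 0"] by simp
 ultimately show ?thesis
  using e(2) K_inv K_carrier by (simp add: kpath_def)
qed

text \<open>Two sections with values in \<open>K\<close> differ by a continuous map \<open>k\<close>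
  to the unit component. Along edges it contributes a pullback of the cocycle
  \<open>path_class\<close>, whose coboundary is trivial; so the obstruction does not depend on the
  section.\<close>

lemma cobd_edge_class_unique:
 assumes s: "ksect M \<T> Y f s" and s': "ksect M \<T> Y f s'" and t: "sing 2 Y t"
 shows "cobd pi1 2 (edge_class M \<T> f s') t = cobd pi1 2 (edge_class M \<T> f s) t"
proof -
 note at = flat_atlas[OF fl]
 define k where "k y = inv (s' y) \<otimes> s y" for y
 have kK: "k y \<in> K" if "y \<in> topspace Y" for y
  using ksect_K[OF s that] ksect_K[OF s' that] by (simp add: k_def K_mult K_inv)
 have "cmap Y T k"
  unfolding k_def by (rule sect_div[OF at ksect_sect[OF s'] ksect_sect[OF s]])
 hence kc: "cmap Y (subtop T K) k"
  using kK by (auto simp: cmap_in_sub)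
 have e: "kpath (%x. inv (s (v x)) \<otimes> edge M \<T> (simplex_map 1 f v) x)" "edge M \<T> (simplex_map 1 f v) (vert 0) = \<one>" "edge M \<T> (simplex_map 1 f v) (vert 1) = \<one>"
  if v: "sing 1 Y v" for v
  using kpath_edge[OF s v] edge(2,3)[OF fl sect_simplex(1)[OF ksect_sect[OF s] v]] by simp_all
 have "cobd pi1 2 (edge_class M \<T> f s') t = cobd pi1 2 (%v. path_class (%x. k (v x) \<otimes> (inv (s (v x)) \<otimes> edge M \<T> (simplex_map 1 f v) x))) t"
  unfolding edge_class_def
 proof (rule cobd_path_class_cong[OF t kpath_edge[OF s']])
  fix v and x :: "nat => real" assume v: "sing 1 Y v" and x: "x \<in> splx 1"
  have "s (v x) \<in> carrier G" "s' (v x) \<in> carrier G" "edge M \<T> (simplex_map 1 f v) x \<in> carrier G"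
   using sing_maps[OF v x] ksect_K[OF s] ksect_K[OF s'] K_carrier x
    sect_carrier[OF edge(1)[OF fl sect_simplex(1)[OF ksect_sect[OF s] v]]] by auto
  thus "inv (s' (v x)) \<otimes> edge M \<T> (simplex_map 1 f v) x = k (v x) \<otimes> (inv (s (v x)) \<otimes> edge M \<T> (simplex_map 1 f v) x)"
   by (simp add: k_def m_assoc mult_div)
 qed
 also have "\<dots> = cobd pi1 2 (%v. path_class (%x. k (v x))) t \<cdot> cobd pi1 2 (edge_class M \<T> f s) t"
  unfolding edge_class_def
  by (rule cobd_path_class_mult[OF t, of _ k _ "%y. inv (s y) \<otimes> \<one>"]) (simp_all add: kpath_map[OF kc] e)
 finally show ?thesis
  by (simp add: cobd_path_class_map[OF kc t] P1.cobd_closed[OF cochain_edge_class])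
qed

text \<open>A section over \<open>Y\<close> restricts to every triangle, so one section computes the
  obstruction on all triangles of \<open>Y\<close> at once.\<close>

lemma obstruction_map:
 assumes s: "ksect M \<T> Y f s" and e: "sing 2 Y e"
 shows "obstruction M \<T> (simplex_map 2 f e) = cobd pi1 2 (edge_class M \<T> f s) e"
proof -
 let ?t = "simplex_map 2 f e" and ?D = "top_of_set (splx 2)"
 note s' = ksect_simplex[OF s e]
 have t: "sing 2 M ?t" by (rule sect_simplex(1)[OF ksect_sect[OF s] e])
 have "ksect M \<T> ?D ?t (SOME s. ksect M \<T> ?D ?t s)"
  using someI[of "ksect M \<T> ?D ?t", OF s'] .
 from cobd_edge_class_unique[OF s' this id_simplex]
 have "obstruction M \<T> ?t = cobd pi1 2 (edge_class M \<T> ?t (%x. s (e x))) (id_simplex 2)"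
  using t by (simp add: obstruction_def)
 also have "\<dots> = cobd pi1 2 (%v. edge_class M \<T> f s (simplex_map (2 - 1) e v)) (id_simplex 2)"
 proof (rule P1.cobd_cong[OF cochain_edge_class cochain_comp[OF cochain_edge_class] id_simplex])
  fix v assume "sing (2 - 1) ?D v"
  hence v: "sing 1 ?D v" by simp
  have "simplex_map 1 ?t v = simplex_map 1 f (simplex_map 1 e v)"
   by (rule simplex_map_cong) (use sing_maps[OF v] in \<open>simp add: simplex_map_apply\<close>)
  thus "edge_class M \<T> ?t (%x. s (e x)) v = edge_class M \<T> f s (simplex_map (2 - 1) e v)"
   using path_class_cong(2)[OF kpath_edge[OF s' v], of "%x. inv (s (simplex_map 1 e v x)) \<otimes> edge M \<T> (simplex_map 1 ?t v) x"]
   by (simp add: edge_class_def simplex_map_apply)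
 qed
 also have "\<dots> = cobd pi1 2 (edge_class M \<T> f s) (simplex_map 2 e (id_simplex 2))"
  by (rule P1.cobd_simplex_map[OF cochain_edge_class id_simplex, symmetric])
 finally show ?thesis
  using simplex_map_id_simplex[OF e] by simp
qed

lemma cochain_obstruction: "cochain pi1 (obstruction M \<T>)"
 by (rule cochainI) (simp add: obstruction_def P1.cobd_closed[OF cochain_edge_class])

lemma obstruction_chain:
 assumes s: "ksect M \<T> Y f s" and c: "singular_chain 2 Y c"
 shows "chain_eval pi1 (obstruction M \<T>) (chain_map 2 f c) = chain_eval pi1 (edge_class M \<T> f s) (chain_boundary 2 c)"
proof -
 have "chain_eval pi1 (obstruction M \<T>) (chain_map 2 f c) = chain_eval pi1 (%e. obstruction M \<T> (simplex_map 2 f e)) c"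
  by (rule P1.chain_eval_chain_map[OF cochain_obstruction])
 also have "\<dots> = chain_eval pi1 (cobd pi1 2 (edge_class M \<T> f s)) c"
  by (rule P1.chain_eval_cong[OF cochain_comp[OF cochain_obstruction] P1.cobd_fun[OF cochain_edge_class]])
   (use c obstruction_map[OF s] in \<open>auto simp: singular_chain_def\<close>)
 also have "\<dots> = chain_eval pi1 (edge_class M \<T> f s) (chain_boundary 2 c)"
  by (rule P1.eval_boundary[OF cochain_edge_class, symmetric])
 finally show ?thesis .
qed

text \<open>A section with values in \<open>K\<close> over the whole 3-simplex exhibits the
  obstruction on its faces as a coboundary.\<close>

lemma cocycle_obstruction: "cocycle pi1 2 M (obstruction M \<T>)"
 unfolding cocycle_def
proof (intro conjI allI impI cochain_obstruction)
 fix t :: "(nat => real) => 'm" assume t: "sing (Suc 2) M t"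
 let ?D = "top_of_set (splx (Suc 2))"
 obtain s where s: "ksect M \<T> ?D t s" by (rule ksect_exists_simplex[OF fl t])
 have "cobd pi1 (Suc 2) (obstruction M \<T>) (simplex_map (Suc 2) t (id_simplex (Suc 2))) =
   cobd pi1 (Suc 2) (%e. obstruction M \<T> (simplex_map (Suc 2 - 1) t e)) (id_simplex (Suc 2))"
  by (rule P1.cobd_simplex_map[OF cochain_obstruction id_simplex])
 also have "\<dots> = cobd pi1 (Suc 2) (cobd pi1 2 (edge_class M \<T> t s)) (id_simplex (Suc 2))"
 proof (rule P1.cobd_cong[OF cochain_comp[OF cochain_obstruction] P1.cobd_fun[OF cochain_edge_class] id_simplex])
  fix e assume "sing (Suc 2 - 1) ?D e"
  thus "obstruction M \<T> (simplex_map (Suc 2 - 1) t e) = cobd pi1 2 (edge_class M \<T> t s) e"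
   using obstruction_map[OF s] by simp
 qed
 also have "\<dots> = one1"
  by (rule P1.cobd_cobd[OF cochain_edge_class id_simplex])
 finally show "cobd pi1 (Suc 2) (obstruction M \<T>) t = one1"
  using simplex_map_id_simplex[OF t] by simp
qed

lemma edge_class_const:
 assumes "a \<in> topspace M" "s y \<in> K" "f y = a" shows "edge_class M \<T> f s (csimp 1 y) = one1"
proof -
 have "simplex_map 1 f (csimp 1 y) = csimp 1 a"
  using assms(3) by (auto simp: simplex_map_def csimp_def fun_eq_iff)
 hence "edge M \<T> (simplex_map 1 f (csimp 1 y)) = (%_. \<one>)"
  by (auto simp: edge_def)
 moreover have "kpath (%_. inv (s y))"
  using K_inv[OF assms(2)] K_carrier topspace_eq by (simp add: kpath_def)
 hence "path_class (%_. inv (s y)) = path_class (%x. inv (s (csimp 1 y x)) \<otimes> \<one>)"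
  by (rule path_class_cong(2)) (use K_carrier[OF assms(2)] in \<open>simp add: csimp_def\<close>)
 ultimately show ?thesis
  using path_class_const[OF K_inv[OF assms(2)]] by (simp add: edge_class_def)
qed

lemma obstruction_const:
 assumes a: "a \<in> topspace M" shows "obstruction M \<T> (csimp 2 a) = one1"
proof -
 let ?Y = "top_of_set (splx 0)"
 have s: "ksect M \<T> M' (%_. a) (%_. \<one>)" for M' :: "(nat => real) topology"
  using a by (auto simp: ksect_def K_one intro: sect_const[OF flat_atlas[OF fl]])
 have "simplex_map 2 (%_. a) (csimp 2 (vert 0)) = csimp 2 a"
  by (auto simp: simplex_map_def csimp_def fun_eq_iff)
 moreover have "sing 2 ?Y (csimp 2 (vert 0))"
  by (rule singular_simplex_const) simp
 ultimately have "obstruction M \<T> (csimp 2 a) = cobd pi1 2 (edge_class M \<T> (%_. a) (%_. \<one>)) (csimp 2 (vert 0))"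
  using obstruction_map[OF s] by metis
 also have "\<dots> = one1"
  using edge_class_const[OF a, of "%_. \<one>" "vert 0" "%_. a"]
  by (simp add: P1.cobd_2[OF cochain_edge_class] singular_face_const K_one)
 finally show ?thesis .
qed

lemma obstruction_cobounds:
 assumes s: "ksect M \<T> M (%x. x) s" and t: "sing 2 M t"
 shows "obstruction M \<T> t = cobd pi1 2 (edge_class M \<T> (%x. x) s) t"
proof -
 have "simplex_map 2 (%x. x) t = t"
  by (rule simplex_map_id_gen[OF t]) simp
 thus ?thesis
  using obstruction_map[OF s t] by simp
qed

end

end

section \<open>Bundles over cell complexes\<close>

lemma topspace_quotient: "quotient_map Z Y q ==> q ` topspace Z = topspace Y"
 by (simp add: quotient_map_def)

lemma compact_standard_simplex: "compact (splx p)"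
 using compactin_standard_simplex[of p] by (simp add: powertop_eq)

lemma quotient_map_compact:
 fixes f :: "'x::topological_space => 'y::metric_space"
 assumes "continuous_on S f" "compact S" "f ` S = S'"
 shows "quotient_map (top_of_set S) (top_of_set S') f"
proof (rule T1_Spaces.continuous_imp_quotient_map)
 show "Hausdorff_space (top_of_set S')"
  by (rule Hausdorff_space_subtopology) simp
qed (use assms in \<open>auto simp: cmap_in_sub compact_space_subtopology\<close>)

lemma circ_eq_iff:
 assumes "0 \<le> t" "t \<le> 1" "0 \<le> u" "u \<le> 1"
 shows "circ t = circ u \<longleftrightarrow> t = u \<or> {t, u} = {0, 1}"
proof
 assume "circ t = circ u"
 hence "circ t 0 = circ u 0" "circ t 1 = circ u 1" by simp_all
 hence "sin (2 * pi * t) = sin (2 * pi * u) \<and> cos (2 * pi * t) = cos (2 * pi * u)"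
  by (simp add: circ_def)
 then obtain k :: int where "2 * pi * t = 2 * pi * u + 2 * pi * k"
  unfolding sin_cos_eq_iff by blast
 hence "2 * pi * t = 2 * pi * (u + k)" by (simp add: distrib_left)
 hence tk: "t = u + k" by simp
 hence "- 1 \<le> real_of_int k" "real_of_int k \<le> 1" using assms by linarith+
 hence "k = -1 \<or> k = 0 \<or> k = 1" by linarith
 thus "t = u \<or> {t, u} = {0, 1}"
  using tk assms by auto
next
 assume "t = u \<or> {t, u} = {0, 1}"
 thus "circ t = circ u"
  using circ_0 circ_1 by (auto simp: doubleton_eq_iff)
qed

lemma quotient_circ: "quotient_map (top_of_set (splx 1)) (top_of_set (disc_sphere 2)) (%x. circ (x 1))"
proof (rule quotient_map_compact[OF _ compact_standard_simplex])
 show "continuous_on (splx 1) (%x. circ (x 1))"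
  by (rule continuous_on_compose2[OF continuous_on_circ[of UNIV] cont_coord]) auto
 have "\<exists>x\<in>standard_simplex 1. y = circ (x 1)" if y: "y \<in> disc_sphere 2" for y
 proof -
  obtain t where t: "0 \<le> t" "t < 1" "y = circ t" using disc_sphere_circ[OF y] .
  have "slide t (vert 0) (vert 1) \<in> splx 1" by (rule slide_in_simplex) (use t in auto)
  thus ?thesis using t by (intro bexI[of _ "slide t (vert 0) (vert 1)"]) (simp_all add: vert_def)
 qed
 thus "(%x. circ (x 1)) ` splx 1 = disc_sphere 2"
  using circ_sphere by auto
qed

lemma simplex_1_ext:
 assumes "x \<in> splx 1" "y \<in> splx 1" "x 1 = y 1" shows "x = y"
 using simplex_1_as_slide[OF assms(1)] simplex_1_as_slide[OF assms(2)] assms(3) by metis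

lemma simplex_1_vert: "x \<in> splx 1 ==> x 1 = 0 ==> x = vert 0" "x \<in> splx 1 ==> x 1 = 1 ==> x = vert 1"
 by (rule simplex_1_ext; simp add: vert_def)+

lemma circ_factor:
 assumes ends: "p (vert 0) = p (vert 1)"
 obtains s where "!!x. x \<in> splx 1 ==> s (circ (x 1)) = p x"
proof
 fix x assume x: "x \<in> splx 1"
 define x' where "x' = (SOME x'. x' \<in> splx 1 \<and> circ (x' 1) = circ (x 1))"
 have x': "x' \<in> splx 1" "circ (x' 1) = circ (x 1)"
  using someI[of "%x'. x' \<in> splx 1 \<and> circ (x' 1) = circ (x 1)" x] x by (auto simp: x'_def)
 hence "x' 1 = x 1 \<or> {x' 1, x 1} = {0, 1}"
  using circ_eq_iff simplex_1_coord x by metis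
 hence "p x' = p x"
  using simplex_1_ext[OF x'(1) x] simplex_1_vert[OF x] simplex_1_vert[OF x'(1)] ends by (auto simp: doubleton_eq_iff)
 thus "(%y. p (SOME x'. x' \<in> splx 1 \<and> circ (x' 1) = y)) (circ (x 1)) = p x"
  by (simp add: x'_def)
qed

text \<open>The disc is a cylinder over the circle with one end collapsed to the centre, and the
  circle is an interval with its ends identified. Compactness makes this a quotient map, so that
  null homotopies of loops become maps on the disc.\<close>

lemma quotient_disc:
 "quotient_map (top_of_set ({0..1::real} \<times> splx 1)) (disc 2) (%q. (%k. (1 - fst q) * circ (snd q 1) k))"
proof (rule quotient_map_compact[OF _ compact_Times[OF compact_Icc compact_standard_simplex]])
 let ?S = "{0..1::real} \<times> splx 1"
 have c: "continuous_on ?S (%q. circ (snd q 1))"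
  by (rule continuous_on_compose2[OF continuous_on_circ[of UNIV] continuous_on_snd_coordinate]) auto
 show "continuous_on ?S (%q. (%k. (1 - fst q) * circ (snd q 1) k))"
  by (intro cont_prod continuous_on_mult continuous_on_diff continuous_on_const
    continuous_on_fst continuous_on_id continuous_on_coord[OF c])
 show "(%q. (%k. (1 - fst q) * circ (snd q 1) k)) ` ?S = cdisc 2"
 proof (intro equalityI subsetI)
  fix y assume y: "y \<in> cdisc 2"
  have "\<exists>z\<in>disc_sphere 2. y = (%k. rad 2 y * z k)"
  proof (cases "y = (%_. 0)")
   case True thus ?thesis using circ_sphere by (intro bexI[of _ "circ 0"]) auto
  next
   case False
   have "(%k. ((1 - 1) + 1 / rad 2 y) * y k) \<in> disc_sphere 2"
    by (rule radial_in_disc(2)[OF punctured_disc_rad[OF y False]]) auto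
   thus ?thesis using punctured_disc_rad(2)[OF y False] by (intro bexI) auto
  qed
  then obtain z where z: "z \<in> disc_sphere 2" "y = (%k. rad 2 y * z k)" by blast
  then obtain x where x: "x \<in> splx 1" "z = circ (x 1)"
   using topspace_quotient[OF quotient_circ] by auto
  have "rad 2 y \<le> 1" "0 \<le> rad 2 y" using y by (auto simp: closed_disc_iff rad_def sum_nonneg)
  thus "y \<in> (%q. (%k. (1 - fst q) * circ (snd q 1) k)) ` ?S"
   using z x by (intro image_eqI[of _ _ "(1 - rad 2 y, x)"]) auto
 next
  fix y assume "y \<in> (%q. (%k. (1 - fst q) * circ (snd q 1) k)) ` ?S"
  thus "y \<in> cdisc 2"
   using circ_sphere disc_sphere_subset by (auto intro!: scale_in_closed_disc)
 qed
qed

definition restrict_atlas :: "'m set => ('m set \<times> ('m => 'a)) set => ('m set \<times> ('m => 'a)) set" where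
 "restrict_atlas A H = (%(U, t). (U \<inter> A, t)) ` H"

context structure_group begin

lemma sect_quotient:
 assumes q: "quotient_map Z Y q" and s: "sect M A Z (%z. u (q z)) (%z. s (q z))" and at: "atlas M A" and u: "cmap Y M u"
 shows "sect M A Y u s"
 unfolding sect_def
proof (intro conjI ballI u)
 show "s y \<in> carrier G" if "y \<in> topspace Y" for y
  using that sect_carrier[OF s] topspace_quotient[OF q] by force
 show "case p of (U, t) => cmap (subtop Y {y. u y \<in> U}) T (%y. inv (t (u y)) \<otimes> s y)" if p: "p \<in> A" for p
 proof -
  obtain U t where U: "p = (U, t)" "(U, t) \<in> A" using p by (cases p) auto
  let ?V = "{y \<in> topspace Y. u y \<in> U}"
  have "{z \<in> topspace Z. q z \<in> ?V} = {z \<in> topspace Z. u (q z) \<in> U}"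
   using topspace_quotient[OF q] by auto
  from quotient_map_restriction[OF q this] openin_chart_preimage[OF at U(2) u]
  have "quotient_map (subtop Z {z \<in> topspace Z. u (q z) \<in> U}) (subtop Y ?V) q" by blast
  hence "quotient_map (subtop Z {z. u (q z) \<in> U}) (subtop Y {y. u y \<in> U}) q"
   by (simp add: subtop_topspace_Int)
  from continuous_compose_quotient_map[OF this, of T "%y. inv (t (u y)) \<otimes> s y"]
  show ?thesis using sect_chartD[OF s U(2)] by (simp add: U(1) o_def)
 qed
qed

text \<open>With equal end values a section along the loop factors through the circle, which is a
  quotient of the 1-simplex.\<close>

lemma sect_circle:
 assumes at: "atlas M A" and u: "cmap (top_of_set (disc_sphere 2)) M u"
  and p: "psect M A (simplex_map 1 u circ_loop) p" and ends: "p (vert 0) = p (vert 1)"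
 obtains s where "sect M A (top_of_set (disc_sphere 2)) u s" "!!x. x \<in> splx 1 ==> s (circ_loop x) = p x"
proof -
 obtain s where s: "!!x. x \<in> splx 1 ==> s (circ (x 1)) = p x"
  by (rule circ_factor[OF ends]) blast
 have "psect M A (%x. u (circ (x 1))) (%x. s (circ (x 1)))"
  by (rule sect_cong[OF p]) (simp_all add: s simplex_map_apply circ_loop_def)
 hence "sect M A (top_of_set (disc_sphere 2)) u s"
  by (rule sect_quotient[OF quotient_circ _ at u])
 thus thesis using s by (intro that) (auto simp: circ_loop_def)
qed

text \<open>A null homotopy of the loop is constant on the fibres of the quotient map to the disc:
  it is 1 on the end of the cylinder that collapses to the centre, and also along the seam.\<close>

lemma disc_extension:
 assumes w: "cmap (top_of_set (disc_sphere 2)) T w"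
  and one: "w (vert 0) = \<one>" and null: "loop_class (%x. w (circ_loop x)) = one1"
 obtains W where "cmap (disc 2) T W" "!!y. y \<in> disc_sphere 2 ==> W y = w y"
proof -
 have "gpath (%x. w (circ_loop x))"
  by (rule cmap_comp2[OF simplex_cont[OF circ_loop_simplex] w])
 hence "gloop (%x. w (circ_loop x))"
  using one circ_0 circ_1 by (auto simp: gloop_def circ_loop_def vert_def)
 then obtain H where H: "cmap (top_of_set ({0..1::real} \<times> splx 1)) T H"
   "!!x. x \<in> splx 1 ==> H (0, x) = w (circ_loop x)" "!!x. x \<in> splx 1 ==> H (1, x) = \<one>"
   "!!t. [|0 \<le> t; t \<le> 1|] ==> H (t, vert 0) = \<one> \<and> H (t, vert 1) = \<one>"
  using loop_class_null[OF _ null] by metis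
 let ?q = "%q. (%k. (1 - fst q) * circ (snd q 1) k)" and ?S = "{0..1::real} \<times> splx 1"
 have fac: "H q = H q'" if q: "q \<in> ?S" "q' \<in> ?S" and eq: "?q q = ?q q'" for q q'
 proof -
  obtain t x where tx: "q = (t, x)" "0 \<le> t" "t \<le> 1" "x \<in> splx 1" using q(1) by auto
  obtain u y where uy: "q' = (u, y)" "0 \<le> u" "u \<le> 1" "y \<in> splx 1" using q(2) by auto
  have "rad 2 (circ v) = 1" for v using circ_sphere[of v] by (simp add: disc_sphere_iff)
  hence "1 - t = 1 - u"
   using arg_cong[OF eq, of "rad 2"] tx uy by (simp add: rad_scale)
  hence ut: "t = u" by simp
  show ?thesis
  proof (cases "t = 1")
   case True thus ?thesis using ut tx uy H(3) by simp
  next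
   case False
   have "circ (x 1) = circ (y 1)"
    using eq False ut tx(1) uy(1) by (auto simp: fun_eq_iff)
   hence "x 1 = y 1 \<or> {x 1, y 1} = {0, 1}"
    using circ_eq_iff simplex_1_coord tx(4) uy(4) by metis
   thus ?thesis
    using simplex_1_ext[OF tx(4) uy(4)] simplex_1_vert[OF tx(4)] simplex_1_vert[OF uy(4)] H(4)[OF tx(2,3)] ut tx(1) uy(1)
    by (auto simp: doubleton_eq_iff)
  qed
 qed
 define W where "W y = H (SOME q. q \<in> ?S \<and> ?q q = y)" for y
 have W: "W (?q q) = H q" if q: "q \<in> ?S" for q
 proof -
  have "(SOME q'. q' \<in> ?S \<and> ?q q' = ?q q) \<in> ?S \<and> ?q (SOME q'. q' \<in> ?S \<and> ?q q' = ?q q) = ?q q"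
   using someI[of "%q'. q' \<in> ?S \<and> ?q q' = ?q q" q] q by simp
  hence "H (SOME q'. q' \<in> ?S \<and> ?q q' = ?q q) = H q"
   by (intro fac[OF _ q]) simp_all
  thus ?thesis unfolding W_def .
 qed
 have "cmap (disc 2) T W"
  by (rule continuous_compose_quotient_map[OF quotient_disc])
   (rule cmap_eq[OF H(1)], use W in auto)
 moreover have "W y = w y" if y: "y \<in> disc_sphere 2" for y
 proof -
  obtain x where x: "x \<in> splx 1" "y = circ (x 1)"
   using topspace_quotient[OF quotient_circ] y by auto
  show ?thesis
   using W[of "(0, x)"] H(2)[OF x(1)] x by (simp add: circ_loop_def)
 qed
 ultimately show thesis by (rule that)
qed

lemma atlas_restrict:
 assumes at: "atlas M H" shows "atlas (subtop M A) (restrict_atlas A H)"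
proof -
 have "cmap (subtop (subtop M A) (U \<inter> A \<inter> (U' \<inter> A))) T (%x. inv (t x) \<otimes> t' x)"
  if U: "(U, t) \<in> H" and U': "(U', t') \<in> H" for U t U' t'
 proof -
  have "subtop (subtop M A) (U \<inter> A \<inter> (U' \<inter> A)) = subtop (subtop M (U \<inter> U')) A"
   unfolding subtop_subtop by (rule arg_cong[where f = "subtop M"]) auto
  thus ?thesis
   using cmap_from_sub[OF atlas_transition[OF at U U'], of A] by simp
 qed
 moreover have "openin (subtop M A) (U \<inter> A)" if "(U, t) \<in> H" for U t
  using openin_subtopology_Int2[OF atlas_open[OF at that], of A] by (simp add: Int_commute)
 moreover have "\<exists>(U, t)\<in>restrict_atlas A H. x \<in> U" if x: "x \<in> topspace (subtop M A)" for x
 proof -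
  have "x \<in> topspace M" using x by simp
  then obtain U t where "(U, t) \<in> H" "x \<in> U" by (rule atlas_cover[OF at])
  thus ?thesis
   using x unfolding restrict_atlas_def by (intro bexI[of _ "(U \<inter> A, t)"]) force+
 qed
 ultimately show ?thesis
  using atlas_carrier[OF at] unfolding atlas_def by (auto simp: restrict_atlas_def)
qed

lemma sect_restrict_iff:
 "sect (subtop M A) (restrict_atlas A H) Y u s \<longleftrightarrow> sect M H Y u s \<and> (\<forall>y\<in>topspace Y. u y \<in> A)"
proof (cases "\<forall>y\<in>topspace Y. u y \<in> A")
 case True
 have eq: "subtop Y {y. u y \<in> U \<inter> A} = subtop Y {y. u y \<in> U}" for U
 proof -
  have "{y \<in> topspace Y. u y \<in> U \<inter> A} = {y \<in> topspace Y. u y \<in> U}" using True by auto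
  thus ?thesis
   using subtop_topspace_Int[of Y "%y. u y \<in> U \<inter> A"] subtop_topspace_Int[of Y "%y. u y \<in> U"] by simp
 qed
 have "cmap Y (subtop M A) u \<longleftrightarrow> cmap Y M u"
  using True by (auto simp: cmap_in_sub)
 moreover have "(\<forall>(U, t)\<in>restrict_atlas A H. cmap (subtop Y {y. u y \<in> U}) T (%y. inv (t (u y)) \<otimes> s y)) \<longleftrightarrow>
   (\<forall>(U, t)\<in>H. cmap (subtop Y {y. u y \<in> U}) T (%y. inv (t (u y)) \<otimes> s y))"
  unfolding restrict_atlas_def ball_simps split_def fst_conv snd_conv eq ..
 ultimately show ?thesis
  using True unfolding sect_def by blast
next
 case False
 have "\<not> cmap Y (subtop M A) u"
  using False continuous_map_image_in[of Y "subtop M A" u] by auto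
 thus ?thesis
  using False unfolding sect_def by blast
qed

end

section \<open>Isomorphisms checked cell by cell\<close>

locale bundle_cw = structure_group G T + cw X I d ch
 for G :: "'a monoid" (structure) and T and X :: "'m topology" and I :: "'i set" and d ch
begin

text \<open>Continuity is tested on the discs. There the expression of \<open>h\<close> between two
  charts is the image section divided by the given section, each read in its own chart.\<close>

lemma cw_isoI:
 assumes at: "atlas X A" and at': "atlas X A'" and h: "!!x. h x \<in> carrier G"
  and cells: "!!i. i \<in> I ==> \<exists>s. sect X A (disc (d i)) (ch i) s \<and> sect X A' (disc (d i)) (ch i) (%y. h (ch i y) \<otimes> s y)"
 shows "atlas_iso X A A' h"
proof (rule atlas_isoI[OF h])
 fix U t U' t' assume U: "(U, t) \<in> A" and U': "(U', t') \<in> A'"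
 show "cmap (subtop X (U \<inter> U')) T (%x. inv (t' x) \<otimes> h x \<otimes> t x)"
 proof (rule continuous_map_weak)
  show "openin X (U \<inter> U')"
   using atlas_open[OF at U] atlas_open[OF at' U'] by blast
  fix i assume i: "i \<in> I"
  obtain s where s: "sect X A (disc (d i)) (ch i) s" and s': "sect X A' (disc (d i)) (ch i) (%y. h (ch i y) \<otimes> s y)"
   using cells[OF i] by blast
  let ?W = "{y \<in> cdisc (d i). ch i y \<in> U \<inter> U'}"
  have eq: "top_of_set ?W = subtop (subtop (disc (d i)) {y. ch i y \<in> U}) {y. ch i y \<in> U'}"
   "top_of_set ?W = subtop (subtop (disc (d i)) {y. ch i y \<in> U'}) {y. ch i y \<in> U}"
   unfolding subtop_subtop by (rule arg_cong[where f = "subtop euclidean"]; auto)+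
  have 1: "cmap (top_of_set ?W) T (%y. inv (t (ch i y)) \<otimes> s y)"
   unfolding eq(1) by (rule cmap_from_sub[OF sect_chartD[OF s U]])
  have 2: "cmap (top_of_set ?W) T (%y. inv (t' (ch i y)) \<otimes> (h (ch i y) \<otimes> s y))"
   unfolding eq(2) by (rule cmap_from_sub[OF sect_chartD[OF s' U']])
  from cm_mult[OF 2 cm_inv[OF 1]]
  show "cmap (top_of_set ?W) T (%y. inv (t' (ch i y)) \<otimes> h (ch i y) \<otimes> t (ch i y))"
   by (rule cmap_eq)
    (use sect_carrier[OF s] h atlas_carrier[OF at U] atlas_carrier[OF at' U'] in \<open>simp add: inv_mult_group m_assoc mult_div\<close>)
 qed
qed

end

section \<open>Clutching over the top cells\<close>

locale bundle_cw_dim = structure_group G T + cw_dim X I d ch n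
 for G :: "'a monoid" (structure) and T and X :: "'m topology" and I :: "'i set" and d ch n
begin

definition retr :: "'m => 'm" where "retr x = push (1, x)"

abbreviation unit_vec :: "(nat => real) => nat => real" where "unit_vec y \<equiv> (%k. y k / rad n y)"

lemma unit_vec_sphere: "[|y \<in> cdisc n; y \<noteq> (%_. 0)|] ==> unit_vec y \<in> disc_sphere n"
 using radial_in_disc(2)[OF punctured_disc_rad, of y n 1] by simp

lemma unit_vec_id: "y \<in> disc_sphere n ==> unit_vec y = y"
 by (simp add: disc_sphere_iff)

lemma continuous_on_unit_vec: "continuous_on (cdisc n - {%_. 0}) unit_vec"
 by (intro cont_prod continuous_intros cont_coord)
  (use punctured_disc_rad(2) in auto)

lemma retr_cell:
 assumes "i \<in> I" "d i = n" "y \<in> cdisc n" "y \<noteq> (%_. 0)"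
 shows "retr (ch i y) = ch i (unit_vec y)"
 using push_cell[OF assms, of 1] by (simp add: retr_def)

lemma retr_skel [simp]: "x \<in> skel n ==> retr x = x"
 by (simp add: retr_def push_def)

lemma punctured_cases:
 assumes "x \<in> punctured"
 obtains "x \<in> skel n" | i y where "i \<in> I" "d i = n" "y \<in> odisc n" "y \<noteq> (%_. 0)" "x = ch i y"
proof -
 have "x \<in> topspace X" using assms by (simp add: punctured_def)
 then obtain i y where i: "i \<in> I" "y \<in> odisc (d i)" "x = ch i y" by (rule in_cell)
 hence y: "y \<in> cdisc (d i)" using open_sub_disc by blast
 show thesis
  using that i skel_n_iff[OF i(1) y] punctured_iff[OF i(1) y] dim[OF i(1)] assms by (metis le_neq_implies_less)
qed

lemma retr_in_skel: "x \<in> punctured ==> retr x \<in> skel n"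
proof (erule punctured_cases)
 fix i y assume "i \<in> I" "d i = n" "y \<in> odisc n" "y \<noteq> (%_. 0)" "x = ch i y"
 moreover from this have "y \<in> cdisc n" using open_sub_disc by blast
 ultimately show "retr x \<in> skel n"
  using retr_cell[of i y] unit_vec_sphere[of y] skel_boundary[of i n "unit_vec y"] by simp
qed simp

lemma continuous_retr: "cmap (subtop X punctured) (subtop X (skel n)) retr"
proof -
 have "cmap (subtop X punctured) (prod_topology (top_of_set {0..1::real}) (subtop X punctured)) (%x. (1, x))"
  by (intro continuous_map_pairedI) auto
 from cmap_comp2[OF this continuous_push]
 show ?thesis
  using retr_in_skel by (auto simp: retr_def[abs_def, symmetric] retr_def cmap_in_sub)
qed

lemma closed_disc_nonzero_cell:
 assumes "i \<in> I" "d i = n" "y \<in> cdisc n" shows "ch i y \<in> punctured \<longleftrightarrow> y \<noteq> (%_. 0)"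
 using punctured_iff[OF assms(1), of y] assms by simp

context
 fixes \<T>\<^sub>1 and s :: "'i => (nat => real) => 'a"
 assumes at1: "atlas (subtop X (skel n)) \<T>\<^sub>1"
  and s: "!!i. [|i \<in> I; d i = n|] ==> sect (subtop X (skel n)) \<T>\<^sub>1 (top_of_set (disc_sphere n)) (ch i) (s i)"
begin

text \<open>On an open top cell the chart is the boundary section at the radial projection of the
  point. At the centre, which lies in no other chart, the value is arbitrary.\<close>

definition clutch_chart :: "'m => 'a" where
 "clutch_chart x = (if x \<in> top_part \<inter> punctured then s (cidx x) (unit_vec (ccoord x)) else \<one>)"

text \<open>Over the punctured complex the bundle is pulled back along the retraction to the
  skeleton, over the open top cells it is trivial, and the boundary sections \<open>s\<close> glue
  the two parts.\<close>

definition clutching :: "('m set \<times> ('m => 'a)) set" where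
 "clutching = insert (top_part, clutch_chart) ((%(U, t). ({x \<in> punctured. retr x \<in> U}, %x. t (retr x))) ` \<T>\<^sub>1)"

lemma clutch_chart_cell:
 assumes i: "i \<in> I" "d i = n" and y: "y \<in> odisc n" "y \<noteq> (%_. 0)"
 shows "clutch_chart (ch i y) = s i (unit_vec y)"
proof -
 have "ch i y \<in> top_part" using i y top_part_eq by auto
 moreover have "ch i y \<in> punctured"
  using closed_disc_nonzero_cell[OF i, of y] y open_sub_disc by blast
 moreover have "y \<in> odisc (d i)" using y i by simp
 ultimately show ?thesis
  using i y by (simp add: clutch_chart_def)
qed

lemma clutch_cases:
 assumes "x \<in> top_part \<inter> punctured"
 obtains i y where "i \<in> I" "d i = n" "y \<in> odisc n" "y \<noteq> (%_. 0)" "x = ch i y"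
 using assms by (auto simp: top_part_def elim: punctured_cases)

lemma clutch_chart_carrier: "clutch_chart x \<in> carrier G"
proof (cases "x \<in> top_part \<inter> punctured")
 case True
 then obtain i y where i: "i \<in> I" "d i = n" "y \<in> odisc n" "y \<noteq> (%_. 0)" "x = ch i y" by (rule clutch_cases)
 hence "unit_vec y \<in> disc_sphere n" using unit_vec_sphere open_sub_disc by blast
 thus ?thesis
  using sect_carrier[OF s[OF i(1,2)], of "unit_vec y"] clutch_chart_cell[OF i(1-4)] i(5) by simp
next
 case False
 hence "clutch_chart x = \<one>" unfolding clutch_chart_def by (rule if_not_P)
 thus ?thesis by simp
qed

lemma openin_retr_preimage:
 assumes "openin (subtop X (skel n)) V" shows "openin X {x \<in> punctured. retr x \<in> V}"
proof -
 have "openin (subtop X punctured) {x \<in> topspace (subtop X punctured). retr x \<in> V}"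
  by (rule openin_cmap[OF continuous_retr assms])
 thus ?thesis
  using open_punctured openin_subset[OF open_punctured] by (simp add: openin_open_subtopology Int_absorb1)
qed

text \<open>Locally the chart is a boundary section composed with the radial projection. This is the
  continuity of the transitions between the gluing chart and the pulled back charts.\<close>

lemma sect_clutch_chart: "sect (subtop X (skel n)) \<T>\<^sub>1 (subtop X (top_part \<inter> punctured)) retr clutch_chart"
proof (rule sect_local[OF at1])
 let ?Y = "subtop X (top_part \<inter> punctured)"
 fix x assume "x \<in> topspace ?Y"
 hence x: "x \<in> top_part \<inter> punctured" by simp
 obtain i y where i: "i \<in> I" "d i = n" and y: "y \<in> odisc n" "y \<noteq> (%_. 0)" "x = ch i y" using x by (rule clutch_cases)
 let ?C = "ch i ` odisc n" and ?W = "ch i ` odisc n \<inter> punctured"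
 have CT: "?C \<subseteq> top_part" using i top_part_eq by blast
 obtain g where "homeomorphic_maps (top_of_set (odisc n)) (subtop X ?C) (ch i) g"
  using homeo[OF i(1)] i(2) homeomorphic_map_maps by metis
 hence g: "cmap (subtop X ?C) (top_of_set (odisc n)) g" "!!z. z \<in> odisc n ==> g (ch i z) = z"
  by (auto simp: homeomorphic_maps_def)
 have W: "z \<in> ?W \<longleftrightarrow> (\<exists>y\<in>open_disc n. y \<noteq> (%_. 0) \<and> z = ch i y)" for z
  using closed_disc_nonzero_cell[OF i] open_sub_disc[of n] by auto
 have "subtop (subtop X ?C) ?W = subtop X ?W"
  by (simp add: subtop_subtop Int_absorb1)
 hence "cmap (subtop X ?W) (top_of_set (odisc n)) g"
  using cmap_from_sub[OF g(1), of ?W] by simp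
 hence "cmap (subtop X ?W) (top_of_set (cdisc n - {%_. 0})) g"
  unfolding cmap_in_sub using W g(2) open_sub_disc[of n] by force
 moreover have "cmap (top_of_set (cdisc n - {%_. 0})) (top_of_set (disc_sphere n)) unit_vec"
  using continuous_on_unit_vec unit_vec_sphere by (auto simp: cmap_in_sub)
 ultimately have "cmap (subtop X ?W) (top_of_set (disc_sphere n)) (%z. unit_vec (g z))"
  by (rule cmap_comp2)
 from sect_compose[OF s[OF i] this]
 have "sect (subtop X (skel n)) \<T>\<^sub>1 (subtop X ?W) retr clutch_chart"
 proof (rule sect_cong)
  fix z assume "z \<in> topspace (subtop X ?W)"
  then obtain y where y: "y \<in> odisc n" "y \<noteq> (%_. 0)" "z = ch i y" using W by auto
  have "y \<in> cdisc n" using y open_sub_disc by blast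
  thus "retr z = ch i (unit_vec (g z))" "clutch_chart z = s i (unit_vec (g z))"
   using retr_cell[OF i _ y(2)] clutch_chart_cell[OF i y(1,2)] y g(2) by simp_all
 qed
 moreover have "subtop ?Y ?W = subtop X ?W"
  unfolding subtop_subtop by (rule arg_cong[where f = "subtop X"]) (use CT in auto)
 moreover have "openin ?Y ?W"
 proof -
  have "openin ?Y ((top_part \<inter> punctured) \<inter> ?C)" by (rule openin_subtopology_Int2[OF openin_cell[OF i]])
  moreover have "(top_part \<inter> punctured) \<inter> ?C = ?W" using CT by auto
  ultimately show ?thesis by simp
 qed
 ultimately show "\<exists>W. openin ?Y W \<and> x \<in> W \<and> sect (subtop X (skel n)) \<T>\<^sub>1 (subtop ?Y W) retr clutch_chart"
  using x y by (intro exI[of _ ?W]) auto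
qed

lemma atlas_clutching: "atlas X clutching"
 unfolding atlas_def
proof (intro conjI)
 show "\<forall>(U, t)\<in>clutching. openin X U \<and> (\<forall>x. t x \<in> carrier G)"
  using open_top_part clutch_chart_carrier openin_retr_preimage[OF atlas_open[OF at1]] atlas_carrier[OF at1]
  by (auto simp: clutching_def)
 show "\<forall>x\<in>topspace X. \<exists>(U, t)\<in>clutching. x \<in> U"
 proof
  fix x assume x: "x \<in> topspace X"
  show "\<exists>(U, t)\<in>clutching. x \<in> U"
  proof (cases "x \<in> top_part")
   case False
   hence p: "x \<in> punctured" using punctured_top_part x by blast
   have "retr x \<in> topspace (subtop X (skel n))"
    using continuous_map_image_in[OF continuous_retr] p x by simp
   then obtain U t where "(U, t) \<in> \<T>\<^sub>1" "retr x \<in> U" by (rule atlas_cover[OF at1])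
   thus ?thesis
    using p unfolding clutching_def by (intro bexI[of _ "({x \<in> punctured. retr x \<in> U}, %x. t (retr x))"]) auto
  qed (auto simp: clutching_def)
 qed
 let ?P = "%U :: 'm set. {x \<in> punctured. retr x \<in> U}"
 have 1: "cmap (subtop X (?P U \<inter> ?P U')) T (%x. inv (t (retr x)) \<otimes> t' (retr x))"
  if U: "(U, t) \<in> \<T>\<^sub>1" and U': "(U', t') \<in> \<T>\<^sub>1" for U t U' t'
 proof (rule cmap_comp2[OF _ atlas_transition[OF at1 U U']])
  have "subtop X (?P U \<inter> ?P U') = subtop (subtop X punctured) (?P U \<inter> ?P U')"
   unfolding subtop_subtop by (rule arg_cong[where f = "subtop X"]) auto
  thus "cmap (subtop X (?P U \<inter> ?P U')) (subtop (subtop X (skel n)) (U \<inter> U')) retr"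
   using cmap_from_sub[OF continuous_retr, of "?P U \<inter> ?P U'"]
   by (auto simp: cmap_in_sub)
 qed
 have 2: "cmap (subtop X (?P U \<inter> top_part)) T (%x. inv (t (retr x)) \<otimes> clutch_chart x)" if U: "(U, t) \<in> \<T>\<^sub>1" for U t
 proof -
  have "subtop (subtop X (top_part \<inter> punctured)) {x. retr x \<in> U} = subtop X (?P U \<inter> top_part)"
   unfolding subtop_subtop by (rule arg_cong[where f = "subtop X"]) auto
  thus ?thesis using sect_chartD[OF sect_clutch_chart U] by simp
 qed
 have 3: "cmap (subtop X (top_part \<inter> ?P U)) T (%x. inv (clutch_chart x) \<otimes> t (retr x))" if U: "(U, t) \<in> \<T>\<^sub>1" for U t
 proof -
  from cm_inv[OF 2[OF U]] show ?thesis
   unfolding Int_commute[of top_part]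
   by (rule cmap_eq) (simp add: inv_mult_group clutch_chart_carrier atlas_carrier[OF at1 U])
 qed
 have 4: "cmap (subtop X (top_part \<inter> top_part)) T (%x. inv (clutch_chart x) \<otimes> clutch_chart x)"
  by (simp add: clutch_chart_carrier topspace_eq)
 show "\<forall>(U, t)\<in>clutching. \<forall>(U', t')\<in>clutching. cmap (subtop X (U \<inter> U')) T (%x. inv (t x) \<otimes> t' x)"
  unfolding clutching_def using 1 2 3 4 by auto
qed

text \<open>Over the punctured complex the clutched bundle is a pullback, so sections of the bundle
  over the skeleton along the retracted map serve as its sections.\<close>

lemma sect_clutching_punctured:
 assumes u: "cmap Y (subtop X punctured) u" and s0: "sect (subtop X (skel n)) \<T>\<^sub>1 Y (%y. retr (u y)) s\<^sub>0"
 shows "sect X clutching Y u s\<^sub>0"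
proof (rule sect_coverI[OF atlas_clutching])
 show "cmap Y X u" using u by (simp add: cmap_in_sub)
 show "s\<^sub>0 y \<in> carrier G" if "y \<in> topspace Y" for y by (rule sect_carrier[OF s0 that])
 fix y assume y: "y \<in> topspace Y"
 have "retr (u y) \<in> topspace (subtop X (skel n))"
  using continuous_map_image_in[OF sect_continuous[OF s0] y] .
 then obtain U t where U: "(U, t) \<in> \<T>\<^sub>1" "retr (u y) \<in> U" by (rule atlas_cover[OF at1])
 let ?W = "{y \<in> topspace Y. retr (u y) \<in> U}"
 have "openin Y ?W" by (rule openin_chart_preimage[OF at1 U(1) sect_continuous[OF s0]])
 moreover have "cmap (subtop Y ?W) T (%y. inv (t (retr (u y))) \<otimes> s\<^sub>0 y)"
  using sect_chartD[OF s0 U(1)] by (simp add: subtop_topspace_Int)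
 moreover have "u ` ?W \<subseteq> {x \<in> punctured. retr x \<in> U}"
  using continuous_map_image_in[OF u] by auto
 moreover have "({x \<in> punctured. retr x \<in> U}, %x. t (retr x)) \<in> clutching"
  using U(1) by (force simp: clutching_def)
 ultimately show "\<exists>W U t. openin Y W \<and> y \<in> W \<and> (U, t) \<in> clutching \<and> u ` W \<subseteq> U \<and>
    cmap (subtop Y W) T (%y. inv (t (u y)) \<otimes> s\<^sub>0 y)"
  using y U(2) by (intro exI[of _ ?W] exI[of _ "{x \<in> punctured. retr x \<in> U}"] exI[of _ "%x. t (retr x)"]) auto
qed

lemma sect_clutching_skel:
 assumes s0: "sect (subtop X (skel n)) \<T>\<^sub>1 Y u s\<^sub>0" shows "sect X clutching Y u s\<^sub>0"
proof -
 have u: "cmap Y (subtop X (skel n)) u" by (rule sect_continuous[OF s0])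
 hence "u y \<in> skel n" if "y \<in> topspace Y" for y
  using continuous_map_image_in[OF u that] by simp
 thus ?thesis
  using u skel_subset_punctured
  by (intro sect_clutching_punctured sect_cong[OF s0]) (auto simp: cmap_in_sub)
qed

text \<open>The trivialisation of the open cell and the given section on the sphere fit together,
  because away from the centre the former is constant along radii.\<close>

lemma sect_clutching_cell:
 assumes i: "i \<in> I" "d i = n"
 obtains s' where "sect X clutching (disc n) (ch i) s'" "!!y. y \<in> disc_sphere n ==> s' y = s i y"
proof -
 let ?O = "odisc n" and ?P = "cdisc n - {%_. 0}"
 define s' where "s' y = (if y \<in> odisc n then clutch_chart (ch i y) else s i y)" for y
 have ch: "cmap (disc n) X (ch i)" using cont[OF i(1)] i(2) by simp
 have sub: "subtop (disc n) ?O = top_of_set ?O" "subtop (disc n) ?P = top_of_set ?P"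
  using open_sub_disc[of n] by (auto simp: subtop_subtop Int_absorb1 intro!: arg_cong[where f = "subtop euclidean"])
 have 1: "sect X clutching (top_of_set ?O) (ch i) s'"
 proof (rule sect_cong)
  show "sect X clutching (top_of_set ?O) (ch i) (%y. clutch_chart (ch i y))"
  proof (rule sect_chart[OF atlas_clutching])
   show "(top_part, clutch_chart) \<in> clutching" by (simp add: clutching_def)
   show "cmap (top_of_set ?O) X (ch i)"
    using cmap_from_sub[OF ch, of ?O] sub(1) by simp
   show "ch i y \<in> top_part" if "y \<in> topspace (top_of_set ?O)" for y
    using that i top_part_eq by auto
  qed
 qed (simp_all add: s'_def)
 have 2: "sect X clutching (top_of_set ?P) (ch i) s'"
 proof (rule sect_clutching_punctured)
  show "cmap (top_of_set ?P) (subtop X punctured) (ch i)"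
   using cmap_from_sub[OF ch, of ?P] sub(2) closed_disc_nonzero_cell[OF i]
   by (auto simp: cmap_in_sub)
  have "cmap (top_of_set ?P) (top_of_set (disc_sphere n)) unit_vec"
   using continuous_on_unit_vec unit_vec_sphere by (auto simp: cmap_in_sub)
  from sect_compose[OF s[OF i] this]
  show "sect (subtop X (skel n)) \<T>\<^sub>1 (top_of_set ?P) (%y. retr (ch i y)) s'"
  proof (rule sect_cong)
   fix y assume "y \<in> topspace (top_of_set ?P)"
   hence y: "y \<in> cdisc n" "y \<noteq> (%_. 0)" by auto
   show "retr (ch i y) = ch i (unit_vec y)" by (rule retr_cell[OF i y])
   show "s' y = s i (unit_vec y)"
    using clutch_chart_cell[OF i _ y(2)] y(1) unit_vec_id[of y] by (auto simp: s'_def disc_sphere_def)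
  qed
 qed
 have "sect X clutching (disc n) (ch i) s'"
 proof (rule sect_local[OF atlas_clutching])
  fix y assume y: "y \<in> topspace (disc n)"
  have o: "openin (disc n) ?O"
  proof -
   have "openin (disc n) {y \<in> topspace (disc n). rad n y \<in> {..<1}}"
    by (rule openin_cmap[of _ euclideanreal]) (auto intro: continuous_intros)
   moreover have "{y \<in> topspace (disc n). rad n y \<in> {..<1}} = ?O" by (auto simp: open_disc_iff closed_disc_iff)
   ultimately show ?thesis by simp
  qed
  have p: "openin (disc n) ?P"
   by (rule openin_diff) (auto simp: closed_subset)
  show "\<exists>W. openin (disc n) W \<and> y \<in> W \<and> sect X clutching (subtop (disc n) W) (ch i) s'"
  proof (cases "y \<in> ?O")
   case True thus ?thesis using o 1 sub by metis
  next
   case False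
   hence "y \<in> ?P" using y by auto
   thus ?thesis using p 2 sub by metis
  qed
 qed
 moreover have "s' y = s i y" if "y \<in> disc_sphere n" for y
  using that by (simp add: s'_def disc_sphere_def)
 ultimately show thesis by (rule that)
qed

end

end

section \<open>Bundles over surfaces\<close>

definition disc_1_inv :: "(nat => real) => nat => real" where
 "disc_1_inv y = (%k. if k = 0 then (1 - y 0) / 2 else if k = 1 then (1 + y 0) / 2 else 0)"

lemma disc_1_inv:
 shows continuous_disc_1_inv: "cmap (disc 1) (top_of_set (splx 1)) disc_1_inv"
  and edge_path_disc_1_inv: "y \<in> cdisc 1 ==> edge_path (disc_1_inv y) = y"
  and disc_1_inv_edge_path: "x \<in> splx 1 ==> disc_1_inv (edge_path x) = x"
  and disc_1_inv_sphere: "y \<in> disc_sphere 1 ==> disc_1_inv y = vert 0 \<or> disc_1_inv y = vert 1"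
proof -
 have y: "\<bar>y 0\<bar> \<le> 1" "\<forall>k\<ge>1. y k = 0" if "y \<in> cdisc 1" for y
 proof -
  have "{..<1::nat} = {0}" by auto
  thus "\<bar>y 0\<bar> \<le> 1" "\<forall>k\<ge>1. y k = 0"
   using that by (auto simp: closed_disc_iff rad_def abs_square_le_1)
 qed
 have in_S: "disc_1_inv y \<in> splx 1" if "y \<in> cdisc 1" for y
  using y[OF that] by (auto simp: standard_simplex_1_iff disc_1_inv_def fun_eq_iff field_simps)
 have "continuous_on (cdisc 1) disc_1_inv"
  unfolding disc_1_inv_def
  by (intro cont_prod cont_if_const continuous_intros cont_coord) auto
 thus "cmap (disc 1) (top_of_set (splx 1)) disc_1_inv"
  using in_S by (auto simp: cmap_in_sub)
 show "edge_path (disc_1_inv y) = y" if "y \<in> cdisc 1"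
  using in_S[OF that] y[OF that] by (auto simp: edge_path_def disc_1_inv_def fun_eq_iff add_divide_distrib)
 show "disc_1_inv (edge_path x) = x" if x: "x \<in> splx 1"
 proof
  have "x = (%k. if k = 0 then 1 - x 1 else if k = 1 then x 1 else 0)" using x unfolding standard_simplex_1_iff by blast
  hence e: "x k = (if k = 0 then 1 - x 1 else if k = 1 then x 1 else 0)" for k by (rule fun_cong)
  show "disc_1_inv (edge_path x) k = x k" for k
   unfolding e[of k] using x by (simp add: edge_path_def disc_1_inv_def)
 qed
 show "disc_1_inv y = vert 0 \<or> disc_1_inv y = vert 1" if "y \<in> disc_sphere 1"
  using that unfolding disc_sphere_1 by (auto simp: disc_1_inv_def vert_def fun_eq_iff)
qed

sublocale bundle_cw_dim \<subseteq> bundle_cw G T X I d ch ..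

locale surface_bundles = bundle_cw_dim G T X I d ch 2
 for G :: "'a monoid" (structure) and T and X :: "'m topology" and I :: "'i set" and d ch +
 fixes x\<^sub>0
 assumes path_connected: "path_connected_space X" and x0: "x\<^sub>0 \<in> topspace X"
begin

abbreviation X1 :: "'m topology" where "X1 \<equiv> subtop X (skel 2)"

abbreviation cells1 :: "'i set" where "cells1 \<equiv> {i \<in> I. d i < 2}"

lemma skeleton: "bundle_cw_dim G T X1 cells1 d ch 1"
proof -
 interpret S: cw X1 cells1 d ch by unfold_locales (rule cw_skel)
 show ?thesis by unfold_locales auto
qed

lemma simplex_X1:
 "sing p X1 u \<longleftrightarrow> sing p X u \<and> (\<forall>x\<in>standard_simplex p. u x \<in> skel 2)"
 by (auto simp: singular_simplex_iff cmap_in_sub)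

lemma cell_X1: "[|i \<in> I; d i < 2; y \<in> cdisc (d i)|] ==> ch i y \<in> skel 2"
 by (rule skel_closed_cell)

lemma boundary_X1: "[|i \<in> I; d i = 2|] ==> cmap (top_of_set (disc_sphere 2)) X1 (ch i)"
 using cmap_mono[OF cont[of i] disc_sphere_subset[of "d i"]] skel_boundary[of i 2]
 by (auto simp: cmap_in_sub)

lemma cidx_skel:
 assumes "x \<in> skel 2" obtains i y where "i \<in> I" "d i < 2" "y \<in> odisc (d i)" "x = ch i y" "cidx x = i"
 using assms cidx unfolding skel_def by blast

definition rim :: "'i => (nat => real) => 'm" where "rim i = simplex_map 1 (ch i) circ_loop"

lemma rim:
 assumes "i \<in> I" "d i = 2"
 shows "sing 1 X1 (rim i)" "rim i (vert 0) = rim i (vert 1)"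
  "x \<in> splx 1 ==> rim i x = ch i (circ_loop x)"
  "chain_boundary 2 (chain_map 2 (ch i) disc_chain) = frag_of (rim i)" "singular_chain 2 X (chain_map 2 (ch i) disc_chain)"
proof -
 show "sing 1 X1 (rim i)"
  unfolding rim_def by (rule singular_simplex_simplex_map[OF circ_loop_simplex boundary_X1[OF assms]])
 show "rim i (vert 0) = rim i (vert 1)"
  using circ_0 circ_1 by (simp add: rim_def simplex_map_apply circ_loop_def) (simp add: vert_def)
 show "x \<in> splx 1 ==> rim i x = ch i (circ_loop x)"
  by (simp add: rim_def simplex_map_apply)
 have c: "singular_chain 2 (disc 2) disc_chain" by (rule disc_chain)
 show "chain_boundary 2 (chain_map 2 (ch i) disc_chain) = frag_of (rim i)"
  using chain_boundary_chain_map[OF c, of "ch i"] disc_chain(2) by (simp add: rim_def)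
 show "singular_chain 2 X (chain_map 2 (ch i) disc_chain)"
  using singular_chain_chain_map[OF c, of X "ch i"] cont[OF assms(1)] assms(2) by simp
qed

lemma circ_loop_disc: "sing 1 (disc 2) circ_loop"
 using singular_simplex_top_of_set_mono[OF circ_loop_simplex disc_sphere_subset] .

section \<open>Flat bundles with cohomologous obstructions are isomorphic\<close>

context
 fixes \<T> \<T>' \<beta>
 assumes fl: "flat X \<T>" and fl': "flat X \<T>'" and \<beta>: "cochain pi1 \<beta>"
  and eq: "!!\<tau>. sing 2 X \<tau> ==> obstruction X \<T> \<tau> = cobd pi1 2 \<beta> \<tau> \<cdot> obstruction X \<T>' \<tau>"
begin

text \<open>On a 1-cell the edge section of one bundle is sent to that of the other, twisted by a
  loop of class \<beta>. Edge sections and loops are 1 at the ends, so the isomorphism is 1 at the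
  vertices and the pieces fit together.\<close>

lemma skeleton_iso:
 obtains h where "!!x. h x \<in> K"
  "!!(Y :: (nat => real) topology) u s. [|sect X \<T> Y u s; !!y. y \<in> topspace Y ==> u y \<in> skel 2|] ==> sect X \<T>' Y u (%y. h (u y) \<otimes> s y)"
  "!!i. [|i \<in> I; d i = 1|] ==> path_class (%x. inv (edge X \<T>' (simplex_map 1 (ch i) edge_path) x) \<otimes>
    (h (simplex_map 1 (ch i) edge_path x) \<otimes> edge X \<T> (simplex_map 1 (ch i) edge_path) x)) = \<beta> (simplex_map 1 (ch i) edge_path)"
proof -
 note at = flat_atlas[OF fl] and at' = flat_atlas[OF fl']
 interpret S: bundle_cw_dim G T X1 cells1 d ch 1 by (rule skeleton)
 define v where "v i = simplex_map 1 (ch i) edge_path" for i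
 have v: "sing 1 X (v i)" if "i \<in> I" "d i = 1" for i
  unfolding v_def using singular_simplex_simplex_map[OF edge_path_simplex, of X "ch i"] cont[OF that(1)] that(2) by simp
 have "\<exists>l. gloop l \<and> loop_class l = \<beta> (v i)" for i
  using loop_class_surj[OF cochainD[OF \<beta>]] by metis
 then obtain l where l: "!!i. gloop (l i)" "!!i. loop_class (l i) = \<beta> (v i)" by metis
 \<comment> \<open>Solved from the requirement that \<open>b\<close> times the edge section of \<T>
   is the edge section of \<T>' times the loop \<open>l i\<close>, with the parameter of the edge
   carried over to the disc.\<close>
 define b where "b i y = edge X \<T>' (v i) (disc_1_inv y) \<otimes> l i (disc_1_inv y) \<otimes> inv (edge X \<T> (v i) (disc_1_inv y))" for i y
 have inS: "disc_1_inv y \<in> splx 1" if "y \<in> cdisc 1" for y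
  using continuous_map_image_in[OF continuous_disc_1_inv] that by auto
 have lK: "l i x \<in> K" if "x \<in> splx 1" for i x
  by (rule map_to_K[of "splx 1" "l i" "vert 0"])
   (use l(1)[of i] that in \<open>auto simp: gloop_def K_one intro: slide_in_simplex\<close>)
 have eK: "edge X \<T> (v i) x \<in> K" "edge X \<T>' (v i) x \<in> K" if "i \<in> I" "d i = 1" "x \<in> splx 1" for i x
  using ksect_K[OF ksect_edge[OF fl v]] ksect_K[OF ksect_edge[OF fl' v]] that by auto
 define h where "h x = (if x \<in> skel 2 \<and> d (cidx x) = 1 then b (cidx x) (ccoord x) else \<one>)" for x
 have h_vertex: "h (ch i y) = \<one>" if "i \<in> I" "d i = 0" "y \<in> cdisc (d i)" for i y
 proof -
  have "y \<in> odisc (d i)" using that by (auto simp: closed_disc_iff open_disc_iff rad_def)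
  thus ?thesis using that by (simp add: h_def)
 qed
 have h_edge: "h (ch i y) = b i y" if i: "i \<in> I" "d i = 1" and y: "y \<in> cdisc 1" for i y
 proof (cases "y \<in> odisc 1")
  case True
  thus ?thesis using i y cell_X1[of i y] by (simp add: h_def)
 next
  case False
  hence s: "y \<in> disc_sphere 1" using y by (simp add: disc_sphere_def)
  have "ch i y \<in> skel 1" using skel_boundary[of i 1 y] i s by simp
  then obtain j z where j: "j \<in> I" "d j < 1" "z \<in> odisc (d j)" "ch i y = ch j z" by (auto simp: skel_def)
  hence "h (ch i y) = \<one>" using h_vertex[of j z] open_sub_disc[of "d j"] by auto
  moreover have "b i y = \<one>"
   using disc_1_inv_sphere[OF s] edge[OF fl v[OF i]] edge[OF fl' v[OF i]] l(1)[of i] by (auto simp: b_def gloop_def)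
  ultimately show ?thesis by simp
 qed
 have hK: "h x \<in> K" for x
 proof (cases "x \<in> skel 2 \<and> d (cidx x) = 1")
  case True
  then obtain i y where i: "i \<in> I" "y \<in> odisc (d i)" "x = ch i y" "cidx x = i" using cidx_skel by metis
  hence y: "y \<in> cdisc 1" using True open_sub_disc[of "d i"] by auto
  thus ?thesis
   using h_edge[of i y] i True lK[OF inS[OF y]] eK[OF _ _ inS[OF y]] by (simp add: b_def K_mult K_inv)
 qed (auto simp: h_def K_one)
 have iso: "atlas_iso X1 (restrict_atlas (skel 2) \<T>) (restrict_atlas (skel 2) \<T>') h"
 proof (rule S.cw_isoI[OF atlas_restrict[OF at] atlas_restrict[OF at']])
  show "h x \<in> carrier G" for x using hK K_carrier by blast
  fix i assume "i \<in> cells1"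
  hence i: "i \<in> I" "d i < 2" by auto
  have ch: "cmap (disc (d i)) X (ch i)" by (rule cont[OF i(1)])
  have in_skel: "\<forall>y\<in>closed_disc (d i). ch i y \<in> skel 2" using cell_X1[OF i] by blast
  have "\<exists>s. sect X \<T> (disc (d i)) (ch i) s \<and> sect X \<T>' (disc (d i)) (ch i) (%y. h (ch i y) \<otimes> s y)"
  proof (cases "d i = 0")
   case True
   have c: "ch i y = ch i (%_. 0)" if "y \<in> topspace (disc (d i))" for y
   proof -
    have "y = (%_. 0)" using that True by (auto simp: closed_disc_iff)
    thus ?thesis by simp
   qed
   show ?thesis
    using sect_const[OF at ch c one_closed] sect_cong[OF sect_const[OF at' ch c one_closed], of "ch i" "%y. h (ch i y) \<otimes> \<one>"]
     h_vertex[OF i(1) True] by (intro exI[of _ "%_. \<one>"]) auto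
  next
   case False
   hence d1: "d i = 1" using i(2) by simp
   have g: "v i (disc_1_inv y) = ch i y" if "y \<in> cdisc 1" for y
    using edge_path_disc_1_inv[OF that] inS[OF that] by (simp add: v_def simplex_map_apply)
   note e = edge(1)[OF fl v[OF i(1) d1]] and e' = edge(1)[OF fl' v[OF i(1) d1]]
   have "sect X \<T> (disc (d i)) (ch i) (%y. edge X \<T> (v i) (disc_1_inv y))"
    unfolding d1 by (rule sect_cong[OF sect_compose[OF e continuous_disc_1_inv]]) (simp_all add: g)
   moreover have "gpath (l i)" using l(1) by (simp add: gloop_def)
   hence "sect X \<T>' (disc (d i)) (ch i) (%y. h (ch i y) \<otimes> edge X \<T> (v i) (disc_1_inv y))"
    unfolding d1
   proof (rule sect_cong[OF sect_compose[OF sect_mult[OF at' e'] continuous_disc_1_inv]])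
    fix y assume "y \<in> topspace (disc 1)"
    hence y: "y \<in> cdisc 1" by simp
    show "ch i y = v i (disc_1_inv y)" by (simp add: g[OF y])
    show "h (ch i y) \<otimes> edge X \<T> (v i) (disc_1_inv y) = edge X \<T>' (v i) (disc_1_inv y) \<otimes> l i (disc_1_inv y)"
     using eK[OF i(1) d1 inS[OF y]] lK[OF inS[OF y]] K_carrier by (simp add: h_edge[OF i(1) d1 y] b_def m_assoc)
   qed
   ultimately show ?thesis by blast
  qed
  thus "\<exists>s. sect X1 (restrict_atlas (skel 2) \<T>) (disc (d i)) (ch i) s \<and> sect X1 (restrict_atlas (skel 2) \<T>') (disc (d i)) (ch i) (%y. h (ch i y) \<otimes> s y)"
   using in_skel by (simp add: sect_restrict_iff)
 qed
 show thesis
 proof (rule that[OF hK])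
  show "sect X \<T>' Y u (%y. h (u y) \<otimes> s y)" if "sect X \<T> Y u s" "!!y. y \<in> topspace Y ==> u y \<in> skel 2" for Y :: "(nat => real) topology" and u s
   using sect_iso[OF atlas_restrict[OF at] atlas_restrict[OF at'] iso, of Y u s] that by (simp add: sect_restrict_iff)
  fix i assume i: "i \<in> I" "d i = 1"
  have "path_class (l i) = path_class (%x. inv (edge X \<T>' (v i) x) \<otimes> (h (v i x) \<otimes> edge X \<T> (v i) x))"
  proof (rule path_class_cong(2)[OF gloop_kpath[OF l(1)]])
   fix x assume x: "x \<in> splx 1"
   have ex: "edge_path x \<in> cdisc 1" using sing_maps[OF edge_path_simplex x] by simp
   have "h (v i x) = edge X \<T>' (v i) x \<otimes> l i x \<otimes> inv (edge X \<T> (v i) x)"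
    using h_edge[OF i ex] disc_1_inv_edge_path[OF x] x by (simp add: v_def[of i] simplex_map_apply b_def)
   thus "l i x = inv (edge X \<T>' (v i) x) \<otimes> (h (v i x) \<otimes> edge X \<T> (v i) x)"
    using eK[OF i x] lK[OF x] K_carrier by (simp add: m_assoc) (simp add: m_assoc[symmetric])
  qed
  thus "path_class (%x. inv (edge X \<T>' (simplex_map 1 (ch i) edge_path) x) \<otimes>
    (h (simplex_map 1 (ch i) edge_path x) \<otimes> edge X \<T> (simplex_map 1 (ch i) edge_path) x)) = \<beta> (simplex_map 1 (ch i) edge_path)"
   using path_class_gloop[OF l(1)] l(2) by (simp add: v_def)
 qed
qed

text \<open>The isomorphism on the graph is extended over each 2-cell. There \<open>h\<close>, read
  between two sections with values in \<open>K\<close>, is a map from the boundary circle to the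
  unit component; its class is trivial because the obstructions differ by the coboundary of
  \<beta>.\<close>

lemma flat_iso: obtains h where "atlas_iso X \<T> \<T>' h"
proof -
 note at = flat_atlas[OF fl] and at' = flat_atlas[OF fl']
 interpret S: bundle_cw_dim G T X1 cells1 d ch 1 by (rule skeleton)
 obtain h where hK: "!!x. h x \<in> K"
  and h: "!!(Y :: (nat => real) topology) z s. [|sect X \<T> Y z s; !!y. y \<in> topspace Y ==> z y \<in> skel 2|] ==> sect X \<T>' Y z (%y. h (z y) \<otimes> s y)"
  and h_edge: "!!i. [|i \<in> I; d i = 1|] ==> path_class (%x. inv (edge X \<T>' (simplex_map 1 (ch i) edge_path) x) \<otimes>
    (h (simplex_map 1 (ch i) edge_path x) \<otimes> edge X \<T> (simplex_map 1 (ch i) edge_path) x)) = \<beta> (simplex_map 1 (ch i) edge_path)"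
  by (rule skeleton_iso) blast
 have hc [simp]: "h x \<in> carrier G" for x using hK K_carrier by blast
 \<comment> \<open>The class of \<open>h\<close> along a path in the graph, measured between the
   edge sections of the two bundles. On 1-cells it is \<beta> by construction.\<close>
 define E where "E l = path_class (%x. inv (edge X \<T>' l x) \<otimes> (h (l x) \<otimes> edge X \<T> l x))" for l
 have Ec: "cochain pi1 E" by (rule cochainI) (simp add: E_def)
 \<comment> \<open>\<open>P\<close> compares an edge section with a section with values in
   \<open>K\<close>; \<open>W\<close> compares two such sections of the two bundles through
   \<open>h\<close>. In this notation \<open>E\<close> is the class of the product P'^-1 W
   P.\<close>
 define P where "P \<S> f s e x = inv (s (e x)) \<otimes> edge X \<S> (simplex_map 1 f e) x"
  for \<S> and f :: "(nat => real) => 'm" and s e x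
 define W where "W f s s' y = inv (s' y) \<otimes> (h (f y) \<otimes> s y)" for f s s' and y :: "nat => real"
 have split: "kpath (P \<T> f s e) \<and> kpath (P \<T>' f s' e) \<and> kpath (%x. W f s s' (e x)) \<and> kpath (%x. W f s s' (e x) \<otimes> P \<T> f s e x) \<and>
   E (simplex_map 1 f e) = path_class (%x. inv (P \<T>' f s' e x) \<otimes> (W f s s' (e x) \<otimes> P \<T> f s e x)) \<and>
   P \<T> f s e (vert 0) = inv (s (e (vert 0))) \<and> P \<T> f s e (vert 1) = inv (s (e (vert 1))) \<and>
   P \<T>' f s' e (vert 0) = inv (s' (e (vert 0))) \<and> P \<T>' f s' e (vert 1) = inv (s' (e (vert 1)))"
  if s: "ksect X \<T> Y f s" and s': "ksect X \<T>' Y f s'" and e: "sing 1 Y e"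
   and sk: "sing 1 X1 (simplex_map 1 f e)"
  for Y :: "(nat => real) topology" and f s s' e
 proof -
  let ?l = "simplex_map 1 f e"
  have l: "sing 1 X ?l" by (rule sect_simplex(1)[OF ksect_sect[OF s] e])
  have c: "s (e x) \<in> K" "s' (e x) \<in> K" "edge X \<T> ?l x \<in> carrier G" "edge X \<T>' ?l x \<in> carrier G" if "x \<in> splx 1" for x
   using that ksect_K[OF s] ksect_K[OF s'] sing_maps[OF e that] sect_carrier[OF edge(1)[OF fl l]] sect_carrier[OF edge(1)[OF fl' l]] by auto
  have k: "kpath (P \<T> f s e)" "kpath (P \<T>' f s' e)"
   using kpath_edge[OF fl s e] kpath_edge[OF fl' s' e] by (simp_all add: P_def[abs_def])
  have "sect X \<T>' (top_of_set (splx 1)) ?l (%x. h (?l x) \<otimes> s (e x))"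
   by (rule h[OF sect_simplex(2)[OF ksect_sect[OF s] e]]) (use sk in \<open>simp add: simplex_X1\<close>)
  from sect_div[OF at' sect_simplex(2)[OF ksect_sect[OF s'] e] this]
  have "gpath (%x. W f s s' (e x))" by (rule cmap_eq) (simp add: W_def simplex_map_apply)
  hence kw: "kpath (%x. W f s s' (e x))"
   using c[of "vert 0"] hK by (simp add: kpath_def W_def K_mult K_inv)
  have "E ?l = path_class (%x. inv (P \<T>' f s' e x) \<otimes> (W f s s' (e x) \<otimes> P \<T> f s e x))"
   unfolding E_def
  proof (rule path_class_cong(2)[symmetric, OF kpath_mult[OF kpath_inv[OF k(2)] kpath_mult[OF kw k(1)]]])
   fix x assume x: "x \<in> splx 1"
   thus "inv (P \<T>' f s' e x) \<otimes> (W f s s' (e x) \<otimes> P \<T> f s e x) = inv (edge X \<T>' ?l x) \<otimes> (h (?l x) \<otimes> edge X \<T> ?l x)"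
    using c[OF x] K_carrier by (simp add: P_def W_def simplex_map_apply inv_mult_group m_assoc mult_div)
  qed
  thus ?thesis
   using k kw kpath_mult[OF kw k(1)] edge(2,3)[OF fl l] edge(2,3)[OF fl' l] c[of "vert 0"] c[of "vert 1"] K_carrier
   by (simp add: P_def)
 qed
 \<comment> \<open>Over triangles in the graph the coboundaries of \<open>P\<close> and P' are the
   two obstructions and \<open>W\<close> contributes nothing, so \<open>E\<close> and \<beta> have
   the same coboundary. Their quotient \<open>j\<close> is a cocycle that is trivial on the 1-cells,
   hence a coboundary.\<close>
 define j where "j l = E l \<cdot> inv1 \<beta> l" for l
 have \<delta>c: "cochain pi1 j" unfolding j_def by (intro P1.cochain_mult Ec P1.cochain_inv \<beta>)
 have "cocycle pi1 1 X1 j"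
  unfolding cocycle_def
 proof (intro conjI allI impI \<delta>c)
  fix \<tau> assume "sing (Suc 1) X1 \<tau>"
  hence \<tau>: "sing 2 X \<tau>" and sk: "!!x. x \<in> splx 2 ==> \<tau> x \<in> skel 2" by (simp_all add: simplex_X1)
  let ?D = "top_of_set (splx 2)"
  obtain s where s: "ksect X \<T> ?D \<tau> s" by (rule ksect_exists_simplex[OF fl \<tau>])
  obtain s' where s': "ksect X \<T>' ?D \<tau> s'" by (rule ksect_exists_simplex[OF fl' \<tau>])
  let ?p = "P \<T> \<tau> s" and ?p' = "P \<T>' \<tau> s'" and ?w = "W \<tau> s s'"
  have "cmap ?D X1 \<tau>" using simplex_cont[OF \<tau>] sk by (auto simp: cmap_in_sub)
  note sp = split[OF s s' _ singular_simplex_simplex_map[OF _ this]]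
  have wc: "cmap ?D (subtop T K) ?w"
  proof -
   have "sect X \<T>' ?D \<tau> (%y. h (\<tau> y) \<otimes> s y)" by (rule h[OF ksect_sect[OF s]]) (simp add: sk)
   from sect_div[OF at' ksect_sect[OF s'] this] show ?thesis
    using ksect_K[OF s] ksect_K[OF s'] hK by (auto simp: cmap_in_sub W_def[abs_def] K_mult K_inv)
  qed
  have L: "cochain pi1 (%e. path_class (r e))" for r :: "((nat => real) => nat => real) => (nat => real) => 'a"
   by (simp add: cochainI)
  note id2 = id_simplex[of 2]
  have "cobd pi1 2 E \<tau> = cobd pi1 2 (%e. E (simplex_map (2 - 1) \<tau> e)) (id_simplex 2)"
   using P1.cobd_simplex_map[OF Ec id2, of \<tau>] simplex_map_id_simplex[OF \<tau>] by simp
  also have "\<dots> = cobd pi1 2 (%e. path_class (%x. inv (?p' e x) \<otimes> (?w (e x) \<otimes> ?p e x))) (id_simplex 2)"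
   by (rule P1.cobd_cong[OF cochain_comp[OF Ec] L id2]) (use sp in simp)
  also have "\<dots> = cobd pi1 2 (%e. path_class (%x. inv (?p' e x))) (id_simplex 2) \<cdot> cobd pi1 2 (%e. path_class (%x. ?w (e x) \<otimes> ?p e x)) (id_simplex 2)"
   by (rule cobd_path_class_mult[OF id2, of _ "%y. inv (inv (s' y))" _ "%y. ?w y \<otimes> inv (s y)"]) (use sp kpath_inv in simp_all)
  also have "cobd pi1 2 (%e. path_class (%x. inv (?p' e x))) (id_simplex 2) = inv1 cobd pi1 2 (%e. path_class (?p' e)) (id_simplex 2)"
   by (rule cobd_path_class_inv[OF id2, of _ "%y. inv (s' y)"]) (use sp in simp)
  also have "cobd pi1 2 (%e. path_class (%x. ?w (e x) \<otimes> ?p e x)) (id_simplex 2) = cobd pi1 2 (%e. path_class (%x. ?w (e x))) (id_simplex 2) \<cdot> cobd pi1 2 (%e. path_class (?p e)) (id_simplex 2)"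
   by (rule cobd_path_class_mult[OF id2, of _ ?w _ "%y. inv (s y)"]) (use sp in simp_all)
  also have "cobd pi1 2 (%e. path_class (%x. ?w (e x))) (id_simplex 2) = one1"
   by (rule cobd_path_class_map[OF wc id2])
  also have "cobd pi1 2 (%e. path_class (?p e)) (id_simplex 2) = obstruction X \<T> \<tau>"
   using obstruction_map[OF fl s id2] simplex_map_id_simplex[OF \<tau>] by (simp add: P_def[abs_def] edge_class_def[abs_def])
  also have "cobd pi1 2 (%e. path_class (?p' e)) (id_simplex 2) = obstruction X \<T>' \<tau>"
   using obstruction_map[OF fl' s' id2] simplex_map_id_simplex[OF \<tau>] by (simp add: P_def[abs_def] edge_class_def[abs_def])
  finally have "cobd pi1 2 E \<tau> = cobd pi1 2 \<beta> \<tau>"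
   using cochainD[OF cochain_obstruction[OF fl'], of \<tau>] P1.cobd_closed[OF \<beta>, of 2 \<tau>] eq[OF \<tau>]
   by (simp add: P1.m_comm[of "cobd pi1 2 \<beta> \<tau>"] P1.m_assoc[symmetric])
  hence "cobd pi1 2 j \<tau> = one1"
   unfolding j_def by (simp add: P1.cobd_mult[OF Ec P1.cochain_inv[OF \<beta>]] P1.cobd_inv[OF \<beta>] P1.cobd_closed[OF \<beta>])
  thus "cobd pi1 (Suc 1) j \<tau> = one1" by simp
 qed
 then obtain f where "cobounds pi1 1 X1 f j"
 proof (rule S.graph_cobounds_1[OF refl comm_group_pi1])
  show "j (simplex_map 1 (ch i) edge_path) = one1" if "i \<in> cells1" "d i = 1" for i
   using h_edge[of i] that cochainD[OF \<beta>] by (simp add: j_def E_def)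
 qed
 then obtain g where g: "!!x. g x \<in> carrier pi1" "!!l. sing 1 X1 l ==> j l = g (l (vert 1)) \<cdot> inv1 (g (l (vert 0)))"
  using P1.cobounds_1_fun by metis
 \<comment> \<open>A coboundary is trivial on closed paths. So \<open>E\<close> equals \<beta> on
   the rims, although this was arranged on the 1-cells only.\<close>
 have E_rim: "E (rim i) = \<beta> (rim i)" if "i \<in> I" "d i = 2" for i
 proof -
  have "E (rim i) \<cdot> inv1 \<beta> (rim i) = one1"
   using g(2)[OF rim(1)[OF that]] rim(2)[OF that] g(1) by (simp add: j_def)
  thus ?thesis
   using cochainD[OF Ec] cochainD[OF \<beta>] by (metis P1.inv_closed P1.inv_inv P1.inv_equality P1.inv_comm)
 qed
 define Q where "Q i b s \<longleftrightarrow> sect X \<T> (disc 2) (ch i) s \<and> sect X \<T>' (disc 2) (ch i) (%y. b y \<otimes> s y) \<and>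
   (\<forall>y\<in>disc_sphere 2. b y = h (ch i y)) \<and> (\<forall>y\<in>closed_disc 2. b y \<in> carrier G)" for i b s
 have "\<exists>b s. sect X \<T> (disc 2) (ch i) s \<and> sect X \<T>' (disc 2) (ch i) (%y. b y \<otimes> s y) \<and>
   (\<forall>y\<in>disc_sphere 2. b y = h (ch i y)) \<and> (\<forall>y\<in>closed_disc 2. b y \<in> carrier G)" if i: "i \<in> I" "d i = 2" for i
 proof -
  have ch: "cmap (disc 2) X (ch i)" using cont[OF i(1)] i(2) by simp
  obtain s where s: "ksect X \<T> (disc 2) (ch i) s" by (rule ksect_exists_disc[OF fl ch])
  obtain s' where s': "ksect X \<T>' (disc 2) (ch i) s'" by (rule ksect_exists_disc[OF fl' ch])
  have sk: "ch i y \<in> skel 2" if "y \<in> disc_sphere 2" for y using skel_boundary[OF i(1), of 2 y] i(2) that by simp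
  have cl: "circ_loop x \<in> disc_sphere 2" if "x \<in> splx 1" for x
   using sing_maps[OF circ_loop_simplex that] by simp
  have ends: "circ_loop (vert 0) = vert 0" "circ_loop (vert 1) = vert 0"
   using circ_0 circ_1 by (simp_all add: circ_loop_def) (simp_all add: vert_def)
  have v0: "vert 0 \<in> disc_sphere 2" using cl[of "vert 0"] ends by simp
  let ?p = "P \<T> (ch i) s circ_loop" and ?p' = "P \<T>' (ch i) s' circ_loop" and ?w = "%x. W (ch i) s s' (circ_loop x)"
  note sp = split[OF s s' circ_loop_disc rim(1)[OF i, unfolded rim_def]]
  \<comment> \<open>By Stokes' formula evaluation on the disc chain turns the two obstructions into
    the classes of \<open>P\<close> and P' along the boundary loop.\<close>
  let ?c = "chain_map 2 (ch i) disc_chain" and ?P = "path_class ?p" and ?P' = "path_class ?p'"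
  have ob: "chain_eval pi1 (obstruction X \<T>) ?c = ?P" "chain_eval pi1 (obstruction X \<T>') ?c = ?P'"
   using obstruction_chain[OF fl s disc_chain(1)] obstruction_chain[OF fl' s' disc_chain(1)] disc_chain(2)
   by (simp_all add: P1.chain_eval_of[OF cochain_edge_class]) (simp_all add: edge_class_def P_def[abs_def])
  have "chain_eval pi1 (obstruction X \<T>) ?c = chain_eval pi1 (%\<tau>. cobd pi1 2 \<beta> \<tau> \<cdot> obstruction X \<T>' \<tau>) ?c"
   by (rule P1.chain_eval_cong[OF cochain_obstruction[OF fl] P1.cochain_mult[OF P1.cobd_fun[OF \<beta>] cochain_obstruction[OF fl']]])
    (use rim(5)[OF i] eq in \<open>auto simp: singular_chain_def\<close>)
  hence P: "?P = \<beta> (rim i) \<cdot> ?P'"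
   using P1.eval_boundary[OF \<beta>, of 2 ?c]
   by (simp add: P1.chain_eval_mult[OF P1.cobd_fun[OF \<beta>] cochain_obstruction[OF fl']] ob rim(4)[OF i] P1.chain_eval_of[OF \<beta>])
  have "path_class (%x. inv (?p' x)) \<cdot> ?P' = one1"
  proof -
   have "path_class (%x. inv (?p' x) \<otimes> ?p' x) = path_class (%_. \<one>)"
    using sp kpath_mult[OF kpath_inv] l_inv[OF gpath_carrier[OF kpath_gpath]] by (intro path_class_cong(2)) blast+
   thus ?thesis
    using path_class_mult_closed[OF kpath_inv, of "?p'" "?p'"] sp ends path_class_const[OF K_one] by simp
  qed
  hence "path_class (%x. inv (?p' x)) = inv1 ?P'"
   by (rule P1.inv_equality[symmetric]) simp_all
  moreover have "path_class (%x. ?w x \<otimes> ?p x) = path_class ?w \<cdot> ?P"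
   by (rule path_class_mult_closed) (use sp ends in simp_all)
  moreover have "E (rim i) = path_class (%x. inv (?p' x)) \<cdot> path_class (%x. ?w x \<otimes> ?p x)"
   unfolding rim_def using sp path_class_mult_closed[OF kpath_inv, of "?p'" "%x. ?w x \<otimes> ?p x"] ends by simp
  ultimately have "\<beta> (rim i) = inv1 ?P' \<cdot> (path_class ?w \<cdot> (\<beta> (rim i) \<cdot> ?P'))"
   using E_rim[OF i] P by simp
  also have "\<dots> = path_class ?w \<cdot> \<beta> (rim i)"
  proof -
   have "inv1 q \<cdot> (u \<cdot> (v \<cdot> q)) = u \<cdot> v" if "q \<in> carrier pi1" "u \<in> carrier pi1" "v \<in> carrier pi1" for q u v
    using that P1.m_comm[of "inv1 q" "u \<cdot> (v \<cdot> q)"] by (simp add: P1.m_assoc)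
   thus ?thesis using cochainD[OF \<beta>] by simp
  qed
  \<comment> \<open>The value \<beta> on the rim occurs on both sides, once from \<open>E\<close>
    and once from the relation between the obstructions; cancelling it leaves the class of the
    comparison map on the circle.\<close>
  finally have w1: "path_class ?w = one1"
   using cochainD[OF \<beta>, of "rim i"] by (metis P1.r_cancel_one path_class_closed)
  have wK: "W (ch i) s s' y \<in> K" if "y \<in> disc_sphere 2" for y
  proof -
   have "y \<in> cdisc 2" using that disc_sphere_subset by blast
   thus ?thesis using ksect_K[OF s, of y] ksect_K[OF s', of y] hK by (simp add: W_def K_mult K_inv)
  qed
  let ?W = "W (ch i) s s'"
  \<comment> \<open>Division by the value at the base point of the circle turns the comparison into
    a loop at 1, as the extension over the disc requires; the factor is restored in
    \<open>b\<close>.\<close>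
  define k where "k = ?W (vert 0)"
  have kK: "k \<in> K" using wK[OF v0] by (simp add: k_def)
  have kc [simp]: "k \<in> carrier G" using K_carrier[OF kK] .
  have sS: "sect X \<T> (top_of_set (disc_sphere 2)) (ch i) s" "sect X \<T>' (top_of_set (disc_sphere 2)) (ch i) s'"
   using sect_subset[OF ksect_sect[OF s] disc_sphere_subset] sect_subset[OF ksect_sect[OF s'] disc_sphere_subset] .
  have "sect X \<T>' (top_of_set (disc_sphere 2)) (ch i) (%y. h (ch i y) \<otimes> s y)"
   by (rule h[OF sS(1)]) (simp add: sk)
  from sect_div[OF at' sS(2) this] have wc: "cmap (top_of_set (disc_sphere 2)) T ?W"
   by (simp add: W_def[abs_def])
  have kinv: "kpath (%_. inv k)"
   using K_inv[OF kK] by (simp add: kpath_def topspace_eq)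
  have "path_class (%x. ?w x \<otimes> inv k) = one1"
   using path_class_mult_closed[OF _ kinv, of ?w] sp ends w1 path_class_const[OF K_inv[OF kK]] by simp
  moreover have "gloop (%x. ?w x \<otimes> inv k)"
   using kpath_gpath[OF kpath_mult[OF _ kinv, of ?w]] sp ends by (simp add: gloop_def k_def[symmetric])
  ultimately have null: "loop_class (%x. ?w x \<otimes> inv k) = one1"
   using path_class_gloop by metis
  have "cmap (top_of_set (disc_sphere 2)) T (%y. ?W y \<otimes> inv k)"
   by (intro cm_mult[OF wc] cm_const) simp
  then obtain V where W: "cmap (disc 2) T V" "!!y. y \<in> disc_sphere 2 ==> V y = ?W y \<otimes> inv k"
   by (rule disc_extension[OF _ _ null]) (auto simp: k_def[symmetric])
  have c: "s y \<in> carrier G" "s' y \<in> carrier G" "V y \<in> carrier G" if "y \<in> cdisc 2" for y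
   using ksect_K[OF s, of y] ksect_K[OF s', of y] cm_carrier[OF W(1), of y] K_carrier that by auto
  \<comment> \<open>On the boundary \<open>V y \<otimes> k\<close> is the comparison map itself, so
    \<open>b\<close> agrees with \<open>h\<close> there.\<close>
  define b where "b y = s' y \<otimes> (V y \<otimes> k) \<otimes> inv (s y)" for y
  have "sect X \<T>' (disc 2) (ch i) (%y. s' y \<otimes> (V y \<otimes> k))"
   by (rule sect_mult[OF at' ksect_sect[OF s'] cm_mult[OF W(1) cm_const]]) simp
  hence "sect X \<T>' (disc 2) (ch i) (%y. b y \<otimes> s y)"
   by (rule sect_cong) (use c in \<open>simp_all add: b_def m_assoc\<close>)
  moreover have "b y = h (ch i y)" if y: "y \<in> disc_sphere 2" for y
  proof -
   have "y \<in> cdisc 2" using y disc_sphere_subset by blast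
   thus ?thesis
    using c[of y] K_carrier[OF wK[OF y]] by (simp add: b_def W(2)[OF y] m_assoc) (simp add: W_def m_assoc mult_div)
  qed
  moreover have "b y \<in> carrier G" if "y \<in> cdisc 2" for y using c[OF that] by (simp add: b_def)
  ultimately show ?thesis
   using ksect_sect[OF s] by blast
 qed
 hence "\<forall>i. \<exists>b s. i \<in> I --> d i = 2 --> Q i b s"
  unfolding Q_def by blast
 then obtain b s where "!!i. [|i \<in> I; d i = 2|] ==> Q i (b i) (s i)" by metis
 note b = this[unfolded Q_def]
 define h' where "h' x = (if x \<in> top_part then b (cidx x) (ccoord x) else h x)" for x
 have h'_skel: "h' x = h x" if "x \<in> skel 2" for x
  using that by (simp add: h'_def top_part_def)
 have h'_cell: "h' (ch i y) = b i y" if i: "i \<in> I" "d i = 2" and y: "y \<in> cdisc 2" for i y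
 proof (cases "y \<in> odisc 2")
  case True
  thus ?thesis using i top_part_eq by (auto simp: h'_def)
 next
  case False
  hence "y \<in> disc_sphere 2" using y by (simp add: disc_sphere_def)
  thus ?thesis using h'_skel skel_boundary[OF i(1), of 2 y] b[OF i] i by simp
 qed
 have "atlas_iso X \<T> \<T>' h'"
 proof (rule cw_isoI[OF at at'])
  show "h' x \<in> carrier G" for x
  proof (cases "x \<in> top_part")
   case True
   then obtain i y where "i \<in> I" "d i = 2" "y \<in> odisc 2" "x = ch i y" using top_part_eq by auto
   thus ?thesis using h'_cell[of i y] b[of i] open_sub_disc[of 2] by auto
  qed (simp add: h'_def)
  fix i assume i: "i \<in> I"
  show "\<exists>s. sect X \<T> (disc (d i)) (ch i) s \<and> sect X \<T>' (disc (d i)) (ch i) (%y. h' (ch i y) \<otimes> s y)"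
  proof (cases "d i = 2")
   case True
   hence "sect X \<T>' (disc 2) (ch i) (%y. h' (ch i y) \<otimes> s i y)"
    using sect_cong[of X \<T>' "disc 2" "ch i" "%y. b i y \<otimes> s i y" "ch i" "%y. h' (ch i y) \<otimes> s i y"] b[OF i True] h'_cell[OF i True] by simp
   thus ?thesis using b[OF i True] True by auto
  next
   case False
   hence i2: "d i < 2" using dim[OF i] by simp
   obtain s where s: "sect X \<T> (disc (d i)) (ch i) s" by (rule sect_exists_disc[OF at cont[OF i]])
   have "sect X \<T>' (disc (d i)) (ch i) (%y. h (ch i y) \<otimes> s y)" by (rule h[OF s]) (simp add: cell_X1[OF i i2])
   hence "sect X \<T>' (disc (d i)) (ch i) (%y. h' (ch i y) \<otimes> s y)"
    by (rule sect_cong) (simp_all add: h'_skel cell_X1[OF i i2])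
   thus ?thesis using s by blast
  qed
 qed
 thus thesis by (rule that)
qed

end

end

section \<open>The exact sequence\<close>

sublocale structure_group \<subseteq> C0: coeff_group "pi0_group G T" ..

sublocale structure_group \<subseteq> C1: coeff_group "homotopy_group 1 T \<one>" ..

context structure_group begin

lemma sect_trivial_iff: "sect M (trivial_atlas M) Y u s \<longleftrightarrow> cmap Y M u \<and> cmap Y T s"
proof (cases "cmap Y M u")
 case True
 have eq: "subtop Y {y. u y \<in> topspace M} = Y"
  using continuous_map_image_in[OF True] by (intro subtopology_superset) auto
 have "cmap Y T (%y. \<one> \<otimes> s y) \<longleftrightarrow> cmap Y T s" if "!!y. y \<in> topspace Y ==> s y \<in> carrier G"
  using cmap_eq[of Y T "%y. \<one> \<otimes> s y" s] cmap_eq[of Y T s "%y. \<one> \<otimes> s y"] that by auto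
 thus ?thesis
  using True cm_carrier[of Y s] by (auto simp: sect_def trivial_atlas_def eq)
qed (simp add: sect_def)

lemma sect_global:
 assumes at: "atlas M A" and h: "atlas_iso M (trivial_atlas M) A h" shows "sect M A M (%x. x) h"
proof -
 have "sect M (trivial_atlas M) M (%x. x) (%_. \<one>)" by (simp add: sect_trivial_iff topspace_eq)
 from sect_iso[OF atlas_trivial at h this] show ?thesis
  by (rule sect_cong) (simp_all add: atlas_iso_carrier[OF h])
qed

definition is_cobd :: "'m topology => (((nat => real) => 'm) => 'a set) => (((nat => real) => 'm) => 'a set) => ('m => 'a set) => bool" where
 "is_cobd M z w b \<longleftrightarrow> (\<forall>x. b x \<in> carrier pi0) \<and>
   (\<forall>c. sing 1 M c --> z c = b (c (vert 1)) \<star> inv0 b (c (vert 0)) \<star> w c)"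

lemma coh_class_1_eq_iff:
 assumes a: "a \<in> topspace M" and z: "cocycle pi0 1 M z" and w: "cocycle pi0 1 M w"
 shows "C0.coh_class M a 1 z = C0.coh_class M a 1 w \<longleftrightarrow> (\<exists>b. is_cobd M z w b)"
proof -
 have "C0.coh_class M a 1 z = C0.coh_class M a 1 w \<longleftrightarrow> (\<exists>b. cochain pi0 b \<and> b (csimp 0 a) = one0 \<and>
   (\<forall>c. sing 1 M c --> z c = cobd pi0 1 b c \<star> w c))" (is "_ \<longleftrightarrow> (\<exists>b. ?Q b)")
  using C0.coh_class_eq_iff[OF a, of 0 z w] P0.cocycle_1_const[OF z a] P0.cocycle_1_const[OF w a] z w by simp
 also have "\<dots> \<longleftrightarrow> (\<exists>b. is_cobd M z w b)"
 proof
  assume "\<exists>b. ?Q b"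
  then obtain b where b: "?Q b" by blast
  hence "is_cobd M z w (%x. b (csimp 0 x))"
   unfolding is_cobd_def using P0.cobd_1_const[of b] cochainD by metis
  thus "\<exists>b. is_cobd M z w b" by blast
 next
  assume "\<exists>b. is_cobd M z w b"
  then obtain b where b: "!!x. b x \<in> carrier pi0" "!!c. sing 1 M c ==>
    z c = b (c (vert 1)) \<star> inv0 b (c (vert 0)) \<star> w c"
   by (auto simp: is_cobd_def)
  \<comment> \<open>Division by the value at the base point gives the normalisation required for the
    pair and does not change the coboundary.\<close>
  let ?b = "%x. b x \<star> inv0 b a"
  have bc: "?b x \<in> carrier pi0" for x using b(1) by simp
  have "?b x \<star> inv0 ?b y = b x \<star> inv0 b y" for x y
   using b(1) by (simp add: P0.inv_mult_group P0.m_assoc) (simp add: P0.m_assoc[symmetric])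
  hence "?Q (cochain0 ?b)"
   using b cochain_cochain0[of ?b, OF bc] by (simp add: P0.cobd_cochain0[of ?b, OF bc])
  thus "\<exists>b. ?Q b" by blast
 qed
 finally show ?thesis .
qed

end

section \<open>The map to the first cohomology\<close>

context surface_bundles begin

definition jump_class :: "('m set \<times> ('m => 'a)) set => ('m chain => 'a set) set" where
 "jump_class A = C0.coh_class X x\<^sub>0 1 (jump X A)"

lemma jump_class_iso:
 assumes at: "atlas X A" and at': "atlas X A'" and h: "atlas_iso X A A' h"
 shows "jump_class A' = jump_class A"
proof -
 have "is_cobd X (jump X A') (jump X A) (%x. pc (h x))"
  unfolding is_cobd_def using jump_iso[OF at at' h] atlas_iso_carrier[OF h] by simp
 thus ?thesis
  unfolding jump_class_def using coh_class_1_eq_iff[OF x0 cocycle_jump[OF at'] cocycle_jump[OF at]] by blast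
qed

lemma cocycle_one: "cocycle pi0 1 X (%_. one0)"
 using P0.cocycle_cobd[of "%_. one0" 1 X] by (simp add: cocycle_def cochainI P0.cobd_2)

text \<open>A primitive of the jump cocycle is what makes a bundle isomorphic to a flat one;
  conversely the jump of a flat atlas is trivial on every edge, and the class is invariant under
  isomorphism.\<close>

lemma jump_class_trivial_iff:
 assumes at: "atlas X A"
 shows "jump_class A = C0.coh_class X x\<^sub>0 1 (%_. one0) \<longleftrightarrow> (\<exists>A' h. flat X A' \<and> atlas_iso X A A' h)"
proof
 assume "jump_class A = C0.coh_class X x\<^sub>0 1 (%_. one0)"
 then obtain b where b: "is_cobd X (jump X A) (%_. one0) b"
  unfolding jump_class_def using coh_class_1_eq_iff[OF x0 cocycle_jump[OF at] cocycle_one] by blast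
 have bc: "b x \<in> carrier pi0" for x using b by (simp add: is_cobd_def)
 have "cobounds pi0 1 X (cochain0 b) (jump X A)"
  using b cochain_cochain0[of b, OF bc] by (simp add: cobounds_def is_cobd_def P0.cobd_cochain0[of b, OF bc])
 thus "\<exists>A' h. flat X A' \<and> atlas_iso X A A' h" by (rule flat_exists[OF at]) blast
next
 assume "\<exists>A' h. flat X A' \<and> atlas_iso X A A' h"
 then obtain A' h where f: "flat X A'" "atlas_iso X A A' h" by blast
 have "is_cobd X (jump X A') (%_. one0) (%_. one0)" using f(1) by (simp add: is_cobd_def flat_def)
 hence "jump_class A' = C0.coh_class X x\<^sub>0 1 (%_. one0)"
  unfolding jump_class_def using coh_class_1_eq_iff[OF x0 cocycle_jump[OF flat_atlas[OF f(1)]] cocycle_one] by blast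
 thus "jump_class A = C0.coh_class X x\<^sub>0 1 (%_. one0)"
  using jump_class_iso[OF at flat_atlas[OF f(1)] f(2)] by simp
qed

lemma jump_clutching:
 assumes at1: "atlas X1 A\<^sub>1"
  and s: "!!i. [|i \<in> I; d i = 2|] ==> sect X1 A\<^sub>1 (top_of_set (disc_sphere 2)) (ch i) (s i)"
  and c: "sing 1 X1 c"
 shows "jump X (clutching A\<^sub>1 s) c = jump X1 A\<^sub>1 c"
proof -
 obtain p where p: "psect X1 A\<^sub>1 c p" by (rule sect_exists_simplex[OF at1 simplex_cont[OF c]])
 have "psect X (clutching A\<^sub>1 s) c p" by (rule sect_clutching_skel[OF at1 s p])
 moreover have "sing 1 X c" using c by (simp add: simplex_X1)
 ultimately show ?thesis
  using jump_eq[OF atlas_clutching[OF at1 s]] jump_eq[OF at1 c p] by simp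
qed

text \<open>The rim is the boundary of the image of the disc chain in \<open>X\<close>.\<close>

lemma cocycle_rim:
 fixes A :: "('c, 'b) monoid_scheme"
 assumes A: "comm_group A" and z: "cocycle A 1 X z" and i: "i \<in> I" "d i = 2" shows "z (rim i) = \<one>\<^bsub>A\<^esub>"
 using comm_group.cocycle_boundary[OF A z, of "chain_map 2 (ch i) disc_chain"] rim(4,5)[OF i]
  comm_group.chain_eval_of[OF A comm_group.cocycle_fun[OF A z]] by simp

text \<open>The graph is clutched from the trivial bundle over its vertices. An edge is glued in by
  the unit at its left end and by an element in the class of the cocycle at its right end, which
  prescribes the jump along the edge. On a graph the values on the 1-cells determine a 1-cocycle up
  to a coboundary.\<close>

lemma skeleton_atlas:
 assumes w: "cocycle pi0 1 X w"
 obtains A\<^sub>1 f where "atlas X1 A\<^sub>1" "is_cobd X1 (jump X1 A\<^sub>1) w f"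
proof -
 interpret S: bundle_cw_dim G T X1 cells1 d ch 1 by (rule skeleton)
 let ?X0 = "subtop X1 (S.skel 1)"
 define v where "v i = simplex_map 1 (ch i) edge_path" for i
 have "\<exists>g\<in>carrier G. pc g = w (v i)" for i
  by (rule pc_surj[OF cochainD[OF P0.cocycle_fun[OF w]]]) blast
 then obtain g where g: "!!i. g i \<in> carrier G" "!!i. pc (g i) = w (v i)" by metis
 \<comment> \<open>The two end points of the edge are told apart by the sign of the
   coordinate.\<close>
 define s where "s i y = (if y (0::nat) < (0::real) then \<one> else g i)" for i y
 have sc: "sect ?X0 (trivial_atlas ?X0) (top_of_set (disc_sphere 1)) (ch i) (s i)" if i: "i \<in> cells1" "d i = 1" for i
  unfolding sect_trivial_iff
 proof
  show "cmap (top_of_set (disc_sphere 1)) ?X0 (ch i)"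
   using S.skel_boundary[OF i(1), of 1] i(2) cmap_mono[OF S.cont[OF i(1)] disc_sphere_subset[of "d i"]]
   by (auto simp: cmap_in_sub)
  show "cmap (top_of_set (disc_sphere 1)) T (s i)"
  proof (rule continuous_map_local)
   fix y assume "y \<in> topspace (top_of_set (disc_sphere 1))"
   hence y: "y \<in> disc_sphere 1" by simp
   have c: "cmap (top_of_set (disc_sphere 1)) euclideanreal (%y. y 0)"
    by (simp add: cont_coord)
   have n: "z 0 \<noteq> 0" if "z \<in> disc_sphere 1" for z using that unfolding disc_sphere_1 by (auto simp: vert_def)
   show "\<exists>W. openin (top_of_set (disc_sphere 1)) W \<and> y \<in> W \<and> cmap (subtop (top_of_set (disc_sphere 1)) W) T (s i)"
   proof (cases "y 0 < 0")
    case True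
    have "cmap (subtop (top_of_set (disc_sphere 1)) {y \<in> disc_sphere 1. y 0 < 0}) T (s i)"
     by (rule cmap_eq[OF cm_const[OF one_closed]]) (simp add: s_def)
    thus ?thesis
     using openin_cmap[OF c, of "{..<0}"] y True by (intro exI[of _ "{y \<in> disc_sphere 1. y 0 < 0}"]) simp
   next
    case False
    have "cmap (subtop (top_of_set (disc_sphere 1)) {y \<in> disc_sphere 1. 0 < y 0}) T (s i)"
     by (rule cmap_eq[OF cm_const[OF g(1)]]) (auto simp: s_def)
    thus ?thesis
     using openin_cmap[OF c, of "{0<..}"] y n[OF y] False by (intro exI[of _ "{y \<in> disc_sphere 1. 0 < y 0}"]) simp
   qed
  qed
 qed
 note at0 = atlas_trivial[of ?X0]
 define A\<^sub>1 where "A\<^sub>1 = S.clutching (trivial_atlas ?X0) s"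
 have at1: "atlas X1 A\<^sub>1" unfolding A\<^sub>1_def by (rule S.atlas_clutching[OF at0 sc])
 have w1: "cocycle pi0 1 X1 w" by (rule P0.cocycle_subtopology[OF w])
 have jc: "jump X1 A\<^sub>1 (v i) = w (v i)" if i: "i \<in> cells1" "d i = 1" for i
 proof -
  obtain s' where s': "sect X1 A\<^sub>1 (disc 1) (ch i) s'" "!!y. y \<in> disc_sphere 1 ==> s' y = s i y"
   unfolding A\<^sub>1_def by (rule S.sect_clutching_cell[OF at0 sc i]) (assumption+, rule that[unfolded A\<^sub>1_def])
  have "s' (edge_path (vert 0)) = \<one>" "s' (edge_path (vert 1)) = g i"
   unfolding edge_path_ends using s'(2) by (simp_all add: disc_sphere_1 s_def) (simp_all add: vert_def)
  thus ?thesis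
   using jump_map[OF at1 s'(1) edge_path_simplex] g cochainD[OF P0.cocycle_fun[OF w], of "v i"]
   by (simp add: v_def pc_K[OF K_one])
 qed
 have "cocycle pi0 1 X1 (%v. jump X1 A\<^sub>1 v \<star> inv0 w v)"
  by (rule P0.cocycle_diff[OF cocycle_jump[OF at1] w1])
 then obtain F where F: "cobounds pi0 1 X1 F (%v. jump X1 A\<^sub>1 v \<star> inv0 w v)"
  by (rule S.graph_cobounds_1[OF refl pi0_comm])
   (use jc cochainD[OF P0.cocycle_fun[OF w]] in \<open>simp add: v_def\<close>)
 have "is_cobd X1 (jump X1 A\<^sub>1) w (%x. F (csimp 0 x))"
  unfolding is_cobd_def
 proof (intro conjI allI impI)
  show "F (csimp 0 x) \<in> carrier pi0" for x using cochainD[OF P0.cobounds_fun[OF F]] .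
  show "jump X1 A\<^sub>1 v = F (csimp 0 (v (vert 1))) \<star> inv0 F (csimp 0 (v (vert 0))) \<star> w v"
   if "sing 1 X1 v" for v
   using P0.cobounds_diffD[OF F P0.cocycle_fun[OF cocycle_jump[OF at1]] P0.cocycle_fun[OF w] that]
    P0.cobd_1_const[OF P0.cobounds_fun[OF F]] P0.m_comm[OF cochainD[OF P0.cocycle_fun[OF w]]] cochainD[OF P0.cobounds_fun[OF F]]
   by simp
 qed
 thus thesis by (rule that[OF at1])
qed

text \<open>A bundle over the graph extends over a 2-cell once it has a section over the boundary
  circle. Along the rim the cocycle is trivial, so the end values of a section differ by an element
  of the unit component and can be made equal by a path in it.\<close>

lemma jump_class_surj:
 assumes z: "cocycle pi0 1 X z"
 obtains A where "atlas X A" "jump_class A = C0.coh_class X x\<^sub>0 1 z"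
proof -
 obtain A\<^sub>1 f where at1: "atlas X1 A\<^sub>1" and f: "is_cobd X1 (jump X1 A\<^sub>1) z f"
  by (rule skeleton_atlas[OF z])
 have fc: "f x \<in> carrier pi0" for x using f by (simp add: is_cobd_def)
 have jf: "jump X1 A\<^sub>1 c = f (c (vert 1)) \<star> inv0 f (c (vert 0)) \<star> z c" if "sing 1 X1 c" for c
  using f that by (simp add: is_cobd_def)
 have "\<exists>s. sect X1 A\<^sub>1 (top_of_set (disc_sphere 2)) (ch i) s" if i: "i \<in> I" "d i = 2" for i
 proof -
  note r = rim(1,2)[OF i]
  obtain p where p: "psect X1 A\<^sub>1 (rim i) p" by (rule sect_exists_simplex[OF at1 simplex_cont[OF r(1)]])
  have pG: "p (vert 0) \<in> carrier G" "p (vert 1) \<in> carrier G" using sect_carrier[OF p] by simp_all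
  have "jump X1 A\<^sub>1 (rim i) = one0"
   using jf[OF r(1)] r(2) fc cocycle_rim[OF pi0_comm z i] by simp
  hence "pc (p (vert 1)) \<star> inv0 pc (p (vert 0)) = one0"
   using jump_eq[OF at1 r(1) p] by simp
  hence "pc (inv (p (vert 1)) \<otimes> p (vert 0)) = one0"
   using pG by (simp add: pc_mult pc_inv) (metis P0.inv_comm P0.inv_equality P0.inv_inv P0.inv_closed pc_closed P0.l_inv)
  hence k: "inv (p (vert 1)) \<otimes> p (vert 0) \<in> K" using pG pc_eq_one_iff by simp
  have "psect X1 A\<^sub>1 (rim i) (%x. p x \<otimes> to_one (inv (p (vert 1)) \<otimes> p (vert 0)) x)"
   by (rule sect_mult[OF at1 p to_one(1)[OF k]])
  then obtain s where "sect X1 A\<^sub>1 (top_of_set (disc_sphere 2)) (ch i) s"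
   by (rule sect_circle[OF at1 boundary_X1[OF i], folded rim_def]) (use pG in \<open>simp_all add: to_one(2,3)[OF k] mult_div\<close>)
  thus ?thesis by blast
 qed
 then obtain s where s: "!!i. [|i \<in> I; d i = 2|] ==> sect X1 A\<^sub>1 (top_of_set (disc_sphere 2)) (ch i) (s i)" by metis
 note at = atlas_clutching[OF at1 s]
 let ?j = "jump X (clutching A\<^sub>1 s)"
 \<comment> \<open>The given cocycle, changed by the coboundary that relates it to the jump over the
   graph. There it equals the jump, so the quotient of the two is trivial on the graph and hence a
   coboundary on the surface.\<close>
 define D where "D c = cobd pi0 1 (cochain0 f) c \<star> z c" for c
 have D: "cocycle pi0 1 X D"
  unfolding D_def by (intro P0.cocycle_mult P0.cocycle_cobd cochain_cochain0 z fc)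
 have "cocycle pi0 1 X (%c. ?j c \<star> inv0 D c)"
  by (rule P0.cocycle_diff[OF cocycle_jump[OF at] D])
 then obtain F where F: "cobounds pi0 1 X F (%c. ?j c \<star> inv0 D c)"
 proof (rule surface_cobounds_1[OF refl pi0_comm])
  show "?j c \<star> inv0 D c = one0" if "sing 1 X1 c" for c
   using jump_clutching[OF at1 s that] jf[OF that] cochainD[OF P0.cocycle_fun[OF D], of c]
   by (simp add: D_def P0.cobd_cochain0[of f, OF fc])
 qed
 note Fc = cochainD[OF P0.cobounds_fun[OF F]]
 have "is_cobd X ?j z (%x. F (csimp 0 x) \<star> f x)"
  unfolding is_cobd_def
 proof (intro conjI allI impI)
  show "F (csimp 0 x) \<star> f x \<in> carrier pi0" for x using Fc fc by simp
  fix c assume c: "sing 1 X c"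
  have \<zeta>c: "z c \<in> carrier pi0" using cochainD[OF P0.cocycle_fun[OF z]] .
  show "?j c = F (csimp 0 (c (vert 1))) \<star> f (c (vert 1)) \<star> inv0 (F (csimp 0 (c (vert 0))) \<star> f (c (vert 0))) \<star> z c"
   using P0.cobounds_diffD[OF F P0.cocycle_fun[OF cocycle_jump[OF at]] P0.cocycle_fun[OF D] c] \<zeta>c Fc fc
   by (simp add: P0.cobd_1_const[OF P0.cobounds_fun[OF F]] D_def P0.cobd_cochain0[of f, OF fc] P0.inv_mult P0.m_ac)
 qed
 hence "jump_class (clutching A\<^sub>1 s) = C0.coh_class X x\<^sub>0 1 z"
  unfolding jump_class_def using coh_class_1_eq_iff[OF x0 cocycle_jump[OF at] z] by blast
 with at show thesis by (rule that)
qed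

section \<open>The second cohomology and nontrivial bundles\<close>

lemma skel_2_nonempty: obtains a where "a \<in> skel 2"
proof -
 obtain i y where i: "i \<in> I" "y \<in> odisc (d i)" "x\<^sub>0 = ch i y" using x0 by (rule in_cell)
 show thesis
 proof (cases "d i = 2")
  case True
  have "circ 0 \<in> disc_sphere (d i)" using circ_sphere True by simp
  thus ?thesis using that skel_boundary[OF i(1), of 2 "circ 0"] True by simp
 next
  case False
  thus ?thesis using that cell_X1[OF i(1), of "%_. 0"] dim[OF i(1)] by simp
 qed
qed

lemma path_simplex:
 assumes "a \<in> topspace X" "x \<in> topspace X"
 obtains c where "sing 1 X c" "c (vert 0) = a" "c (vert 1) = x"
proof -
 obtain g where g: "pathin X g" "g 0 = a" "g 1 = x"
  using path_connected assms unfolding path_connected_space_def by blast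
 have "cmap (top_of_set (splx 1)) X (%s. g (s 1))"
  using g(1) unfolding pathin_def by (rule cmap_into) (auto simp: simplex_1_coord cont_coord)
 from singular_simplex_restrict[OF this] show thesis
  by (rule that) (simp_all, simp_all add: vert_def g)
qed

text \<open>The normalisation of the primitive at the base point is automatic: on the constant
  triangle its coboundary is its value on the constant edge, and both cocycles are trivial
  there.\<close>

lemma coh_class_2_eq_iff:
 assumes z: "cocycle pi1 2 X z" "z (csimp 2 x\<^sub>0) = one1" and w: "cocycle pi1 2 X w" "w (csimp 2 x\<^sub>0) = one1"
 shows "C1.coh_class X x\<^sub>0 2 z = C1.coh_class X x\<^sub>0 2 w \<longleftrightarrow>
  (\<exists>b. cochain pi1 b \<and> (\<forall>u. sing 2 X u --> z u = cobd pi1 2 b u \<cdot> w u))" (is "_ \<longleftrightarrow> ?R")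
proof -
 have "b (csimp 1 x\<^sub>0) = one1"
  if b: "cochain pi1 b" "!!u. sing 2 X u ==> z u = cobd pi1 2 b u \<cdot> w u" for b
  using b(2)[OF singular_simplex_const[OF x0]] z(2) w(2) cochainD[OF b(1)] P1.cobd_closed[OF b(1)]
  by (simp add: P1.cobd_2[OF b(1)] singular_face_const)
 moreover have "C1.coh_class X x\<^sub>0 2 z = C1.coh_class X x\<^sub>0 2 w \<longleftrightarrow> (\<exists>b. cochain pi1 b \<and> b (csimp 1 x\<^sub>0) = one1 \<and>
   (\<forall>u. sing 2 X u --> z u = cobd pi1 2 b u \<cdot> w u))"
  using C1.coh_class_eq_iff[OF x0, of 1 z w] z w by simp
 ultimately show ?thesis by blast
qed

text \<open>A trivialisation is a global section. The complex is path-connected and the atlas flat,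
  so division by the value at the base point brings all values into \<open>K\<close>.\<close>

lemma obstruction_trivial:
 assumes fl: "flat X A" and h: "atlas_iso X (trivial_atlas X) A h"
 shows "\<exists>b. cochain pi1 b \<and> (\<forall>t. sing 2 X t --> obstruction X A t = cobd pi1 2 b t \<cdot> one1)"
proof -
 have "ksect X A X (%x. x) (%x. h x \<otimes> inv (h x\<^sub>0))"
  by (rule ksect_translate[OF fl sect_global[OF flat_atlas[OF fl] h] x0]) (use path_simplex[OF x0] in metis)
 from obstruction_cobounds[OF fl this] show ?thesis
  using P1.cobd_closed[OF cochain_edge_class]
  by (intro exI[of _ "edge_class X A (%x. x) (%x. h x \<otimes> inv (h x\<^sub>0))"]) (simp add: cochain_edge_class)
qed

lemma cocycle_one_2: "cocycle pi1 2 X (%_. one1)"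
proof -
 have "chain_eval pi1 (%_. one1) c = one1" for c :: "'m chain"
  by (rule P1.chain_eval_eq_one) (simp_all add: cochainI)
 thus ?thesis by (simp add: cocycle_def cochainI cobd_def)
qed

text \<open>The loop classes \<open>z\<close> assigns to the 2-cells are the clutching data of a bundle; a section over the
 1-skeleton of this bundle is a cochain with coboundary \<open>z\<close>.\<close>

lemma nontrivial_bundle:
 assumes z: "cocycle pi1 2 X z" and nt: "\<nexists>b. cobounds pi1 2 X b z"
 obtains A where "atlas X A" "jump_class A = C0.coh_class X x\<^sub>0 1 (%_. one0)" "\<nexists>h. atlas_iso X (trivial_atlas X) A h"
proof -
 interpret S: bundle_cw_dim G T X1 cells1 d ch 1 by (rule skeleton)
 obtain b\<^sub>1 where b1: "cobounds pi1 2 X1 b\<^sub>1 z"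
  by (rule S.graph_cobounds_2[OF refl comm_group_pi1 P1.cocycle_subtopology[OF z]])
 note b1c = P1.cobounds_fun[OF b1]
 \<comment> \<open>A graph has no second cohomology, so the cocycle may be changed to be trivial on
   triangles in the graph. Its values on the disc chains then carry the information.\<close>
 define z' where "z' r = z r \<cdot> inv1 cobd pi1 2 b\<^sub>1 r" for r
 have z': "cocycle pi1 2 X z'"
  unfolding z'_def by (rule P1.cocycle_diff[OF z P1.cocycle_cobd[OF b1c]])
 note zc = P1.cocycle_fun[OF z] and z'c = P1.cocycle_fun[OF z']
 have z'1: "z' r = one1" if "sing 2 X1 r" for r
  using b1 that P1.cobd_closed[OF b1c] by (simp add: z'_def cobounds_def)
 \<comment> \<open>Loops that represent the values on the 2-cells; the trivial bundle over the graph
   is clutched along them.\<close>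
 have "\<exists>p. gloop p \<and> loop_class p = chain_eval pi1 z' (chain_map 2 (ch i) disc_chain)" for i
  using loop_class_surj[OF P1.chain_eval_closed[OF z'c]] by metis
 then obtain p where p: "!!i. gloop (p i)" "!!i. loop_class (p i) = chain_eval pi1 z' (chain_map 2 (ch i) disc_chain)" by metis
 let ?T = "trivial_atlas X1"
 define Q where "Q i s \<longleftrightarrow> sect X1 ?T (top_of_set (disc_sphere 2)) (ch i) s \<and> (\<forall>x\<in>standard_simplex 1. s (circ_loop x) = p i x)" for i s
 have "\<exists>s. sect X1 ?T (top_of_set (disc_sphere 2)) (ch i) s \<and> (\<forall>x\<in>standard_simplex 1. s (circ_loop x) = p i x)" if i: "i \<in> I" "d i = 2" for i
 proof -
  have "psect X1 ?T (simplex_map 1 (ch i) circ_loop) (p i)"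
   using simplex_cont[OF rim(1)[OF i]] p(1)[of i] by (simp add: sect_trivial_iff rim_def gloop_def)
  thus ?thesis
   by (rule sect_circle[OF atlas_trivial boundary_X1[OF i]]) (use p(1)[of i] in \<open>auto simp: gloop_def\<close>)
 qed
 hence "\<forall>i. \<exists>s. i \<in> I --> d i = 2 --> Q i s" unfolding Q_def by blast
 then obtain k where "!!i. [|i \<in> I; d i = 2|] ==> Q i (k i)" by metis
 hence k: "!!i. [|i \<in> I; d i = 2|] ==> sect X1 ?T (top_of_set (disc_sphere 2)) (ch i) (k i)"
   "!!i x. [|i \<in> I; d i = 2; x \<in> splx 1|] ==> k i (circ_loop x) = p i x" unfolding Q_def by blast+
 define A where "A = clutching ?T k"
 have at: "atlas X A" unfolding A_def by (rule atlas_clutching[OF atlas_trivial k(1)])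
 have j1: "jump X A q = one0" if q: "sing 1 X1 q" for q
 proof -
  have "psect X1 ?T q (%_. \<one>)" using simplex_cont[OF q] by (simp add: sect_trivial_iff topspace_eq)
  moreover have "jump X (clutching ?T k) q = jump X1 ?T q" by (rule jump_clutching[OF atlas_trivial k(1) q])
  ultimately show ?thesis
   unfolding A_def using jump_eq[OF atlas_trivial q, of "%_. \<one>"] by (simp add: pc_K[OF K_one])
 qed
 \<comment> \<open>The jump is trivial on edges in the graph, so the primitive can be taken trivial
   at the points of the graph. This is what later keeps a global section in one component over the
   graph.\<close>
 obtain F where F: "cobounds pi0 1 X F (jump X A)" and F1: "!!x. x \<in> skel 2 ==> F (csimp 0 x) = one0"
  by (rule surface_cobounds_1[OF refl pi0_comm cocycle_jump[OF at] j1]) (assumption, rule that)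
 have "\<exists>A' h. flat X A' \<and> atlas_iso X A A' h" by (rule flat_exists[OF at F]) blast
 hence jc: "jump_class A = C0.coh_class X x\<^sub>0 1 (%_. one0)"
  using jump_class_trivial_iff[OF at] by blast
 have False if h: "atlas_iso X (trivial_atlas X) A h" for h
 proof -
  note sh = sect_global[OF at h]
  have hc: "h x \<in> carrier G" for x by (rule atlas_iso_carrier[OF h])
  obtain a where a: "a \<in> skel 2" by (rule skel_2_nonempty)
  \<comment> \<open>Right division by the value at a point of the graph. By \<open>F1\<close> the
    jump along any path between two points of the graph is trivial, so over the graph the values lie
    in \<open>K\<close>.\<close>
  define s where "s x = h x \<otimes> inv (h a)" for x
  have ss: "sect X A X (%x. x) s"
   unfolding s_def by (rule sect_mult[OF at sh cm_const]) (simp add: hc)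
  have sK: "s x \<in> K" if x: "x \<in> skel 2" for x
  proof -
   obtain q where q: "sing 1 X q" "q (vert 0) = a" "q (vert 1) = x"
    by (rule path_simplex[OF subsetD[OF skel_subset a] subsetD[OF skel_subset x]])
   have "simplex_map 1 (%x. x) q = q" by (rule simplex_map_id_gen[OF q(1)]) simp
   hence "pc (h x) \<star> inv0 pc (h a) = cobd pi0 1 F q"
    using jump_map[OF at sh q(1)] q F by (simp add: cobounds_def)
   also have "\<dots> = one0" using F1[OF a] F1[OF x] q by (simp add: P0.cobd_1_const[OF P0.cobounds_fun[OF F]])
   finally show ?thesis using pc_eq_one_iff[of "s x"] hc by (simp add: s_def pc_mult pc_inv)
  qed
  \<comment> \<open>Over the graph the clutched bundle has the constant section 1; measured against
    it the global section is a continuous map to the unit component.\<close>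
  have "sect X1 ?T X1 (%x. x) (%_. \<one>)" by (simp add: sect_trivial_iff topspace_eq)
  from sect_clutching_skel[OF atlas_trivial k(1) this]
  have "sect X A X1 (%x. x) (%_. \<one>)" by (simp add: A_def)
  from sect_div[OF at this sect_subtopology[OF ss]]
  have "cmap X1 T (%x. inv \<one> \<otimes> s x)" .
  hence "cmap X1 T s" by (rule cmap_eq) (simp add: s_def hc)
  hence sc: "cmap X1 (subtop T K) s" using sK by (auto simp: cmap_in_sub)
  \<comment> \<open>The class of this map along edges: a cocycle on the graph, whose value on each
    rim will turn out to be the class of the clutching loop. So its coboundary agrees with
    \<open>z'\<close> on the graph and on the disc chains.\<close>
  define w where "w q = path_class (%x. s (q x))" for q :: "(nat => real) => 'm"
  have wc: "cochain pi1 w" by (simp add: w_def cochainI)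
  have w_rim: "w (rim i) = chain_eval pi1 z' (chain_map 2 (ch i) disc_chain)" if i: "i \<in> I" "d i = 2" for i
  proof -
   obtain k' where k': "sect X A (disc 2) (ch i) k'" "!!y. y \<in> disc_sphere 2 ==> k' y = k i y"
    unfolding A_def by (rule sect_clutching_cell[OF atlas_trivial k(1) i]) (assumption+, rule that[unfolded A_def])
   have ch: "cmap (disc 2) X (ch i)" using cont[OF i(1)] i(2) by simp
   \<comment> \<open>Over a 2-cell the clutched bundle has a section with the clutching loop as
     boundary values. The global section compared with it is a map on the whole disc, so its class
     on the boundary is trivial.\<close>
   define v where "v y = inv (k' y) \<otimes> s (ch i y)" for y
   have vc: "cmap (disc 2) T v"
    unfolding v_def by (rule sect_div[OF at k'(1) sect_compose[OF ss ch]])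
   have cl: "circ_loop x \<in> disc_sphere 2" if "x \<in> splx 1" for x
    using sing_maps[OF circ_loop_simplex that] by simp
   have v: "k' (circ_loop x) = p i x" "s (ch i (circ_loop x)) = p i x \<otimes> v (circ_loop x)" "v (circ_loop x) = inv (p i x) \<otimes> s (ch i (circ_loop x))"
    if x: "x \<in> splx 1" for x
    using k'(2)[OF cl[OF x]] k(2)[OF i x] gpath_carrier[OF kpath_gpath[OF gloop_kpath[OF p(1)]] x] hc by (simp_all add: v_def s_def mult_div)
   have ends: "circ_loop (vert 0) = vert 0" "circ_loop (vert 1) = vert 0"
    using circ_0 circ_1 by (simp_all add: circ_loop_def) (simp_all add: vert_def)
   have v0: "v (vert 0) \<in> K"
    using v(3)[of "vert 0"] ends p(1)[of i] sK[of "ch i (vert 0)"] cl[of "vert 0"] skel_boundary[OF i(1), of 2 "vert 0"] i(2) K_carrier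
    by (simp add: gloop_def)
   have "v y \<in> K" if "y \<in> cdisc 2" for y
   proof -
    \<comment> \<open>Membership is known at the boundary point \<open>vert 0\<close>; it is carried
      along a radius to the centre, and from the centre along radii to all points.\<close>
    have o: "v (%_. 0) \<in> K"
    proof (rule map_to_K[OF vc])
     show "vert 0 \<in> cdisc 2" using cl[of "vert 0"] ends disc_sphere_subset by auto
     thus "slide t (vert 0) (%_. 0) \<in> cdisc 2" if "0 \<le> t" "t \<le> 1" for t
      using scale_in_closed_disc[of "vert 0" 2 "1 - t"] that by simp
    qed (simp_all add: v0)
    show ?thesis by (rule map_to_K[OF vc _ o that]) (use that in \<open>auto intro: scale_in_closed_disc\<close>)
   qed
   hence vK: "cmap (disc 2) (subtop T K) v" using vc by (auto simp: cmap_in_sub)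
   have "path_class (simplex_map 1 v circ_loop) = one1"
    using P1.cocycle_boundary[OF P1.cocycle_pullback[OF cocycle_path_class vK], of disc_chain] disc_chain
    by (simp add: P1.chain_eval_of cochainI)
   hence v1: "path_class (%x. v (circ_loop x)) = one1"
    using path_class_map[OF vK circ_loop_disc] by simp
   have kv: "kpath (%x. v (circ_loop x))" by (rule kpath_map[OF vK circ_loop_disc])
   have "w (rim i) = path_class (%x. p i x \<otimes> v (circ_loop x))"
    unfolding w_def
    by (rule path_class_cong(2)[OF kpath_map[OF sc rim(1)[OF i]]]) (simp add: rim(3)[OF i] v(2))
   also have "\<dots> = path_class (p i) \<cdot> path_class (%x. v (circ_loop x))"
    using p(1)[of i] by (intro path_class_mult_closed gloop_kpath kv) (simp_all add: ends gloop_def)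
   finally show ?thesis
    using path_class_gloop[OF p(1)] p(2) v1 P1.chain_eval_closed[OF z'c] by simp
  qed
  have "cocycle pi1 2 X (%r. z' r \<cdot> inv1 cobd pi1 2 w r)"
   by (rule P1.cocycle_diff[OF z' P1.cocycle_cobd[OF wc]])
  then obtain b\<^sub>2 where b2: "cobounds pi1 2 X b\<^sub>2 (%r. z' r \<cdot> inv1 cobd pi1 2 w r)"
  proof (rule surface_cobounds_2[OF refl comm_group_pi1])
   show "z' r \<cdot> inv1 cobd pi1 2 w r = one1" if "sing 2 X1 r" for r
    using z'1[OF that] cobd_path_class_map[OF sc that] by (simp add: w_def[abs_def])
   fix i assume i: "i \<in> I" "d i = 2"
   show "chain_eval pi1 (%r. z' r \<cdot> inv1 cobd pi1 2 w r) (chain_map 2 (ch i) disc_chain) = one1"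
    using P1.eval_boundary[OF wc, of 2 "chain_map 2 (ch i) disc_chain"] w_rim[OF i] P1.chain_eval_closed[OF z'c]
    by (simp add: P1.chain_eval_mult[OF z'c P1.cochain_inv[OF P1.cobd_fun[OF wc]]] P1.chain_eval_inv[OF P1.cobd_fun[OF wc]]
      rim(4)[OF i] P1.chain_eval_of[OF wc] P1.chain_eval_closed[OF P1.cobd_fun[OF wc]])
  qed
  note b2c = P1.cobounds_fun[OF b2]
  have "cobounds pi1 2 X (%q. b\<^sub>1 q \<cdot> (w q \<cdot> b\<^sub>2 q)) z"
   unfolding cobounds_def
  proof (intro conjI allI impI P1.cochain_mult b1c wc b2c)
   fix r assume r: "sing 2 X r"
   have c: "cobd pi1 2 b\<^sub>1 r \<in> carrier pi1" "cobd pi1 2 w r \<in> carrier pi1" "cobd pi1 2 b\<^sub>2 r \<in> carrier pi1" "z r \<in> carrier pi1"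
    using b1c wc b2c cochainD[OF zc] by simp_all
   have "z' r = cobd pi1 2 w r \<cdot> cobd pi1 2 b\<^sub>2 r"
    by (rule P1.cobounds_diffD[OF b2 z'c P1.cobd_fun[OF wc] r])
   moreover have "z r = cobd pi1 2 b\<^sub>1 r \<cdot> z' r"
    using c by (simp add: z'_def P1.m_comm[of "z r"] P1.m_assoc[symmetric])
   ultimately show "z r = cobd pi1 2 (%q. b\<^sub>1 q \<cdot> (w q \<cdot> b\<^sub>2 q)) r"
    by (simp add: P1.cobd_mult b1c wc b2c P1.cochain_mult)
  qed
  thus False using nt by blast
 qed
 hence "\<nexists>h. atlas_iso X (trivial_atlas X) A h" by blast
 with at jc show thesis by (rule that)
qed

section \<open>Assembly of the two maps\<close>

theorem exact_sequence:
 "\<exists>f g. short_exact_pointed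
   (carrier (singular_cohomology 2 X {x\<^sub>0} pi1)) \<one>\<^bsub>singular_cohomology 2 X {x\<^sub>0} pi1\<^esub>
   (bundle_classes G T X) (trivial_class G T X)
   (carrier (singular_cohomology 1 X {x\<^sub>0} pi0)) \<one>\<^bsub>singular_cohomology 1 X {x\<^sub>0} pi0\<^esub> f g"
proof -
 let ?H2 = "carrier (singular_cohomology 2 X {x\<^sub>0} pi1)" and ?H1 = "carrier (singular_cohomology 1 X {x\<^sub>0} pi0)"
 let ?B = "bundle_classes G T X" and ?t = "trivial_class G T X"
 let ?e2 = "C1.coh_class X x\<^sub>0 2 (%_. one1)" and ?e1 = "C0.coh_class X x\<^sub>0 1 (%_. one0)"
 have H1: "?H1 = {C0.coh_class X x\<^sub>0 1 z | z. cocycle pi0 1 X z}"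
  unfolding C0.carrier_cohomology[OF x0] by (intro Collect_cong ex_cong1) (auto simp: P0.cocycle_1_const[OF _ x0])
 have H2: "?H2 = {C1.coh_class X x\<^sub>0 2 z | z. cocycle pi1 2 X z \<and> z (csimp 2 x\<^sub>0) = one1}"
  by (rule C1.carrier_cohomology[OF x0])
 have e1: "\<one>\<^bsub>singular_cohomology 1 X {x\<^sub>0} pi0\<^esub> = ?e1"
  using C0.one_cohomology[OF x0, of 0] by simp
 have e2: "\<one>\<^bsub>singular_cohomology 2 X {x\<^sub>0} pi1\<^esub> = ?e2"
  using C1.one_cohomology[OF x0, of 1] by simp
 have e1_in: "?e1 \<in> ?H1" using H1 cocycle_one by blast
 have e2_in: "?e2 \<in> ?H2" using H2 cocycle_one_2 by blast
 have cB: "atlas_class X A \<in> ?B" if "atlas X A" for A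
  using that unfolding bundle_classes_eq by blast
 have B: "\<exists>A. atlas X A \<and> atlas_class X A = y" if "y \<in> ?B" for y
  using that unfolding bundle_classes_eq by blast
 \<comment> \<open>A representing atlas for each class; \<open>g\<close> does not depend on it,
   because isomorphic atlases have the same jump class.\<close>
 define rp where "rp y = (SOME A. atlas X A \<and> atlas_class X A = y)" for y
 have rp: "atlas X (rp y) \<and> atlas_class X (rp y) = y" if "y \<in> ?B" for y
  unfolding rp_def using someI_ex[of "%A. atlas X A \<and> atlas_class X A = y"] B[OF that] by blast
 define g where "g y = jump_class (rp y)" for y
 have g: "g (atlas_class X A) = jump_class A" if A: "atlas X A" for A
 proof -
  note a = rp[OF cB[OF A]]
  then obtain h where "atlas_iso X (rp (atlas_class X A)) A h"
   using atlas_class_eq_iff[of X "rp (atlas_class X A)" A] A by blast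
  thus ?thesis unfolding g_def using jump_class_iso a A by metis
 qed
 have t: "?t \<in> ?B" "?t = atlas_class X (trivial_atlas X)"
  using cB[OF atlas_trivial] by (simp_all add: trivial_class_eq)
 have flat_triv: "flat X A' ==> atlas_iso X A A' h ==> atlas X A ==> jump_class A = ?e1" for A A' h
  using jump_class_trivial_iff by blast
 have gt: "g ?t = ?e1"
 proof -
  have "jump X (trivial_atlas X) c = one0" if c: "sing 1 X c" for c
   using jump_eq[OF atlas_trivial c, of "%_. \<one>"] simplex_cont[OF c] by (simp add: sect_trivial_iff topspace_eq pc_K[OF K_one])
  hence "flat X (trivial_atlas X)" by (simp add: flat_def atlas_trivial)
  thus ?thesis
   unfolding t(2) g[OF atlas_trivial] using flat_triv atlas_iso_refl[OF atlas_trivial] atlas_trivial by blast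
 qed
 have gB: "g y \<in> ?H1" if "y \<in> ?B" for y
  unfolding g_def jump_class_def H1 using cocycle_jump rp[OF that] by blast
 have g_surj: "g ` ?B = ?H1"
 proof (intro equalityI subsetI)
  fix a assume "a \<in> ?H1"
  then obtain v where v: "cocycle pi0 1 X v" "a = C0.coh_class X x\<^sub>0 1 v" unfolding H1 by blast
  obtain A where "atlas X A" "jump_class A = a" using jump_class_surj[OF v(1)] v(2) by metis
  thus "a \<in> g ` ?B" using g cB by blast
 qed (use gB in blast)
 define ker where "ker = {y \<in> ?B. g y = ?e1}"
 have "\<exists>A. flat X A \<and> atlas_class X A = y" if y: "y \<in> ker" for y
 proof -
  have yB: "y \<in> ?B" and "jump_class (rp y) = ?e1" using y by (auto simp: ker_def g_def)
  then obtain A h where A: "flat X A" "atlas_iso X (rp y) A h"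
   using jump_class_trivial_iff rp by blast
  hence "atlas_class X (rp y) = atlas_class X A"
   using atlas_class_eq_iff rp[OF yB] flat_atlas by blast
  thus ?thesis using A(1) rp[OF yB] by metis
 qed
 then obtain fa where fa: "!!y. y \<in> ker ==> flat X (fa y)" "!!y. y \<in> ker ==> atlas_class X (fa y) = y" by metis
 \<comment> \<open>The class is that of an arbitrarily chosen flat representative. By
   \<open>flat_iso\<close> it separates the elements of the kernel, whatever the choice.\<close>
 define ob where "ob y = C1.coh_class X x\<^sub>0 2 (obstruction X (fa y))" for y
 note oc = cocycle_obstruction[OF fa(1)] obstruction_const[OF fa(1) x0]
 have ob_in: "ob y \<in> ?H2" if "y \<in> ker" for y
  unfolding ob_def H2 using oc[OF that] by blast
 have ob_inj: "y = y'" if y: "y \<in> ker" "y' \<in> ker" and eq: "ob y = ob y'" for y y'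
 proof -
  obtain b where b: "cochain pi1 b" "!!u. sing 2 X u ==> obstruction X (fa y) u = cobd pi1 2 b u \<cdot> obstruction X (fa y') u"
   using eq unfolding ob_def coh_class_2_eq_iff[OF oc(1)[OF y(1)] oc(2)[OF y(1)] oc(1)[OF y(2)] oc(2)[OF y(2)]] by blast
  obtain h where "atlas_iso X (fa y) (fa y') h" by (rule flat_iso[OF fa(1)[OF y(1)] fa(1)[OF y(2)] b])
  thus ?thesis
   using atlas_class_eq_iff[of X "fa y" "fa y'"] fa y flat_atlas by metis
 qed
 have t_ker: "?t \<in> ker" using t gt by (simp add: ker_def)
 have ob_t: "ob ?t = ?e2"
 proof -
  obtain h where "atlas_iso X (trivial_atlas X) (fa ?t) h"
   using atlas_class_eq_iff[of X "trivial_atlas X" "fa ?t"] fa[OF t_ker] flat_atlas t(2) atlas_trivial by metis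
  thus ?thesis
   unfolding ob_def coh_class_2_eq_iff[OF oc(1)[OF t_ker] oc(2)[OF t_ker] cocycle_one_2 refl]
   by (rule obstruction_trivial[OF fa(1)[OF t_ker]])
 qed
 \<comment> \<open>Needed for triviality of the kernel of \<open>f\<close>: an element other than
   the base point must have somewhere to go within the kernel of \<open>g\<close> other than the
   trivial class.\<close>
 have nontrivial: "\<exists>y\<in>ker. y \<noteq> ?t" if a: "a \<in> ?H2" "a \<noteq> ?e2" for a
 proof -
  obtain z where z: "cocycle pi1 2 X z" "z (csimp 2 x\<^sub>0) = one1" "a = C1.coh_class X x\<^sub>0 2 z" using a(1) H2 by blast
  have "\<nexists>b. cobounds pi1 2 X b z"
  proof
   assume "\<exists>b. cobounds pi1 2 X b z"
   then obtain b where b: "cobounds pi1 2 X b z" by blast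
   hence "cochain pi1 b \<and> (\<forall>u. sing 2 X u --> z u = cobd pi1 2 b u \<cdot> one1)"
    using P1.cobd_closed[OF P1.cobounds_fun[OF b]] by (simp add: cobounds_def)
   hence "C1.coh_class X x\<^sub>0 2 z = ?e2" unfolding coh_class_2_eq_iff[OF z(1,2) cocycle_one_2 refl] by (intro exI[of _ b])
   thus False using a(2) z(3) by simp
  qed
  then obtain A where A: "atlas X A" "jump_class A = ?e1" "\<nexists>h. atlas_iso X (trivial_atlas X) A h"
   by (rule nontrivial_bundle[OF z(1)]) (rule that)
  hence "atlas_class X A \<noteq> ?t" using atlas_class_eq_iff[OF atlas_trivial A(1)] t(2) by metis
  moreover have "atlas_class X A \<in> ker" using g[OF A(1)] A(2) cB[OF A(1)] by (simp add: ker_def)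
  ultimately show ?thesis by blast
 qed
 text \<open>Exactness constrains \<open>f\<close> only as a map of pointed sets, so classes not realised by \<open>ob\<close> may be sent
  to any nontrivial element of the kernel of \<open>g\<close>.\<close>
 have "\<exists>y. y \<in> ker \<and> (y = ?t \<longleftrightarrow> a = ?e2) \<and> (a \<in> ob ` ker --> ob y = a)" if a: "a \<in> ?H2" for a
 proof (cases "a \<in> ob ` ker")
  case True
  then obtain y where "y \<in> ker" "ob y = a" by blast
  moreover from this have "y = ?t \<longleftrightarrow> a = ?e2" using ob_inj[of y ?t] t_ker ob_t by metis
  ultimately show ?thesis by blast
 next
  case False
  hence "a \<noteq> ?e2" using ob_t t_ker by blast
  thus ?thesis using nontrivial[OF a] False by blast
 qed
 hence "\<forall>a\<in>?H2. \<exists>y. y \<in> ker \<and> (y = ?t \<longleftrightarrow> a = ?e2) \<and> (a \<in> ob ` ker --> ob y = a)" by blast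
 from bchoice[OF this] obtain f where
  "\<forall>a\<in>?H2. f a \<in> ker \<and> (f a = ?t \<longleftrightarrow> a = ?e2) \<and> (a \<in> ob ` ker --> ob (f a) = a)" by blast
 hence f: "!!a. a \<in> ?H2 ==> f a \<in> ker" "!!a. a \<in> ?H2 ==> f a = ?t \<longleftrightarrow> a = ?e2"
  "!!a. a \<in> ?H2 ==> a \<in> ob ` ker ==> ob (f a) = a" by simp_all
 \<comment> \<open>On the image of \<open>ob\<close> the map \<open>f\<close> inverts it:
   \<open>f (ob y)\<close> and \<open>y\<close> have the same obstruction, and \<open>ob\<close> is
   injective.\<close>
 have "f ` ?H2 = ker"
 proof (intro equalityI subsetI)
  fix y assume y: "y \<in> ker"
  have "f (ob y) = y" using ob_inj[of "f (ob y)" y] f[OF ob_in[OF y]] y by blast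
  thus "y \<in> f ` ?H2" using ob_in[OF y] by force
 qed (use f(1) in blast)
 moreover have "{a \<in> ?H2. f a = ?t} = {?e2}" using f(2) e2_in by blast
 moreover have "{y \<in> ?H1. ()  = ()} = ?H1" by simp
 ultimately show ?thesis
  unfolding short_exact_pointed_def pointed_map_def pointed_exact_def e1 e2
  using e1_in e2_in t(1) gt gB g_surj f by (intro exI[of _ f] exI[of _ g]) (auto simp: ker_def)
qed

end

theorem theorem4p4:
  fixes M :: "'m topology" and x\<^sub>0 :: 'm
    and I :: "'i set" and d :: "'i \<Rightarrow> nat" and \<Phi> :: "'i \<Rightarrow> (nat \<Rightarrow> real) \<Rightarrow> 'm"
    and G :: "'g monoid" and T :: "'g topology"
  assumes "cw_complex M I d \<Phi>"
    and "cw_dimension I d 2"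
    and "path_connected_space M"
    and "x\<^sub>0 \<in> topspace M"
    and "topological_group G T"
    and "comm_group (pi0_group G T)"
    and "pi0_discrete G T"
    and "\<And>n C \<alpha>. \<lbrakk>1 \<le> n; C \<in> carrier (pi0_group G T); \<alpha> \<in> carrier (homotopy_group n T \<one>\<^bsub>G\<^esub>)\<rbrakk>
           \<Longrightarrow> pi0_action G T n C \<alpha> = \<alpha>"
  shows "\<exists>f g. short_exact_pointed
           (carrier (singular_cohomology 2 M {x\<^sub>0} (homotopy_group 1 T \<one>\<^bsub>G\<^esub>)))
           \<one>\<^bsub>singular_cohomology 2 M {x\<^sub>0} (homotopy_group 1 T \<one>\<^bsub>G\<^esub>)\<^esub>
           (bundle_classes G T M) (trivial_class G T M)
           (carrier (singular_cohomology 1 M {x\<^sub>0} (pi0_group G T)))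
           \<one>\<^bsub>singular_cohomology 1 M {x\<^sub>0} (pi0_group G T)\<^esub>
           f g"
proof -
  interpret topological_group G T by fact
  interpret structure_group G T by (intro structure_group.intro structure_group_axioms.intro) fact+
  interpret cw M I d \<Phi> by unfold_locales fact
  interpret surface_bundles G T M I d \<Phi> x\<^sub>0
    by unfold_locales (use assms in \<open>auto simp: cw_dimension_def\<close>)
  show ?thesis by (rule exact_sequence)
qed

end
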